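(* For every integer $d\ge1$ there is a constant $c'_d>0$, depending only on $d$, such that the following holds. Let $C_1,C_2\subset\mathbb{R}^2$ be two irreducible plane algebraic curves of degree at most $d$ which are not parallel lines, not orthogonal lines, and not concentric circles. Then for any set $S_1$ of $m$ points on $C_1$ and any set $S_2$ of $n$ points on $C_2$, the number of distinct distances $|pq|$ with $p\in S_1$, $q\in S_2$ is at least $c'_d\cdot\min\{m^{2/3}n^{2/3},\,m^2,\,n^2\}$.
   Context: A plane algebraic curve is an infinite set of the form $Z_{\mathbb{R}}(f)=\{(a,b)\in\mathbb{R}^2 : f(a,b)=0\}$ for some nonzero $f\in\mathbb{R}[x,y]$; its degree is the minimum degree of such an $f$. It is irreducible if it can be written as $Z_{\mathbb{R}}(f)$ with $f$ irreducible over $\mathbb{R}$. The curves $C_1$ and $C_2$ are allowed to coincide. *)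

theory Defs
  imports Complex_Main "HOL-Computational_Algebra.Polynomial_Factorial"
begin

text \<open>Bivariate real polynomials are represented as elements of real poly poly:
  f = sum_j c_j(x) y^j, with coefficients c_j in R[x].\<close>

definition eval2 :: "real poly poly \<Rightarrow> real \<Rightarrow> real \<Rightarrow> real" where
  "eval2 f a b = poly (map_poly (\<lambda>c. poly c a) f) b"

definition tdeg :: "real poly poly \<Rightarrow> nat" where
  "tdeg f = (if f = 0 then 0 else Max {i + j | i j. coeff (coeff f j) i \<noteq> 0})"

definition zeroset :: "real poly poly \<Rightarrow> (real \<times> real) set" where
  "zeroset f = {(a, b). eval2 f a b = 0}"

definition plane_curve :: "(real \<times> real) set \<Rightarrow> bool" where
  "plane_curve C \<longleftrightarrow> infinite C \<and> (\<exists>f. f \<noteq> 0 \<and> C = zeroset f)"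

definition curve_deg_le :: "(real \<times> real) set \<Rightarrow> nat \<Rightarrow> bool" where
  "curve_deg_le C d \<longleftrightarrow> (\<exists>f. f \<noteq> 0 \<and> C = zeroset f \<and> tdeg f \<le> d)"

definition irreducible_curve :: "(real \<times> real) set \<Rightarrow> bool" where
  "irreducible_curve C \<longleftrightarrow> plane_curve C \<and> (\<exists>f. irreducible f \<and> C = zeroset f)"

definition line_with_normal :: "(real \<times> real) set \<Rightarrow> real \<Rightarrow> real \<Rightarrow> bool" where
  "line_with_normal C a b \<longleftrightarrow> (a, b) \<noteq> (0, 0) \<and>
     (\<exists>c. C = {(x, y). a * x + b * y + c = 0})"

definition parallel_lines :: "(real \<times> real) set \<Rightarrow> (real \<times> real) set \<Rightarrow> bool" where
  "parallel_lines C1 C2 \<longleftrightarrow> (\<exists>a1 b1 a2 b2. line_with_normal C1 a1 b1 \<and>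
     line_with_normal C2 a2 b2 \<and> a1 * b2 - a2 * b1 = 0)"

definition orthogonal_lines :: "(real \<times> real) set \<Rightarrow> (real \<times> real) set \<Rightarrow> bool" where
  "orthogonal_lines C1 C2 \<longleftrightarrow> (\<exists>a1 b1 a2 b2. line_with_normal C1 a1 b1 \<and>
     line_with_normal C2 a2 b2 \<and> a1 * a2 + b1 * b2 = 0)"

definition circle_with_center :: "(real \<times> real) set \<Rightarrow> real \<times> real \<Rightarrow> bool" where
  "circle_with_center C z \<longleftrightarrow> (\<exists>r>0. C = {(x, y). (x - fst z)^2 + (y - snd z)^2 = r^2})"

definition concentric_circles :: "(real \<times> real) set \<Rightarrow> (real \<times> real) set \<Rightarrow> bool" where
  "concentric_circles C1 C2 \<longleftrightarrow> (\<exists>z. circle_with_center C1 z \<and> circle_with_center C2 z)"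

definition edist :: "real \<times> real \<Rightarrow> real \<times> real \<Rightarrow> real" where
  "edist p q = sqrt ((fst p - fst q)^2 + (snd p - snd q)^2)"

end

theory Submission
  imports Defs "HOL-Analysis.Analysis" "HOL-Computational_Algebra.Field_as_Ring"
begin

text \<open>Incidence bounds are replaced by proximity. Put the points on smooth arcs, one in each curve, and cut each arc
  into \<open>r\<close> blocks of consecutive points. Away from boundedly many values of \<open>\<delta>\<close>, the level curve \<open>|pq|\<^sup>2 = \<delta>\<close> has
  boundedly many critical pairs, so that it meets only \<open>O(r)\<close> of the \<open>r\<^sup>2\<close> boxes. If there are \<open>D\<close> distances, the
  Cauchy--Schwarz inequality gives at least about \<open>m\<^sup>2n\<^sup>2/(Dr)\<close> quadruples \<open>|pq| = |p'q'|\<close> with \<open>p, p'\<close> in one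
  block and \<open>q, q'\<close> in one block. These are the edges between the \<open>O(m\<^sup>2/r)\<close> pairs \<open>(p, p')\<close> and the
  \<open>O(n\<^sup>2/r)\<close> pairs \<open>(q, q')\<close>. Two pairs \<open>(p, p')\<close> have boundedly many common neighbours with few exceptions: by
  Bezout an exception forces an affine map that sends the second curve to itself and \<open>q\<close> to \<open>q'\<close>, and these maps
  are controlled unless the curves are parallel lines, orthogonal lines or concentric circles. The
  Kovari--Sos--Turan argument bounds the number of edges, and the choice \<open>r = cmn/D\<close> gives \<open>D\<^sup>3 \<ge> cmn\<^sup>3\<close>.\<close>

section \<open>Real polynomial functions on the complex plane\<close>

text \<open>Elimination sees complex zeros, while the curves are irreducible only over the reals.
  Real polynomials are therefore evaluated at complex points: eliminating the square root that gives
  \<open>q'\<close> from \<open>q\<close> leaves a polynomial in \<open>q\<close>, and if it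
  vanishes on the whole curve, each \<open>q\<close> gets merely a complex partner. Exceptions that
  share a partner bring it back to the reals: differences of squared distances are linear, so three
  pairs fix the partner as a real affine image of \<open>q\<close>, up to a reflection if they are
  collinear. Such a map T satisfies |Tq - p'| = |q - p| on the curve but is not an isometry at once.
  If it were none, this equation would be a conic containing the curve, T would multiply it by a
  constant, and comparing trace, determinant and discriminant gives a contradiction. Isometries are
  counted as symmetries of the curve, finite in number unless it is a circle. In the box count only
  the derivative along the second curve is used: critical pairs are feet of normals, one algebraic
  condition on \<open>q\<close> for each \<delta>.\<close>

definition bideg_le :: "real poly poly \<Rightarrow> nat \<Rightarrow> bool" where
  "bideg_le P k \<longleftrightarrow> degree P \<le> k \<and> (\<forall>j. degree (coeff P j) \<le> k)"

definition ceval1 :: "real poly \<Rightarrow> complex \<Rightarrow> complex" where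
  "ceval1 p z = poly (map_poly complex_of_real p) z"

definition ceval :: "real poly poly \<Rightarrow> complex \<Rightarrow> complex \<Rightarrow> complex" where
  "ceval P z w = poly (map_poly (\<lambda>c. ceval1 c z) P) w"

lemma ceval1_0 [simp]: "ceval1 0 z = 0"
  by (simp add: ceval1_def)

lemma ceval1_pCons: "ceval1 (pCons c p) z = of_real c + z * ceval1 p z"
  by (simp add: ceval1_def map_poly_pCons)

lemma ceval1_add: "ceval1 (p + q) z = ceval1 p z + ceval1 q z"
  by (induction p q rule: poly_induct2) (auto simp: ceval1_pCons algebra_simps)

lemma ceval1_smult: "ceval1 (smult c p) z = of_real c * ceval1 p z"
  by (induction p) (auto simp: ceval1_pCons algebra_simps)

lemma ceval1_mult: "ceval1 (p * q) z = ceval1 p z * ceval1 q z"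
  by (induction p) (auto simp: ceval1_pCons ceval1_add ceval1_smult algebra_simps)

lemma ceval1_1 [simp]: "ceval1 1 z = 1"
  by (simp add: one_pCons ceval1_pCons)

lemma ceval_0 [simp]: "ceval 0 z w = 0"
  by (simp add: ceval_def)

lemma ceval_pCons: "ceval (pCons c P) z w = ceval1 c z + w * ceval P z w"
  by (simp add: ceval_def map_poly_pCons)

lemma ceval_add: "ceval (P + Q) z w = ceval P z w + ceval Q z w"
  by (induction P Q rule: poly_induct2) (auto simp: ceval_pCons ceval1_add algebra_simps)

lemma ceval_smult: "ceval (smult c P) z w = ceval1 c z * ceval P z w"
  by (induction P) (auto simp: ceval_pCons ceval1_mult algebra_simps)

lemma ceval_mult: "ceval (P * Q) z w = ceval P z w * ceval Q z w"
  by (induction P) (auto simp: ceval_pCons ceval_add ceval_smult algebra_simps)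

lemma ceval1_of_real: "ceval1 p (of_real x) = of_real (poly p x)"
  by (induction p) (auto simp: ceval1_pCons)

lemma eval2_0 [simp]: "eval2 0 a b = 0"
  by (simp add: eval2_def)

lemma eval2_pCons: "eval2 (pCons c P) a b = poly c a + b * eval2 P a b"
  by (simp add: eval2_def map_poly_pCons)

lemma ceval_of_real: "ceval P (of_real x) (of_real y) = of_real (eval2 P x y)"
  by (induction P) (auto simp: ceval_pCons eval2_pCons ceval1_of_real)

lemma eval2_add: "eval2 (P + Q) a b = eval2 P a b + eval2 Q a b"
  by (induction P Q rule: poly_induct2) (auto simp: eval2_pCons algebra_simps)

lemma eval2_smult: "eval2 (smult c P) a b = poly c a * eval2 P a b"
  by (induction P) (auto simp: eval2_pCons algebra_simps)

lemma eval2_mult: "eval2 (P * Q) a b = eval2 P a b * eval2 Q a b"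
  by (induction P) (auto simp: eval2_pCons eval2_add eval2_smult algebra_simps)

text \<open>Polynomials are handled as functions with a bidegree as their only record, so that
  degree bounds come from closure rules and no composed polynomial has to be written out.\<close>

definition rpoly :: "nat \<Rightarrow> (complex \<Rightarrow> complex \<Rightarrow> complex) \<Rightarrow> bool" where
  "rpoly k G \<longleftrightarrow> (\<exists>P. bideg_le P k \<and> G = ceval P)"

lemma bideg_le_mono: "bideg_le P k \<Longrightarrow> k \<le> l \<Longrightarrow> bideg_le P l"
  unfolding bideg_le_def by (meson le_trans)

lemma bideg_le_add: "bideg_le P k \<Longrightarrow> bideg_le Q k \<Longrightarrow> bideg_le (P + Q) k"
  unfolding bideg_le_def by (auto intro!: degree_add_le)

lemma bideg_le_mult:
  assumes "bideg_le P k" "bideg_le Q l" shows "bideg_le (P * Q) (k + l)"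
  unfolding bideg_le_def
proof (intro conjI allI)
  show "degree (P * Q) \<le> k + l"
    using assms degree_mult_le[of P Q] unfolding bideg_le_def by linarith
  fix j
  show "degree (coeff (P * Q) j) \<le> k + l"
    unfolding coeff_mult
  proof (rule degree_sum_le)
    fix i assume "i \<in> {..j}"
    show "degree (coeff P i * coeff Q (j - i)) \<le> k + l"
      using assms degree_mult_le[of "coeff P i" "coeff Q (j - i)"] unfolding bideg_le_def
      by (meson add_mono le_trans)
  qed simp
qed

lemma rpoly_mono: "rpoly k G \<Longrightarrow> k \<le> l \<Longrightarrow> rpoly l G"
  unfolding rpoly_def using bideg_le_mono by blast

lemma rpoly_const: "rpoly k (\<lambda>z w. of_real c)"
  unfolding rpoly_def
  by (rule exI[of _ "[:[:c:]:]"])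
     (auto simp: bideg_le_def fun_eq_iff ceval_pCons ceval1_pCons coeff_pCons split: nat.split)

lemma rpoly_fst: "k \<ge> 1 \<Longrightarrow> rpoly k (\<lambda>z w. z)"
  unfolding rpoly_def
  by (rule exI[of _ "[:[:0,1:]:]"])
     (auto simp: bideg_le_def fun_eq_iff ceval_pCons ceval1_pCons coeff_pCons simp flip: one_pCons split: nat.split)

lemma rpoly_snd: "k \<ge> 1 \<Longrightarrow> rpoly k (\<lambda>z w. w)"
  unfolding rpoly_def
  by (rule exI[of _ "[:0,1:]"])
     (auto simp: bideg_le_def fun_eq_iff ceval_pCons ceval1_pCons coeff_pCons split: nat.split)

lemma rpoly_add:
  assumes "rpoly k F" "rpoly k G" shows "rpoly k (\<lambda>z w. F z w + G z w)"
proof -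
  from assms obtain P Q where "bideg_le P k" "F = ceval P" "bideg_le Q k" "G = ceval Q"
    unfolding rpoly_def by blast
  then show ?thesis unfolding rpoly_def
    by (intro exI[of _ "P + Q"]) (auto simp: bideg_le_add ceval_add fun_eq_iff)
qed

lemma rpoly_mult:
  assumes "rpoly k F" "rpoly l G" "k + l \<le> n" shows "rpoly n (\<lambda>z w. F z w * G z w)"
proof -
  from assms obtain P Q where "bideg_le P k" "F = ceval P" "bideg_le Q l" "G = ceval Q"
    unfolding rpoly_def by blast
  then show ?thesis unfolding rpoly_def using assms(3)
    by (intro exI[of _ "P * Q"]) (auto simp: ceval_mult fun_eq_iff intro: bideg_le_mono bideg_le_mult)
qed

lemma rpoly_cmult:
  assumes "rpoly k F" shows "rpoly k (\<lambda>z w. of_real c * F z w)"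
  by (rule rpoly_mult[OF rpoly_const[of 0] assms]) simp

lemma rpoly_diff:
  assumes "rpoly k F" "rpoly k G" shows "rpoly k (\<lambda>z w. F z w - G z w)"
  using rpoly_add[OF assms(1) rpoly_cmult[OF assms(2), of "-1"]] by simp

lemma rpoly_power:
  assumes "rpoly k F" shows "rpoly (i * k) (\<lambda>z w. F z w ^ i)"
proof (induction i)
  case 0 show ?case using rpoly_const[of 0 1] by simp
next
  case (Suc i) show ?case using rpoly_mult[OF assms Suc, of "Suc i * k"] by simp
qed

section \<open>Elimination of a square root by a norm\<close>

lemma ceval1_sum: "degree p \<le> k \<Longrightarrow> ceval1 p z = (\<Sum>i\<le>k. of_real (coeff p i) * z ^ i)"
  unfolding ceval1_def
  by (subst poly_altdef)
     (auto simp: coeff_map_poly degree_map_poly intro!: sum.mono_neutral_left le_degree)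

lemma ceval_sum:
  assumes "bideg_le P k"
  shows "ceval P z w = (\<Sum>j\<le>k. \<Sum>i\<le>k. of_real (coeff (coeff P j) i) * (z ^ i * w ^ j))"
proof -
  let ?Q = "map_poly (\<lambda>c. ceval1 c z) P"
  have co: "coeff ?Q j = ceval1 (coeff P j) z" for j
    by (simp add: coeff_map_poly)
  have dQ: "degree ?Q \<le> k"
    using assms unfolding bideg_le_def by (intro degree_le) (auto simp: co coeff_eq_0)
  have "ceval P z w = (\<Sum>j\<le>degree ?Q. coeff ?Q j * w ^ j)"
    unfolding ceval_def poly_altdef ..
  also have "\<dots> = (\<Sum>j\<le>k. coeff ?Q j * w ^ j)"
    using dQ by (intro sum.mono_neutral_left) (auto simp: coeff_eq_0)
  also have "\<dots> = (\<Sum>j\<le>k. \<Sum>i\<le>k. of_real (coeff (coeff P j) i) * (z ^ i * w ^ j))"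
  proof (intro sum.cong refl)
    fix j
    have "degree (coeff P j) \<le> k" using assms unfolding bideg_le_def by blast
    from ceval1_sum[OF this, of z]
    show "coeff ?Q j * w ^ j = (\<Sum>i\<le>k. of_real (coeff (coeff P j) i) * (z ^ i * w ^ j))"
      by (simp only: co sum_distrib_right mult.assoc)
  qed
  finally show ?thesis .
qed

text \<open>The normal form A + s B of a function on the double cover s^2 = U / V, with the
  denominator cleared by a power of V. Exponent and bidegree are tracked because they determine the
  bidegree of the norm taken at the end.\<close>

definition split_form :: "nat \<Rightarrow> nat \<Rightarrow> (complex \<Rightarrow> complex \<Rightarrow> complex) \<Rightarrow> (complex \<Rightarrow> complex \<Rightarrow> complex) \<Rightarrow>
    (complex \<Rightarrow> complex \<Rightarrow> complex \<Rightarrow> complex) \<Rightarrow> bool" where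
  "split_form K j U V \<Phi> \<longleftrightarrow> (\<exists>A B. rpoly K A \<and> rpoly K B \<and>
     (\<forall>z w s. s\<^sup>2 * V z w = U z w \<longrightarrow> V z w ^ j * \<Phi> z w s = A z w + s * B z w))"

lemma split_form_mono: "split_form K j U V \<Phi> \<Longrightarrow> K \<le> L \<Longrightarrow> split_form L j U V \<Phi>"
  unfolding split_form_def by (meson rpoly_mono)

lemma split_form_linear:
  assumes "rpoly k a" "rpoly k b" shows "split_form k 0 U V (\<lambda>z w s. a z w + s * b z w)"
  unfolding split_form_def using assms by auto

text \<open>A product of two normal forms contains one s^2, to be replaced by U / V; this costs one
  more factor V in the denominator and k in the bidegree.\<close>

lemma split_form_mult:
  assumes "split_form K j U V \<Phi>" "split_form L i U V \<Psi>" "rpoly k U" "rpoly k V"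
  shows "split_form (K + L + k) (j + i + 1) U V (\<lambda>z w s. \<Phi> z w s * \<Psi> z w s)"
proof -
  from assms(1) obtain A B where AB: "rpoly K A" "rpoly K B"
    "\<And>z w s. s\<^sup>2 * V z w = U z w \<Longrightarrow> V z w ^ j * \<Phi> z w s = A z w + s * B z w"
    unfolding split_form_def by blast
  from assms(2) obtain A' B' where AB': "rpoly L A'" "rpoly L B'"
    "\<And>z w s. s\<^sup>2 * V z w = U z w \<Longrightarrow> V z w ^ i * \<Psi> z w s = A' z w + s * B' z w"
    unfolding split_form_def by blast
  define A2 where "A2 = (\<lambda>z w. A z w * A' z w * V z w + B z w * B' z w * U z w)"
  define B2 where "B2 = (\<lambda>z w. (A z w * B' z w + B z w * A' z w) * V z w)"
  have A2: "rpoly (K + L + k) A2" unfolding A2_def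
    using rpoly_add[OF rpoly_mult[OF rpoly_mult[OF AB(1) AB'(1) order_refl] assms(4) order_refl]
        rpoly_mult[OF rpoly_mult[OF AB(2) AB'(2) order_refl] assms(3) order_refl]] .
  have B2: "rpoly (K + L + k) B2" unfolding B2_def
    using rpoly_mult[OF rpoly_add[OF rpoly_mult[OF AB(1) AB'(2) order_refl]
        rpoly_mult[OF AB(2) AB'(1) order_refl]] assms(4) order_refl] .
  have "V z w ^ (j + i + 1) * (\<Phi> z w s * \<Psi> z w s) = A2 z w + s * B2 z w"
    if s: "s\<^sup>2 * V z w = U z w" for z w s
  proof -
    have "V z w ^ (j + i + 1) * (\<Phi> z w s * \<Psi> z w s)
      = V z w * ((V z w ^ j * \<Phi> z w s) * (V z w ^ i * \<Psi> z w s))"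
      by (simp add: power_add algebra_simps)
    also have "\<dots> = V z w * ((A z w + s * B z w) * (A' z w + s * B' z w))"
      by (simp add: AB(3)[OF s] AB'(3)[OF s])
    also have "\<dots> = A2 z w + s * B2 z w"
      unfolding A2_def B2_def s[symmetric] by (simp add: algebra_simps power2_eq_square)
    finally show ?thesis .
  qed
  then show ?thesis unfolding split_form_def using A2 B2 by blast
qed

lemma split_form_add:
  assumes "split_form K j U V \<Phi>" "split_form K j U V \<Psi>"
  shows "split_form K j U V (\<lambda>z w s. \<Phi> z w s + \<Psi> z w s)"
proof -
  from assms(1) obtain A B where AB: "rpoly K A" "rpoly K B"
    "\<And>z w s. s\<^sup>2 * V z w = U z w \<Longrightarrow> V z w ^ j * \<Phi> z w s = A z w + s * B z w"
    unfolding split_form_def by blast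
  from assms(2) obtain A' B' where AB': "rpoly K A'" "rpoly K B'"
    "\<And>z w s. s\<^sup>2 * V z w = U z w \<Longrightarrow> V z w ^ j * \<Psi> z w s = A' z w + s * B' z w"
    unfolding split_form_def by blast
  show ?thesis unfolding split_form_def
    by (rule exI[of _ "\<lambda>z w. A z w + A' z w"], rule exI[of _ "\<lambda>z w. B z w + B' z w"])
       (auto simp: AB AB' ring_distribs intro!: rpoly_add)
qed

lemma split_form_sum:
  assumes "finite I" "\<And>i. i \<in> I \<Longrightarrow> split_form K j U V (\<Phi> i)"
  shows "split_form K j U V (\<lambda>z w s. \<Sum>i\<in>I. \<Phi> i z w s)"
  using assms
proof (induction I rule: finite_induct)
  case empty
  show ?case unfolding split_form_def
    by (rule exI[of _ "\<lambda>z w. 0"], rule exI[of _ "\<lambda>z w. 0"]) (use rpoly_const[of K 0] in auto)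
next
  case (insert x I) then show ?case using split_form_add[of K j U V "\<Phi> x"] by simp
qed

text \<open>Normal forms can be added only over the same power of V.\<close>

lemma split_form_raise:
  assumes "split_form K j U V \<Phi>" "rpoly k V"
  shows "split_form (K + t * k) (j + t) U V \<Phi>"
proof -
  from assms(1) obtain A B where AB: "rpoly K A" "rpoly K B"
    "\<And>z w s. s\<^sup>2 * V z w = U z w \<Longrightarrow> V z w ^ j * \<Phi> z w s = A z w + s * B z w"
    unfolding split_form_def by blast
  have "V z w ^ (j + t) * \<Phi> z w s = A z w * V z w ^ t + s * (B z w * V z w ^ t)"
    if "s\<^sup>2 * V z w = U z w" for z w s
  proof -
    have "V z w ^ (j + t) * \<Phi> z w s = V z w ^ t * (V z w ^ j * \<Phi> z w s)"
      by (simp add: power_add mult_ac)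
    also have "\<dots> = V z w ^ t * (A z w + s * B z w)" using AB(3)[OF that] by simp
    also have "\<dots> = A z w * V z w ^ t + s * (B z w * V z w ^ t)" by (simp add: algebra_simps)
    finally show ?thesis .
  qed
  moreover have "rpoly (K + t * k) (\<lambda>z w. A z w * V z w ^ t)" "rpoly (K + t * k) (\<lambda>z w. B z w * V z w ^ t)"
    using rpoly_mult[OF AB(1) rpoly_power[OF assms(2)] order_refl]
      rpoly_mult[OF AB(2) rpoly_power[OF assms(2)] order_refl] by blast+
  ultimately show ?thesis unfolding split_form_def by blast
qed

lemma split_form_cmult:
  assumes "split_form K j U V \<Phi>"
  shows "split_form K j U V (\<lambda>z w s. of_real c * \<Phi> z w s)"
proof -
  from assms obtain A B where AB: "rpoly K A" "rpoly K B"
    "\<And>z w s. s\<^sup>2 * V z w = U z w \<Longrightarrow> V z w ^ j * \<Phi> z w s = A z w + s * B z w"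
    unfolding split_form_def by blast
  have "V z w ^ j * (of_real c * \<Phi> z w s) = of_real c * A z w + s * (of_real c * B z w)"
    if "s\<^sup>2 * V z w = U z w" for z w s
    using arg_cong[OF AB(3)[OF that], of "\<lambda>x. of_real c * x"] by (simp add: algebra_simps)
  then show ?thesis unfolding split_form_def using rpoly_cmult AB by blast
qed

lemma split_form_power:
  assumes "rpoly k a" "rpoly k b" "rpoly k U" "rpoly k V"
  shows "split_form (i * (2 * k)) i U V (\<lambda>z w s. (a z w + s * b z w) ^ i)"
proof (induction i)
  case 0
  show ?case unfolding split_form_def
    by (rule exI[of _ "\<lambda>z w. 1"], rule exI[of _ "\<lambda>z w. 0"])
       (use rpoly_const[of 0 1] rpoly_const[of 0 0] in auto)
next
  case (Suc i)
  from split_form_mult[OF split_form_linear[OF assms(1,2)] Suc assms(3,4)]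
  show ?case by (auto simp: algebra_simps)
qed

lemma split_form_ceval:
  assumes "bideg_le P k" "rpoly l a" "rpoly l b" "rpoly l c" "rpoly l e" "rpoly l U" "rpoly l V"
  shows "split_form (l * (4 * k + 1)) (2 * k + 1) U V
           (\<lambda>z w s. ceval P (a z w + s * b z w) (c z w + s * e z w))"
  unfolding ceval_sum[OF assms(1)]
proof (intro split_form_sum split_form_cmult finite_atMost)
  fix i j assume ij: "j \<in> {..k}" "i \<in> {..k}"
  \<comment> \<open>The monomial z^i w^j needs the exponent i + j + 1; the padding t brings all
    monomials to the common exponent 2k + 1.\<close>
  define t where "t = 2 * k - i - j"
  have t: "t + i + j = 2 * k" using ij unfolding t_def by auto
  from split_form_raise[OF split_form_mult[OF split_form_power[OF assms(2,3,6,7), of i]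
        split_form_power[OF assms(4,5,6,7), of j] assms(6,7)] assms(7), of t]
  have h1: "split_form (i * (2 * l) + j * (2 * l) + l + t * l) (i + j + 1 + t) U V
     (\<lambda>z w s. (a z w + s * b z w) ^ i * (c z w + s * e z w) ^ j)" .
  have h2: "i + j + 1 + t = 2 * k + 1" using t by simp
  have h3: "i * (2 * l) + j * (2 * l) + l + t * l \<le> l * (4 * k + 1)"
  proof -
    have "i * (2 * l) + j * (2 * l) + l + t * l = l * (2 * i + 2 * j + t + 1)" by (simp add: algebra_simps)
    also have "\<dots> \<le> l * (4 * k + 1)" using t by (intro mult_le_mono) auto
    finally show ?thesis .
  qed
  show "split_form (l * (4 * k + 1)) (2 * k + 1) U V
     (\<lambda>z w s. (a z w + s * b z w) ^ i * (c z w + s * e z w) ^ j)"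
    using split_form_mono[OF h1 h3] unfolding h2 .
qed

text \<open>N is V times the norm of A + s B over the two roots s and -s, that is V A^2 - U B^2. If
  it vanishes, so does one of the two factors; complex numbers are needed for the root s to exist.
  One factor U or V and two factors of bidegree l (4k + 1) give l (8k + 3).\<close>

lemma eliminate_sqrt:
  assumes "bideg_le P k" "rpoly l a" "rpoly l b" "rpoly l c" "rpoly l e" "rpoly l U" "rpoly l V"
  shows "\<exists>N. rpoly (l * (8 * k + 3)) N \<and> (\<forall>z w. V z w \<noteq> 0 \<longrightarrow> (N z w = 0 \<longleftrightarrow>
       (\<exists>s. s\<^sup>2 * V z w = U z w \<and> ceval P (a z w + s * b z w) (c z w + s * e z w) = 0)))"
proof -
  define \<Phi> where "\<Phi> = (\<lambda>z w s. ceval P (a z w + s * b z w) (c z w + s * e z w))"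
  from split_form_ceval[OF assms] obtain A B where AB: "rpoly (l * (4 * k + 1)) A" "rpoly (l * (4 * k + 1)) B"
    "\<And>z w s. s\<^sup>2 * V z w = U z w \<Longrightarrow> V z w ^ (2 * k + 1) * \<Phi> z w s = A z w + s * B z w"
    unfolding split_form_def \<Phi>_def by blast
  define N where "N = (\<lambda>z w. V z w * (A z w * A z w) - U z w * (B z w * B z w))"
  have deg: "l + (l * (4 * k + 1) + l * (4 * k + 1)) \<le> l * (8 * k + 3)"
    by (simp add: algebra_simps)
  have "rpoly (l * (8 * k + 3)) N" unfolding N_def
    using rpoly_diff[OF rpoly_mult[OF assms(7) rpoly_mult[OF AB(1) AB(1) order_refl] deg]
        rpoly_mult[OF assms(6) rpoly_mult[OF AB(2) AB(2) order_refl] deg]] .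
  moreover have "N z w = 0 \<longleftrightarrow> (\<exists>s. s\<^sup>2 * V z w = U z w \<and> \<Phi> z w s = 0)" if V: "V z w \<noteq> 0" for z w
  proof
    assume "\<exists>s. s\<^sup>2 * V z w = U z w \<and> \<Phi> z w s = 0"
    then obtain s where s: "s\<^sup>2 * V z w = U z w" "\<Phi> z w s = 0" by blast
    with AB(3)[OF s(1)] have "A z w = - s * B z w" by (simp add: add_eq_0_iff2)
    then show "N z w = 0" unfolding N_def s(1)[symmetric] by (simp add: power2_eq_square)
  next
    assume N: "N z w = 0"
    define s where "s = csqrt (U z w / V z w)"
    have s: "s\<^sup>2 * V z w = U z w" "(-s)\<^sup>2 * V z w = U z w" using V by (auto simp: s_def)
    have "V z w * ((A z w + s * B z w) * (A z w + (-s) * B z w)) = N z w"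
      unfolding N_def s(1)[symmetric] by (simp add: algebra_simps power2_eq_square)
    then have "A z w + s * B z w = 0 \<or> A z w + (-s) * B z w = 0" using N V by auto
    then have "\<Phi> z w s = 0 \<or> \<Phi> z w (-s) = 0"
      using AB(3)[OF s(1)] AB(3)[OF s(2)] V by auto
    then show "\<exists>s. s\<^sup>2 * V z w = U z w \<and> \<Phi> z w s = 0" using s by blast
  qed
  ultimately show ?thesis unfolding \<Phi>_def by blast
qed

section \<open>Intersections of curves\<close>

lemma underdetermined_system:
  fixes A :: "'j \<Rightarrow> 'i \<Rightarrow> real"
  assumes "finite J" "finite I" "card J < card I"
  shows "\<exists>x. (\<exists>i\<in>I. x i \<noteq> 0) \<and> (\<forall>j\<in>J. (\<Sum>i\<in>I. A j i * x i) = 0)"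
  using assms
proof (induction J arbitrary: I A rule: finite_induct)
  case empty
  then obtain i where "i \<in> I" by fastforce
  then show ?case by (intro exI[of _ "\<lambda>_. 1"]) auto
next
  case (insert j J)
  show ?case
  proof (cases "\<forall>i\<in>I. A j i = 0")
    case True
    from insert.IH[of I A] insert.prems insert.hyps obtain x
      where "\<exists>i\<in>I. x i \<noteq> 0" "\<forall>j\<in>J. (\<Sum>i\<in>I. A j i * x i) = 0" by auto
    then show ?thesis using True by (intro exI[of _ x]) auto
  next
    case False
    then obtain i0 where i0: "i0 \<in> I" "A j i0 \<noteq> 0" by blast
    define I' where "I' = I - {i0}"
    have I': "finite I'" "I = insert i0 I'" "i0 \<notin> I'" using insert.prems i0 by (auto simp: I'_def)
    have "card J < card I'" using insert.prems insert.hyps i0 by (simp add: I'_def)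
    from insert.IH[OF I'(1) this, of "\<lambda>j' i. A j' i - A j' i0 * A j i / A j i0"] obtain x
      where x: "\<exists>i\<in>I'. x i \<noteq> 0"
        "\<forall>j'\<in>J. (\<Sum>i\<in>I'. (A j' i - A j' i0 * A j i / A j i0) * x i) = 0" by blast
    define x0 where "x0 = - (\<Sum>i\<in>I'. A j i * x i) / A j i0"
    define y where "y = x(i0 := x0)"
    have y: "(\<Sum>i\<in>I. A j' i * y i) = A j' i0 * x0 + (\<Sum>i\<in>I'. A j' i * x i)" for j'
    proof -
      have "(\<Sum>i\<in>I'. A j' i * y i) = (\<Sum>i\<in>I'. A j' i * x i)"
        using I'(3) by (intro sum.cong) (auto simp: y_def)
      then show ?thesis using I' by (simp add: y_def)
    qed
    have "(\<Sum>i\<in>I. A j i * y i) = 0" using i0 by (simp add: y x0_def)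
    moreover have "(\<Sum>i\<in>I. A j' i * y i) = 0" if "j' \<in> J" for j'
    proof -
      have "(\<Sum>i\<in>I'. (A j' i - A j' i0 * A j i / A j i0) * x i)
          = (\<Sum>i\<in>I'. A j' i * x i) - A j' i0 / A j i0 * (\<Sum>i\<in>I'. A j i * x i)"
        by (simp add: algebra_simps sum_subtractf sum_distrib_left)
      with x(2) that show ?thesis by (simp add: y x0_def)
    qed
    moreover have "\<exists>i\<in>I. y i \<noteq> 0" using x(1) I' by (auto simp: y_def)
    ultimately show ?thesis by (intro exI[of _ y]) auto
  qed
qed

text \<open>A dimension count takes the place of the resultant: in the combinations B G + A f there
  are more free coefficients than coefficients of positive y-degree to be killed, so a nontrivial
  combination is a polynomial r in x alone. It is nonzero, since otherwise f divides B G, hence B,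
  whose y-degree is too small.\<close>

lemma irreducible_not_dvd_eliminate:
  fixes f G :: "real poly poly"
  assumes irr: "irreducible f" and deg: "degree f \<ge> 1" and f: "bideg_le f d" and G: "bideg_le G k"
    and ndvd: "\<not> f dvd G"
  obtains r where "r \<noteq> 0" "degree r \<le> (d + k) * (d + k) + (d + k)"
    "\<And>a b. eval2 f a b = 0 \<Longrightarrow> eval2 G a b = 0 \<Longrightarrow> poly r a = 0"
proof -
  define e where "e = degree f"
  \<comment> \<open>With n = e + k - 1, unknowns outnumber equations when (n + 1)(M + 1) > n (M + d
    + k + 1), that is when n (d + k) < M + 1.\<close>
  define M where "M = (d + k) * (d + k)"
  define I where "I = {..<e + k} \<times> {..M}"
  \<comment> \<open>The row of y^0 is left out: its coefficients form the polynomial r that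
    remains.\<close>
  define J where "J = {1..<e + k} \<times> {..M + d + k}"
  define E where "E = (\<lambda>(j, i). if j < e then monom (monom 1 i) j * G else monom (monom 1 i) (j - e) * f)"
  have e: "1 \<le> e" "e \<le> d" using deg f by (auto simp: e_def bideg_le_def)
  have "card J < card I"
  proof -
    obtain n where n: "e + k = Suc n" using e by (cases "e + k") auto
    have "n < d + k" using n e by simp
    then have "n * (d + k) \<le> M" unfolding M_def by (intro mult_le_mono) auto
    then have "n * (M + d + k + 1) < Suc n * (M + 1)" by (simp add: algebra_simps)
    then show ?thesis by (simp add: I_def J_def n)
  qed
  from underdetermined_system[OF _ _ this, of "\<lambda>(j, i) p. coeff (coeff (E p) j) i"]
  obtain x where x: "\<exists>p\<in>I. x p \<noteq> 0"
    and x0: "\<forall>(j, i)\<in>J. (\<Sum>p\<in>I. coeff (coeff (E p) j) i * x p) = 0"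
    unfolding I_def J_def by (auto simp: case_prod_unfold)
  define R where "R = (\<Sum>p\<in>I. smult [:x p:] (E p))"
  have coR: "coeff (coeff R j) i = (\<Sum>p\<in>I. coeff (coeff (E p) j) i * x p)" for i j
    by (simp add: R_def coeff_sum mult.commute)
  have E_y: "coeff (E p) j = 0" if "p \<in> I" "j \<ge> e + k" for p j
  proof (rule coeff_eq_0)
    obtain j' i' where p: "p = (j', i')" by force
    have "degree (E p) \<le> e + k - 1"
    proof (cases "j' < e")
      case True
      have "degree (monom (monom (1::real) i') j' * G) \<le> j' + degree G"
        by (rule order_trans[OF degree_mult_le]) (simp add: degree_monom_le)
      then show ?thesis using True G by (auto simp: p E_def bideg_le_def)
    next
      case False
      have "degree (monom (monom (1::real) i') (j' - e) * f) \<le> (j' - e) + degree f"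
        by (rule order_trans[OF degree_mult_le]) (simp add: degree_monom_le)
      then show ?thesis using False that by (auto simp: p E_def I_def e_def[symmetric])
    qed
    then show "degree (E p) < j" using that e by simp
  qed
  have E_x: "coeff (coeff (E p) j) i = 0" if p: "p \<in> I" and i: "i > M + d + k" for p j i
  proof -
    obtain j' i' where p': "p = (j', i')" by force
    have i': "i' \<le> M" using p by (auto simp: p' I_def)
    have *: "coeff (coeff (monom (monom (1::real) i') l * h) j) i = 0" if "bideg_le h (d + k)" for l h
    proof -
      have "degree (coeff h (j - l)) \<le> d + k" using that unfolding bideg_le_def by blast
      then have "degree (coeff h (j - l)) < i - i'" using i i' by linarith
      then show ?thesis by (auto simp: coeff_monom_mult coeff_eq_0)
    qed
    have "bideg_le f (d + k)" "bideg_le G (d + k)" using f G by (auto intro: bideg_le_mono)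
    then show ?thesis using * by (auto simp: p' E_def)
  qed
  have R1: "coeff R j = 0" if "j \<ge> 1" for j
  proof (rule poly_eqI)
    fix i
    have "(j, i) \<in> J \<or> j \<ge> e + k \<or> i > M + d + k" using that by (auto simp: J_def)
    then consider "(j, i) \<in> J" | "j \<ge> e + k" | "i > M + d + k" by blast
    then show "coeff (coeff R j) i = coeff 0 i"
    proof cases
      case 1 then show ?thesis using x0 by (auto simp: coR)
    next
      case 2 then show ?thesis using E_y by (simp add: coR)
    next
      case 3 then show ?thesis using E_x by (simp add: coR)
    qed
  qed
  define r where "r = coeff R 0"
  have R: "R = [:r:]"
    by (rule poly_eqI) (use R1 in \<open>auto simp: r_def coeff_pCons split: nat.splits\<close>)
  have "degree r \<le> M + d + k"
    unfolding r_def by (rule degree_le) (use E_x in \<open>auto simp: coR\<close>)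
  moreover have "poly r a = 0" if ab: "eval2 f a b = 0" "eval2 G a b = 0" for a b
  proof -
    have "eval2 (\<Sum>p\<in>S. smult [:x p:] (E p)) a b = 0" if "finite S" for S
      using that ab by induction (auto simp: eval2_add eval2_smult E_def eval2_mult split: prod.splits)
    then have "eval2 R a b = 0" unfolding R_def I_def by simp
    then show ?thesis by (simp add: R eval2_pCons)
  qed
  moreover have "r \<noteq> 0"
  proof
    assume "r = 0"
    then have R0: "R = 0" by (simp add: R)
    define B where "B = (\<Sum>p\<in>{..<e} \<times> {..M}. monom (monom (x p) (snd p)) (fst p))"
    define A where "A = (\<Sum>p\<in>{e..<e+k} \<times> {..M}. monom (monom (x p) (snd p)) (fst p - e))"
    have Isplit: "I = ({..<e} \<times> {..M}) \<union> ({e..<e+k} \<times> {..M})" by (auto simp: I_def)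
    have "R = (\<Sum>p\<in>{..<e} \<times> {..M}. smult [:x p:] (E p)) + (\<Sum>p\<in>{e..<e+k} \<times> {..M}. smult [:x p:] (E p))"
      unfolding R_def Isplit by (rule sum.union_disjoint) auto
    also have "(\<Sum>p\<in>{..<e} \<times> {..M}. smult [:x p:] (E p)) = B * G"
      unfolding B_def sum_distrib_right
      by (rule sum.cong) (auto simp: E_def smult_monom mult_smult_left[symmetric] simp del: mult_smult_left)
    also have "(\<Sum>p\<in>{e..<e+k} \<times> {..M}. smult [:x p:] (E p)) = A * f"
      unfolding A_def sum_distrib_right
      by (rule sum.cong) (auto simp: E_def smult_monom mult_smult_left[symmetric] simp del: mult_smult_left)
    finally have BA: "B * G + A * f = 0" using R0 by simp
    have coB: "coeff (coeff B j) i = x (j, i)" if "j < e" "i \<le> M" for j i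
    proof -
      have "coeff (coeff B j) i = (\<Sum>p\<in>{..<e} \<times> {..M}. if p = (j, i) then x p else 0)"
        unfolding B_def coeff_sum by (intro sum.cong) auto
      also have "\<dots> = x (j, i)" using that by (simp add: sum.delta)
      finally show ?thesis .
    qed
    have coA: "coeff (coeff A (j - e)) i = x (j, i)" if "e \<le> j" "j < e + k" "i \<le> M" for j i
    proof -
      have "coeff (coeff A (j - e)) i = (\<Sum>p\<in>{e..<e+k} \<times> {..M}. if p = (j, i) then x p else 0)"
        unfolding A_def coeff_sum using that by (intro sum.cong) auto
      also have "\<dots> = x (j, i)" using that by (simp add: sum.delta)
      finally show ?thesis .
    qed
    have "f dvd B * G" using BA by (metis add_eq_0_iff2 dvd_minus_iff dvd_triv_right)
    moreover have "prime_elem f" using irr by (simp add: irreducible_imp_prime_elem_gcd)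
    ultimately have "f dvd B" using ndvd prime_elem_dvd_mult_iff by blast
    moreover have "degree B \<le> e - 1"
      unfolding B_def by (rule degree_sum_le) (auto intro!: order_trans[OF degree_monom_le])
    ultimately have B0: "B = 0" using e dvd_imp_degree_le[of f B] unfolding e_def by fastforce
    then have "A = 0" using BA irr by auto
    with B0 coA coB have "x (j, i) = 0" if "(j, i) \<in> I" for j i
      using that unfolding Isplit by (metis SigmaD1 SigmaD2 UnE atLeastLessThan_iff atMost_iff coeff_0 lessThan_iff)
    then show False using x by auto
  qed
  ultimately show thesis using that[of r] unfolding M_def by (simp add: add.assoc)
qed

section \<open>A Bezout bound for curves irreducible over the reals\<close>

definition acurve :: "nat \<Rightarrow> real poly poly \<Rightarrow> (real \<times> real) set \<Rightarrow> bool" where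
  "acurve d f C \<longleftrightarrow> irreducible f \<and> bideg_le f d \<and> C = zeroset f \<and> infinite C"

definition pev :: "(complex \<Rightarrow> complex \<Rightarrow> complex) \<Rightarrow> real \<times> real \<Rightarrow> complex" where
  "pev G p = G (complex_of_real (fst p)) (complex_of_real (snd p))"

lemma pev_ceval: "pev (ceval P) p = of_real (eval2 P (fst p) (snd p))"
  by (simp add: pev_def ceval_of_real)

text \<open>The product counts the zeros of the eliminant in x times at most d points above each;
  the last summand covers a vertical line, on which the other polynomial has at most k
  zeros.\<close>

definition bez :: "nat \<Rightarrow> nat \<Rightarrow> nat" where
  "bez d k = ((d + k) * (d + k) + (d + k)) * d + (d + k)"

lemma irreducible_linear_dvd:
  fixes f :: "real poly poly"
  assumes "irreducible f" "[:[:-a, 1:]:] dvd f" shows "degree f = 0" "\<exists>c. c \<noteq> 0 \<and> f = [:[:c:] * [:-a, 1:]:]"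
proof -
  from assms(2) obtain h where h: "f = [:[:-a, 1:]:] * h" by (rule dvdE)
  have "\<not> [:[:-a, 1:]:] dvd (1 :: real poly poly)"
    by (auto simp: const_poly_dvd_iff coeff_1 poly_eq_0_iff_dvd[symmetric])
  then have "is_unit h" using irreducibleD[OF assms(1) h] by blast
  then obtain u where u: "h = [:u:]" "is_unit u" by (auto simp: is_unit_poly_iff)
  then obtain c where c: "u = [:c:]" using is_unit_poly_iff by blast
  have "f = [:[:c:] * [:-a, 1:]:]" using h u(1) c by (simp add: mult.commute)
  moreover have "c \<noteq> 0" using u c by auto
  ultimately show "degree f = 0" "\<exists>c. c \<noteq> 0 \<and> f = [:[:c:] * [:-a, 1:]:]" by auto
qed

text \<open>A polynomial that vanished on x = a would have x - a as a factor, which irreducibility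
  and a positive y-degree forbid.\<close>

lemma irreducible_fiber:
  fixes f :: "real poly poly"
  assumes "irreducible f" "degree f \<ge> 1" "bideg_le f d"
  shows "finite {b. eval2 f a b = 0}" "card {b. eval2 f a b = 0} \<le> d"
proof -
  define p where "p = map_poly (\<lambda>c. poly c a) f"
  have "p \<noteq> 0"
  proof
    assume "p = 0"
    then have "poly (coeff f j) a = 0" for j
      using coeff_map_poly[of "\<lambda>c. poly c a" f j] by (simp add: p_def)
    then have "[:[:-a, 1:]:] dvd f" by (auto simp: const_poly_dvd_iff poly_eq_0_iff_dvd[symmetric])
    from irreducible_linear_dvd(1)[OF assms(1) this] assms(2) show False by simp
  qed
  then have "finite {b. poly p b = 0}" "card {b. poly p b = 0} \<le> degree p"
    by (simp_all add: poly_roots_finite card_poly_roots_bound)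
  moreover have "degree p \<le> degree f"
    unfolding p_def by (rule degree_le) (auto simp: coeff_map_poly coeff_eq_0)
  ultimately show "finite {b. eval2 f a b = 0}" "card {b. eval2 f a b = 0} \<le> d"
    using assms(3) by (auto simp: eval2_def p_def bideg_le_def)
qed

lemma irreducible_degree0_curve:
  assumes "irreducible f" "degree f = 0" "eval2 f a b = 0"
  shows "zeroset f = {p. fst p = a}" "\<exists>c. c \<noteq> 0 \<and> f = [:[:c:] * [:-a, 1:]:]"
proof -
  from assms(2) obtain g where g: "f = [:g:]" by (metis degree_0_id)
  then have "poly g a = 0" using assms(3) by (simp add: eval2_pCons)
  then have "[:[:-a, 1:]:] dvd f" by (auto simp: g const_poly_dvd_iff poly_eq_0_iff_dvd[symmetric] coeff_pCons split: nat.splits)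
  from irreducible_linear_dvd(2)[OF assms(1) this]
  show c: "\<exists>c. c \<noteq> 0 \<and> f = [:[:c:] * [:-a, 1:]:]" .
  then show "zeroset f = {p. fst p = a}"
    by (auto simp: zeroset_def eval2_pCons algebra_simps)
qed

text \<open>Since y is the eliminated variable, polynomials of y-degree 0 need their own treatment:
  their curve is a vertical line, and G is restricted to it as a polynomial in y.\<close>

lemma bezout_poly:
  assumes C: "acurve d f C" and G: "bideg_le G k"
  shows "(f dvd G \<and> (\<forall>p\<in>C. eval2 G (fst p) (snd p) = 0)) \<or> (\<forall>p\<in>C. eval2 G (fst p) (snd p) = 0) \<and> degree f = 0 \<or>
     (finite {p\<in>C. eval2 G (fst p) (snd p) = 0} \<and> card {p\<in>C. eval2 G (fst p) (snd p) = 0} \<le> bez d k)"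
proof (cases "degree f \<ge> 1")
  case True
  note c = C[unfolded acurve_def]
  show ?thesis
  proof (cases "f dvd G")
    case dvd: True
    then obtain h where "G = f * h" by (rule dvdE)
    then show ?thesis using dvd c by (auto simp: zeroset_def eval2_mult)
  next
    case False
    with c True G obtain r where r: "r \<noteq> 0" "degree r \<le> (d + k) * (d + k) + (d + k)"
      "\<And>a b. eval2 f a b = 0 \<Longrightarrow> eval2 G a b = 0 \<Longrightarrow> poly r a = 0"
      using irreducible_not_dvd_eliminate[of f d G k] by metis
    define X where "X = {a. poly r a = 0}"
    have X: "finite X" "card X \<le> (d + k) * (d + k) + (d + k)"
      using poly_roots_finite[OF r(1)] card_poly_roots_bound[OF r(1)] r(2) by (auto simp: X_def)
    have fib: "finite {b. eval2 f a b = 0}" "card {b. eval2 f a b = 0} \<le> d" for a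
      using irreducible_fiber[of f d a] c True by auto
    let ?S = "{p\<in>C. eval2 G (fst p) (snd p) = 0}"
    have sub: "?S \<subseteq> (SIGMA a:X. {b. eval2 f a b = 0})"
      using r(3) c by (auto simp: X_def zeroset_def)
    have fin: "finite (SIGMA a:X. {b. eval2 f a b = 0})" using X(1) fib(1) by auto
    have "card ?S \<le> card (SIGMA a:X. {b. eval2 f a b = 0})" by (rule card_mono[OF fin sub])
    also have "\<dots> = (\<Sum>a\<in>X. card {b. eval2 f a b = 0})" using X(1) fib(1) by simp
    also have "\<dots> \<le> card X * d" using sum_bounded_above[of X _ d] fib(2) by fastforce
    also have "\<dots> \<le> bez d k" using X(2) unfolding bez_def by (simp add: trans_le_add1)
    finally show ?thesis using finite_subset[OF sub fin] by blast
  qed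
next
  case False
  note c = C[unfolded acurve_def]
  then obtain a b where "(a, b) \<in> C" by (metis finite.emptyI ex_in_conv surj_pair)
  then have Ca: "C = {p. fst p = a}"
    using irreducible_degree0_curve(1)[of f a b] c False by (auto simp: zeroset_def)
  define p where "p = map_poly (\<lambda>c. poly c a) G"
  have ev: "eval2 G a b = poly p b" for b by (simp add: p_def eval2_def)
  show ?thesis
  proof (cases "p = 0")
    case True then show ?thesis using Ca False by (auto simp: ev)
  next
    case p0: False
    have "degree p \<le> degree G"
      unfolding p_def by (rule degree_le) (auto simp: coeff_map_poly coeff_eq_0)
    then have dp: "degree p \<le> k" using G by (simp add: bideg_le_def)
    have eq: "{p\<in>C. eval2 G (fst p) (snd p) = 0} = Pair a ` {b. poly p b = 0}"
      by (auto simp: Ca ev)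
    have "card {b. poly p b = 0} \<le> k" using card_poly_roots_bound[OF p0] dp by simp
    moreover have "card (Pair a ` {b. poly p b = 0}) = card {b. poly p b = 0}"
      by (rule card_image) (auto simp: inj_on_def)
    ultimately show ?thesis unfolding eq
      using poly_roots_finite[OF p0] by (auto simp: bez_def)
  qed
qed

lemma bezout:
  assumes C: "acurve d f C" and G: "rpoly k G"
  shows "(\<forall>p\<in>C. pev G p = 0) \<or> (finite {p\<in>C. pev G p = 0} \<and> card {p\<in>C. pev G p = 0} \<le> bez d k)"
proof -
  from G obtain P where P: "bideg_le P k" "G = ceval P" unfolding rpoly_def by blast
  show ?thesis using bezout_poly[OF C P(1)] by (auto simp: P(2) pev_ceval)
qed

corollary bezout_infinite:
  assumes "acurve d f C" "rpoly k G" "infinite {p\<in>C. pev G p = 0}" "p \<in> C"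
  shows "pev G p = 0"
  using bezout[OF assms(1,2)] assms(3,4) by blast

text \<open>The curve is infinite, so a finite zero set rules out vanishing on all of it.\<close>

corollary bezout_finite:
  assumes "acurve d f C" "rpoly k G" "finite {p\<in>C. pev G p = 0}"
  shows "card {p\<in>C. pev G p = 0} \<le> bez d k"
proof -
  have "{p\<in>C. pev G p = 0} \<noteq> C" using assms unfolding acurve_def by metis
  then show ?thesis using bezout[OF assms(1,2)] by blast
qed

text \<open>The polynomial in y that multiplies x^i; it exchanges the roles of the two
  variables.\<close>

definition xrow :: "real poly poly \<Rightarrow> nat \<Rightarrow> real poly" where
  "xrow P i = map_poly (\<lambda>c. coeff c i) P"

lemma coeff_xrow: "coeff (xrow P i) j = coeff (coeff P j) i"
  by (simp add: xrow_def coeff_map_poly)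

lemma xrow_pCons: "xrow (pCons c P) i = pCons (coeff c i) (xrow P i)"
  by (simp add: xrow_def map_poly_pCons)

lemma coeff_poly_const: "coeff (poly P [:b:]) i = poly (xrow P i) b"
  by (induction P) (auto simp: xrow_pCons, simp add: xrow_def)

text \<open>For the degree in x, substitute a constant y = b at which neither the coefficient of x^i
  in f nor some chosen coefficient of h vanishes. Then degrees in x add, and only finitely many b
  are excluded.\<close>

lemma bideg_le_factor:
  fixes f h :: "real poly poly"
  assumes "f * h \<noteq> 0" "bideg_le (f * h) d"
  shows "bideg_le f d"
  unfolding bideg_le_def
proof (intro conjI allI)
  have [simp]: "f \<noteq> 0" "h \<noteq> 0" using assms(1) by auto
  have "degree (f * h) = degree f + degree h" by (simp add: degree_mult_eq)
  then show "degree f \<le> d" using assms(2) by (simp add: bideg_le_def)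
  fix j
  show "degree (coeff f j) \<le> d"
  proof (cases "coeff f j = 0")
    case False
    define i where "i = degree (coeff f j)"
    have "coeff (xrow f i) j \<noteq> 0" using False by (simp add: coeff_xrow i_def)
    then have f0: "xrow f i \<noteq> 0" by auto
    obtain j' where "coeff h j' \<noteq> 0" using \<open>h \<noteq> 0\<close> by (meson leading_coeff_neq_0)
    then have "coeff (xrow h (degree (coeff h j'))) j' \<noteq> 0" by (simp add: coeff_xrow)
    then have h0: "xrow h (degree (coeff h j')) \<noteq> 0" by auto
    have "finite ({b. poly (xrow f i) b = 0} \<union> {b. poly (xrow h (degree (coeff h j'))) b = 0})"
      using f0 h0 by (simp add: poly_roots_finite)
    from ex_new_if_finite[OF infinite_UNIV_char_0 this] obtain b
      where b: "poly (xrow f i) b \<noteq> 0" "poly (xrow h (degree (coeff h j'))) b \<noteq> 0" by auto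
    have "coeff (poly f [:b:]) i \<noteq> 0" "poly h [:b:] \<noteq> 0"
      using b by (auto simp flip: coeff_poly_const)
    then have "i \<le> degree (poly f [:b:])" "poly f [:b:] \<noteq> 0" "poly h [:b:] \<noteq> 0"
      by (auto simp: le_degree)
    then have "i \<le> degree (poly (f * h) [:b:])" by (simp add: degree_mult_eq)
    also have "\<dots> \<le> d"
    proof (rule degree_le, intro allI impI)
      fix l assume "d < l"
      have "xrow (f * h) l = 0"
      proof (rule poly_eqI)
        fix n
        have "degree (coeff (f * h) n) < l" using assms(2) \<open>d < l\<close>
          by (meson bideg_le_def le_less_trans)
        then show "coeff (xrow (f * h) l) n = coeff 0 n" by (simp add: coeff_xrow coeff_eq_0)
      qed
      then show "coeff (poly (f * h) [:b:]) l = 0" by (simp add: coeff_poly_const del: poly_mult)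
    qed
    finally show ?thesis by (simp add: i_def)
  qed simp
qed

lemma tdeg_bideg_le:
  assumes "f \<noteq> 0" "tdeg f \<le> d" shows "bideg_le f d"
proof -
  let ?S = "{i + j | i j. coeff (coeff f j) i \<noteq> 0}"
  have "?S \<subseteq> (\<lambda>(j, i). i + j) ` (SIGMA j:{..degree f}. {..degree (coeff f j)})"
    by (force simp: image_def intro: le_degree)
  then have fin: "finite ?S" by (rule finite_subset) auto
  have le: "i + j \<le> d" if "coeff (coeff f j) i \<noteq> 0" for i j
  proof -
    have "i + j \<le> Max ?S" using fin that by (intro Max_ge) auto
    then show ?thesis using assms by (simp add: tdeg_def)
  qed
  show ?thesis unfolding bideg_le_def
  proof (intro conjI allI)
    have "coeff (coeff f (degree f)) (degree (coeff f (degree f))) \<noteq> 0" using assms(1) by simp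
    from le[OF this] show "degree f \<le> d" by simp
    fix j show "degree (coeff f j) \<le> d"
    proof (cases "coeff f j = 0")
      case False
      then have "coeff (coeff f j) (degree (coeff f j)) \<noteq> 0" by simp
      from le[OF this] show ?thesis by simp
    qed simp
  qed
qed

text \<open>Irreducibility and the degree bound are witnessed by different polynomials. The
  irreducible f divides the low-degree g because g vanishes on the infinite set C, and a factor
  inherits the bidegree bound; for a vertical line the explicit equation is used.\<close>

lemma irreducible_curve_acurve:
  assumes "irreducible_curve C" "curve_deg_le C d" "d \<ge> 1"
  obtains f where "acurve d f C"
proof -
  from assms(1) obtain f where f: "irreducible f" "C = zeroset f" "infinite C"
    unfolding irreducible_curve_def plane_curve_def by blast
  from assms(2) obtain g where g: "g \<noteq> 0" "C = zeroset g" "tdeg g \<le> d"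
    unfolding curve_deg_le_def by blast
  have "f \<noteq> 0" using f(1) by auto
  then have "bideg_le f (tdeg f)" by (rule tdeg_bideg_le) simp
  then have C: "acurve (tdeg f) f C" using f by (simp add: acurve_def)
  have gd: "bideg_le g d" using g tdeg_bideg_le by blast
  have eq: "{p\<in>C. eval2 g (fst p) (snd p) = 0} = C" using g(2) by (auto simp: zeroset_def)
  from bezout_poly[OF C gd] f(3) have "f dvd g \<or> degree f = 0" unfolding eq by auto
  then have "bideg_le f d"
  proof
    assume "f dvd g"
    then obtain h where "g = f * h" by (rule dvdE)
    then show ?thesis using bideg_le_factor g gd by metis
  next
    assume 2: "degree f = 0"
    from f(3) obtain a b where "(a, b) \<in> C" by (metis finite.emptyI ex_in_conv surj_pair)
    then have "eval2 f a b = 0" using f(2) by (simp add: zeroset_def)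
    from irreducible_degree0_curve(2)[OF f(1) 2 this] obtain c where "f = [:[:c:] * [:-a, 1:]:]" by blast
    then show ?thesis using assms(3) by (auto simp: bideg_le_def coeff_pCons split: nat.splits)
  qed
  with f that show thesis by (simp add: acurve_def)
qed

section \<open>Curves that meet a line or a circle infinitely often\<close>

lemma poly_clear_denom:
  "\<exists>n q. \<forall>t. poly w t \<noteq> 0 \<longrightarrow> poly w t ^ n * poly p (poly u t / poly w t) = poly q (t::real)"
proof (induction p)
  case 0 then show ?case by (intro exI[of _ 0]) auto
next
  case (pCons c p)
  then obtain n q where "\<And>t. poly w t \<noteq> 0 \<Longrightarrow> poly w t ^ n * poly p (poly u t / poly w t) = poly q t" by blast
  then have "poly w t \<noteq> 0 \<Longrightarrow> poly w t ^ Suc n * poly (pCons c p) (poly u t / poly w t)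
      = poly (smult c (w ^ Suc n) + u * q) t" for t
    by (simp add: algebra_simps)
  then show ?case by blast
qed

lemma eval2_clear_denom:
  "\<exists>n q. \<forall>t. poly w t \<noteq> 0 \<longrightarrow> poly w t ^ n * eval2 P (poly u t / poly w t) (poly v t / poly w t) = poly q (t::real)"
proof (induction P)
  case 0 then show ?case by (intro exI[of _ 0]) auto
next
  case (pCons c P)
  then obtain n q where 1: "\<And>t. poly w t \<noteq> 0 \<Longrightarrow> poly w t ^ n * eval2 P (poly u t / poly w t) (poly v t / poly w t) = poly q t" by blast
  obtain n' q' where 2: "\<And>t. poly w t \<noteq> 0 \<Longrightarrow> poly w t ^ n' * poly c (poly u t / poly w t) = poly q' t"
    using poly_clear_denom by blast
  have "poly w t ^ (n' + Suc n) * eval2 (pCons c P) (poly u t / poly w t) (poly v t / poly w t)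
      = poly (w ^ Suc n * q' + w ^ n' * v * q) t" if t: "poly w t \<noteq> 0" for t
  proof -
    have "poly w t ^ (n' + Suc n) * eval2 (pCons c P) (poly u t / poly w t) (poly v t / poly w t)
      = poly w t ^ Suc n * (poly w t ^ n' * poly c (poly u t / poly w t))
       + poly w t ^ n' * poly v t * (poly w t ^ n * eval2 P (poly u t / poly w t) (poly v t / poly w t))"
    proof -
      obtain k where k: "poly v t = k * poly w t" using t by (metis nonzero_divide_eq_eq)
      show ?thesis unfolding k eval2_pCons using t by (simp add: power_add algebra_simps)
    qed
    then show ?thesis unfolding 1[OF t] 2[OF t] by simp
  qed
  then show ?case by blast
qed

text \<open>Clearing denominators turns vanishing along the arc into vanishing of one polynomial in
  t. This gives the inclusion of a line or circle in C that Bezout does not give.\<close>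

lemma rational_arc_in_curve:
  fixes f :: "real poly poly"
  assumes w: "\<And>t. poly w t \<noteq> 0"
    and inf: "infinite {t. eval2 f (poly u t / poly w t) (poly v t / poly w t) = 0}"
  shows "eval2 f (poly u t / poly w t) (poly v t / poly w t) = 0"
proof -
  obtain n q where q: "\<And>t. poly w t \<noteq> 0 \<Longrightarrow> poly w t ^ n * eval2 f (poly u t / poly w t) (poly v t / poly w t) = poly q t"
    using eval2_clear_denom by blast
  have "{t. eval2 f (poly u t / poly w t) (poly v t / poly w t) = 0} = {t. poly q t = 0}"
    using w by (auto simp flip: q)
  with inf have "q = 0" using poly_roots_finite by force
  with q[OF w] w show ?thesis by simp
qed

definition dist2 :: "real \<times> real \<Rightarrow> real \<times> real \<Rightarrow> real" where
  "dist2 p q = (fst p - fst q)^2 + (snd p - snd q)^2"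

definition line :: "real \<Rightarrow> real \<Rightarrow> real \<Rightarrow> (real \<times> real) set" where
  "line a b c = {(x, y). a * x + b * y + c = 0}"

lemma pev_linear: "pev (\<lambda>z w. of_real a * z + of_real b * w + of_real c) p = of_real (a * fst p + b * snd p + c)"
  by (simp add: pev_def)

lemma rpoly_linear: "rpoly 1 (\<lambda>z w. of_real a * z + of_real b * w + of_real c)"
  by (intro rpoly_add rpoly_cmult rpoly_fst rpoly_snd rpoly_const) auto

text \<open>The base point is the foot of the perpendicular from the origin.\<close>

lemma line_param:
  assumes "(a, b) \<noteq> (0, 0)"
  shows "line a b c = range (\<lambda>t. (- a * c / (a\<^sup>2 + b\<^sup>2) + b * t, - b * c / (a\<^sup>2 + b\<^sup>2) - a * t))" (is "_ = range ?g")
    "inj (\<lambda>t. (- a * c / (a\<^sup>2 + b\<^sup>2) + b * t, - b * c / (a\<^sup>2 + b\<^sup>2) - a * t))"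
proof -
  have n: "a\<^sup>2 + b\<^sup>2 \<noteq> 0" using assms by (simp add: sum_power2_eq_zero_iff)
  have "p \<in> range ?g" if "p \<in> line a b c" for p
  proof -
    obtain x y where p: "p = (x, y)" by force
    have c: "c = - (a * x + b * y)" using that by (simp add: line_def p)
    define n where "n = a\<^sup>2 + b\<^sup>2"
    have n0: "n \<noteq> 0" using n by (simp add: n_def)
    have "- a * c / n + b * ((b * x - a * y) / n) = (x * n) / n"
      unfolding c times_divide_eq_right add_divide_distrib[symmetric]
      by (simp add: n_def power2_eq_square algebra_simps)
    moreover have "- b * c / n - a * ((b * x - a * y) / n) = (y * n) / n"
      unfolding c times_divide_eq_right diff_divide_distrib[symmetric]
      by (simp add: n_def power2_eq_square algebra_simps)
    ultimately have "p = ?g ((b * x - a * y) / n)" using n0 by (simp add: p n_def[symmetric])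
    then show ?thesis by blast
  qed
  moreover have "?g t \<in> line a b c" for t
  proof -
    have "a * (- a * c / (a\<^sup>2 + b\<^sup>2) + b * t) + b * (- b * c / (a\<^sup>2 + b\<^sup>2) - a * t) + c
       = (- c * (a\<^sup>2 + b\<^sup>2)) / (a\<^sup>2 + b\<^sup>2) + c"
      by (simp add: add_divide_distrib diff_divide_distrib power2_eq_square algebra_simps)
    then have "a * (- a * c / (a\<^sup>2 + b\<^sup>2) + b * t) + b * (- b * c / (a\<^sup>2 + b\<^sup>2) - a * t) + c = 0"
      using n by (simp only: nonzero_mult_div_cancel_right) simp
    then show ?thesis by (simp only: line_def case_prod_conv mem_Collect_eq)
  qed
  ultimately show "line a b c = range ?g" by blast
  show "inj ?g" using assms by (auto simp: inj_def)
qed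

text \<open>Bezout puts C into the line; the parametrization puts the line into C, since infinitely
  many parameters on C force all of them.\<close>

lemma line_bound:
  assumes C: "acurve d f C" and ab: "(a, b) \<noteq> (0, 0)"
  shows "C = line a b c \<or> finite (C \<inter> line a b c) \<and> card (C \<inter> line a b c) \<le> bez d 1"
proof -
  have eq: "{p\<in>C. pev (\<lambda>z w. of_real a * z + of_real b * w + of_real c) p = 0} = C \<inter> line a b c"
    by (auto simp: pev_linear line_def simp del: of_real_add of_real_mult)
  have "C = line a b c" if inf: "infinite (C \<inter> line a b c)"
  proof
    show "C \<subseteq> line a b c"
    proof
      fix p assume "p \<in> C"
      then have "pev (\<lambda>z w. of_real a * z + of_real b * w + of_real c) p = 0"
        using bezout_infinite[OF C rpoly_linear[of a b c]] inf unfolding eq by blast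
      then show "p \<in> line a b c"
        by (simp only: pev_linear of_real_eq_0_iff line_def mem_Collect_eq case_prod_unfold)
    qed
    define x0 where "x0 = - a * c / (a\<^sup>2 + b\<^sup>2)"
    define y0 where "y0 = - b * c / (a\<^sup>2 + b\<^sup>2)"
    define g where "g = (\<lambda>t. (x0 + b * t, y0 - a * t))"
    have g: "line a b c = range g" "inj g"
      using line_param[OF ab, of c] unfolding g_def x0_def y0_def by auto
    have eg: "eval2 f (fst (g t)) (snd (g t)) = eval2 f (poly [:x0, b:] t / poly 1 t) (poly [:y0, -a:] t / poly 1 t)" for t
      by (simp add: g_def algebra_simps)
    have CZ: "p \<in> C \<longleftrightarrow> eval2 f (fst p) (snd p) = 0" for p
      using C by (auto simp: acurve_def zeroset_def case_prod_unfold)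
    have "C \<inter> line a b c = g ` {t. eval2 f (fst (g t)) (snd (g t)) = 0}"
      using g by (auto simp: CZ)
    with inf have "infinite {t. eval2 f (fst (g t)) (snd (g t)) = 0}" by (metis finite_imageI)
    then have "eval2 f (fst (g t)) (snd (g t)) = 0" for t
      unfolding eg by (intro rational_arc_in_curve) auto
    then show "line a b c \<subseteq> C" unfolding g using CZ by blast
  qed
  then show ?thesis
    using bezout_finite[OF C rpoly_linear[of a b c]] unfolding eq by blast
qed

definition circle :: "real \<times> real \<Rightarrow> real \<Rightarrow> (real \<times> real) set" where
  "circle z \<rho> = {p. dist2 p z = \<rho>}"

definition dist2c :: "real \<times> real \<Rightarrow> complex \<Rightarrow> complex \<Rightarrow> complex" where
  "dist2c p = (\<lambda>z w. (z - of_real (fst p))\<^sup>2 + (w - of_real (snd p))\<^sup>2)"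

lemma rpoly_dist2c: "rpoly 2 (dist2c p)"
proof -
  have "rpoly 1 (\<lambda>z w. z - of_real (fst p))" "rpoly 1 (\<lambda>z w. w - of_real (snd p))"
    by (intro rpoly_diff rpoly_fst rpoly_snd rpoly_const order_refl)+
  from rpoly_add[OF rpoly_power[OF this(1), of 2, simplified] rpoly_power[OF this(2), of 2, simplified]]
  show ?thesis unfolding dist2c_def .
qed

lemma pev_dist2c: "pev (dist2c z) p = of_real (dist2 p z)"
  by (simp add: pev_def dist2c_def dist2_def)

lemma dist2_commute: "dist2 p q = dist2 q p"
  by (simp add: dist2_def power2_commute)

lemma dist2_nonneg [simp]: "0 \<le> dist2 p q"
  by (simp add: dist2_def)

lemma dist2_eq_0 [simp]: "dist2 p q = 0 \<longleftrightarrow> p = q"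
  by (auto simp: dist2_def sum_power2_eq_zero_iff prod_eq_iff)

text \<open>Stereographic projection from (a - R, b), the only point missed. The sign of R is free,
  so R and -R project from opposite points.\<close>

lemma circle_param:
  assumes "R \<noteq> 0" "dist2 (x, y) (a, b) = R\<^sup>2" "x \<noteq> a - R"
  shows "\<exists>t. x = a + R * (1 - t\<^sup>2) / (1 + t\<^sup>2) \<and> y = b + R * (2 * t) / (1 + t\<^sup>2)"
proof -
  define X where "X = x - a"
  define Y where "Y = y - b"
  have XY: "X\<^sup>2 + Y\<^sup>2 = R\<^sup>2" "X + R \<noteq> 0" using assms by (auto simp: dist2_def X_def Y_def)
  define t where "t = Y / (X + R)"
  have Y: "Y = t * (X + R)" using XY(2) by (simp add: t_def)
  have "(R - X) * (X + R) = t\<^sup>2 * (X + R) * (X + R)"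
    using XY(1) unfolding Y by (simp add: power2_eq_square algebra_simps)
  then have "R - X = t\<^sup>2 * (X + R)" using XY(2) by simp
  then have X: "X * (1 + t\<^sup>2) = R * (1 - t\<^sup>2)" by (simp add: algebra_simps)
  have p: "1 + t\<^sup>2 > 0" by (simp add: add_pos_nonneg)
  have "X = R * (1 - t\<^sup>2) / (1 + t\<^sup>2)" using X p by (simp add: eq_divide_eq)
  moreover have "Y * (1 + t\<^sup>2) = R * (2 * t)"
  proof -
    have "Y * (1 + t\<^sup>2) = t * (X * (1 + t\<^sup>2) + R * (1 + t\<^sup>2))" unfolding Y by (simp add: algebra_simps)
    then show ?thesis unfolding X by (simp add: algebra_simps)
  qed
  then have "Y = R * (2 * t) / (1 + t\<^sup>2)" using p by (simp add: eq_divide_eq)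
  ultimately show ?thesis unfolding X_def Y_def by (intro exI[of _ t]) auto
qed

text \<open>The argument for lines with a rational parametrization. As this misses one point, it is
  used twice, with sqrt \<rho> and with its negative.\<close>

lemma circle_bound:
  assumes C: "acurve d f C"
  shows "(C = circle z \<rho> \<and> \<rho> > 0) \<or> finite (C \<inter> circle z \<rho>) \<and> card (C \<inter> circle z \<rho>) \<le> bez d 2"
proof -
  have rp: "rpoly 2 (\<lambda>u v. dist2c z u v - of_real \<rho>)"
    by (intro rpoly_diff rpoly_dist2c rpoly_const)
  have pv: "pev (\<lambda>u v. dist2c z u v - of_real \<rho>) p = of_real (dist2 p z - \<rho>)" for p
    using pev_dist2c[of z p] by (simp add: pev_def)
  have eq: "{p\<in>C. pev (\<lambda>u v. dist2c z u v - of_real \<rho>) p = 0} = C \<inter> circle z \<rho>"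
    by (auto simp: pv circle_def simp del: of_real_diff)
  have "C = circle z \<rho> \<and> \<rho> > 0" if inf: "infinite (C \<inter> circle z \<rho>)"
  proof -
    have CZ: "p \<in> C \<longleftrightarrow> eval2 f (fst p) (snd p) = 0" for p
      using C by (auto simp: acurve_def zeroset_def case_prod_unfold)
    have sub: "C \<subseteq> circle z \<rho>"
    proof
      fix p assume "p \<in> C"
      then have "pev (\<lambda>u v. dist2c z u v - of_real \<rho>) p = 0"
        using bezout_infinite[OF C rp] inf unfolding eq by blast
      then show "p \<in> circle z \<rho>" by (auto simp: pv circle_def simp del: of_real_diff)
    qed
    have "\<rho> > 0"
    proof (rule ccontr)
      assume "\<not> \<rho> > 0"
      then have "C \<inter> circle z \<rho> \<subseteq> {z}" unfolding circle_def
        using dist2_nonneg dist2_eq_0 by (smt (verit, best) IntD2 mem_Collect_eq singleton_iff subsetI)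
      then show False using inf by (meson finite.simps finite_subset)
    qed
    define a where "a = fst z"
    define b where "b = snd z"
    have z: "z = (a, b)" by (simp add: a_def b_def)
    have main: "p \<in> C" if p: "p \<in> circle z \<rho>" "fst p \<noteq> a - R" and R: "R\<^sup>2 = \<rho>" for p R
    proof -
      have R0: "R \<noteq> 0" using R \<open>\<rho> > 0\<close> by auto
      define g where "g = (\<lambda>t. (a + R * (1 - t\<^sup>2) / (1 + t\<^sup>2), b + R * (2 * t) / (1 + t\<^sup>2)))"
      have cov: "\<exists>t. p = g t" if "p \<in> circle z \<rho>" "fst p \<noteq> a - R" for p
        using circle_param[OF R0, of "fst p" "snd p" a b] that unfolding circle_def g_def z R
        by (auto simp: prod_eq_iff)
      define w where "w = [:1, 0, 1 :: real:]"
      have w: "poly w t = 1 + t\<^sup>2" for t by (simp add: w_def power2_eq_square)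
      have w0: "poly w t \<noteq> 0" for t unfolding w by (simp add: add_nonneg_eq_0_iff)
      define u where "u = smult a w + smult R [:1, 0, -1:]"
      define v where "v = smult b w + smult R [:0, 2:]"
      have uv: "poly u t / poly w t = fst (g t)" "poly v t / poly w t = snd (g t)" for t
      proof -
        have "poly u t = a * poly w t + R * (1 - t\<^sup>2)" "poly v t = b * poly w t + R * (2 * t)"
          by (simp_all add: u_def v_def power2_eq_square algebra_simps)
        then show "poly u t / poly w t = fst (g t)" "poly v t / poly w t = snd (g t)"
          using w0[of t] by (simp_all add: g_def add_divide_distrib flip: w)
      qed
      have "C \<inter> circle z \<rho> \<subseteq> g ` {t. eval2 f (fst (g t)) (snd (g t)) = 0} \<union> {(a - R, b)}"
      proof
        fix p assume p: "p \<in> C \<inter> circle z \<rho>"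
        show "p \<in> g ` {t. eval2 f (fst (g t)) (snd (g t)) = 0} \<union> {(a - R, b)}"
        proof (cases "fst p = a - R")
          case True
          then have "snd p = b" using p by (auto simp: circle_def dist2_def z simp flip: R)
          then show ?thesis using True by (auto simp: prod_eq_iff)
        next
          case False
          then show ?thesis using cov[of p] p CZ by auto
        qed
      qed
      with inf have "infinite {t. eval2 f (fst (g t)) (snd (g t)) = 0}"
        by (meson finite.emptyI finite_Un finite_imageI finite_insert finite_subset)
      then have "eval2 f (fst (g t)) (snd (g t)) = 0" for t
        unfolding uv[symmetric] by (intro rational_arc_in_curve w0)
      then show ?thesis using cov[OF p] CZ by blast
    qed
    have "p \<in> C" if p: "p \<in> circle z \<rho>" for p
    proof (cases "fst p = a - sqrt \<rho>")
      case True
      then have "fst p \<noteq> a - (- sqrt \<rho>)" using \<open>\<rho> > 0\<close> by simp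
      from main[OF p this] show ?thesis using \<open>\<rho> > 0\<close> by simp
    next
      case False
      from main[OF p this] show ?thesis using \<open>\<rho> > 0\<close> by simp
    qed
    with sub \<open>\<rho> > 0\<close> show ?thesis by blast
  qed
  then show ?thesis
    using bezout_finite[OF C rp] unfolding eq by blast
qed

section \<open>Smooth arcs of a curve\<close>

abbreviation eval_at :: "real poly poly \<Rightarrow> real \<times> real \<Rightarrow> real" where
  "eval_at f p \<equiv> eval2 f (fst p) (snd p)"

text \<open>The derivative in x; the derivative in y is \<open>pderiv\<close>, because y is the
  outer variable.\<close>

definition px :: "real poly poly \<Rightarrow> real poly poly" where
  "px f = map_poly pderiv f"

lemma px_pCons: "px (pCons c P) = pCons (pderiv c) (px P)"
  by (simp add: px_def map_poly_pCons)

lemma px_0 [simp]: "px 0 = 0"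
  by (simp add: px_def)

lemma bideg_le_px: "bideg_le f d \<Longrightarrow> bideg_le (px f) d"
  unfolding bideg_le_def px_def
  by (auto simp: coeff_map_poly degree_pderiv coeff_eq_0 intro!: degree_le)
     (metis coeff_pderiv degree_pderiv diff_le_self le_trans coeff_eq_0 le_less_trans)

lemma bideg_le_pderiv: "bideg_le f d \<Longrightarrow> bideg_le (pderiv f) d"
proof -
  assume f: "bideg_le f d"
  have "degree (coeff (pderiv f) j) \<le> d" for j
  proof -
    have "coeff (pderiv f) j = smult (of_nat (Suc j)) (coeff f (Suc j))"
      by (simp add: coeff_pderiv of_nat_poly)
    then show ?thesis using f unfolding bideg_le_def by (metis degree_smult_le le_trans)
  qed
  then show ?thesis using f unfolding bideg_le_def by (simp add: degree_pderiv le_diff_conv)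
qed

lemma continuous_eval2: "continuous_on UNIV (eval_at f)"
proof (induction f)
  case 0 show ?case by (simp add: continuous_on_const)
next
  case (pCons c f)
  have "continuous_on UNIV (\<lambda>p::real\<times>real. poly c (fst p))"
    by (intro continuous_intros)
  then have "continuous_on UNIV (\<lambda>p::real\<times>real. poly c (fst p) + snd p * eval_at f p)"
    by (intro continuous_intros pCons.IH)
  then show ?case by (simp add: eval2_pCons)
qed

lemma isCont_eval2: "isCont (eval_at f) p"
  using continuous_eval2[of f] continuous_on_eq_continuous_at[OF open_UNIV] by blast

text \<open>Differentiability in the form of Caratheodory: increments are exact combinations with
  continuous coefficients, so that implicit derivatives come from solving for a quotient instead of
  from a chain rule.\<close>

lemma eval2_caratheodory:
  "\<exists>a b. (\<forall>p. eval_at f p - eval2 f x y = (fst p - x) * a p + (snd p - y) * b p) \<and>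
     isCont a (x, y) \<and> isCont b (x, y) \<and> a (x, y) = eval2 (px f) x y \<and> b (x, y) = eval2 (pderiv f) x y"
proof (induction f)
  case 0 show ?case by (intro exI[of _ "\<lambda>_. 0"]) auto
next
  case (pCons c f)
  then obtain a b where ab: "\<And>p. eval_at f p - eval2 f x y = (fst p - x) * a p + (snd p - y) * b p"
    "isCont a (x, y)" "isCont b (x, y)" "a (x, y) = eval2 (px f) x y" "b (x, y) = eval2 (pderiv f) x y"
    by blast
  from poly_DERIV[of c x, unfolded CARAT_DERIV] obtain g
    where g: "\<And>z. poly c z - poly c x = g z * (z - x)" "isCont g x" "g x = poly (pderiv c) x" by blast
  have "isCont (\<lambda>p. g (fst p)) (x, y)"
    by (rule isCont_o2[where g = g]) (auto intro!: continuous_intros g(2))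
  then have 1: "isCont (\<lambda>p. g (fst p) + y * a p) (x, y)" by (intro continuous_intros ab)
  have 2: "isCont (\<lambda>p. eval_at f p + y * b p) (x, y)" by (intro continuous_intros ab isCont_eval2)
  have 3: "eval_at (pCons c f) p - eval2 (pCons c f) x y
      = (fst p - x) * (g (fst p) + y * a p) + (snd p - y) * (eval_at f p + y * b p)" for p
  proof -
    have "eval_at (pCons c f) p - eval2 (pCons c f) x y
      = (poly c (fst p) - poly c x) + (snd p - y) * eval_at f p + y * (eval_at f p - eval2 f x y)"
      by (simp add: eval2_pCons algebra_simps)
    then show ?thesis unfolding g(1) ab(1) by (simp add: algebra_simps)
  qed
  show ?case
    by (intro exI[of _ "\<lambda>p. g (fst p) + y * a p"] exI[of _ "\<lambda>p. eval_at f p + y * b p"])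
       (use 1 2 3 g ab in \<open>auto simp: px_pCons pderiv_pCons eval2_pCons eval2_add\<close>)
qed

text \<open>On the curve the Caratheodory identity reads (s - t) a + (\<phi> s - \<phi> t) b = 0, so
  the difference quotient of \<phi> is -a / b and its limit can be read off.\<close>

lemma implicit_function_deriv:
  assumes "open U" "t \<in> U" "\<And>s. s \<in> U \<Longrightarrow> eval2 f s (\<phi> s) = 0" "isCont \<phi> t"
    and "eval2 (pderiv f) t (\<phi> t) \<noteq> 0"
  shows "(\<phi> has_real_derivative - eval2 (px f) t (\<phi> t) / eval2 (pderiv f) t (\<phi> t)) (at t)"
proof -
  obtain a b where ab: "\<And>p. eval_at f p - eval2 f t (\<phi> t) = (fst p - t) * a p + (snd p - \<phi> t) * b p"
    "isCont a (t, \<phi> t)" "isCont b (t, \<phi> t)" "a (t, \<phi> t) = eval2 (px f) t (\<phi> t)"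
    "b (t, \<phi> t) = eval2 (pderiv f) t (\<phi> t)"
    using eval2_caratheodory by blast
  have g: "isCont (\<lambda>s. (s, \<phi> s)) t" by (intro continuous_intros assms)
  have A: "((\<lambda>s. a (s, \<phi> s)) \<longlongrightarrow> eval2 (px f) t (\<phi> t)) (at t)"
    using isCont_o2[OF g ab(2)] ab(4) by (simp add: isCont_def)
  have B: "((\<lambda>s. b (s, \<phi> s)) \<longlongrightarrow> eval2 (pderiv f) t (\<phi> t)) (at t)"
    using isCont_o2[OF g ab(3)] ab(5) by (simp add: isCont_def)
  have lim: "((\<lambda>s. - a (s, \<phi> s) / b (s, \<phi> s)) \<longlongrightarrow> - eval2 (px f) t (\<phi> t) / eval2 (pderiv f) t (\<phi> t)) (at t)"
    by (intro tendsto_intros A B assms)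
  have "eventually (\<lambda>s. b (s, \<phi> s) \<noteq> 0) (at t)"
    using tendsto_imp_eventually_ne[OF B] assms(5) by blast
  moreover have "eventually (\<lambda>s. s \<in> U) (at t)" using assms(1,2) eventually_at_in_open' by blast
  moreover have "eventually (\<lambda>s. s \<noteq> t) (at t)" by (simp add: eventually_at_filter)
  ultimately have "eventually (\<lambda>s. - a (s, \<phi> s) / b (s, \<phi> s) = (\<phi> s - \<phi> t) / (s - t)) (at t)"
  proof eventually_elim
    case (elim s)
    have "(s - t) * a (s, \<phi> s) + (\<phi> s - \<phi> t) * b (s, \<phi> s) = 0"
      using ab(1)[of "(s, \<phi> s)"] assms(2,3) elim by simp
    then show ?case using elim by (simp add: field_simps)
  qed
  from Lim_transform_eventually[OF lim this] show ?thesis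
    by (simp add: has_field_derivative_iff)
qed

section \<open>Roots in y as functions of x\<close>

lemma eval2_sum: "eval2 f x y = (\<Sum>j\<le>degree f. poly (coeff f j) x * y ^ j)"
proof -
  have "degree (map_poly (\<lambda>c. poly c x) f) \<le> degree f"
    by (rule degree_le) (auto simp: coeff_map_poly coeff_eq_0)
  then have "(\<Sum>j\<le>degree (map_poly (\<lambda>c. poly c x) f). coeff (map_poly (\<lambda>c. poly c x) f) j * y ^ j)
    = (\<Sum>j\<le>degree f. coeff (map_poly (\<lambda>c. poly c x) f) j * y ^ j)"
    by (intro sum.mono_neutral_left) (auto simp: coeff_eq_0)
  then show ?thesis by (simp add: eval2_def poly_altdef coeff_map_poly)
qed

lemma DERIV_eval2: "((\<lambda>y. eval2 f x y) has_real_derivative eval2 (pderiv f) x y) (at y)"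
proof (induction f)
  case 0 show ?case by simp
next
  case (pCons c f)
  have "((\<lambda>y. poly c x + y * eval2 f x y) has_real_derivative (0 + (1 * eval2 f x y + eval2 (pderiv f) x y * y))) (at y)"
    by (intro DERIV_add DERIV_const DERIV_mult DERIV_ident pCons.IH)
  then show ?case by (simp add: eval2_pCons pderiv_pCons eval2_add algebra_simps)
qed

text \<open>Where the leading coefficient stays away from zero it dominates for large |y|, uniformly
  near \<open>x0\<close>. No root can escape to infinity.\<close>

lemma roots_locally_bounded:
  assumes "degree f \<ge> 1" "poly (lead_coeff f) x0 \<noteq> 0"
  obtains M \<eta> where "\<eta> > 0" "\<And>x y. \<bar>x - x0\<bar> \<le> \<eta> \<Longrightarrow> eval2 f x y = 0 \<Longrightarrow> \<bar>y\<bar> \<le> M"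
proof -
  define n where "n = degree f"
  define l where "l = \<bar>poly (lead_coeff f) x0\<bar> / 2"
  have l: "l > 0" using assms by (simp add: l_def)
  have "open {x. l < \<bar>poly (lead_coeff f) x\<bar>}"
    by (intro open_Collect_less continuous_intros)
  moreover have "x0 \<in> {x. l < \<bar>poly (lead_coeff f) x\<bar>}" using l by (simp add: l_def)
  ultimately obtain \<eta>0 where e0: "\<eta>0 > 0" "\<And>x. \<bar>x - x0\<bar> < \<eta>0 \<Longrightarrow> l < \<bar>poly (lead_coeff f) x\<bar>"
    unfolding open_dist dist_real_def by blast
  define \<eta> where "\<eta> = \<eta>0 / 2"
  have e: "\<eta> > 0" "\<And>x. \<bar>x - x0\<bar> \<le> \<eta> \<Longrightarrow> l < \<bar>poly (lead_coeff f) x\<bar>"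
    using e0 by (auto simp: \<eta>_def)
  have "\<exists>A. \<forall>x\<in>{x0-\<eta>..x0+\<eta>}. \<forall>j<n. \<bar>poly (coeff f j) x\<bar> \<le> A"
  proof -
    have "\<exists>A. \<forall>x\<in>{x0-\<eta>..x0+\<eta>}. \<bar>poly (coeff f j) x\<bar> \<le> A" for j
    proof -
      have "compact ((\<lambda>x. poly (coeff f j) x) ` {x0-\<eta>..x0+\<eta>})"
        by (intro compact_continuous_image continuous_intros compact_Icc)
      then have "bounded ((\<lambda>x. poly (coeff f j) x) ` {x0-\<eta>..x0+\<eta>})" by (rule compact_imp_bounded)
      then show ?thesis by (auto simp: bounded_iff)
    qed
    then obtain A where A: "\<And>j x. x\<in>{x0-\<eta>..x0+\<eta>} \<Longrightarrow> \<bar>poly (coeff f j) x\<bar> \<le> A j" by metis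
    have "\<bar>poly (coeff f j) x\<bar> \<le> (\<Sum>j<n. \<bar>A j\<bar>)" if "x\<in>{x0-\<eta>..x0+\<eta>}" "j < n" for x j
    proof -
      have "\<bar>poly (coeff f j) x\<bar> \<le> \<bar>A j\<bar>" using A[OF that(1), of j] by linarith
      also have "\<dots> \<le> (\<Sum>j<n. \<bar>A j\<bar>)" by (rule member_le_sum) (use that in auto)
      finally show ?thesis .
    qed
    then show ?thesis by blast
  qed
  then obtain A where A: "\<And>x j. x\<in>{x0-\<eta>..x0+\<eta>} \<Longrightarrow> j < n \<Longrightarrow> \<bar>poly (coeff f j) x\<bar> \<le> A" by blast
  have "\<bar>y\<bar> \<le> max 1 (n * A / l)" if x: "\<bar>x - x0\<bar> \<le> \<eta>" and y: "eval2 f x y = 0" for x y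
  proof (cases "\<bar>y\<bar> \<le> 1")
    case False
    obtain m where m: "n = Suc m" using assms(1) by (cases n) (auto simp: n_def)
    have xi: "x\<in>{x0-\<eta>..x0+\<eta>}" using x by (auto simp: abs_le_iff)
    have "eval2 f x y = (\<Sum>j<n. poly (coeff f j) x * y ^ j) + poly (lead_coeff f) x * y ^ n"
      unfolding eval2_sum n_def[symmetric] by (simp add: lessThan_Suc_atMost[symmetric])
    then have "poly (lead_coeff f) x * y ^ n = - (\<Sum>j<n. poly (coeff f j) x * y ^ j)" using y by simp
    then have "\<bar>poly (lead_coeff f) x\<bar> * \<bar>y\<bar> ^ n = \<bar>\<Sum>j<n. poly (coeff f j) x * y ^ j\<bar>"
      by (metis abs_minus_cancel abs_mult power_abs)
    also have "\<dots> \<le> (\<Sum>j<n. A * \<bar>y\<bar> ^ m)"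
    proof (rule order_trans[OF sum_abs sum_mono])
      fix j assume j: "j \<in> {..<n}"
      have "\<bar>y\<bar> ^ j \<le> \<bar>y\<bar> ^ m" using False j m by (intro power_increasing) auto
      moreover have "\<bar>poly (coeff f j) x\<bar> \<le> A" using A[OF xi] j by simp
      ultimately show "\<bar>poly (coeff f j) x * y ^ j\<bar> \<le> A * \<bar>y\<bar> ^ m"
        unfolding abs_mult power_abs by (intro mult_mono) auto
    qed
    also have "\<dots> = n * A * \<bar>y\<bar> ^ m" by simp
    finally have "(\<bar>poly (lead_coeff f) x\<bar> * \<bar>y\<bar>) * \<bar>y\<bar> ^ m \<le> (n * A) * \<bar>y\<bar> ^ m"
      by (simp add: m mult_ac)
    then have "\<bar>poly (lead_coeff f) x\<bar> * \<bar>y\<bar> \<le> n * A"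
      using False by (subst (asm) mult_le_cancel_right_pos) auto
    moreover have "l * \<bar>y\<bar> \<le> \<bar>poly (lead_coeff f) x\<bar> * \<bar>y\<bar>"
      using e(2)[OF x] by (intro mult_right_mono) auto
    ultimately have "l * \<bar>y\<bar> \<le> n * A" by linarith
    then have "\<bar>y\<bar> \<le> n * A / l" using l by (simp add: field_simps)
    then show ?thesis by simp
  qed simp
  with e(1) show thesis using that by blast
qed

text \<open>Sorted, so that a fixed index follows one branch of the curve.\<close>

definition roots :: "real poly poly \<Rightarrow> real \<Rightarrow> real list" where
  "roots f x = sorted_list_of_set {y. eval2 f x y = 0}"

lemma finite_pos_lower_bound:
  fixes A :: "real set"
  assumes "finite A" "\<And>a. a \<in> A \<Longrightarrow> a > 0"
  shows "\<exists>e>0. \<forall>a\<in>A. e < a"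
proof (cases "A = {}")
  case True then show ?thesis by (auto intro: exI[of _ 1])
next
  case False
  then have "Min A > 0" using assms by auto
  moreover have "Min A / 2 < a" if "a \<in> A" for a
    using Min_le[OF assms(1) that] \<open>Min A > 0\<close> by linarith
  ultimately show ?thesis by (intro exI[of _ "Min A / 2"]) auto
qed

lemma open_nhd_interval:
  assumes "open S" "(x0::real) \<in> S"
  shows "\<exists>\<eta>>0. \<forall>x. \<bar>x - x0\<bar> < \<eta> \<longrightarrow> x \<in> S"
  using assms unfolding open_dist dist_real_def by blast

text \<open>Near each simple root f is strictly monotone in y and changes sign, so exactly one root
  stays within e of it; compactness excludes roots elsewhere. The order of the roots is kept, hence
  so are the indices.\<close>

lemma roots_locally_stable:
  assumes irr: "irreducible f" and deg: "degree f \<ge> 1" and bd: "bideg_le f d"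
    and lc: "poly (lead_coeff f) x0 \<noteq> 0"
    and simple: "\<And>y. eval2 f x0 y = 0 \<Longrightarrow> eval2 (pderiv f) x0 y \<noteq> 0" and \<epsilon>: "\<epsilon> > 0"
  shows "\<exists>\<eta>>0. \<forall>x. \<bar>x - x0\<bar> < \<eta> \<longrightarrow> length (roots f x) = length (roots f x0) \<and>
     (\<forall>i<length (roots f x0). \<bar>roots f x ! i - roots f x0 ! i\<bar> < \<epsilon>)"
proof -
  define R where "R = (\<lambda>x. {y. eval2 f x y = 0})"
  have finR: "finite (R x)" for x using irreducible_fiber(1)[OF irr deg bd] by (simp add: R_def)
  \<comment> \<open>Multiplying f by its y-derivative at r makes it increasing in y near r, which
    avoids two sign cases.\<close>
  define D where "D = (\<lambda>r. eval2 (pderiv f) x0 r)"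
  have "\<exists>e. e > 0 \<and> (\<forall>x y. \<bar>x - x0\<bar> < e \<longrightarrow> \<bar>y - r\<bar> < e \<longrightarrow> 0 < D r * eval2 (pderiv f) x y)"
    if r: "r \<in> R x0" for r
  proof -
    have "open {p. 0 < D r * eval_at (pderiv f) p}"
      by (intro open_Collect_less continuous_intros continuous_eval2)
    moreover have "D r * D r > 0" using simple[of r] r by (auto simp: D_def R_def zero_less_mult_iff)
    then have "(x0, r) \<in> {p. 0 < D r * eval_at (pderiv f) p}" by (simp add: D_def)
    ultimately obtain A B where AB: "open A" "open B" "(x0, r) \<in> A \<times> B" "A \<times> B \<subseteq> {p. 0 < D r * eval_at (pderiv f) p}"
      by (rule open_prod_elim)
    obtain e1 where e1: "e1 > 0" "\<And>x. \<bar>x - x0\<bar> < e1 \<Longrightarrow> x \<in> A" using open_nhd_interval AB by (metis mem_Sigma_iff)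
    obtain e2 where e2: "e2 > 0" "\<And>x. \<bar>x - r\<bar> < e2 \<Longrightarrow> x \<in> B" using open_nhd_interval AB by (metis mem_Sigma_iff)
    have "0 < D r * eval2 (pderiv f) x y" if "\<bar>x - x0\<bar> < min e1 e2" "\<bar>y - r\<bar> < min e1 e2" for x y
      using e1(2)[of x] e2(2)[of y] that AB(4) by auto
    then show ?thesis using e1(1) e2(1) by (intro exI[of _ "min e1 e2"]) auto
  qed
  then obtain E where E: "\<And>r. r \<in> R x0 \<Longrightarrow> E r > 0"
    "\<And>r x y. r \<in> R x0 \<Longrightarrow> \<bar>x - x0\<bar> < E r \<Longrightarrow> \<bar>y - r\<bar> < E r \<Longrightarrow> 0 < D r * eval2 (pderiv f) x y"
    by metis
  have "finite (insert \<epsilon> (E ` R x0 \<union> (\<lambda>(r, r'). \<bar>r - r'\<bar> / 2) ` ((R x0 \<times> R x0) \<inter> {(r, r'). r \<noteq> r'})))"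
    using finR by auto
  moreover have "a > 0" if "a \<in> insert \<epsilon> (E ` R x0 \<union> (\<lambda>(r, r'). \<bar>r - r'\<bar> / 2) ` ((R x0 \<times> R x0) \<inter> {(r, r'). r \<noteq> r'}))" for a
    using that \<epsilon> E(1) by auto
  ultimately have "\<exists>e>0. \<forall>a\<in>insert \<epsilon> (E ` R x0 \<union> (\<lambda>(r, r'). \<bar>r - r'\<bar> / 2) ` ((R x0 \<times> R x0) \<inter> {(r, r'). r \<noteq> r'})). e < a"
    by (rule finite_pos_lower_bound)
  \<comment> \<open>Being below half of every gap, e makes the neighbourhoods of distinct roots
    disjoint.\<close>
  then obtain e where e: "e > 0"
    "\<And>a. a \<in> insert \<epsilon> (E ` R x0 \<union> (\<lambda>(r, r'). \<bar>r - r'\<bar> / 2) ` ((R x0 \<times> R x0) \<inter> {(r, r'). r \<noteq> r'})) \<Longrightarrow> e < a"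
    by blast
  have e\<epsilon>: "e < \<epsilon>" and eE: "\<And>r. r \<in> R x0 \<Longrightarrow> e < E r" using e(2) by auto
  have gap: "2 * e < \<bar>r - r'\<bar>" if "r \<in> R x0" "r' \<in> R x0" "r \<noteq> r'" for r r'
  proof -
    have "e < \<bar>r - r'\<bar> / 2" using that by (intro e(2)) force
    then show ?thesis by simp
  qed
  have incr: "D r * eval2 f x y < D r * eval2 f x y'"
    if "r \<in> R x0" "\<bar>x - x0\<bar> < e" "r - e \<le> y" "y < y'" "y' \<le> r + e" for r x y y'
  proof (rule DERIV_pos_imp_increasing[OF that(4)])
    fix z assume z: "y \<le> z" "z \<le> y'"
    have "0 < D r * eval2 (pderiv f) x z"
      using that z eE[OF that(1)] by (intro E(2)) auto
    moreover have "((\<lambda>y. D r * eval2 f x y) has_real_derivative D r * eval2 (pderiv f) x z) (at z)"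
      by (intro DERIV_cmult DERIV_eval2)
    ultimately show "\<exists>l. ((\<lambda>y. D r * eval2 f x y) has_real_derivative l) (at z) \<and> 0 < l" by blast
  qed
  have "\<exists>\<eta>>0. \<forall>x. \<bar>x - x0\<bar> < \<eta> \<longrightarrow> D r * eval2 f x (r - e) < 0 \<and> 0 < D r * eval2 f x (r + e)"
    if r: "r \<in> R x0" for r
  proof -
    have c: "continuous_on UNIV (\<lambda>x. eval2 f x y)" for y
      using continuous_on_compose2[OF continuous_eval2[of f], of UNIV "\<lambda>x. (x, y)"]
      by (simp add: continuous_on_Pair continuous_on_id)
    have "open ({x. D r * eval2 f x (r - e) < 0} \<inter> {x. 0 < D r * eval2 f x (r + e)})"
      by (intro open_Int open_Collect_less continuous_intros c)
    moreover have "x0 \<in> {x. D r * eval2 f x (r - e) < 0} \<inter> {x. 0 < D r * eval2 f x (r + e)}"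
      using incr[OF r, of x0 "r - e" r] incr[OF r, of x0 r "r + e"] e(1) r by (auto simp: R_def)
    ultimately have "\<exists>\<eta>>0. \<forall>x. \<bar>x - x0\<bar> < \<eta> \<longrightarrow> x \<in> {x. D r * eval2 f x (r - e) < 0} \<inter> {x. 0 < D r * eval2 f x (r + e)}"
      by (rule open_nhd_interval)
    then show ?thesis by blast
  qed
  then obtain H where H: "\<And>r. r \<in> R x0 \<Longrightarrow> H r > 0"
    "\<And>r x. r \<in> R x0 \<Longrightarrow> \<bar>x - x0\<bar> < H r \<Longrightarrow> D r * eval2 f x (r - e) < 0 \<and> 0 < D r * eval2 f x (r + e)"
    by metis
  obtain M \<eta>2 where M: "\<eta>2 > 0" "\<And>x y. \<bar>x - x0\<bar> \<le> \<eta>2 \<Longrightarrow> eval2 f x y = 0 \<Longrightarrow> \<bar>y\<bar> \<le> M"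
    by (rule roots_locally_bounded[OF deg lc]) blast
  \<comment> \<open>The zeros in a bounded window that stay e-far from every root at
    \<open>x0\<close>. The projection of this compact set is closed and misses \<open>x0\<close>,
    hence a neighbourhood of \<open>x0\<close>.\<close>
  define K where "K = ({x0 - \<eta>2..x0 + \<eta>2} \<times> {-M..M}) \<inter> ({p. eval_at f p = 0} \<inter> (\<Inter>r\<in>R x0. {p. e \<le> \<bar>snd p - r\<bar>}))"
  have "closed {p. eval_at f p = 0}"
    by (rule closed_Collect_eq[OF continuous_eval2 continuous_on_const])
  moreover have "closed {p :: real \<times> real. e \<le> \<bar>snd p - r\<bar>}" for r
    by (intro closed_Collect_le continuous_intros)
  ultimately have "closed ({p. eval_at f p = 0} \<inter> (\<Inter>r\<in>R x0. {p. e \<le> \<bar>snd p - r\<bar>}))"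
    by blast
  then have "compact K" unfolding K_def
    by (rule compact_Int_closed[OF compact_Times[OF compact_Icc compact_Icc]])
  then have "closed (fst ` K)"
    by (intro compact_imp_closed compact_continuous_image continuous_intros)
  moreover have "x0 \<notin> fst ` K"
  proof
    assume "x0 \<in> fst ` K"
    then obtain y where y: "(x0, y) \<in> K" by auto
    then have "y \<in> R x0" by (simp add: K_def R_def)
    then have "e \<le> \<bar>y - y\<bar>" using y by (auto simp: K_def)
    then show False using e(1) by simp
  qed
  ultimately obtain \<eta>3 where e3: "\<eta>3 > 0" "\<And>x. \<bar>x - x0\<bar> < \<eta>3 \<Longrightarrow> x \<in> - fst ` K"
    using open_nhd_interval[of "- fst ` K" x0] by auto
  have "finite (insert e (insert \<eta>2 (insert \<eta>3 (H ` R x0))))" using finR by auto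
  moreover have "a > 0" if "a \<in> insert e (insert \<eta>2 (insert \<eta>3 (H ` R x0)))" for a
    using that e(1) M(1) e3(1) H(1) by auto
  ultimately have "\<exists>\<eta>>0. \<forall>a\<in>insert e (insert \<eta>2 (insert \<eta>3 (H ` R x0))). \<eta> < a"
    by (rule finite_pos_lower_bound)
  then obtain \<eta> where \<eta>: "\<eta> > 0" "\<And>a. a \<in> insert e (insert \<eta>2 (insert \<eta>3 (H ` R x0))) \<Longrightarrow> \<eta> < a"
    by blast
  have main: "length (roots f x) = length (roots f x0) \<and>
     (\<forall>i<length (roots f x0). \<bar>roots f x ! i - roots f x0 ! i\<bar> < \<epsilon>)" if x: "\<bar>x - x0\<bar> < \<eta>" for x
  proof -
    have xs: "\<bar>x - x0\<bar> < e" "\<bar>x - x0\<bar> < \<eta>2" "\<bar>x - x0\<bar> < \<eta>3" "\<And>r. r \<in> R x0 \<Longrightarrow> \<bar>x - x0\<bar> < H r"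
      using x \<eta>(2) by (auto intro: order.strict_trans)
    have "\<exists>y. r - e < y \<and> y < r + e \<and> y \<in> R x" if r: "r \<in> R x0" for r
    proof -
      have "continuous_on {r-e..r+e} (\<lambda>y. D r * eval2 f x y)"
        using DERIV_eval2 by (intro continuous_at_imp_continuous_on ballI continuous_intros) (rule DERIV_isCont)
      with H(2)[OF r xs(4)[OF r]] IVT'[of "\<lambda>y. D r * eval2 f x y" "r - e" 0 "r + e"] e(1)
      obtain y where y: "r - e \<le> y" "y \<le> r + e" "D r * eval2 f x y = 0" by auto
      have "y \<noteq> r - e" "y \<noteq> r + e" using H(2)[OF r xs(4)[OF r]] y(3) by auto
      moreover have "D r \<noteq> 0" using simple[of r] r by (auto simp: D_def R_def)
      ultimately show ?thesis using y by (intro exI[of _ y]) (auto simp: R_def)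
    qed
    then obtain \<rho> where \<rho>: "\<And>r. r \<in> R x0 \<Longrightarrow> r - e < \<rho> r \<and> \<rho> r < r + e \<and> \<rho> r \<in> R x" by metis
    have img: "R x = \<rho> ` R x0"
    proof
      show "\<rho> ` R x0 \<subseteq> R x" using \<rho> by auto
      show "R x \<subseteq> \<rho> ` R x0"
      proof
        fix y assume y: "y \<in> R x"
        have "\<bar>y\<bar> \<le> M" using M(2)[of x y] xs(2) y by (auto simp: R_def)
        moreover have "x \<notin> fst ` K" using e3(2) xs(3) by auto
        ultimately obtain r where r: "r \<in> R x0" "\<bar>y - r\<bar> < e"
        proof -
          have "(x, y) \<notin> K" using \<open>x \<notin> fst ` K\<close> by force
          moreover have "x \<in> {x0 - \<eta>2..x0 + \<eta>2}" "y \<in> {-M..M}" using xs(2) \<open>\<bar>y\<bar> \<le> M\<close> by (auto simp: abs_le_iff abs_less_iff)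
          moreover have "eval2 f x y = 0" using y by (simp add: R_def)
          ultimately have "\<exists>r\<in>R x0. \<not> e \<le> \<bar>y - r\<bar>" by (auto simp: K_def)
          then show thesis using that by auto
        qed
        have "y = \<rho> r"
        proof (rule ccontr)
          assume "y \<noteq> \<rho> r"
          have "r - e \<le> y" "y \<le> r + e" using r(2) by (auto simp: abs_less_iff)
          note this [simp]
          consider "y < \<rho> r" | "\<rho> r < y" using \<open>y \<noteq> \<rho> r\<close> by linarith
          then show False
          proof cases
            case 1
            then show ?thesis using incr[OF r(1) xs(1), of y "\<rho> r"] \<rho>[OF r(1)] r(2) y by (auto simp: R_def)
          next
            case 2
            then show ?thesis using incr[OF r(1) xs(1), of "\<rho> r" y] \<rho>[OF r(1)] r(2) y by (auto simp: R_def)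
          qed
        qed
        then show "y \<in> \<rho> ` R x0" using r by blast
      qed
    qed
    have mono: "\<rho> r < \<rho> r'" if "r \<in> R x0" "r' \<in> R x0" "r < r'" for r r'
      using gap[OF that(1,2)] that \<rho>[OF that(1)] \<rho>[OF that(2)] by auto
    have "sorted_wrt (<) (roots f x0)" "set (roots f x0) = R x0"
      using finR[of x0] by (auto simp: roots_def R_def)
    then have "sorted_wrt (<) (map \<rho> (roots f x0))"
      unfolding sorted_wrt_map using mono by (auto intro: sorted_wrt_mono_rel[rotated])
    moreover have "set (map \<rho> (roots f x0)) = R x" using img \<open>set (roots f x0) = R x0\<close> by simp
    ultimately have eq: "roots f x = map \<rho> (roots f x0)"
      using finR[of x] by (intro strict_sorted_equal) (simp_all add: roots_def R_def)
    have "\<bar>\<rho> r - r\<bar> < \<epsilon>" if "r \<in> R x0" for r using \<rho>[OF that] e\<epsilon> by auto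
    then show ?thesis unfolding eq using \<open>set (roots f x0) = R x0\<close> nth_mem by auto
  qed
  show ?thesis using \<eta>(1) main by blast
qed

text \<open>The parameter need not be x, so that vertical lines fit the same notion. Of the tangent
  (u, v) only nonvanishing and orthogonality to the gradient are kept, which is what the extremum
  argument uses.\<close>

definition smooth_arc :: "real poly poly \<Rightarrow> real set \<Rightarrow> (real \<Rightarrow> real \<times> real) \<Rightarrow> bool" where
  "smooth_arc f U \<gamma> \<longleftrightarrow> open U \<and> connected U \<and> continuous_on U \<gamma> \<and> inj_on \<gamma> U \<and>
     (\<forall>t\<in>U. eval_at f (\<gamma> t) = 0 \<and> (eval_at (px f) (\<gamma> t), eval_at (pderiv f) (\<gamma> t)) \<noteq> (0, 0) \<and>
       (\<exists>u v. (u, v) \<noteq> (0, 0) \<and> ((\<lambda>s. fst (\<gamma> s)) has_real_derivative u) (at t) \<and>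
          ((\<lambda>s. snd (\<gamma> s)) has_real_derivative v) (at t) \<and>
          u * eval_at (px f) (\<gamma> t) + v * eval_at (pderiv f) (\<gamma> t) = 0))"

text \<open>With \<beta> = \<open>bez d d + d\<close> bad abscissas there are at most (\<beta> + 1)
  d arcs and \<beta> d points left over; this number bounds both.\<close>

definition arcK :: "nat \<Rightarrow> nat" where
  "arcK d = (bez d d + d + 1) * (d + 1)"

text \<open>A vertical line is no graph over x and is parametrized by y instead.\<close>

lemma vertical_smooth_arc:
  assumes "acurve d f C" "degree f = 0"
  shows "\<exists>U \<gamma>. smooth_arc f U \<gamma> \<and> C = \<gamma> ` U"
proof -
  note C = assms(1)[unfolded acurve_def]
  then obtain a b where "(a, b) \<in> C" by (metis finite.emptyI ex_in_conv surj_pair)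
  then have ab: "eval2 f a b = 0" using C by (simp add: zeroset_def)
  from irreducible_degree0_curve[OF _ assms(2) ab] C
  obtain c where c: "c \<noteq> 0" "f = [:[:c:] * [:-a, 1:]:]" and Z: "zeroset f = {p. fst p = a}" by blast
  define \<gamma> where "\<gamma> = (\<lambda>t::real. (a, t))"
  have "px f = [:[:c:]:]" "pderiv f = 0"
    by (simp_all add: c px_def map_poly_pCons pderiv_pCons)
  then have ev: "eval_at (px f) p = c" "eval_at (pderiv f) p = 0" for p
    by (simp_all add: eval2_pCons)
  have d1: "((\<lambda>s. snd (\<gamma> s)) has_real_derivative 1) (at t)" for t
    by (simp add: \<gamma>_def)
  have d2: "((\<lambda>s. fst (\<gamma> s)) has_real_derivative 0) (at t)" for t
    by (simp add: \<gamma>_def)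
  have "smooth_arc f UNIV \<gamma>" unfolding smooth_arc_def
  proof (intro conjI ballI)
    show "continuous_on UNIV \<gamma>" unfolding \<gamma>_def by (intro continuous_intros)
    show "inj \<gamma>" by (auto simp: \<gamma>_def inj_def)
    fix t :: real
    show "eval_at f (\<gamma> t) = 0" by (simp add: c \<gamma>_def eval2_pCons)
    show "(eval_at (px f) (\<gamma> t), eval_at (pderiv f) (\<gamma> t)) \<noteq> (0, 0)" using c(1) by (simp add: ev)
    show "\<exists>u v. (u, v) \<noteq> (0, 0) \<and> ((\<lambda>s. fst (\<gamma> s)) has_real_derivative u) (at t) \<and>
          ((\<lambda>s. snd (\<gamma> s)) has_real_derivative v) (at t) \<and>
          u * eval_at (px f) (\<gamma> t) + v * eval_at (pderiv f) (\<gamma> t) = 0"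
      by (rule exI[of _ 0], rule exI[of _ 1]) (use d1 d2 in \<open>simp add: ev\<close>)
  qed auto
  moreover have "C = {p. fst p = a}" using C Z by blast
  then have "C = range \<gamma>" by (auto simp: \<gamma>_def image_iff)
  ultimately show ?thesis by blast
qed

text \<open>The number of elements of B below x labels the components of the complement of B, so
  that B need not be sorted.\<close>

lemma card_less_const_interval:
  fixes B :: "real set"
  assumes "finite B"
  defines "V \<equiv> \<lambda>k. {x. x \<notin> B \<and> card {b\<in>B. b < x} = k}"
  shows "open (V k)" "connected (V k)"
proof -
  have "\<exists>e>0. \<forall>x. dist x x0 < e \<longrightarrow> x \<in> V k" if x0: "x0 \<in> V k" for x0
  proof -
    have "a > 0" if "a \<in> (\<lambda>b. \<bar>b - x0\<bar>) ` B" for a using that x0 by (auto simp: V_def)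
    then obtain e where e: "e > 0" "\<forall>a\<in>(\<lambda>b. \<bar>b - x0\<bar>) ` B. e < a"
      using finite_pos_lower_bound[of "(\<lambda>b. \<bar>b - x0\<bar>) ` B"] assms(1) by blast
    have "x \<in> V k" if "dist x x0 < e" for x
    proof -
      have far: "e < \<bar>b - x0\<bar>" if "b \<in> B" for b using e(2) that by blast
      have "x \<notin> B" using far[of x] that by (auto simp: dist_real_def)
      moreover have "b < x \<longleftrightarrow> b < x0" if "b \<in> B" for b
        using far[OF that] \<open>dist x x0 < e\<close> by (auto simp: dist_real_def)
      then have "{b\<in>B. b < x} = {b\<in>B. b < x0}" by blast
      ultimately show ?thesis using x0 by (simp add: V_def)
    qed
    with e(1) show ?thesis by blast
  qed
  then show "open (V k)" unfolding open_dist by blast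
  have "is_interval (V k)" unfolding is_interval_1
  proof (intro ballI allI impI)
    fix x z y assume xz: "x \<in> V k" "z \<in> V k" "x \<le> y \<and> y \<le> z"
    have sub: "{b\<in>B. b < x} \<subseteq> {b\<in>B. b < y}" "{b\<in>B. b < y} \<subseteq> {b\<in>B. b < z}" using xz(3) by auto
    have "{b\<in>B. b < x} = {b\<in>B. b < z}"
      using sub xz(1,2) assms(1) by (intro card_subset_eq) (auto simp: V_def)
    moreover from this sub have "{b\<in>B. b < y} = {b\<in>B. b < x}" by blast
    moreover have "y \<notin> B"
    proof
      assume "y \<in> B"
      moreover have "y \<noteq> z" using xz(2) \<open>y \<in> B\<close> by (auto simp: V_def)
      ultimately have "y \<in> {b\<in>B. b < z}" using xz(3) by auto
      then have "y \<in> {b\<in>B. b < x}" using \<open>{b\<in>B. b < x} = {b\<in>B. b < z}\<close> by simp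
      then show False using xz(3) by simp
    qed
    ultimately show "y \<in> V k" using xz(1) by (simp add: V_def)
  qed
  then show "connected (V k)" by (rule is_interval_connected)
qed

text \<open>Off the zeros of the leading coefficient and the abscissas of points with vanishing
  y-derivative, the curve consists of graphs of the sorted roots over intervals. By pigeonhole one
  of these arcs carries a fixed fraction of S, up to the points above the bad abscissas.\<close>

lemma arcs_cover:
  assumes C: "acurve d f C" and S: "finite S" "S \<subseteq> C"
  shows "\<exists>U \<gamma>. smooth_arc f U \<gamma> \<and> card S \<le> arcK d * card (S \<inter> \<gamma> ` U) + arcK d"
proof (cases "degree f = 0")
  case True
  from vertical_smooth_arc[OF C this] obtain U \<gamma> where "smooth_arc f U \<gamma>" "C = \<gamma> ` U" by blast
  moreover from this S have "S \<inter> \<gamma> ` U = S" by blast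
  moreover have "card S \<le> arcK d * card S + arcK d" by (simp add: arcK_def)
  ultimately show ?thesis by metis
next
  case False
  then have deg: "degree f \<ge> 1" by simp
  note c = C[unfolded acurve_def]
  have irr: "irreducible f" and bd: "bideg_le f d" using c by auto
  have d: "d \<ge> 1" using bd deg by (simp add: bideg_le_def)
  define Sg where "Sg = {p\<in>C. eval_at (pderiv f) p = 0}"
  \<comment> \<open>The y-derivative is nonzero and of smaller degree, so Bezout bounds its zeros on
    the curve.\<close>
  have "\<not> f dvd pderiv f"
    using dvd_imp_degree_le[of f "pderiv f"] deg by (auto simp: degree_pderiv pderiv_eq_0_iff)
  with bezout_poly[OF C bideg_le_pderiv[OF bd]] False have Sg: "finite Sg" "card Sg \<le> bez d d"
    unfolding Sg_def by auto
  define B where "B = {x. poly (lead_coeff f) x = 0} \<union> fst ` Sg"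
  define \<beta> where "\<beta> = bez d d + d"
  have lc: "lead_coeff f \<noteq> 0" using deg by auto
  have finB: "finite B" using Sg(1) poly_roots_finite[OF lc] by (simp add: B_def)
  have "card B \<le> card {x. poly (lead_coeff f) x = 0} + card (fst ` Sg)" unfolding B_def by (rule card_Un_le)
  moreover have "card {x. poly (lead_coeff f) x = 0} \<le> d"
    using card_poly_roots_bound[OF lc] bd unfolding bideg_le_def by (meson le_trans)
  moreover have "card (fst ` Sg) \<le> bez d d" using card_image_le[OF Sg(1)] Sg(2) le_trans by blast
  ultimately have cardB: "card B \<le> \<beta>" by (simp add: \<beta>_def)
  define V where "V = (\<lambda>k. {x. x \<notin> B \<and> card {b\<in>B. b < x} = k})"
  have V: "open (V k)" "connected (V k)" for k
    using card_less_const_interval[OF finB] unfolding V_def by auto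
  have finR: "finite {y. eval2 f x y = 0}" "card {y. eval2 f x y = 0} \<le> d" for x
    using irreducible_fiber[OF irr deg bd] by auto
  have simple: "eval2 (pderiv f) x y \<noteq> 0" if "x \<notin> B" "eval2 f x y = 0" for x y
    using that c by (force simp: B_def Sg_def zeroset_def)
  have lcB: "poly (lead_coeff f) x \<noteq> 0" if "x \<notin> B" for x using that by (auto simp: B_def)
  have stable: "\<exists>\<eta>>0. \<forall>x. \<bar>x - x0\<bar> < \<eta> \<longrightarrow> length (roots f x) = length (roots f x0) \<and>
     (\<forall>i<length (roots f x0). \<bar>roots f x ! i - roots f x0 ! i\<bar> < \<epsilon>)" if "x0 \<notin> B" "\<epsilon> > 0" for x0 \<epsilon>
  proof -
    have s: "\<And>y. eval2 f x0 y = 0 \<Longrightarrow> eval2 (pderiv f) x0 y \<noteq> 0" using simple that(1) by blast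
    show ?thesis by (rule roots_locally_stable[OF irr deg bd lcB[OF that(1)] s that(2)])
  qed
  have Nconst: "length (roots f x) = length (roots f y)" if "x \<in> V k" "y \<in> V k" for x y k
  proof (rule connected_local_const[OF V(2) that])
    show "\<forall>a\<in>V k. eventually (\<lambda>b. length (roots f a) = length (roots f b)) (at a within V k)"
    proof
      fix a assume "a \<in> V k"
      then have "a \<notin> B" by (simp add: V_def)
      from stable[OF this, of 1] obtain \<eta> where \<eta>: "\<eta> > 0"
        "\<And>x. \<bar>x - a\<bar> < \<eta> \<Longrightarrow> length (roots f x) = length (roots f a)" by (metis zero_less_one)
      show "eventually (\<lambda>b. length (roots f a) = length (roots f b)) (at a within V k)"
        unfolding eventually_at dist_real_def
        by (intro exI[of _ \<eta>] conjI ballI impI \<eta>(1)) (rule \<eta>(2)[symmetric], blast)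
    qed
  qed
  define U where "U = (\<lambda>k i. {x\<in>V k. i < length (roots f x)})"
  define \<gamma> where "\<gamma> = (\<lambda>i x. (x, roots f x ! i))"
  \<comment> \<open>The number of roots is constant on \<open>V k\<close>, so an index is available
    everywhere on it or nowhere; this makes \<open>U k i\<close> open and connected.\<close>
  have Ucases: "U k i = V k \<or> U k i = {}" for k i
  proof (cases "\<exists>y\<in>V k. i < length (roots f y)")
    case True
    then obtain y where y: "y \<in> V k" "i < length (roots f y)" by blast
    have "i < length (roots f x)" if "x \<in> V k" for x using Nconst[OF that y(1)] y(2) by simp
    then show ?thesis by (auto simp: U_def)
  qed (auto simp: U_def)
  have rts: "eval2 f x (roots f x ! i) = 0" if "i < length (roots f x)" for x i
  proof -
    have "roots f x ! i \<in> set (roots f x)" using that by simp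
    then show ?thesis using finR(1)[of x] by (simp add: roots_def)
  qed
  have arc: "smooth_arc f (U k i) (\<gamma> i)" for k i
  proof -
    have op: "open (U k i)" "connected (U k i)" using Ucases[of k i] V[of k] by auto
    have cont: "isCont (\<lambda>x. roots f x ! i) x0" if "x0 \<in> U k i" for x0
      unfolding continuous_at_eps_delta dist_real_def
    proof (intro allI impI)
      fix \<epsilon> :: real assume "\<epsilon> > 0"
      have "x0 \<notin> B" "i < length (roots f x0)" using that by (auto simp: U_def V_def)
      with stable[OF _ \<open>\<epsilon> > 0\<close>, of x0] show "\<exists>d>0. \<forall>x'. \<bar>x' - x0\<bar> < d \<longrightarrow> \<bar>roots f x' ! i - roots f x0 ! i\<bar> < \<epsilon>"
        by blast
    qed
    have co: "continuous_on (U k i) (\<gamma> i)" unfolding \<gamma>_def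
      using cont by (intro continuous_intros continuous_at_imp_continuous_on) auto
    have inj: "inj_on (\<gamma> i) (U k i)" by (auto simp: \<gamma>_def inj_on_def)
    have "eval_at f (\<gamma> i t) = 0 \<and> (eval_at (px f) (\<gamma> i t), eval_at (pderiv f) (\<gamma> i t)) \<noteq> (0, 0) \<and>
       (\<exists>u v. (u, v) \<noteq> (0, 0) \<and> ((\<lambda>s. fst (\<gamma> i s)) has_real_derivative u) (at t) \<and>
          ((\<lambda>s. snd (\<gamma> i s)) has_real_derivative v) (at t) \<and>
          u * eval_at (px f) (\<gamma> i t) + v * eval_at (pderiv f) (\<gamma> i t) = 0)" if t: "t \<in> U k i" for t
    proof -
      have z: "eval2 f s (roots f s ! i) = 0" if "s \<in> U k i" for s using rts that by (auto simp: U_def)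
      have nz: "eval2 (pderiv f) t (roots f t ! i) \<noteq> 0" using simple z[OF t] t by (auto simp: U_def V_def)
      from implicit_function_deriv[of "U k i" t f "\<lambda>s. roots f s ! i", OF op(1) t z cont[OF t] nz]
      have der: "((\<lambda>s. roots f s ! i) has_real_derivative
        - eval2 (px f) t (roots f t ! i) / eval2 (pderiv f) t (roots f t ! i)) (at t)" .
      have "((\<lambda>s. fst (\<gamma> i s)) has_real_derivative 1) (at t)" by (simp add: \<gamma>_def)
      moreover have "((\<lambda>s. snd (\<gamma> i s)) has_real_derivative
        - eval2 (px f) t (roots f t ! i) / eval2 (pderiv f) t (roots f t ! i)) (at t)"
        using der by (simp add: \<gamma>_def)
      ultimately show ?thesis using z[OF t] nz
        by (intro conjI exI[of _ 1] exI[of _ "- eval2 (px f) t (roots f t ! i) / eval2 (pderiv f) t (roots f t ! i)"])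
           (auto simp: \<gamma>_def)
    qed
    then show ?thesis unfolding smooth_arc_def using op co inj by blast
  qed
  define I where "I = {..\<beta>} \<times> {..<d}"
  define cl where "cl = (\<lambda>(k, i). S \<inter> \<gamma> i ` U k i)"
  have "(0, 0) \<in> I" using d by (simp add: I_def)
  then have I: "finite I" "I \<noteq> {}" by (auto simp: I_def)
  define m where "m = Max ((card \<circ> cl) ` I)"
  have mle: "card (cl ki) \<le> m" if "ki \<in> I" for ki unfolding m_def using I that by (intro Max_ge) auto
  have "m \<in> (card \<circ> cl) ` I" unfolding m_def using I by (intro Max_in) auto
  then obtain k i where ki: "m = card (S \<inter> \<gamma> i ` U k i)" by (auto simp: cl_def)
  \<comment> \<open>The points above bad abscissas, at most d above each, are the additive
    loss.\<close>
  define T where "T = (SIGMA x:B. {y. eval2 f x y = 0})"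
  have T: "finite T" using finB finR by (auto simp: T_def)
  have "card T = (\<Sum>x\<in>B. card {y. eval2 f x y = 0})" unfolding T_def using finB finR by simp
  also have "\<dots> \<le> card B * d" using sum_bounded_above[of B _ d] finR(2) by fastforce
  also have "\<dots> \<le> \<beta> * d" using cardB by simp
  finally have cT: "card T \<le> \<beta> * d" .
  have "S \<subseteq> T \<union> (\<Union>ki\<in>I. cl ki)"
  proof
    fix p assume p: "p \<in> S"
    obtain x y where xy: "p = (x, y)" by force
    have z: "eval2 f x y = 0" using p S c by (auto simp: xy zeroset_def)
    show "p \<in> T \<union> (\<Union>ki\<in>I. cl ki)"
    proof (cases "x \<in> B")
      case True then show ?thesis using z by (auto simp: T_def xy)
    next
      case xB: False
      define k where "k = card {b\<in>B. b < x}"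
      have "k \<le> card B" unfolding k_def using finB by (intro card_mono) auto
      then have k: "k \<le> \<beta>" using cardB by simp
      have "y \<in> set (roots f x)" using z finR(1)[of x] by (simp add: roots_def)
      then obtain i where i: "i < length (roots f x)" "roots f x ! i = y" by (auto simp: in_set_conv_nth)
      have "length (roots f x) \<le> d" using finR[of x] by (simp add: roots_def)
      then have "(k, i) \<in> I" using k i by (auto simp: I_def)
      moreover have "x \<in> U k i" using xB i by (simp add: U_def V_def k_def)
      then have "p \<in> \<gamma> i ` U k i" using i by (force simp: \<gamma>_def xy)
      ultimately show ?thesis using p by (auto simp: cl_def)
    qed
  qed
  moreover have "finite (cl ki)" for ki using S by (auto simp: cl_def split: prod.splits)
  ultimately have "card S \<le> card (T \<union> (\<Union>ki\<in>I. cl ki))" using T I by (intro card_mono) auto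
  also have "\<dots> \<le> card T + card (\<Union>ki\<in>I. cl ki)" by (rule card_Un_le)
  also have "card (\<Union>ki\<in>I. cl ki) \<le> (\<Sum>ki\<in>I. card (cl ki))" by (rule card_UN_le[OF I(1)])
  also have "\<dots> \<le> card I * m" using sum_bounded_above[of I _ m] mle by fastforce
  finally have "card S \<le> \<beta> * d + (\<beta> + 1) * d * m" using cT by (simp add: I_def)
  also have "\<dots> \<le> arcK d * m + arcK d"
  proof -
    have "(\<beta> + 1) * d \<le> arcK d" "\<beta> * d \<le> arcK d" by (simp_all add: arcK_def \<beta>_def)
    then show ?thesis by (metis add.commute add_mono mult_le_mono1)
  qed
  finally show ?thesis using arc[of k i] unfolding ki by blast
qed

section \<open>Critical pairs and level curves of the distance\<close>

lemma continuous_nonzero_sign: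
  fixes g :: "real \<Rightarrow> real"
  assumes "continuous_on {a..b} g" "\<And>x. x \<in> {a..b} \<Longrightarrow> g x \<noteq> c" "x \<in> {a..b}" "y \<in> {a..b}" "g x > c"
  shows "g y > c"
proof (rule ccontr)
  assume "\<not> g y > c"
  then have y: "g y \<le> c" by simp
  show False
  proof (cases "x \<le> y")
    case True
    have "continuous_on {x..y} g" using assms by (auto intro: continuous_on_subset)
    from IVT2'[of g y c x, OF y _ True this] assms(5) obtain z where "x \<le> z" "z \<le> y" "g z = c" by auto
    then show False using assms(2)[of z] assms(3,4) by auto
  next
    case False
    have "continuous_on {y..x} g" using assms by (auto intro: continuous_on_subset)
    from IVT'[of g y c x, OF y _ _ this] assms(5) False obtain z where "y \<le> z" "z \<le> x" "g z = c" by auto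
    then show False using assms(2)[of z] assms(3,4) by auto
  qed
qed

text \<open>On the three avoided sides F exceeds \<delta> by connectedness. Take the level point
  with the largest s: if F were below \<delta> at another t for this s, increasing s towards
  \<open>s2\<close> would cross the level again at a larger s. The side s = \<open>s1\<close> may be
  met freely.\<close>

lemma box_level_minimum:
  fixes F :: "real \<Rightarrow> real \<Rightarrow> real"
  assumes cont: "continuous_on ({s1..s2} \<times> {t1..t2}) (\<lambda>p. F (fst p) (snd p))"
    and st: "s \<in> {s1..s2}" "t \<in> {t1..t2}" "F s t = \<delta>"
    and bd1: "\<And>t. t \<in> {t1..t2} \<Longrightarrow> F s2 t \<noteq> \<delta>"
    and bd2: "\<And>s. s \<in> {s1..s2} \<Longrightarrow> F s t1 \<noteq> \<delta> \<and> F s t2 \<noteq> \<delta>"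
    and pos: "F s2 t1 > \<delta>"
  shows "\<exists>s\<in>{s1..s2}. \<exists>t\<in>{t1<..<t2}. F s t = \<delta> \<and> (\<forall>t\<in>{t1..t2}. F s t \<ge> \<delta>)"
proof -
  have le: "s1 \<le> s2" "t1 \<le> t2" using st by auto
  have cs: "continuous_on {s1..s2} (\<lambda>s. F s t)" if "t \<in> {t1..t2}" for t
  proof -
    have 1: "continuous_on {s1..s2} (\<lambda>s. (s, t))" by (intro continuous_intros)
    have 2: "(\<lambda>s. (s, t)) ` {s1..s2} \<subseteq> {s1..s2} \<times> {t1..t2}" using that by auto
    from continuous_on_compose2[OF cont 1 2] show ?thesis by simp
  qed
  have ct: "continuous_on {t1..t2} (\<lambda>t. F s t)" if "s \<in> {s1..s2}" for s
  proof -
    have 1: "continuous_on {t1..t2} (\<lambda>t. (s, t))" by (intro continuous_intros)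
    have 2: "(\<lambda>t. (s, t)) ` {t1..t2} \<subseteq> {s1..s2} \<times> {t1..t2}" using that by auto
    from continuous_on_compose2[OF cont 1 2] show ?thesis by simp
  qed
  have b1: "F s t1 > \<delta>" if "s \<in> {s1..s2}" for s
    using continuous_nonzero_sign[OF cs[of t1], of \<delta> s2 s] bd2 pos that le by auto
  have b2: "F s2 t > \<delta>" if "t \<in> {t1..t2}" for t
    using continuous_nonzero_sign[OF ct[of s2], of \<delta> t1 t] bd1 pos that le by auto
  have b3: "F s t2 > \<delta>" if "s \<in> {s1..s2}" for s
    using continuous_nonzero_sign[OF cs[of t2], of \<delta> s2 s] bd2 b2[of t2] that le by auto
  define K where "K = {p \<in> {s1..s2} \<times> {t1..t2}. F (fst p) (snd p) = \<delta>}"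
  have "closed K"
    unfolding K_def by (rule continuous_closed_preimage_constant[OF cont]) (intro closed_Times closed_atLeastAtMost)
  moreover have "bounded K" unfolding K_def
    by (rule bounded_subset[OF bounded_Times[OF bounded_closed_interval bounded_closed_interval]]) auto
  ultimately have "compact K" by (simp add: compact_eq_bounded_closed)
  then have "compact (fst ` K)" by (intro compact_continuous_image continuous_intros)
  moreover have "(s, t) \<in> K" using st by (simp add: K_def)
  then have "fst ` K \<noteq> {}" by blast
  ultimately have "\<exists>s\<in>fst ` K. \<forall>t\<in>fst ` K. t \<le> s" by (rule compact_attains_sup)
  then obtain s0 where s0: "s0 \<in> fst ` K" "\<And>s. s \<in> fst ` K \<Longrightarrow> s \<le> s0" by blast
  then obtain t0 where t0: "(s0, t0) \<in> K" by auto
  then have K0: "s0 \<in> {s1..s2}" "t0 \<in> {t1..t2}" "F s0 t0 = \<delta>" by (auto simp: K_def)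
  have "t0 \<noteq> t1" "t0 \<noteq> t2" using b1[OF K0(1)] b3[OF K0(1)] K0(3) by auto
  then have "t0 \<in> {t1<..<t2}" using K0(2) by auto
  moreover have "F s0 t \<ge> \<delta>" if t: "t \<in> {t1..t2}" for t
  proof (rule ccontr)
    assume neg: "\<not> F s0 t \<ge> \<delta>"
    have s2: "s2 \<in> {s1..s2}" using le by simp
    have "continuous_on {s0..s2} (\<lambda>s. F s t)" using cs[OF t] K0(1) by (auto intro: continuous_on_subset)
    from IVT'[of "\<lambda>s. F s t" s0 \<delta> s2, OF _ _ _ this] neg b2[OF t] K0(1)
    obtain s' where s': "s0 \<le> s'" "s' \<le> s2" "F s' t = \<delta>" by auto
    then have "(s', t) \<in> K" using K0(1) t by (auto simp: K_def)
    then have "s' \<le> s0" using s0(2) by force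
    then have "s' = s0" using s' by simp
    then show False using s'(3) neg by simp
  qed
  ultimately show ?thesis using K0 by blast
qed

lemma box_level_extremum:
  fixes F :: "real \<Rightarrow> real \<Rightarrow> real"
  assumes cont: "continuous_on ({s1..s2} \<times> {t1..t2}) (\<lambda>p. F (fst p) (snd p))"
    and st: "s \<in> {s1..s2}" "t \<in> {t1..t2}" "F s t = \<delta>"
    and bd1: "\<And>t. t \<in> {t1..t2} \<Longrightarrow> F s2 t \<noteq> \<delta>"
    and bd2: "\<And>s. s \<in> {s1..s2} \<Longrightarrow> F s t1 \<noteq> \<delta> \<and> F s t2 \<noteq> \<delta>"
  shows "\<exists>s\<in>{s1..s2}. \<exists>t\<in>{t1<..<t2}. F s t = \<delta> \<and>
     ((\<forall>t\<in>{t1..t2}. F s t \<ge> \<delta>) \<or> (\<forall>t\<in>{t1..t2}. F s t \<le> \<delta>))"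
proof (cases "F s2 t1 > \<delta>")
  case True
  from box_level_minimum[OF cont st bd1 bd2 True] show ?thesis by blast
next
  case False
  have "F s2 t1 \<noteq> \<delta>" using bd1[of t1] st by auto
  then have neg: "- F s2 t1 > - \<delta>" using False by simp
  have cont': "continuous_on ({s1..s2} \<times> {t1..t2}) (\<lambda>p. - F (fst p) (snd p))"
    by (intro continuous_intros cont)
  have "\<exists>s\<in>{s1..s2}. \<exists>t\<in>{t1<..<t2}. - F s t = - \<delta> \<and> (\<forall>t\<in>{t1..t2}. - F s t \<ge> - \<delta>)"
    by (rule box_level_minimum[of s1 s2 t1 t2 "\<lambda>s t. - F s t" s t "-\<delta>"])
       (use cont' st bd1 bd2 neg in auto)
  then show ?thesis by auto
qed

text \<open>The segment pq is normal to the second curve at q: these are critical points of the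
  distance in q alone. As p need not be critical, a fixed \<delta> leaves finitely many pairs in
  general.\<close>

definition crit :: "real poly poly \<Rightarrow> real poly poly \<Rightarrow> real \<Rightarrow> ((real \<times> real) \<times> (real \<times> real)) set" where
  "crit f g \<delta> = {(p, q). eval_at f p = 0 \<and> eval_at g q = 0 \<and> (eval_at (px g) q, eval_at (pderiv g) q) \<noteq> (0, 0) \<and>
     (\<exists>\<sigma>. p = (fst q + \<sigma> * eval_at (px g) q, snd q + \<sigma> * eval_at (pderiv g) q)) \<and> dist2 p q = \<delta>}"

text \<open>At an interior extremum in t the derivative of the squared distance vanishes, so p - q
  is orthogonal to the tangent and hence a multiple of the gradient.\<close>

lemma extremum_crit:
  assumes arcs: "smooth_arc f U1 \<gamma>1" "smooth_arc g U2 \<gamma>2"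
    and s: "s \<in> U1" and t: "t \<in> {t1<..<t2}" "{t1..t2} \<subseteq> U2" and \<delta>: "dist2 (\<gamma>1 s) (\<gamma>2 t) = \<delta>"
    and ext: "(\<forall>t\<in>{t1..t2}. dist2 (\<gamma>1 s) (\<gamma>2 t) \<ge> \<delta>) \<or> (\<forall>t\<in>{t1..t2}. dist2 (\<gamma>1 s) (\<gamma>2 t) \<le> \<delta>)"
  shows "(\<gamma>1 s, \<gamma>2 t) \<in> crit f g \<delta>"
proof -
  have tU: "t \<in> U2" using t by auto
  define q where "q = \<gamma>2 t"
  define p where "p = \<gamma>1 s"
  define X where "X = eval_at (px g) q"
  define Y where "Y = eval_at (pderiv g) q"
  from arcs(2) tU obtain u v where uv: "(u, v) \<noteq> (0, 0)"
    "((\<lambda>s. fst (\<gamma>2 s)) has_real_derivative u) (at t)" "((\<lambda>s. snd (\<gamma>2 s)) has_real_derivative v) (at t)"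
    "u * X + v * Y = 0" and g0: "eval_at g q = 0" "(X, Y) \<noteq> (0, 0)"
    unfolding smooth_arc_def q_def X_def Y_def by blast
  have f0: "eval_at f p = 0" using arcs(1) s unfolding smooth_arc_def p_def by blast
  have der: "((\<lambda>t. dist2 p (\<gamma>2 t)) has_real_derivative
     2 * (fst p - fst q) * (- u) + 2 * (snd p - snd q) * (- v)) (at t)"
    unfolding dist2_def q_def
    by (rule derivative_eq_intros uv(2,3) refl | simp add: algebra_simps)+
  have rng: "y \<in> {t1..t2}" if "\<bar>t - y\<bar> < min (t - t1) (t2 - t)" for y
    using that by auto
  have m: "0 < min (t - t1) (t2 - t)" using t(1) by auto
  have "2 * (fst p - fst q) * (- u) + 2 * (snd p - snd q) * (- v) = 0"
    using ext
  proof
    assume "\<forall>t\<in>{t1..t2}. dist2 (\<gamma>1 s) (\<gamma>2 t) \<ge> \<delta>"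
    then show ?thesis using DERIV_local_min[OF der m] rng \<delta> by (auto simp: p_def)
  next
    assume "\<forall>t\<in>{t1..t2}. dist2 (\<gamma>1 s) (\<gamma>2 t) \<le> \<delta>"
    then show ?thesis using DERIV_local_max[OF der m] rng \<delta> by (auto simp: p_def)
  qed
  then have orth: "u * (fst p - fst q) + v * (snd p - snd q) = 0" by (simp add: algebra_simps)
  have "\<exists>\<sigma>. fst p - fst q = \<sigma> * X \<and> snd p - snd q = \<sigma> * Y"
  proof (cases "u = 0")
    case True
    then have "Y = 0" "snd p - snd q = 0" using uv orth by auto
    then show ?thesis using g0(2) by (intro exI[of _ "(fst p - fst q) / X"]) auto
  next
    case False
    have X: "X = - v * Y / u" using uv(4) False by (simp add: field_simps add_eq_0_iff2)
    have "Y \<noteq> 0" using g0(2) X by auto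
    have "fst p - fst q = - v * (snd p - snd q) / u" using orth False by (simp add: field_simps add_eq_0_iff2)
    then show ?thesis using \<open>Y \<noteq> 0\<close> by (intro exI[of _ "(snd p - snd q) / Y"]) (simp add: X)
  qed
  then obtain \<sigma> where "fst p - fst q = \<sigma> * X" "snd p - snd q = \<sigma> * Y" by blast
  then have "p = (fst q + \<sigma> * X, snd q + \<sigma> * Y)" by (auto simp: prod_eq_iff)
  then show ?thesis using f0 g0 \<delta> unfolding crit_def X_def Y_def by (auto simp flip: p_def q_def)
qed

lemma acurve_mem: "acurve d f C \<Longrightarrow> p \<in> C \<longleftrightarrow> eval_at f p = 0"
  by (auto simp: acurve_def zeroset_def case_prod_unfold)

text \<open>For positive y-degree the y-derivative alone has finitely many zeros on the curve; on a
  vertical line the gradient is a nonzero constant.\<close>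

lemma singular_finite:
  assumes C: "acurve d f C"
  shows "finite {p\<in>C. (eval_at (px f) p, eval_at (pderiv f) p) = (0, 0)}"
proof (cases "degree f = 0")
  case True
  note c = C[unfolded acurve_def]
  then obtain a b where "(a, b) \<in> C" by (metis finite.emptyI ex_in_conv surj_pair)
  then have ab: "eval2 f a b = 0" using c by (simp add: zeroset_def)
  from irreducible_degree0_curve[OF _ True ab] c
  obtain k where k: "k \<noteq> 0" "f = [:[:k:] * [:-a, 1:]:]" by blast
  have "px f = [:[:k:]:]" by (simp add: k px_def map_poly_pCons pderiv_pCons)
  then have "eval_at (px f) p = k" for p by (simp add: eval2_pCons)
  then show ?thesis using k by simp
next
  case False
  note c = C[unfolded acurve_def]
  have "\<not> f dvd pderiv f"
    using dvd_imp_degree_le[of f "pderiv f"] False by (auto simp: degree_pderiv pderiv_eq_0_iff)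
  with bezout_poly[OF C bideg_le_pderiv[of f d]] False c
  have "finite {p\<in>C. eval_at (pderiv f) p = 0}" by auto
  then show ?thesis by (rule rev_finite_subset) auto
qed

text \<open>The eliminant used below has bidegree 2d (8d + 3), and each of its zeros q allows two
  signs of the normal offset.\<close>

definition critK :: "nat \<Rightarrow> nat" where
  "critK d = 2 * bez d (2 * d * (8 * d + 3))"

text \<open>Given q on \<open>C2\<close>, the candidates for p are q plus or minus sqrt \<delta>
  times the unit normal. Eliminating this root turns f(p) = 0 into a polynomial condition on q,
  which bounds the pairs unless it holds on all of \<open>C2\<close>. For such a bad \<delta> the
  normal line at one fixed regular point meets \<open>C1\<close> at distance sqrt \<delta>, so bad
  values are few once that line is not \<open>C1\<close>.\<close>

lemma crit_count:
  assumes C1: "acurve d f C1" and C2: "acurve d g C2"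
    and nl: "\<And>a b c. (a, b) \<noteq> (0, 0) \<Longrightarrow> \<not> (C1 = line a b c \<and> C2 = line a b c)"
  shows "\<exists>Bad. finite Bad \<and> card Bad \<le> bez d 1 \<and>
     (\<forall>\<delta>>0. \<delta> \<notin> Bad \<longrightarrow> finite (crit f g \<delta>) \<and> card (crit f g \<delta>) \<le> critK d)"
proof -
  have fd: "bideg_le f d" and gd: "bideg_le g d" using C1 C2 by (auto simp: acurve_def)
  define nx where "nx = ceval (px g)"
  define ny where "ny = ceval (pderiv g)"
  have rn: "rpoly d nx" "rpoly d ny"
    using bideg_le_px[OF gd] bideg_le_pderiv[OF gd] unfolding rpoly_def nx_def ny_def by blast+
  define W where "W = (\<lambda>z w. nx z w * nx z w + ny z w * ny z w)"
  define w where "w = (\<lambda>q. (eval_at (px g) q)\<^sup>2 + (eval_at (pderiv g) q)\<^sup>2)"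
  have rW: "rpoly (2 * d) W" unfolding W_def
    using rpoly_add[OF rpoly_mult[OF rn(1) rn(1), of "2*d"] rpoly_mult[OF rn(2) rn(2), of "2*d"]] by simp
  have Wq: "W (of_real (fst q)) (of_real (snd q)) = of_real (w q)" for q
    by (simp add: W_def w_def nx_def ny_def ceval_of_real power2_eq_square)
  have dpos: "d \<ge> 1"
  proof (rule ccontr)
    assume "\<not> d \<ge> 1"
    then have "degree f \<le> 0" "degree (coeff f 0) \<le> 0" using fd unfolding bideg_le_def by (metis less_one not_less)+
    then have "degree f = 0" "degree (coeff f 0) = 0" by auto
    then obtain c where "f = [:[:c:]:]" by (metis degree_0_id coeff_pCons_0)
    moreover have "f \<noteq> 0" "\<not> is_unit f" using C1 irreducible_not_unit[of f] by (auto simp: acurve_def)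
    ultimately have "c \<noteq> 0" "\<not> is_unit [:[:c:]:]" by auto
    then show False by (auto simp: is_unit_const_poly_iff dvd_field_iff)
  qed
  have "\<exists>N. rpoly (2 * d * (8 * d + 3)) N \<and> (\<forall>z w. W z w \<noteq> 0 \<longrightarrow>
      (N z w = 0 \<longleftrightarrow> (\<exists>s. s\<^sup>2 * W z w = of_real \<delta> \<and> ceval f (z + s * nx z w) (w + s * ny z w) = 0)))" for \<delta>
  proof -
    have r: "rpoly (2 * d) (\<lambda>z w. z)" "rpoly (2 * d) nx" "rpoly (2 * d) (\<lambda>z w. w)" "rpoly (2 * d) ny"
      using rpoly_fst rpoly_snd rn dpos by (auto intro: rpoly_mono)
    show ?thesis by (rule eliminate_sqrt[OF fd r rpoly_const[of _ \<delta>] rW])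
  qed
  then obtain N where N: "\<And>\<delta>. rpoly (2 * d * (8 * d + 3)) (N \<delta>)"
    "\<And>\<delta> z w. W z w \<noteq> 0 \<Longrightarrow> N \<delta> z w = 0 \<longleftrightarrow> (\<exists>s. s\<^sup>2 * W z w = of_real \<delta> \<and> ceval f (z + s * nx z w) (w + s * ny z w) = 0)"
    by metis
  have ev: "ceval f (of_real (fst q) + of_real s * nx (of_real (fst q)) (of_real (snd q)))
      (of_real (snd q) + of_real s * ny (of_real (fst q)) (of_real (snd q)))
      = of_real (eval_at f (fst q + s * eval_at (px g) q, snd q + s * eval_at (pderiv g) q))" for q s
    unfolding nx_def ny_def ceval_of_real
    by (simp only: of_real_mult[symmetric] of_real_add[symmetric] ceval_of_real fst_conv snd_conv)
  have Nq: "pev (N \<delta>) q = 0 \<longleftrightarrow> (\<exists>s. s\<^sup>2 * w q = \<delta> \<and> eval_at f (fst q + s * eval_at (px g) q, snd q + s * eval_at (pderiv g) q) = 0)"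
    if "w q \<noteq> 0" "\<delta> > 0" for q \<delta>
  proof
    assume "\<exists>s. s\<^sup>2 * w q = \<delta> \<and> eval_at f (fst q + s * eval_at (px g) q, snd q + s * eval_at (pderiv g) q) = 0"
    then obtain s where s: "s\<^sup>2 * w q = \<delta>" "eval_at f (fst q + s * eval_at (px g) q, snd q + s * eval_at (pderiv g) q) = 0" by blast
    then show "pev (N \<delta>) q = 0" unfolding pev_def using that
      by (subst N(2)) (auto simp only: Wq of_real_eq_0_iff ev intro!: exI[of _ "of_real s"] simp flip: of_real_power of_real_mult)
  next
    assume N0: "pev (N \<delta>) q = 0"
    have "W (of_real (fst q)) (of_real (snd q)) \<noteq> 0" using that(1) unfolding Wq by simp
    from N(2)[OF this, of \<delta>] N0 obtain s where s: "s\<^sup>2 * of_real (w q) = of_real \<delta>"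
      "ceval f (of_real (fst q) + s * nx (of_real (fst q)) (of_real (snd q)))
        (of_real (snd q) + s * ny (of_real (fst q)) (of_real (snd q))) = 0"
      unfolding pev_def Wq by blast
    \<comment> \<open>Both \<delta> and \<open>w q\<close> are positive, so the root produced by
      elimination is real.\<close>
    have wp: "w q > 0" using that(1) by (simp add: w_def less_le)
    have "s\<^sup>2 = of_real (\<delta> / w q)" using s(1) that(1) by (simp add: field_simps)
    also have "\<delta> / w q = (sqrt (\<delta> / w q))\<^sup>2" using wp that by simp
    finally have "s\<^sup>2 = (of_real (sqrt (\<delta> / w q)))\<^sup>2" by simp
    then have "s = of_real (sqrt (\<delta> / w q)) \<or> s = of_real (- sqrt (\<delta> / w q))"
      by (auto simp: power2_eq_iff)
    then obtain r where r: "s = of_real r" by blast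
    have "r\<^sup>2 * w q = \<delta>" using s(1) unfolding r by (simp flip: of_real_power of_real_mult)
    moreover have "eval_at f (fst q + r * eval_at (px g) q, snd q + r * eval_at (pderiv g) q) = 0"
      using s(2) unfolding r ev by simp
    ultimately show "\<exists>s. s\<^sup>2 * w q = \<delta> \<and> eval_at f (fst q + s * eval_at (px g) q, snd q + s * eval_at (pderiv g) q) = 0" by blast
  qed
  have w0: "w q \<noteq> 0 \<longleftrightarrow> (eval_at (px g) q, eval_at (pderiv g) q) \<noteq> (0, 0)" for q
    by (simp add: w_def sum_power2_eq_zero_iff)
  define Bad where "Bad = {\<delta>. \<delta> > 0 \<and> (\<forall>q\<in>C2. pev (N \<delta>) q = 0)}"
  have good: "finite (crit f g \<delta>) \<and> card (crit f g \<delta>) \<le> critK d" if \<delta>: "\<delta> > 0" "\<delta> \<notin> Bad" for \<delta>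
  proof -
    define Q where "Q = {q\<in>C2. pev (N \<delta>) q = 0}"
    have Q: "finite Q" "card Q \<le> bez d (2 * d * (8 * d + 3))"
      using bezout[OF C2 N(1)[of \<delta>]] \<delta> unfolding Q_def Bad_def by auto
    define \<Phi> where "\<Phi> = (\<lambda>(q, e). ((fst q + e * sqrt (\<delta> / w q) * eval_at (px g) q, snd q + e * sqrt (\<delta> / w q) * eval_at (pderiv g) q), q))"
    have sub: "crit f g \<delta> \<subseteq> \<Phi> ` (Q \<times> {1, -1})"
    proof
      fix x assume "x \<in> crit f g \<delta>"
      then obtain p q \<sigma> where x: "x = (p, q)" "eval_at f p = 0" "eval_at g q = 0" "w q \<noteq> 0"
        "p = (fst q + \<sigma> * eval_at (px g) q, snd q + \<sigma> * eval_at (pderiv g) q)" "dist2 p q = \<delta>"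
        unfolding crit_def w0 by blast
      have \<sigma>: "\<sigma>\<^sup>2 * w q = \<delta>" using x(6) unfolding x(5) by (simp add: dist2_def w_def power2_eq_square algebra_simps)
      then have "q \<in> Q" using Nq[OF x(4) \<delta>(1)] x C2 unfolding Q_def by (auto simp: acurve_mem)
      have wp: "w q > 0" using x(4) by (simp add: w_def less_le)
      have "\<sigma>\<^sup>2 = (sqrt (\<delta> / w q))\<^sup>2" using \<sigma> wp \<delta>(1) by (simp add: field_simps)
      then have "\<sigma> = 1 * sqrt (\<delta> / w q) \<or> \<sigma> = -1 * sqrt (\<delta> / w q)" by (simp add: power2_eq_iff)
      then have "x = \<Phi> (q, 1) \<or> x = \<Phi> (q, -1)" unfolding \<Phi>_def x(1,5) by auto
      then show "x \<in> \<Phi> ` (Q \<times> {1, -1})" using \<open>q \<in> Q\<close> by auto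
    qed
    have "card (crit f g \<delta>) \<le> card (\<Phi> ` (Q \<times> {1, -1}))" using Q by (intro card_mono sub) auto
    also have "\<dots> \<le> card (Q \<times> {1, -1 :: real})" using Q by (intro card_image_le) auto
    also have "\<dots> \<le> critK d" using Q by (simp add: critK_def card_cartesian_product)
    finally show ?thesis using Q finite_subset[OF sub] by auto
  qed
  have "finite Bad \<and> card Bad \<le> bez d 1"
  proof -
    define Rg where "Rg = {q\<in>C2. w q \<noteq> 0}"
    have spl: "C2 = Rg \<union> {p\<in>C2. (eval_at (px g) p, eval_at (pderiv g) p) = (0, 0)}" using w0 by (auto simp: Rg_def)
    have infR: "infinite Rg"
    proof
      assume "finite Rg"
      then have "finite (Rg \<union> {p\<in>C2. (eval_at (px g) p, eval_at (pderiv g) p) = (0, 0)})"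
        using singular_finite[OF C2] by (rule finite_UnI)
      then have "finite C2" by (subst spl)
      then show False using C2 unfolding acurve_def by blast
    qed
    define nl where "nl = (\<lambda>q. line (eval_at (pderiv g) q) (- eval_at (px g) q)
        (- eval_at (pderiv g) q * fst q + eval_at (px g) q * snd q))"
    \<comment> \<open>If \<open>C1\<close> were the normal line at every regular point of
      \<open>C2\<close>, all these points would lie on it, and both curves would be the same
      line.\<close>
    have "\<exists>q0\<in>Rg. C1 \<noteq> nl q0"
    proof (rule ccontr)
      assume "\<not> (\<exists>q0\<in>Rg. C1 \<noteq> nl q0)"
      then have all: "\<And>q. q \<in> Rg \<Longrightarrow> C1 = nl q" by blast
      have "Rg \<noteq> {}" using infR by auto
      then obtain q where q: "q \<in> Rg" by blast
      have ne: "(eval_at (pderiv g) q, - eval_at (px g) q) \<noteq> (0, 0)" using q w0[of q] by (auto simp: Rg_def)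
      have "q' \<in> nl q'" for q' by (simp add: nl_def line_def case_prod_unfold)
      then have "Rg \<subseteq> C2 \<inter> nl q" using all[OF q] all by (auto simp: Rg_def)
      then have "infinite (C2 \<inter> nl q)" using infR finite_subset by blast
      then have "C2 = nl q" using line_bound[OF C2 ne] unfolding nl_def by blast
      then show False using nl[OF ne] all[OF q] unfolding nl_def by blast
    qed
    then obtain q0 where q0: "q0 \<in> Rg" "C1 \<noteq> nl q0" by blast
    have ne: "(eval_at (pderiv g) q0, - eval_at (px g) q0) \<noteq> (0, 0)" using q0 w0[of q0] by (auto simp: Rg_def)
    have fin: "finite (C1 \<inter> nl q0)" "card (C1 \<inter> nl q0) \<le> bez d 1"
      using line_bound[OF C1 ne] q0(2) unfolding nl_def by blast+
    have "Bad \<subseteq> (\<lambda>p. dist2 p q0) ` (C1 \<inter> nl q0)"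
    proof
      fix \<delta> assume "\<delta> \<in> Bad"
      then have "\<delta> > 0" "pev (N \<delta>) q0 = 0" using q0 by (auto simp: Bad_def Rg_def)
      with Nq[of q0 \<delta>] q0(1) obtain s where s: "s\<^sup>2 * w q0 = \<delta>"
        "eval_at f (fst q0 + s * eval_at (px g) q0, snd q0 + s * eval_at (pderiv g) q0) = 0"
        by (auto simp: Rg_def)
      define p where "p = (fst q0 + s * eval_at (px g) q0, snd q0 + s * eval_at (pderiv g) q0)"
      have "p \<in> C1" using s(2) acurve_mem[OF C1] by (simp add: p_def)
      moreover have "p \<in> nl q0" by (simp add: p_def nl_def line_def algebra_simps)
      moreover have "dist2 p q0 = \<delta>" unfolding s(1)[symmetric] by (simp add: p_def dist2_def w_def power2_eq_square algebra_simps)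
      ultimately show "\<delta> \<in> (\<lambda>p. dist2 p q0) ` (C1 \<inter> nl q0)" by blast
    qed
    then show ?thesis using fin by (meson card_image_le card_mono finite_imageI finite_subset le_trans)
  qed
  with good show ?thesis by blast
qed

section \<open>Boxes met by a level curve\<close>

lemma card_disjoint_hits:
  fixes J :: "nat \<Rightarrow> 'a set"
  assumes "\<And>i j. i \<in> R \<Longrightarrow> j \<in> R \<Longrightarrow> i \<noteq> j \<Longrightarrow> J i \<inter> J j = {}"
    and "\<And>j. j \<in> R \<Longrightarrow> J j \<subseteq> U" and "finite {t\<in>U. P t}"
  shows "card {j. j \<in> R \<and> (\<exists>t\<in>J j. P t)} \<le> card {t\<in>U. P t}"
proof (rule surj_card_le[OF assms(3)])
  show "{j. j \<in> R \<and> (\<exists>t\<in>J j. P t)} \<subseteq> (\<lambda>t. THE j. j \<in> R \<and> t \<in> J j) ` {t\<in>U. P t}"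
  proof
    fix j assume "j \<in> {j. j \<in> R \<and> (\<exists>t\<in>J j. P t)}"
    then obtain t where t: "j \<in> R" "t \<in> J j" "P t" by blast
    have "(THE j. j \<in> R \<and> t \<in> J j) = j" using t assms(1) by (intro the_equality) blast+
    moreover have "t \<in> {t\<in>U. P t}" using t assms(2) by blast
    ultimately show "j \<in> (\<lambda>t. THE j. j \<in> R \<and> t \<in> J j) ` {t\<in>U. P t}"
      by (intro image_eqI[of _ _ t]) simp_all
  qed
qed

text \<open>A box met by the level curve has one of three sides met by it or contains a critical
  pair. On the line through a side the level has at most M points, each in at most one of the
  disjoint intervals; critical pairs of distinct boxes are distinct because the arcs are
  injective.\<close>

lemma level_box_count:
  fixes lo1 hi1 lo2 hi2 :: "nat \<Rightarrow> real"
  assumes arcs: "smooth_arc f U1 \<gamma>1" "smooth_arc g U2 \<gamma>2"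
    and fin: "finite R1" "finite R2"
    and M1: "\<And>s. s \<in> hi1 ` R1 \<Longrightarrow> finite {t\<in>U2. dist2 (\<gamma>1 s) (\<gamma>2 t) = \<delta>} \<and> card {t\<in>U2. dist2 (\<gamma>1 s) (\<gamma>2 t) = \<delta>} \<le> M"
    and M2: "\<And>t. t \<in> lo2 ` R2 \<union> hi2 ` R2 \<Longrightarrow> finite {s\<in>U1. dist2 (\<gamma>1 s) (\<gamma>2 t) = \<delta>} \<and> card {s\<in>U1. dist2 (\<gamma>1 s) (\<gamma>2 t) = \<delta>} \<le> M"
    and crit: "finite (crit f g \<delta>)" "card (crit f g \<delta>) \<le> Kc"
    and I: "\<And>i. i \<in> R1 \<Longrightarrow> lo1 i \<le> hi1 i \<and> {lo1 i..hi1 i} \<subseteq> U1"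
      "\<And>i i'. i \<in> R1 \<Longrightarrow> i' \<in> R1 \<Longrightarrow> i \<noteq> i' \<Longrightarrow> {lo1 i..hi1 i} \<inter> {lo1 i'..hi1 i'} = {}"
    and J: "\<And>j. j \<in> R2 \<Longrightarrow> lo2 j \<le> hi2 j \<and> {lo2 j..hi2 j} \<subseteq> U2"
      "\<And>j j'. j \<in> R2 \<Longrightarrow> j' \<in> R2 \<Longrightarrow> j \<noteq> j' \<Longrightarrow> {lo2 j..hi2 j} \<inter> {lo2 j'..hi2 j'} = {}"
  shows "card {(i, j). i \<in> R1 \<and> j \<in> R2 \<and> (\<exists>s\<in>{lo1 i..hi1 i}. \<exists>t\<in>{lo2 j..hi2 j}. dist2 (\<gamma>1 s) (\<gamma>2 t) = \<delta>)}
     \<le> card R1 * M + 2 * (card R2 * M) + Kc" (is "card ?V \<le> _")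
proof -
  define F where "F = (\<lambda>s t. dist2 (\<gamma>1 s) (\<gamma>2 t))"
  define A1 where "A1 = (SIGMA i:R1. {j. j \<in> R2 \<and> (\<exists>t\<in>{lo2 j..hi2 j}. F (hi1 i) t = \<delta>)})"
  define A2 where "A2 = (SIGMA j:R2. {i. i \<in> R1 \<and> (\<exists>s\<in>{lo1 i..hi1 i}. F s (lo2 j) = \<delta>)})"
  define A3 where "A3 = (SIGMA j:R2. {i. i \<in> R1 \<and> (\<exists>s\<in>{lo1 i..hi1 i}. F s (hi2 j) = \<delta>)})"
  define A4 where "A4 = {(i, j). i \<in> R1 \<and> j \<in> R2 \<and> (\<exists>s\<in>{lo1 i..hi1 i}. \<exists>t\<in>{lo2 j..hi2 j}. (\<gamma>1 s, \<gamma>2 t) \<in> crit f g \<delta>)}"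
  define sw where "sw = (\<lambda>(j::nat, i::nat). (i, j))"
  have "?V \<subseteq> A1 \<union> sw ` A2 \<union> sw ` A3 \<union> A4"
  proof
    fix x assume "x \<in> ?V"
    then obtain i j s t where x: "x = (i, j)" "i \<in> R1" "j \<in> R2" "s \<in> {lo1 i..hi1 i}" "t \<in> {lo2 j..hi2 j}" "F s t = \<delta>"
      by (auto simp: F_def)
    show "x \<in> A1 \<union> sw ` A2 \<union> sw ` A3 \<union> A4"
    proof (rule ccontr)
      assume neg: "x \<notin> A1 \<union> sw ` A2 \<union> sw ` A3 \<union> A4"
      have n1: "F (hi1 i) t \<noteq> \<delta>" if "t \<in> {lo2 j..hi2 j}" for t
        using neg x that by (auto simp: A1_def)
      have n2: "F s (lo2 j) \<noteq> \<delta> \<and> F s (hi2 j) \<noteq> \<delta>" if "s \<in> {lo1 i..hi1 i}" for s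
      proof -
        have "(j, i) \<notin> A2" "(j, i) \<notin> A3" using neg x by (force simp: sw_def)+
        then show ?thesis using x that by (auto simp: A2_def A3_def)
      qed
      have sub: "{lo1 i..hi1 i} \<subseteq> U1" "{lo2 j..hi2 j} \<subseteq> U2" using I J x by auto
      have c1: "continuous_on {lo1 i..hi1 i} \<gamma>1" "continuous_on {lo2 j..hi2 j} \<gamma>2"
        using arcs sub unfolding smooth_arc_def by (meson continuous_on_subset)+
      have "continuous_on ({lo1 i..hi1 i} \<times> {lo2 j..hi2 j}) (\<lambda>p. \<gamma>1 (fst p))"
        "continuous_on ({lo1 i..hi1 i} \<times> {lo2 j..hi2 j}) (\<lambda>p. \<gamma>2 (snd p))"
        by (rule continuous_on_compose2[OF c1(1)] continuous_on_compose2[OF c1(2)]; auto intro!: continuous_intros)+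
      then have "continuous_on ({lo1 i..hi1 i} \<times> {lo2 j..hi2 j}) (\<lambda>p. F (fst p) (snd p))"
        unfolding F_def dist2_def by (intro continuous_intros)
      from box_level_extremum[OF this x(4,5,6) n1 n2]
      obtain s' t' where st: "s' \<in> {lo1 i..hi1 i}" "t' \<in> {lo2 j<..<hi2 j}" "F s' t' = \<delta>"
        "(\<forall>t\<in>{lo2 j..hi2 j}. F s' t \<ge> \<delta>) \<or> (\<forall>t\<in>{lo2 j..hi2 j}. F s' t \<le> \<delta>)" by blast
      have cr: "(\<gamma>1 s', \<gamma>2 t') \<in> crit f g \<delta>"
        by (rule extremum_crit[OF arcs _ st(2) sub(2)]) (use st sub in \<open>auto simp: F_def\<close>)
      have "t' \<in> {lo2 j..hi2 j}" using st(2) by simp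
      then have "x \<in> A4" unfolding A4_def x(1) using st(1) cr x(2,3) by blast
      then show False using neg by blast
    qed
  qed
  moreover have fA: "finite A1" "finite A2" "finite A3" using fin by (auto simp: A1_def A2_def A3_def)
  have fA4: "finite A4" unfolding A4_def by (rule finite_subset[of _ "R1 \<times> R2"]) (use fin in auto)
  ultimately have "card ?V \<le> card (A1 \<union> sw ` A2 \<union> sw ` A3 \<union> A4)" using fA by (intro card_mono) auto
  also have "\<dots> \<le> card A1 + card (sw ` A2) + card (sw ` A3) + card A4"
    by (meson add_mono card_Un_le le_refl le_trans)
  also have "card (sw ` A2) \<le> card A2" by (rule card_image_le[OF fA(2)])
  also have "card (sw ` A3) \<le> card A3" by (rule card_image_le[OF fA(3)])
  also have "card A1 \<le> card R1 * M"
  proof -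
    have "card {j. j \<in> R2 \<and> (\<exists>t\<in>{lo2 j..hi2 j}. F (hi1 i) t = \<delta>)} \<le> M" if i: "i \<in> R1" for i
    proof -
      have "hi1 i \<in> hi1 ` R1" using i by blast
      from M1[OF this] have m: "finite {t\<in>U2. F (hi1 i) t = \<delta>}" "card {t\<in>U2. F (hi1 i) t = \<delta>} \<le> M"
        by (auto simp: F_def)
      from card_disjoint_hits[of R2 "\<lambda>j. {lo2 j..hi2 j}" U2 "\<lambda>t. F (hi1 i) t = \<delta>", OF J(2) _ m(1)] J(1) m(2)
      show ?thesis by (meson le_trans)
    qed
    then show ?thesis unfolding A1_def using sum_bounded_above[of R1 _ M] fin by simp
  qed
  also have "card A2 \<le> card R2 * M"
  proof -
    have "card {i. i \<in> R1 \<and> (\<exists>s\<in>{lo1 i..hi1 i}. F s (lo2 j) = \<delta>)} \<le> M" if j: "j \<in> R2" for j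
    proof -
      have "lo2 j \<in> lo2 ` R2 \<union> hi2 ` R2" using j by blast
      from M2[OF this] have m: "finite {s\<in>U1. F s (lo2 j) = \<delta>}" "card {s\<in>U1. F s (lo2 j) = \<delta>} \<le> M"
        by (auto simp: F_def)
      from card_disjoint_hits[of R1 "\<lambda>i. {lo1 i..hi1 i}" U1 "\<lambda>s. F s (lo2 j) = \<delta>", OF I(2) _ m(1)] I(1) m(2)
      show ?thesis by (meson le_trans)
    qed
    then show ?thesis unfolding A2_def using sum_bounded_above[of R2 _ M] fin by simp
  qed
  also have "card A3 \<le> card R2 * M"
  proof -
    have "card {i. i \<in> R1 \<and> (\<exists>s\<in>{lo1 i..hi1 i}. F s (hi2 j) = \<delta>)} \<le> M" if j: "j \<in> R2" for j
    proof -
      have "hi2 j \<in> lo2 ` R2 \<union> hi2 ` R2" using j by blast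
      from M2[OF this] have m: "finite {s\<in>U1. F s (hi2 j) = \<delta>}" "card {s\<in>U1. F s (hi2 j) = \<delta>} \<le> M"
        by (auto simp: F_def)
      from card_disjoint_hits[of R1 "\<lambda>i. {lo1 i..hi1 i}" U1 "\<lambda>s. F s (hi2 j) = \<delta>", OF I(2) _ m(1)] I(1) m(2)
      show ?thesis by (meson le_trans)
    qed
    then show ?thesis unfolding A3_def using sum_bounded_above[of R2 _ M] fin by simp
  qed
  also have "card A4 \<le> card (crit f g \<delta>)"
  proof -
    have "\<exists>s t. i \<in> R1 \<and> j \<in> R2 \<and> s \<in> {lo1 i..hi1 i} \<and> t \<in> {lo2 j..hi2 j} \<and> (\<gamma>1 s, \<gamma>2 t) \<in> crit f g \<delta>"
      if "(i, j) \<in> A4" for i j using that unfolding A4_def by blast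
    then obtain S T where ST: "\<And>i j. (i, j) \<in> A4 \<Longrightarrow> i \<in> R1 \<and> j \<in> R2 \<and> S i j \<in> {lo1 i..hi1 i} \<and>
       T i j \<in> {lo2 j..hi2 j} \<and> (\<gamma>1 (S i j), \<gamma>2 (T i j)) \<in> crit f g \<delta>" by metis
    have inj: "inj_on (\<lambda>(i, j). (\<gamma>1 (S i j), \<gamma>2 (T i j))) A4"
    proof (rule inj_onI)
      fix x y assume xy: "x \<in> A4" "y \<in> A4" "(case x of (i, j) \<Rightarrow> (\<gamma>1 (S i j), \<gamma>2 (T i j))) = (case y of (i, j) \<Rightarrow> (\<gamma>1 (S i j), \<gamma>2 (T i j)))"
      obtain i j i' j' where ij: "x = (i, j)" "y = (i', j')" by force
      note 1 = ST[OF xy(1)[unfolded ij]] and 2 = ST[OF xy(2)[unfolded ij]]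
      have U: "S i j \<in> U1" "S i' j' \<in> U1" "T i j \<in> U2" "T i' j' \<in> U2" using 1 2 I(1) J(1) by blast+
      have "S i j = S i' j'" "T i j = T i' j'" using xy(3) arcs U unfolding ij smooth_arc_def by (auto dest: inj_onD)
      then have "i = i'" "j = j'" using 1 2 I(2)[of i i'] J(2)[of j j'] by (metis disjoint_iff)+
      then show "x = y" by (simp add: ij)
    qed
    show ?thesis by (rule card_inj_on_le[OF inj _ crit(1)]) (use ST in auto)
  qed
  finally show ?thesis using crit(2) by simp
qed

section \<open>Affine maps preserving a conic\<close>

definition nonline :: "(real \<times> real) set \<Rightarrow> bool" where
  "nonline C \<longleftrightarrow> infinite C \<and> (\<forall>a b c. (a, b) \<noteq> (0, 0) \<longrightarrow> finite (C \<inter> line a b c))"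

definition quad :: "real \<Rightarrow> real \<Rightarrow> real \<Rightarrow> real \<Rightarrow> real \<Rightarrow> real \<Rightarrow> real \<Rightarrow> real \<Rightarrow> real" where
  "quad \<alpha> \<beta> \<gamma> \<delta> \<epsilon> \<zeta> x y = \<alpha> * x\<^sup>2 + \<beta> * x * y + \<gamma> * y\<^sup>2 + \<delta> * x + \<epsilon> * y + \<zeta>"

text \<open>Four times the determinant of the symmetric 3 x 3 matrix of the conic.\<close>

definition qdisc :: "real \<Rightarrow> real \<Rightarrow> real \<Rightarrow> real \<Rightarrow> real \<Rightarrow> real \<Rightarrow> real" where
  "qdisc \<alpha> \<beta> \<gamma> \<delta> \<epsilon> \<zeta> = 4 * \<alpha> * \<gamma> * \<zeta> + \<beta> * \<delta> * \<epsilon> - \<alpha> * \<epsilon>\<^sup>2 - \<gamma> * \<delta>\<^sup>2 - \<zeta> * \<beta>\<^sup>2"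

lemma nonline_two_lines:
  assumes "nonline C" "(a, b) \<noteq> (0, 0)" "(a', b') \<noteq> (0, 0)"
    and "\<And>x y. (x, y) \<in> C \<Longrightarrow> a * x + b * y + c = 0 \<or> a' * x + b' * y + c' = 0"
  shows False
proof -
  have "C \<subseteq> (C \<inter> line a b c) \<union> (C \<inter> line a' b' c')" using assms(4) by (auto simp: line_def)
  then show False using assms(1-3) unfolding nonline_def by (meson finite_Un finite_subset)
qed

lemma nonline_one_line:
  assumes "nonline C" "(a, b) \<noteq> (0, 0)" "\<And>x y. (x, y) \<in> C \<Longrightarrow> a * x + b * y + c = 0"
  shows False
  using nonline_two_lines[OF assms(1,2,2)] assms(3) by blast

lemma nonline_infinite_fst:
  assumes "nonline C" shows "infinite (fst ` C)"
proof
  assume fin: "finite (fst ` C)"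
  have "C \<subseteq> (\<Union>x\<in>fst ` C. C \<inter> line 1 0 (-x))" by (force simp: line_def)
  moreover have "finite (C \<inter> line 1 0 (-x))" for x using assms unfolding nonline_def by simp
  ultimately show False using fin assms unfolding nonline_def by (meson finite_UN finite_subset)
qed

lemma infinite_zeros_coeffs4:
  fixes c0 c1 c2 c3 c4 :: real
  assumes "infinite X" "\<And>x. x \<in> X \<Longrightarrow> c0 + c1 * x + c2 * x^2 + c3 * x^3 + c4 * x^4 = 0"
  shows "c0 = 0 \<and> c1 = 0 \<and> c2 = 0 \<and> c3 = 0 \<and> c4 = 0"
proof -
  define p where "p = [:c0, c1, c2, c3, c4:]"
  have "X \<subseteq> {x. poly p x = 0}" using assms(2) by (auto simp: p_def algebra_simps power2_eq_square power3_eq_cube power4_eq_xxxx)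
  then have "infinite {x. poly p x = 0}" using assms(1) finite_subset by blast
  then have "p = 0" using poly_roots_finite by blast
  then show ?thesis by (simp add: p_def)
qed

text \<open>Completing the square gives Y^2 = D2 x^2 + D1 x + D0 with Y = y + b x + e. A zero
  discriminant would put C into two lines. A second equation, after subtracting a multiple of the
  first, is linear in Y; squaring it gives a polynomial identity in x, and if anything were left of
  the equation, C would again lie in two lines.\<close>

lemma pencil_aux:
  assumes C: "nonline C" and E: "\<And>x y. (x, y) \<in> C \<Longrightarrow> quad \<alpha> (2 * b) 1 \<delta> (2 * e) \<zeta> x y = 0"
  shows "qdisc \<alpha> (2 * b) 1 \<delta> (2 * e) \<zeta> \<noteq> 0"
    and "(\<And>x y. (x, y) \<in> C \<Longrightarrow> quad \<alpha>' \<beta>' \<gamma>' \<delta>' \<epsilon>' \<zeta>' x y = 0) \<Longrightarrow>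
      \<alpha>' = \<gamma>' * \<alpha> \<and> \<beta>' = \<gamma>' * (2 * b) \<and> \<delta>' = \<gamma>' * \<delta> \<and> \<epsilon>' = \<gamma>' * (2 * e) \<and> \<zeta>' = \<gamma>' * \<zeta>"
proof -
  define D2 where "D2 = b\<^sup>2 - \<alpha>"
  define D1 where "D1 = 2 * b * e - \<delta>"
  define D0 where "D0 = e\<^sup>2 - \<zeta>"
  define Y where "Y = (\<lambda>x y. y + b * x + e)"
  have Y2: "(Y x y)\<^sup>2 = D2 * x\<^sup>2 + D1 * x + D0" if "(x, y) \<in> C" for x y
    using E[OF that] unfolding quad_def Y_def D2_def D1_def D0_def by (simp add: power2_eq_square algebra_simps)
  show "qdisc \<alpha> (2 * b) 1 \<delta> (2 * e) \<zeta> \<noteq> 0"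
  proof
    assume "qdisc \<alpha> (2 * b) 1 \<delta> (2 * e) \<zeta> = 0"
    \<comment> \<open>Up to sign, \<open>qdisc\<close> is here the discriminant of D2 x^2 + D1 x +
      D0.\<close>
    then have disc: "D1\<^sup>2 = 4 * D2 * D0"
      unfolding qdisc_def D2_def D1_def D0_def by (simp add: power2_eq_square algebra_simps)
    have sq: "\<exists>m u. \<forall>x y. (x, y) \<in> C \<longrightarrow> Y x y = m * x + u \<or> Y x y = - (m * x + u)"
    proof (cases "D2 = 0")
      case True
      then have D1: "D1 = 0" using disc by simp
      have "Y x y = 0 * x + sqrt \<bar>D0\<bar> \<or> Y x y = - (0 * x + sqrt \<bar>D0\<bar>)" if "(x, y) \<in> C" for x y
      proof -
        have "(Y x y)\<^sup>2 = D0" using Y2[OF that] True D1 by simp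
        moreover from this have "D0 \<ge> 0" by (metis zero_le_power2)
        ultimately have "(Y x y)\<^sup>2 = (sqrt \<bar>D0\<bar>)\<^sup>2" by simp
        from power2_eq_iff[THEN iffD1, OF this] show ?thesis by simp
      qed
      then show ?thesis by blast
    next
      case False
      define u where "u = D1 / (2 * D2)"
      have Y3: "(Y x y)\<^sup>2 = D2 * (x + u)\<^sup>2" if "(x, y) \<in> C" for x y
      proof -
        have "D0 = D1\<^sup>2 / (4 * D2)" using disc False by simp
        then show ?thesis using Y2[OF that] False by (simp add: u_def power2_eq_square field_simps)
      qed
      show ?thesis
      proof (cases "D2 > 0")
        case True
        have "Y x y = sqrt D2 * x + sqrt D2 * u \<or> Y x y = - (sqrt D2 * x + sqrt D2 * u)" if "(x, y) \<in> C" for x y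
        proof -
          have "(Y x y)\<^sup>2 = (sqrt D2 * (x + u))\<^sup>2" using Y3[OF that] True by (simp add: power_mult_distrib)
          then show ?thesis by (simp add: power2_eq_iff distrib_left)
        qed
        then show ?thesis by blast
      next
        case neg: False
        have "Y x y = 0 * x + 0 \<or> Y x y = - (0 * x + 0)" if "(x, y) \<in> C" for x y
        proof -
          have "D2 * (x + u)\<^sup>2 \<le> 0" using neg by (simp add: mult_nonpos_nonneg)
          then have "(Y x y)\<^sup>2 \<le> 0" using Y3[OF that] by simp
          then show ?thesis by simp
        qed
        then show ?thesis by blast
      qed
    qed
    then obtain m u where me: "\<And>x y. (x, y) \<in> C \<Longrightarrow> Y x y = m * x + u \<or> Y x y = - (m * x + u)" by blast
    show False
    proof (rule nonline_two_lines[OF C, of "b - m" 1 "b + m" 1 "e - u" "e + u"])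
      fix x y assume "(x, y) \<in> C"
      from me[OF this] show "(b - m) * x + 1 * y + (e - u) = 0 \<or> (b + m) * x + 1 * y + (e + u) = 0"
        by (auto simp: Y_def algebra_simps)
    qed auto
  qed
  assume E': "\<And>x y. (x, y) \<in> C \<Longrightarrow> quad \<alpha>' \<beta>' \<gamma>' \<delta>' \<epsilon>' \<zeta>' x y = 0"
  define l1 where "l1 = \<beta>' - \<gamma>' * (2 * b)"
  define l0 where "l0 = \<epsilon>' - \<gamma>' * (2 * e)"
  define n2 where "n2 = (\<alpha>' - \<gamma>' * \<alpha>) - l1 * b"
  define n1 where "n1 = (\<delta>' - \<gamma>' * \<delta>) - (l1 * e + l0 * b)"
  define n0 where "n0 = (\<zeta>' - \<gamma>' * \<zeta>) - l0 * e"
  have lY: "(l1 * x + l0) * Y x y = - (n2 * x\<^sup>2 + n1 * x + n0)" if "(x, y) \<in> C" for x y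
  proof -
    have "0 = quad \<alpha>' \<beta>' \<gamma>' \<delta>' \<epsilon>' \<zeta>' x y - \<gamma>' * quad \<alpha> (2 * b) 1 \<delta> (2 * e) \<zeta> x y" using E[OF that] E'[OF that] by simp
    also have "quad \<alpha>' \<beta>' \<gamma>' \<delta>' \<epsilon>' \<zeta>' x y - \<gamma>' * quad \<alpha> (2 * b) 1 \<delta> (2 * e) \<zeta> x y
        = (l1 * x + l0) * Y x y + (n2 * x\<^sup>2 + n1 * x + n0)"
      unfolding quad_def Y_def l1_def l0_def n2_def n1_def n0_def
      by (simp add: power2_eq_square algebra_simps)
    finally show ?thesis by simp
  qed
  have "(n0\<^sup>2 - l0\<^sup>2 * D0) + (2 * n1 * n0 - 2 * l1 * l0 * D0 - l0\<^sup>2 * D1) * x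
      + (n1\<^sup>2 + 2 * n2 * n0 - l1\<^sup>2 * D0 - 2 * l1 * l0 * D1 - l0\<^sup>2 * D2) * x^2
      + (2 * n2 * n1 - l1\<^sup>2 * D1 - 2 * l1 * l0 * D2) * x^3 + (n2\<^sup>2 - l1\<^sup>2 * D2) * x^4 = 0" if "x \<in> fst ` C" for x
  proof -
    from that obtain y where xy: "(x, y) \<in> C" by auto
    have "((l1 * x + l0) * Y x y)\<^sup>2 = (n2 * x\<^sup>2 + n1 * x + n0)\<^sup>2" unfolding lY[OF xy] by (rule power2_minus)
    then have "(l1 * x + l0)\<^sup>2 * (D2 * x\<^sup>2 + D1 * x + D0) = (n2 * x\<^sup>2 + n1 * x + n0)\<^sup>2"
      by (simp add: power_mult_distrib Y2[OF xy])
    then show ?thesis by (simp add: power2_eq_square power3_eq_cube power4_eq_xxxx algebra_simps)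
  qed
  from infinite_zeros_coeffs4[OF nonline_infinite_fst[OF C] this]
  have co: "n0\<^sup>2 = l0\<^sup>2 * D0" "2 * n1 * n0 - 2 * l1 * l0 * D0 - l0\<^sup>2 * D1 = 0"
    "n1\<^sup>2 + 2 * n2 * n0 - l1\<^sup>2 * D0 - 2 * l1 * l0 * D1 - l0\<^sup>2 * D2 = 0"
    "2 * n2 * n1 - l1\<^sup>2 * D1 - 2 * l1 * l0 * D2 = 0" "n2\<^sup>2 = l1\<^sup>2 * D2" by auto
  have "l1 = 0"
  proof (rule ccontr)
    assume l1: "l1 \<noteq> 0"
    \<comment> \<open>At r the left side of \<open>lY\<close> vanishes and, by the coefficient
      identities, so does the right side. Thus x - r is a common factor, and splitting it off leaves
      two lines.\<close>
    define r where "r = - l0 / l1"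
    have l0: "l0 = - r * l1" using l1 by (simp add: r_def)
    have "(n2 * r\<^sup>2 + n1 * r + n0)\<^sup>2 = n0\<^sup>2 + (2 * n1 * n0) * r + (n1\<^sup>2 + 2 * n2 * n0) * r^2
        + (2 * n2 * n1) * r^3 + n2\<^sup>2 * r^4"
      by (simp add: power2_eq_square power3_eq_cube power4_eq_xxxx algebra_simps)
    also have "\<dots> = l0\<^sup>2 * D0 + (2 * l1 * l0 * D0 + l0\<^sup>2 * D1) * r + (l1\<^sup>2 * D0 + 2 * l1 * l0 * D1 + l0\<^sup>2 * D2) * r^2
        + (l1\<^sup>2 * D1 + 2 * l1 * l0 * D2) * r^3 + (l1\<^sup>2 * D2) * r^4"
    proof -
      have "2 * n1 * n0 = 2 * l1 * l0 * D0 + l0\<^sup>2 * D1" "n1\<^sup>2 + 2 * n2 * n0 = l1\<^sup>2 * D0 + 2 * l1 * l0 * D1 + l0\<^sup>2 * D2"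
        "2 * n2 * n1 = l1\<^sup>2 * D1 + 2 * l1 * l0 * D2" using co(2-4) by linarith+
      then show ?thesis using co(1,5) by (simp only:)
    qed
    also have "\<dots> = 0" unfolding l0
      by (simp add: power2_eq_square power3_eq_cube power4_eq_xxxx algebra_simps)
    finally have "(n2 * r\<^sup>2 + n1 * r + n0)\<^sup>2 = 0" .
    then have n0: "n0 = - n2 * r\<^sup>2 - n1 * r" by simp
    show False
    proof (rule nonline_two_lines[OF C, of 1 0 "l1 * b + n2" l1 "- r" "l1 * e + n2 * r + n1"])
      fix x y assume "(x, y) \<in> C"
      from lY[OF this] have "(x - r) * (l1 * Y x y + n2 * (x + r) + n1) = 0"
        unfolding l0 n0 by (simp add: power2_eq_square algebra_simps)
      then have "x - r = 0 \<or> l1 * Y x y + n2 * (x + r) + n1 = 0" by (simp only: mult_eq_0_iff)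
      then show "1 * x + 0 * y + - r = 0 \<or> (l1 * b + n2) * x + l1 * y + (l1 * e + n2 * r + n1) = 0"
        by (auto simp: Y_def algebra_simps)
    qed (use l1 in auto)
  qed
  then have n2: "n2 = 0" using co(5) by simp
  have "l0 = 0"
  proof (rule ccontr)
    assume l0: "l0 \<noteq> 0"
    show False
    proof (rule nonline_one_line[OF C, of "l0 * b + n1" l0 "l0 * e + n0"])
      fix x y assume "(x, y) \<in> C"
      from lY[OF this] have "l0 * Y x y + n1 * x + n0 = 0" by (simp add: \<open>l1 = 0\<close> n2)
      then show "(l0 * b + n1) * x + l0 * y + (l0 * e + n0) = 0"
        by (simp add: Y_def algebra_simps)
    qed (use l0 in auto)
  qed
  then have "n1 = 0" "n0 = 0" using co(1,3) \<open>l1 = 0\<close> n2 by auto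
  with \<open>l1 = 0\<close> \<open>l0 = 0\<close> n2
  show "\<alpha>' = \<gamma>' * \<alpha> \<and> \<beta>' = \<gamma>' * (2 * b) \<and> \<delta>' = \<gamma>' * \<delta> \<and> \<epsilon>' = \<gamma>' * (2 * e) \<and> \<zeta>' = \<gamma>' * \<zeta>"
    unfolding l1_def l0_def n2_def n1_def n0_def by simp
qed

text \<open>A shear achieves a nonzero coefficient of the square of the second variable, the
  normalization required by \<open>pencil_aux\<close>.\<close>

lemma quad_shear:
  "quad \<alpha> \<beta> \<gamma> \<delta> \<epsilon> \<zeta> (u + t * v) v =
   quad \<alpha> (2 * \<alpha> * t + \<beta>) (\<alpha> * t\<^sup>2 + \<beta> * t + \<gamma>) \<delta> (\<delta> * t + \<epsilon>) \<zeta> u v"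
  by (simp add: quad_def power2_eq_square algebra_simps)

lemma qdisc_shear:
  "qdisc \<alpha> (2 * \<alpha> * t + \<beta>) (\<alpha> * t\<^sup>2 + \<beta> * t + \<gamma>) \<delta> (\<delta> * t + \<epsilon>) \<zeta> = qdisc \<alpha> \<beta> \<gamma> \<delta> \<epsilon> \<zeta>"
  by (simp add: qdisc_def power2_eq_square algebra_simps)

lemma nonline_shear:
  assumes "nonline C" shows "nonline ((\<lambda>(x, y). (x - t * y, y)) ` C)"
proof -
  let ?h = "\<lambda>(x, y). (x - t * y, y)"
  have inj: "inj ?h" by (auto simp: inj_def)
  have eq: "?h ` C \<inter> line a b c = ?h ` (C \<inter> line a (b - a * t) c)" for a b c
    by (auto simp: line_def algebra_simps image_iff)
  show ?thesis unfolding nonline_def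
  proof (intro conjI allI impI)
    show "infinite (?h ` C)"
      using assms finite_imageD[OF _ inj_on_subset[OF inj subset_UNIV]] unfolding nonline_def by blast
    fix a b c :: real assume "(a, b) \<noteq> (0, 0)"
    then have "(a, b - a * t) \<noteq> (0, 0)" by auto
    then have "finite (C \<inter> line a (b - a * t) c)" using assms unfolding nonline_def by blast
    then show "finite (?h ` C \<inter> line a b c)" unfolding eq by (rule finite_imageI)
  qed
qed

text \<open>Reduction to \<open>pencil_aux\<close>: some t has \<alpha> t^2 + \<beta> t + \<gamma>
  nonzero because the quadratic part is nonzero, and the shear by t followed by a division
  normalizes the equation. The shear leaves the discriminant unchanged.\<close>

lemma conic_pencil:
  assumes C: "nonline C" and nz: "(\<alpha>, \<beta>, \<gamma>) \<noteq> (0, 0, 0)"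
    and E: "\<And>x y. (x, y) \<in> C \<Longrightarrow> quad \<alpha> \<beta> \<gamma> \<delta> \<epsilon> \<zeta> x y = 0"
    and E': "\<And>x y. (x, y) \<in> C \<Longrightarrow> quad \<alpha>' \<beta>' \<gamma>' \<delta>' \<epsilon>' \<zeta>' x y = 0"
  shows "qdisc \<alpha> \<beta> \<gamma> \<delta> \<epsilon> \<zeta> \<noteq> 0"
    and "\<exists>\<kappa>. \<alpha>' = \<kappa> * \<alpha> \<and> \<beta>' = \<kappa> * \<beta> \<and> \<gamma>' = \<kappa> * \<gamma> \<and> \<delta>' = \<kappa> * \<delta> \<and> \<epsilon>' = \<kappa> * \<epsilon> \<and> \<zeta>' = \<kappa> * \<zeta>"
proof -
  have "\<exists>t. \<alpha> * t\<^sup>2 + \<beta> * t + \<gamma> \<noteq> 0"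
  proof (rule ccontr)
    assume "\<not> ?thesis"
    then have z: "\<And>t. \<alpha> * t\<^sup>2 + \<beta> * t + \<gamma> = 0" by blast
    from z[of 0] z[of 1] z[of "-1"] nz show False by auto
  qed
  then obtain t where t: "\<alpha> * t\<^sup>2 + \<beta> * t + \<gamma> \<noteq> 0" by blast
  define g where "g = \<alpha> * t\<^sup>2 + \<beta> * t + \<gamma>"
  have g: "g \<noteq> 0" using t by (simp add: g_def)
  define C' where "C' = (\<lambda>(x, y). (x - t * y, y)) ` C"
  have C': "nonline C'" unfolding C'_def by (rule nonline_shear[OF C])
  have mem: "(u + t * v, v) \<in> C" if "(u, v) \<in> C'" for u v using that by (auto simp: C'_def)
  have 1: "quad (\<alpha> / g) (2 * ((2 * \<alpha> * t + \<beta>) / g / 2)) 1 (\<delta> / g) (2 * ((\<delta> * t + \<epsilon>) / g / 2)) (\<zeta> / g) u v = 0" if "(u, v) \<in> C'" for u v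
  proof -
    have "quad (\<alpha> / g) ((2 * \<alpha> * t + \<beta>) / g) (g / g) (\<delta> / g) ((\<delta> * t + \<epsilon>) / g) (\<zeta> / g) u v
       = quad \<alpha> (2 * \<alpha> * t + \<beta>) g \<delta> (\<delta> * t + \<epsilon>) \<zeta> u v / g"
      using g by (simp add: quad_def field_simps)
    also have "\<dots> = 0" using E[OF mem[OF that]] unfolding quad_shear g_def by simp
    finally have "quad (\<alpha> / g) ((2 * \<alpha> * t + \<beta>) / g) (g / g) (\<delta> / g) ((\<delta> * t + \<epsilon>) / g) (\<zeta> / g) u v = 0" .
    moreover have "2 * (x / 2) = x" for x :: real by simp
    ultimately show ?thesis by (simp only: divide_self[OF g] simp_thms)
  qed
  have "qdisc (\<alpha> / g) ((2 * \<alpha> * t + \<beta>) / g) (g / g) (\<delta> / g) ((\<delta> * t + \<epsilon>) / g) (\<zeta> / g)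
      = qdisc \<alpha> (2 * \<alpha> * t + \<beta>) g \<delta> (\<delta> * t + \<epsilon>) \<zeta> / (g * g * g)"
  proof -
    have hom: "qdisc (x1 / g) (x2 / g) (x3 / g) (x4 / g) (x5 / g) (x6 / g) = qdisc x1 x2 x3 x4 x5 x6 / (g * g * g)"
      for x1 x2 x3 x4 x5 x6
      by (simp add: qdisc_def power2_eq_square add_divide_distrib diff_divide_distrib)
    show ?thesis by (rule hom)
  qed
  moreover have "qdisc (\<alpha> / g) ((2 * \<alpha> * t + \<beta>) / g) (g / g) (\<delta> / g) ((\<delta> * t + \<epsilon>) / g) (\<zeta> / g) \<noteq> 0"
  proof -
    have "qdisc (\<alpha> / g) (2 * ((2 * \<alpha> * t + \<beta>) / g / 2)) 1 (\<delta> / g) (2 * ((\<delta> * t + \<epsilon>) / g / 2)) (\<zeta> / g) \<noteq> 0"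
      by (rule pencil_aux(1)[OF C']) (rule 1)
    moreover have "2 * (x / 2) = x" for x :: real by simp
    ultimately show ?thesis by (simp only: divide_self[OF g] simp_thms)
  qed
  ultimately have "qdisc \<alpha> (2 * \<alpha> * t + \<beta>) g \<delta> (\<delta> * t + \<epsilon>) \<zeta> \<noteq> 0" by auto
  then show "qdisc \<alpha> \<beta> \<gamma> \<delta> \<epsilon> \<zeta> \<noteq> 0"
    unfolding g_def qdisc_shear .
  have 2: "quad \<alpha>' (2 * \<alpha>' * t + \<beta>') (\<alpha>' * t\<^sup>2 + \<beta>' * t + \<gamma>') \<delta>' (\<delta>' * t + \<epsilon>') \<zeta>' u v = 0" if "(u, v) \<in> C'" for u v
    using E'[OF mem[OF that]] unfolding quad_shear .
  define \<kappa> where "\<kappa> = (\<alpha>' * t\<^sup>2 + \<beta>' * t + \<gamma>') / g"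
  have kg: "\<alpha>' * t\<^sup>2 + \<beta>' * t + \<gamma>' = \<kappa> * g" using g by (simp add: \<kappa>_def)
  define \<beta>1 where "\<beta>1 = (2 * \<alpha> * t + \<beta>) / g / 2"
  define \<epsilon>1 where "\<epsilon>1 = (\<delta> * t + \<epsilon>) / g / 2"
  have "\<alpha>' = \<kappa> * g * (\<alpha> / g) \<and> 2 * \<alpha>' * t + \<beta>' = \<kappa> * g * (2 * \<beta>1) \<and> \<delta>' = \<kappa> * g * (\<delta> / g) \<and>
    \<delta>' * t + \<epsilon>' = \<kappa> * g * (2 * \<epsilon>1) \<and> \<zeta>' = \<kappa> * g * (\<zeta> / g)"
    by (rule pencil_aux(2)[OF C' 1[folded \<beta>1_def \<epsilon>1_def] 2[unfolded kg]])
  moreover have "\<kappa> * g * (\<alpha> / g) = \<kappa> * \<alpha>" "\<kappa> * g * (\<delta> / g) = \<kappa> * \<delta>" "\<kappa> * g * (\<zeta> / g) = \<kappa> * \<zeta>"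
    "\<kappa> * g * (2 * \<beta>1) = \<kappa> * (2 * \<alpha> * t + \<beta>)" "\<kappa> * g * (2 * \<epsilon>1) = \<kappa> * (\<delta> * t + \<epsilon>)"
    using g by (simp_all add: \<beta>1_def \<epsilon>1_def)
  ultimately have eqs: "\<alpha>' = \<kappa> * \<alpha>" "2 * \<alpha>' * t + \<beta>' = \<kappa> * (2 * \<alpha> * t + \<beta>)" "\<delta>' = \<kappa> * \<delta>"
    "\<delta>' * t + \<epsilon>' = \<kappa> * (\<delta> * t + \<epsilon>)" "\<zeta>' = \<kappa> * \<zeta>" by metis+
  have "\<beta>' = \<kappa> * \<beta>" "\<epsilon>' = \<kappa> * \<epsilon>" using eqs by (auto simp: algebra_simps)
  moreover have "\<gamma>' = \<kappa> * \<gamma>" using kg eqs(1) \<open>\<beta>' = \<kappa> * \<beta>\<close> by (simp add: g_def algebra_simps)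
  ultimately show "\<exists>\<kappa>. \<alpha>' = \<kappa> * \<alpha> \<and> \<beta>' = \<kappa> * \<beta> \<and> \<gamma>' = \<kappa> * \<gamma> \<and> \<delta>' = \<kappa> * \<delta> \<and> \<epsilon>' = \<kappa> * \<epsilon> \<and> \<zeta>' = \<kappa> * \<zeta>"
    using eqs by blast
qed

section \<open>Rigidity of affine maps on conics\<close>

definition aff :: "real \<Rightarrow> real \<Rightarrow> real \<Rightarrow> real \<Rightarrow> real \<Rightarrow> real \<Rightarrow> real \<times> real \<Rightarrow> real \<times> real" where
  "aff a b c d k l q = (a * fst q + b * snd q + k, c * fst q + d * snd q + l)"

lemma quad_affine:
  "quad \<alpha> \<beta> \<gamma> \<delta> \<epsilon> \<zeta> (a * x + b * y + k) (c * x + d * y + l) =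
   quad (\<alpha> * a\<^sup>2 + \<beta> * a * c + \<gamma> * c\<^sup>2) (2 * \<alpha> * a * b + \<beta> * (a * d + b * c) + 2 * \<gamma> * c * d)
     (\<alpha> * b\<^sup>2 + \<beta> * b * d + \<gamma> * d\<^sup>2) (a * (2 * \<alpha> * k + \<beta> * l + \<delta>) + c * (\<beta> * k + 2 * \<gamma> * l + \<epsilon>))
     (b * (2 * \<alpha> * k + \<beta> * l + \<delta>) + d * (\<beta> * k + 2 * \<gamma> * l + \<epsilon>)) (quad \<alpha> \<beta> \<gamma> \<delta> \<epsilon> \<zeta> k l) x y"
  by (simp add: quad_def power2_eq_square algebra_simps)

lemma qdisc_translate:
  "qdisc \<alpha> \<beta> \<gamma> (2 * \<alpha> * k + \<beta> * l + \<delta>) (\<beta> * k + 2 * \<gamma> * l + \<epsilon>) (quad \<alpha> \<beta> \<gamma> \<delta> \<epsilon> \<zeta> k l) = qdisc \<alpha> \<beta> \<gamma> \<delta> \<epsilon> \<zeta>"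
  by (simp add: qdisc_def quad_def power2_eq_square algebra_simps)


lemma qdisc_linear:
  "qdisc (\<alpha> * a\<^sup>2 + \<beta> * a * c + \<gamma> * c\<^sup>2) (2 * \<alpha> * a * b + \<beta> * (a * d + b * c) + 2 * \<gamma> * c * d)
     (\<alpha> * b\<^sup>2 + \<beta> * b * d + \<gamma> * d\<^sup>2) (a * \<delta> + c * \<epsilon>) (b * \<delta> + d * \<epsilon>) \<zeta> = (a * d - b * c)\<^sup>2 * qdisc \<alpha> \<beta> \<gamma> \<delta> \<epsilon> \<zeta>"
  by (simp add: qdisc_def power2_eq_square algebra_simps)

text \<open>The identity det (L^T S L) = (det L)^2 det S for a symmetric 2 x 2 matrix S.\<close>

lemma det_congruence:
  fixes a :: real
  shows "(m1 * a\<^sup>2 + 2 * m2 * a * c + m3 * c\<^sup>2) * (m1 * b\<^sup>2 + 2 * m2 * b * d + m3 * d\<^sup>2)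
     - (m1 * a * b + m2 * (a * d + b * c) + m3 * c * d)\<^sup>2 = (a * d - b * c)\<^sup>2 * (m1 * m3 - m2\<^sup>2)"
  by (simp add: power2_eq_square algebra_simps)

text \<open>Here t and e are trace and determinant of S = L^T L - 1, D = (det L)^2, and L^T S L =
  \<kappa> S. The last two equations are the determinants of 1 + S = L^T L and of its pullback 1 +
  (1 + \<kappa>) S. Together they force \<kappa> = 1.\<close>

lemma conic_scaling_trivial:
  fixes \<kappa> t e D :: real
  assumes "D > 0" "D = \<kappa>^3" "\<kappa>\<^sup>2 * e = D * e" "1 + t + e = D" "1 + (1 + \<kappa>) * t + (1 + \<kappa>)\<^sup>2 * e = D\<^sup>2"
  shows "t = 0" "e = 0"
proof -
  have k: "\<kappa> > 0" using assms(1,2) by (simp add: zero_less_power_eq)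
  have "\<kappa> = 1"
  proof (cases "e = 0")
    case False
    then have "\<kappa>\<^sup>2 = \<kappa> * \<kappa>\<^sup>2" using assms(2,3) by (simp add: power2_eq_square power3_eq_cube)
    then show ?thesis using k by simp
  next
    case True
    then have t: "t = \<kappa>^3 - 1" using assms(2,4) by simp
    have "\<kappa> * ((\<kappa>^3 - 1) * (\<kappa>\<^sup>2 - 1)) = (\<kappa>^3)\<^sup>2 - (1 + (1 + \<kappa>) * (\<kappa>^3 - 1))"
      by (simp add: power2_eq_square power3_eq_cube algebra_simps)
    also have "\<dots> = 0" using assms(5) unfolding True t assms(2) by simp
    finally have "\<kappa>^3 = 1 \<or> \<kappa>\<^sup>2 = 1" using k by auto
    then show ?thesis
    proof
      assume "\<kappa>^3 = 1"
      then show ?thesis using power_eq_imp_eq_base[of \<kappa> 3 1] k by simp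
    next
      assume "\<kappa>\<^sup>2 = 1"
      then show ?thesis using power_eq_imp_eq_base[of \<kappa> 2 1] k by simp
    qed
  qed
  then show "t = 0" "e = 0" using assms by auto
qed

text \<open>The difference E of the two squared distances is a quadratic polynomial that vanishes on
  C, with quadratic part S = L^T L - 1. If S is nonzero, C determines E up to a factor; E composed
  with the map also vanishes on C, and the resulting scaling relation forces S = 0. Then E is affine
  and vanishes on C, hence everywhere, and its value at p yields the image of p.\<close>

lemma conic_rigid:
  assumes C: "nonline C" and det: "a * d - b * c \<noteq> 0"
    and T: "\<And>q. q \<in> C \<Longrightarrow> aff a b c d k l q \<in> C"
    and E: "\<And>q. q \<in> C \<Longrightarrow> dist2 (aff a b c d k l q) p' = dist2 q p"
  shows "a\<^sup>2 + c\<^sup>2 = 1 \<and> b\<^sup>2 + d\<^sup>2 = 1 \<and> a * b + c * d = 0 \<and> aff a b c d k l p = p'"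
proof -
  define h where "h = a * b + c * d"
  define \<alpha> where "\<alpha> = a\<^sup>2 + c\<^sup>2 - 1"
  define \<beta> where "\<beta> = 2 * h"
  define \<gamma> where "\<gamma> = b\<^sup>2 + d\<^sup>2 - 1"
  define \<delta> where "\<delta> = 2 * (a * (k - fst p') + c * (l - snd p') + fst p)"
  define \<epsilon> where "\<epsilon> = 2 * (b * (k - fst p') + d * (l - snd p') + snd p)"
  define \<zeta> where "\<zeta> = (k - fst p')\<^sup>2 + (l - snd p')\<^sup>2 - (fst p)\<^sup>2 - (snd p)\<^sup>2"
  have Eq: "dist2 (aff a b c d k l q) p' - dist2 q p = quad \<alpha> \<beta> \<gamma> \<delta> \<epsilon> \<zeta> (fst q) (snd q)" for q
    unfolding dist2_def aff_def quad_def \<alpha>_def \<beta>_def h_def \<gamma>_def \<delta>_def \<epsilon>_def \<zeta>_def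
    by (simp add: power2_eq_square algebra_simps)
  have E0: "quad \<alpha> \<beta> \<gamma> \<delta> \<epsilon> \<zeta> x y = 0" if "(x, y) \<in> C" for x y
    using Eq[of "(x, y)"] E[OF that] by simp
  have flat: "(\<alpha>, \<beta>, \<gamma>) = (0, 0, 0)"
  proof (rule ccontr)
    assume nz: "(\<alpha>, \<beta>, \<gamma>) \<noteq> (0, 0, 0)"
    define \<delta>' where "\<delta>' = 2 * \<alpha> * k + \<beta> * l + \<delta>"
    define \<epsilon>' where "\<epsilon>' = \<beta> * k + 2 * \<gamma> * l + \<epsilon>"
    define \<zeta>' where "\<zeta>' = quad \<alpha> \<beta> \<gamma> \<delta> \<epsilon> \<zeta> k l"
    define A where "A = \<alpha> * a\<^sup>2 + \<beta> * a * c + \<gamma> * c\<^sup>2"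
    define B where "B = 2 * \<alpha> * a * b + \<beta> * (a * d + b * c) + 2 * \<gamma> * c * d"
    define G where "G = \<alpha> * b\<^sup>2 + \<beta> * b * d + \<gamma> * d\<^sup>2"
    have E1: "quad A B G (a * \<delta>' + c * \<epsilon>') (b * \<delta>' + d * \<epsilon>') \<zeta>' x y = 0" if "(x, y) \<in> C" for x y
      using E0[of "a * x + b * y + k" "c * x + d * y + l"] T[OF that]
      unfolding quad_affine A_def B_def G_def \<delta>'_def \<epsilon>'_def \<zeta>'_def by (simp add: aff_def)
    have disc: "qdisc \<alpha> \<beta> \<gamma> \<delta> \<epsilon> \<zeta> \<noteq> 0" by (rule conic_pencil(1)[OF C nz E0 E1])
    have "\<exists>\<kappa>. A = \<kappa> * \<alpha> \<and> B = \<kappa> * \<beta> \<and> G = \<kappa> * \<gamma> \<and> a * \<delta>' + c * \<epsilon>' = \<kappa> * \<delta> \<and> b * \<delta>' + d * \<epsilon>' = \<kappa> * \<epsilon> \<and> \<zeta>' = \<kappa> * \<zeta>"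
      by (rule conic_pencil(2)[OF C nz E0 E1])
    then obtain \<kappa> where \<kappa>: "A = \<kappa> * \<alpha>" "B = \<kappa> * \<beta>" "G = \<kappa> * \<gamma>" "a * \<delta>' + c * \<epsilon>' = \<kappa> * \<delta>"
      "b * \<delta>' + d * \<epsilon>' = \<kappa> * \<epsilon>" "\<zeta>' = \<kappa> * \<zeta>" by blast
    define D where "D = (a * d - b * c)\<^sup>2"
    have D0: "D > 0" using det by (simp add: D_def)
    have "qdisc A B G (a * \<delta>' + c * \<epsilon>') (b * \<delta>' + d * \<epsilon>') \<zeta>' = D * qdisc \<alpha> \<beta> \<gamma> \<delta>' \<epsilon>' \<zeta>'"
      unfolding A_def B_def G_def D_def by (rule qdisc_linear)
    also have "qdisc \<alpha> \<beta> \<gamma> \<delta>' \<epsilon>' \<zeta>' = qdisc \<alpha> \<beta> \<gamma> \<delta> \<epsilon> \<zeta>"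
      unfolding \<delta>'_def \<epsilon>'_def \<zeta>'_def by (rule qdisc_translate)
    also have "qdisc A B G (a * \<delta>' + c * \<epsilon>') (b * \<delta>' + d * \<epsilon>') \<zeta>' = \<kappa>^3 * qdisc \<alpha> \<beta> \<gamma> \<delta> \<epsilon> \<zeta>"
      unfolding \<kappa> by (simp add: qdisc_def power2_eq_square power3_eq_cube algebra_simps)
    \<comment> \<open>The discriminant is cubic in the coefficients and gets the factor D under the
      map; it is nonzero by \<open>conic_pencil\<close>.\<close>
    finally have D3: "D = \<kappa>^3" using disc by simp
    have "D = (1 + \<alpha>) * (1 + \<gamma>) - h\<^sup>2"
      unfolding D_def \<alpha>_def \<gamma>_def h_def by (simp add: power2_eq_square algebra_simps)
    then have Dm: "D = 1 + (\<alpha> + \<gamma>) + (\<alpha> * \<gamma> - h\<^sup>2)" by (simp add: algebra_simps)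
    have B2: "\<alpha> * a * b + h * (a * d + b * c) + \<gamma> * c * d = \<kappa> * h"
      using \<kappa>(2) unfolding B_def \<beta>_def by (simp add: algebra_simps)
    have A2: "\<alpha> * a\<^sup>2 + 2 * h * a * c + \<gamma> * c\<^sup>2 = \<kappa> * \<alpha>" using \<kappa>(1) unfolding A_def \<beta>_def .
    have G2: "\<alpha> * b\<^sup>2 + 2 * h * b * d + \<gamma> * d\<^sup>2 = \<kappa> * \<gamma>" using \<kappa>(3) unfolding G_def \<beta>_def .
    have e1: "\<kappa>\<^sup>2 * (\<alpha> * \<gamma> - h\<^sup>2) = D * (\<alpha> * \<gamma> - h\<^sup>2)"
      using det_congruence[of \<alpha> a h c \<gamma> b d] unfolding A2 B2 G2 D_def
      by (simp add: power2_eq_square algebra_simps)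
    have A3: "(1 + \<alpha>) * a\<^sup>2 + 2 * h * a * c + (1 + \<gamma>) * c\<^sup>2 = 1 + \<alpha> + \<kappa> * \<alpha>"
      unfolding A2[symmetric] by (simp add: \<alpha>_def algebra_simps)
    have B3: "(1 + \<alpha>) * a * b + h * (a * d + b * c) + (1 + \<gamma>) * c * d = h + \<kappa> * h"
      unfolding B2[symmetric] by (simp add: h_def algebra_simps)
    have G3: "(1 + \<alpha>) * b\<^sup>2 + 2 * h * b * d + (1 + \<gamma>) * d\<^sup>2 = 1 + \<gamma> + \<kappa> * \<gamma>"
      unfolding G2[symmetric] by (simp add: \<gamma>_def algebra_simps)
    have "(1 + \<alpha> + \<kappa> * \<alpha>) * (1 + \<gamma> + \<kappa> * \<gamma>) - (h + \<kappa> * h)\<^sup>2 = D * ((1 + \<alpha>) * (1 + \<gamma>) - h\<^sup>2)"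
      using det_congruence[of "1 + \<alpha>" a h c "1 + \<gamma>" b d] unfolding A3 B3 G3 D_def .
    also have "(1 + \<alpha>) * (1 + \<gamma>) - h\<^sup>2 = D" using Dm by (simp add: algebra_simps)
    finally have e2: "1 + (1 + \<kappa>) * (\<alpha> + \<gamma>) + (1 + \<kappa>)\<^sup>2 * (\<alpha> * \<gamma> - h\<^sup>2) = D\<^sup>2"
      by (simp add: power2_eq_square algebra_simps)
    from conic_scaling_trivial[OF D0 D3 e1 Dm[symmetric] e2]
    have ag: "\<alpha> + \<gamma> = 0" "\<alpha> * \<gamma> = h\<^sup>2" by simp_all
    \<comment> \<open>A real symmetric matrix with trace and determinant zero vanishes.\<close>
    then have "\<gamma> = - \<alpha>" by simp
    then have "\<alpha>\<^sup>2 + h\<^sup>2 = 0" unfolding ag(2)[symmetric] by (simp add: power2_eq_square)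
    then have "\<alpha> = 0" "h = 0" by (simp_all add: sum_power2_eq_zero_iff)
    then show False using nz \<open>\<gamma> = - \<alpha>\<close> by (simp add: \<beta>_def)
  qed
  then have z: "\<alpha> = 0" "\<beta> = 0" "\<gamma> = 0" by auto
  have lin: "\<delta> * x + \<epsilon> * y + \<zeta> = 0" if "(x, y) \<in> C" for x y
    using E0[OF that] by (simp add: quad_def z)
  have "(\<delta>, \<epsilon>) = (0, 0)" using nonline_one_line[OF C _ lin] by blast
  moreover obtain x y where "(x, y) \<in> C" using C unfolding nonline_def by (metis finite.emptyI ex_in_conv surj_pair)
  ultimately have "\<delta> = 0" "\<epsilon> = 0" "\<zeta> = 0" using lin[of x y] by auto
  then have "dist2 (aff a b c d k l p) p' = 0" using Eq[of p] z by (simp add: quad_def dist2_def)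
  then have "aff a b c d k l p = p'" by simp
  then show ?thesis using z by (simp add: \<alpha>_def \<beta>_def \<gamma>_def h_def)
qed

section \<open>Affine maps preserving a curve\<close>

text \<open>The equations on a, b, c, d make the map an isometry. Only inclusion of the image in C
  is asked, which is what Bezout delivers from infinitely many points.\<close>

definition moved :: "(real \<times> real) set \<Rightarrow> real \<times> real \<Rightarrow> real \<times> real \<Rightarrow> bool" where
  "moved C p p' \<longleftrightarrow> (\<exists>a b c d k l. a\<^sup>2 + c\<^sup>2 = 1 \<and> b\<^sup>2 + d\<^sup>2 = 1 \<and> a * b + c * d = 0 \<and>
     aff a b c d k l p = p' \<and> (\<forall>q\<in>C. aff a b c d k l q \<in> C))"

text \<open>The composition of f with the map is a polynomial of bounded bidegree with infinitely
  many zeros on C. It is obtained from \<open>eliminate_sqrt\<close> with U = 0 and V = 1, where the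
  only root is s = 0.\<close>

lemma aff_stays_in_curve:
  assumes C: "acurve n f C" and Q: "infinite Q" "Q \<subseteq> C"
    and z: "\<And>q. q \<in> Q \<Longrightarrow> eval_at f (aff a b c d k l q) = 0" and q: "q \<in> C"
  shows "aff a b c d k l q \<in> C"
proof -
  have fd: "bideg_le f n" using C by (simp add: acurve_def)
  define X where "X = (\<lambda>z w. of_real a * z + of_real b * w + of_real k :: complex)"
  define Y where "Y = (\<lambda>z w. of_real c * z + of_real d * w + of_real l :: complex)"
  have r: "rpoly 1 X" "rpoly 1 Y" unfolding X_def Y_def by (rule rpoly_linear)+
  have r0: "rpoly 1 (\<lambda>z w. 0)" "rpoly 1 (\<lambda>z w. 1)" using rpoly_const[of 1 0] rpoly_const[of 1 1] by simp_all
  from eliminate_sqrt[OF fd r(1) r0(1) r(2) r0(1) r0(1) r0(2)]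
  obtain N where N: "rpoly (1 * (8 * n + 3)) N"
    "\<And>z w. N z w = 0 \<longleftrightarrow> ceval f (X z w) (Y z w) = 0" by auto
  have Np: "pev N p = 0 \<longleftrightarrow> eval_at f (aff a b c d k l p) = 0" for p
  proof -
    have "pev N p = 0 \<longleftrightarrow> ceval f (X (of_real (fst p)) (of_real (snd p))) (Y (of_real (fst p)) (of_real (snd p))) = 0"
      unfolding pev_def using N(2) by simp
    also have "X (of_real (fst p)) (of_real (snd p)) = of_real (fst (aff a b c d k l p))" by (simp add: X_def aff_def)
    also have "Y (of_real (fst p)) (of_real (snd p)) = of_real (snd (aff a b c d k l p))" by (simp add: Y_def aff_def)
    finally show ?thesis by (simp add: ceval_of_real)
  qed
  have "Q \<subseteq> {p\<in>C. pev N p = 0}" using Q(2) z Np by blast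
  then have "infinite {p\<in>C. pev N p = 0}" using Q(1) finite_subset by blast
  from bezout_infinite[OF C N(1) this q] show ?thesis using Np acurve_mem[OF C] by blast
qed

lemma aff_dist_on_curve:
  assumes C: "acurve n f C" and Q: "infinite Q" "Q \<subseteq> C"
    and z: "\<And>q. q \<in> Q \<Longrightarrow> dist2 (aff a b c d k l q) p' = dist2 q p" and q: "q \<in> C"
  shows "dist2 (aff a b c d k l q) p' = dist2 q p"
proof -
  define G where "G = (\<lambda>z w. (of_real a * z + of_real b * w + of_real (k - fst p') :: complex)\<^sup>2
     + (of_real c * z + of_real d * w + of_real (l - snd p'))\<^sup>2 - dist2c p z w)"
  have "rpoly 2 G" unfolding G_def
    using rpoly_diff[OF rpoly_add[OF rpoly_power[OF rpoly_linear[of a b "k - fst p'"], of 2, simplified]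
        rpoly_power[OF rpoly_linear[of c d "l - snd p'"], of 2, simplified]] rpoly_dist2c[of p]] by simp
  moreover have Gp: "pev G r = of_real (dist2 (aff a b c d k l r) p' - dist2 r p)" for r
    by (simp add: G_def pev_def dist2c_def dist2_def aff_def algebra_simps)
  have "Q \<subseteq> {p\<in>C. pev G p = 0}" using Q(2) z by (auto simp: Gp simp del: of_real_diff)
  then have "infinite {p\<in>C. pev G p = 0}" using Q(1) finite_subset by blast
  ultimately have "pev G q = 0" using bezout_infinite[OF C _ _ q] by blast
  then show ?thesis by (simp add: Gp del: of_real_diff)
qed

lemma acurve_nonline:
  assumes "acurve n f C" "\<And>a b c. (a, b) \<noteq> (0, 0) \<Longrightarrow> C \<noteq> line a b c"
  shows "nonline C"
  unfolding nonline_def using assms line_bound[OF assms(1)] by (auto simp: acurve_def)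

text \<open>A singular linear part would send C into a line, which meets C finitely often. Then a
  nontrivial linear form takes finitely many values on C, so C lies in finitely many lines and would
  be finite.\<close>

lemma nonline_aff_det:
  assumes C: "nonline C" and T: "\<And>q. q \<in> C \<Longrightarrow> aff a b c d k l q \<in> C"
    and nz: "(a, b, c, d) \<noteq> (0, 0, 0, 0)"
  shows "a * d - b * c \<noteq> 0"
proof
  assume det: "a * d - b * c = 0"
  obtain u v where uv: "(u, v) \<noteq> (0, 0)" "u * a + v * c = 0" "u * b + v * d = 0"
  proof (cases "(a, c) = (0, 0)")
    case True
    then show thesis using that[of d "-b"] nz by auto
  next
    case False
    then show thesis using that[of c "-a"] det by (auto simp: algebra_simps)
  qed
  have onl: "aff a b c d k l q \<in> C \<inter> line u v (- (u * k + v * l))" if "q \<in> C" for q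
  proof -
    have "u * (a * fst q + b * snd q + k) + v * (c * fst q + d * snd q + l) + - (u * k + v * l)
      = (u * a + v * c) * fst q + (u * b + v * d) * snd q" by (simp add: algebra_simps)
    then show ?thesis using T[OF that] uv by (simp add: line_def aff_def)
  qed
  have "finite (C \<inter> line u v (- (u * k + v * l)))" using C uv(1) unfolding nonline_def by blast
  then have fin: "finite (aff a b c d k l ` C)" by (rule rev_finite_subset) (use onl in blast)
  have "\<exists>r s. (r, s) \<noteq> (0, 0) \<and> finite ((\<lambda>q. r * fst q + s * snd q) ` C)"
  proof (cases "(a, b) = (0, 0)")
    case True
    have "(\<lambda>q. c * fst q + d * snd q) ` C = (\<lambda>q. snd q - l) ` aff a b c d k l ` C"
      by (simp add: image_image aff_def)
    then show ?thesis using fin nz True by (intro exI[of _ c] exI[of _ d]) auto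
  next
    case False
    have "(\<lambda>q. a * fst q + b * snd q) ` C = (\<lambda>q. fst q - k) ` aff a b c d k l ` C"
      by (simp add: image_image aff_def)
    then show ?thesis using fin False by (intro exI[of _ a] exI[of _ b]) auto
  qed
  then obtain r s where rs: "(r, s) \<noteq> (0, 0)" "finite ((\<lambda>q. r * fst q + s * snd q) ` C)" by blast
  have "C \<subseteq> (\<Union>y\<in>(\<lambda>q. r * fst q + s * snd q) ` C. C \<inter> line r s (-y))" by (auto simp: line_def)
  moreover have "finite (C \<inter> line r s (-y))" for y using C rs(1) unfolding nonline_def by blast
  ultimately have "finite C" using rs(2) by (meson finite_UN finite_subset)
  then show False using C by (simp add: nonline_def)
qed

lemma moved_of_three_noncollinear:
  assumes C: "acurve n f C" and nl: "nonline C" and nc: "\<And>\<rho>. \<not> C \<subseteq> circle p0 \<rho>"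
    and Q: "infinite Q" "Q \<subseteq> C"
    and det: "(fst p1' - fst p0') * (snd p2' - snd p0') - (snd p1' - snd p0') * (fst p2' - fst p0') \<noteq> 0"
    and rel: "\<And>q. q \<in> Q \<Longrightarrow> \<exists>X Y. ceval f X Y = 0 \<and> dist2c p0' X Y = of_real (dist2 q p0) \<and>
       dist2c p1' X Y = of_real (dist2 q p1) \<and> dist2c p2' X Y = of_real (dist2 q p2)"
  shows "moved C p0 p0'"
proof -
  define v1 where "v1 = fst p1' - fst p0'" define v2 where "v2 = snd p1' - snd p0'"
  define w1 where "w1 = fst p2' - fst p0'" define w2 where "w2 = snd p2' - snd p0'"
  define V1 where "V1 = fst p1 - fst p0" define V2 where "V2 = snd p1 - snd p0"
  define W1 where "W1 = fst p2 - fst p0" define W2 where "W2 = snd p2 - snd p0"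
  define sq where "sq = (\<lambda>p::real\<times>real. (fst p)\<^sup>2 + (snd p)\<^sup>2)"
  define c1 where "c1 = (sq p1' - sq p0' - sq p1 + sq p0) / 2"
  define c2 where "c2 = (sq p2' - sq p0' - sq p2 + sq p0) / 2"
  \<comment> \<open>Cramer's rule for the two linear equations; its solution supplies the six
    coefficients of the affine map.\<close>
  define D where "D = v1 * w2 - v2 * w1"
  have D: "D \<noteq> 0" using det by (simp add: D_def v1_def v2_def w1_def w2_def)
  define a where "a = (V1 * w2 - W1 * v2) / D" define b where "b = (V2 * w2 - W2 * v2) / D"
  define k where "k = (c1 * w2 - c2 * v2) / D"
  define c where "c = (v1 * W1 - w1 * V1) / D" define d where "d = (v1 * W2 - w1 * V2) / D"
  define l where "l = (v1 * c2 - w1 * c1) / D"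
  have sol: "X = of_real (fst (aff a b c d k l q)) \<and> Y = of_real (snd (aff a b c d k l q))"
    if h: "dist2c p0' X Y = of_real (dist2 q p0)" "dist2c p1' X Y = of_real (dist2 q p1)"
      "dist2c p2' X Y = of_real (dist2 q p2)" for q X Y
  proof -
    have lin: "2 * (of_real (fst r' - fst p0') * X + of_real (snd r' - snd p0') * Y)
       = of_real (2 * ((fst r - fst p0) * fst q + (snd r - snd p0) * snd q) + (sq r' - sq p0' - sq r + sq p0))"
      if "dist2c r' X Y = of_real (dist2 q r)" for r r'
    proof -
      have "2 * (of_real (fst r' - fst p0') * X + of_real (snd r' - snd p0') * Y)
        = dist2c p0' X Y - dist2c r' X Y + of_real (sq r' - sq p0')"
        by (simp add: dist2c_def sq_def power2_eq_square algebra_simps)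
      also have "\<dots> = of_real (dist2 q p0 - dist2 q r + (sq r' - sq p0'))" using h(1) that by simp
      also have "dist2 q p0 - dist2 q r + (sq r' - sq p0')
        = 2 * ((fst r - fst p0) * fst q + (snd r - snd p0) * snd q) + (sq r' - sq p0' - sq r + sq p0)"
        by (simp add: dist2_def sq_def power2_eq_square algebra_simps)
      finally show ?thesis .
    qed
    have e1: "of_real v1 * X + of_real v2 * Y = of_real (V1 * fst q + V2 * snd q + c1)"
    proof -
      have "2 * (of_real v1 * X + of_real v2 * Y) = of_real (2 * (V1 * fst q + V2 * snd q + c1))"
        using lin[OF h(2)] unfolding v1_def[symmetric] v2_def[symmetric] V1_def[symmetric] V2_def[symmetric]
        by (simp add: c1_def)
      then have "2 * (of_real v1 * X + of_real v2 * Y) = 2 * of_real (V1 * fst q + V2 * snd q + c1)"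
        by (simp only: of_real_mult[of 2] of_real_numeral)
      then show ?thesis by (rule mult_left_cancel[THEN iffD1, rotated]) simp
    qed
    have e2: "of_real w1 * X + of_real w2 * Y = of_real (W1 * fst q + W2 * snd q + c2)"
    proof -
      have "2 * (of_real w1 * X + of_real w2 * Y) = of_real (2 * (W1 * fst q + W2 * snd q + c2))"
        using lin[OF h(3)] unfolding w1_def[symmetric] w2_def[symmetric] W1_def[symmetric] W2_def[symmetric]
        by (simp add: c2_def)
      then have "2 * (of_real w1 * X + of_real w2 * Y) = 2 * of_real (W1 * fst q + W2 * snd q + c2)"
        by (simp only: of_real_mult[of 2] of_real_numeral)
      then show ?thesis by (rule mult_left_cancel[THEN iffD1, rotated]) simp
    qed
    have "of_real D * X = of_real w2 * (of_real v1 * X + of_real v2 * Y) - of_real v2 * (of_real w1 * X + of_real w2 * Y)"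
      by (simp add: D_def algebra_simps)
    also have "\<dots> = of_real (w2 * (V1 * fst q + V2 * snd q + c1) - v2 * (W1 * fst q + W2 * snd q + c2))"
      unfolding e1 e2 by simp
    also have "w2 * (V1 * fst q + V2 * snd q + c1) - v2 * (W1 * fst q + W2 * snd q + c2) = D * fst (aff a b c d k l q)"
      using D by (simp add: aff_def a_def b_def k_def algebra_simps)
    finally have X: "X = of_real (fst (aff a b c d k l q))" using D by simp
    have "of_real D * Y = of_real v1 * (of_real w1 * X + of_real w2 * Y) - of_real w1 * (of_real v1 * X + of_real v2 * Y)"
      by (simp add: D_def algebra_simps)
    also have "\<dots> = of_real (v1 * (W1 * fst q + W2 * snd q + c2) - w1 * (V1 * fst q + V2 * snd q + c1))"
      unfolding e1 e2 by simp
    also have "v1 * (W1 * fst q + W2 * snd q + c2) - w1 * (V1 * fst q + V2 * snd q + c1) = D * snd (aff a b c d k l q)"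
      using D by (simp add: aff_def c_def d_def l_def algebra_simps)
    finally show ?thesis using D X by simp
  qed
  have real: "eval_at f (aff a b c d k l q) = 0 \<and> dist2 (aff a b c d k l q) p0' = dist2 q p0" if "q \<in> Q" for q
  proof -
    from rel[OF that] obtain X Y where XY: "ceval f X Y = 0" "dist2c p0' X Y = of_real (dist2 q p0)"
       "dist2c p1' X Y = of_real (dist2 q p1)" "dist2c p2' X Y = of_real (dist2 q p2)" by blast
    from sol[OF XY(2-4)] have s: "X = of_real (fst (aff a b c d k l q))" "Y = of_real (snd (aff a b c d k l q))" by auto
    have "eval_at f (aff a b c d k l q) = 0" using XY(1) unfolding s by (simp add: ceval_of_real)
    moreover have "complex_of_real (dist2 (aff a b c d k l q) p0') = of_real (dist2 q p0)"
      using XY(2) unfolding s pev_dist2c[symmetric] pev_def .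
    ultimately show ?thesis by simp
  qed
  have T: "aff a b c d k l q \<in> C" if "q \<in> C" for q
    by (rule aff_stays_in_curve[OF C Q _ that]) (use real in blast)
  have E: "dist2 (aff a b c d k l q) p0' = dist2 q p0" if "q \<in> C" for q
    by (rule aff_dist_on_curve[OF C Q _ that]) (use real in blast)
  have "(a, b, c, d) \<noteq> (0, 0, 0, 0)"
  proof
    assume "(a, b, c, d) = (0, 0, 0, 0)"
    then have "C \<subseteq> circle p0 (dist2 (k, l) p0')" using E by (auto simp: circle_def aff_def)
    then show False using nc by blast
  qed
  from nonline_aff_det[OF nl T this] have "a * d - b * c \<noteq> 0" by simp
  from conic_rigid[OF nl this T E] T show ?thesis unfolding moved_def by blast
qed

text \<open>With centres on one line, distances determine the coordinate U along it but only the
  square of the coordinate H across it. Comparing the base pair with each of the others expresses U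
  by u in two ways, which forces the slope \<mu> to be 1 or -1. Then H^2 = h^2, and one of the two
  signs of H occurs for infinitely many q.\<close>

lemma moved_of_three_collinear:
  assumes C: "acurve n f C" and nl: "nonline C" and ab: "(a, b) \<noteq> (0, 0)"
    and Q: "infinite Q" "Q \<subseteq> C"
    and g: "g = (\<lambda>t. (x0 + b * t, y0 - a * t))"
    and s': "s0' \<noteq> s1'" "s0' \<noteq> s2'" "s1' \<noteq> s2'"
    and rel: "\<And>q. q \<in> Q \<Longrightarrow> \<exists>X Y. ceval f X Y = 0 \<and> dist2c (g s0') X Y = of_real (dist2 q (g s0)) \<and>
       dist2c (g s1') X Y = of_real (dist2 q (g s1)) \<and> dist2c (g s2') X Y = of_real (dist2 q (g s2))"
  shows "moved C (g s0) (g s0')"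
proof -
  define N where "N = a\<^sup>2 + b\<^sup>2"
  have N: "N \<noteq> 0" using ab by (simp add: N_def sum_power2_eq_zero_iff)
  \<comment> \<open>Coordinates along and across the line, scaled by sqrt N to keep them
    polynomial.\<close>
  define u where "u = (\<lambda>q::real\<times>real. b * (fst q - x0) - a * (snd q - y0))"
  define h where "h = (\<lambda>q::real\<times>real. a * (fst q - x0) + b * (snd q - y0))"
  define U where "U = (\<lambda>X Y::complex. of_real b * (X - of_real x0) - of_real a * (Y - of_real y0))"
  define H where "H = (\<lambda>X Y::complex. of_real a * (X - of_real x0) + of_real b * (Y - of_real y0))"
  have dr: "N * dist2 q (g t) = (u q - N * t)\<^sup>2 + (h q)\<^sup>2" for q t
    by (simp add: N_def dist2_def g u_def h_def power2_eq_square algebra_simps)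
  have dc: "of_real N * dist2c (g t) X Y = (U X Y - of_real (N * t))\<^sup>2 + (H X Y)\<^sup>2" for X Y t
    by (simp add: N_def dist2c_def g U_def H_def power2_eq_square algebra_simps)
  have key: "\<exists>X Y. ceval f X Y = 0 \<and> (U X Y - of_real (N * s0'))\<^sup>2 + (H X Y)\<^sup>2 = of_real ((u q - N * s0)\<^sup>2 + (h q)\<^sup>2) \<and>
     of_real (s1' - s0') * (2 * U X Y - of_real (N * (s1' + s0'))) = of_real ((s1 - s0) * (2 * u q - N * (s1 + s0))) \<and>
     of_real (s2' - s0') * (2 * U X Y - of_real (N * (s2' + s0'))) = of_real ((s2 - s0) * (2 * u q - N * (s2 + s0)))"
    if q: "q \<in> Q" for q
  proof -
    from rel[OF q] obtain X Y where XY: "ceval f X Y = 0" "dist2c (g s0') X Y = of_real (dist2 q (g s0))"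
       "dist2c (g s1') X Y = of_real (dist2 q (g s1))" "dist2c (g s2') X Y = of_real (dist2 q (g s2))" by blast
    have e: "(U X Y - of_real (N * t'))\<^sup>2 + (H X Y)\<^sup>2 = of_real ((u q - N * t)\<^sup>2 + (h q)\<^sup>2)"
      if "dist2c (g t') X Y = of_real (dist2 q (g t))" for t t'
      unfolding dc[symmetric] dr[symmetric] that by simp
    have df: "of_real (t' - s0') * (2 * U X Y - of_real (N * (t' + s0'))) = of_real ((t - s0) * (2 * u q - N * (t + s0)))"
      if "dist2c (g t') X Y = of_real (dist2 q (g t))" for t t'
    proof -
      have "of_real N * (of_real (t' - s0') * (2 * U X Y - of_real (N * (t' + s0'))))
        = ((U X Y - of_real (N * s0'))\<^sup>2 + (H X Y)\<^sup>2) - ((U X Y - of_real (N * t'))\<^sup>2 + (H X Y)\<^sup>2)"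
        by (simp add: power2_eq_square algebra_simps)
      also have "\<dots> = of_real (((u q - N * s0)\<^sup>2 + (h q)\<^sup>2) - ((u q - N * t)\<^sup>2 + (h q)\<^sup>2))"
        unfolding e[OF XY(2)] e[OF that] by simp
      also have "((u q - N * s0)\<^sup>2 + (h q)\<^sup>2) - ((u q - N * t)\<^sup>2 + (h q)\<^sup>2) = N * ((t - s0) * (2 * u q - N * (t + s0)))"
        by (simp add: power2_eq_square algebra_simps)
      finally show ?thesis using N by simp
    qed
    show ?thesis using XY(1) e[OF XY(2)] df[OF XY(3)] df[OF XY(4)] by blast
  qed
  define m1 where "m1 = (s1 - s0) / (s1' - s0')"
  define m2 where "m2 = (s2 - s0) / (s2' - s0')"
  define k1 where "k1 = N * (s1' + s0') - m1 * N * (s1 + s0)"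
  define k2 where "k2 = N * (s2' + s0') - m2 * N * (s2 + s0)"
  have m: "s1 - s0 = m1 * (s1' - s0')" "s2 - s0 = m2 * (s2' - s0')" using s' by (auto simp: m1_def m2_def)
  have key2: "\<exists>X Y. ceval f X Y = 0 \<and> (U X Y - of_real (N * s0'))\<^sup>2 + (H X Y)\<^sup>2 = of_real ((u q - N * s0)\<^sup>2 + (h q)\<^sup>2) \<and>
     2 * U X Y = of_real (m1 * 2 * u q + k1) \<and> 2 * U X Y = of_real (m2 * 2 * u q + k2)" if q: "q \<in> Q" for q
  proof -
    from key[OF q] obtain X Y where XY: "ceval f X Y = 0" "(U X Y - of_real (N * s0'))\<^sup>2 + (H X Y)\<^sup>2 = of_real ((u q - N * s0)\<^sup>2 + (h q)\<^sup>2)"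
      "of_real (s1' - s0') * (2 * U X Y - of_real (N * (s1' + s0'))) = of_real ((s1 - s0) * (2 * u q - N * (s1 + s0)))"
      "of_real (s2' - s0') * (2 * U X Y - of_real (N * (s2' + s0'))) = of_real ((s2 - s0) * (2 * u q - N * (s2 + s0)))" by blast
    have gen: "2 * U X Y = of_real (m * 2 * u q + (N * (t' + s0') - m * N * (t + s0)))"
      if "of_real (t' - s0') * (2 * U X Y - of_real (N * (t' + s0'))) = of_real ((t - s0) * (2 * u q - N * (t + s0)))"
        "t - s0 = m * (t' - s0')" "t' \<noteq> s0'" for t t' m
    proof -
      have "of_real (t' - s0') * (2 * U X Y - of_real (N * (t' + s0')))
        = of_real (t' - s0') * of_real (m * (2 * u q - N * (t + s0)))"
        using that(1) unfolding that(2) by (simp add: mult_ac)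
      then have "2 * U X Y - of_real (N * (t' + s0')) = of_real (m * (2 * u q - N * (t + s0)))"
        using that(3) by (subst (asm) mult_left_cancel) (auto simp del: of_real_diff)
      then have "2 * U X Y = of_real (m * (2 * u q - N * (t + s0)) + N * (t' + s0'))" by (simp add: algebra_simps)
      also have "m * (2 * u q - N * (t + s0)) + N * (t' + s0') = m * 2 * u q + (N * (t' + s0') - m * N * (t + s0))"
        by (simp add: algebra_simps)
      finally show ?thesis .
    qed
    show ?thesis using XY(1,2) gen[OF XY(3) m(1)] gen[OF XY(4) m(2)] s' unfolding k1_def k2_def by blast
  qed
  have infu: "infinite (u ` Q)"
  proof
    assume fin: "finite (u ` Q)"
    have "Q \<subseteq> (\<Union>y\<in>u ` Q. C \<inter> line b (-a) (a * y0 - b * x0 - y))"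
      using Q(2) by (auto simp: line_def u_def algebra_simps)
    moreover have "finite (C \<inter> line b (-a) c)" for c
    proof -
      have "(b, -a) \<noteq> (0, 0)" using ab by auto
      then show ?thesis using nl unfolding nonline_def by blast
    qed
    ultimately show False using fin Q(1) by (meson finite_UN finite_subset)
  qed
  then obtain q1 where q1: "q1 \<in> Q" by (metis finite.emptyI image_empty ex_in_conv)
  from infu have "\<not> u ` Q \<subseteq> {u q1}" by (meson finite.emptyI finite_insert finite_subset)
  then obtain q2 where q2: "q2 \<in> Q" "u q2 \<noteq> u q1" by blast
  have lin: "m1 * 2 * u q + k1 = m2 * 2 * u q + k2" if "q \<in> Q" for q
    using key2[OF that] by (metis of_real_eq_iff)
  have mm: "m1 = m2"
  proof -
    have "(m1 - m2) * (u q1 - u q2) = 0" using lin[OF q1] lin[OF q2(1)] by (simp add: algebra_simps)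
    then show ?thesis using q2(2) by auto
  qed
  then have kk: "k1 = k2" using lin[OF q1] by simp
  define \<mu> where "\<mu> = m1"
  \<comment> \<open>Equal intercepts give s1' - s2' = \<mu> (s1 - s2), equal slopes give the same
    relation in the other direction, and s1' differs from s2'.\<close>
  have "\<mu>\<^sup>2 = 1"
  proof -
    have "N * (s1' - s2' - \<mu> * (s1 - s2)) = 0" using kk mm unfolding k1_def k2_def \<mu>_def by (simp add: algebra_simps)
    then have 1: "s1' - s2' = \<mu> * (s1 - s2)" using N by simp
    have 2: "s1 - s2 = \<mu> * (s1' - s2')" using m mm unfolding \<mu>_def by (simp add: algebra_simps)
    have "(s1' - s2') * (\<mu>\<^sup>2 - 1) = 0" using 1 unfolding 2 by (simp add: power2_eq_square algebra_simps)
    then show ?thesis using s' by simp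
  qed
  have k1: "k1 = 2 * (N * s0' - \<mu> * N * s0)"
  proof -
    have "\<mu> * s1 = s1' - s0' + \<mu> * s0"
    proof -
      have "\<mu> * (s1 - s0) = \<mu>\<^sup>2 * (s1' - s0')" using m(1) by (simp add: \<mu>_def power2_eq_square)
      then show ?thesis using \<open>\<mu>\<^sup>2 = 1\<close> by (simp add: algebra_simps)
    qed
    then have "N * (\<mu> * s1) = N * (s1' - s0' + \<mu> * s0)" by simp
    then show ?thesis unfolding k1_def \<mu>_def[symmetric] by (simp add: algebra_simps)
  qed
  \<comment> \<open>In the orthogonal frame (b, -a), (a, b) the linear part is diag(\<mu>, e); the
    translation is chosen to take g s0 to g s0'.\<close>
  define T where "T = (\<lambda>e. aff ((\<mu> * b\<^sup>2 + e * a\<^sup>2) / N) ((e - \<mu>) * a * b / N) ((e - \<mu>) * a * b / N) ((\<mu> * a\<^sup>2 + e * b\<^sup>2) / N)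
     (x0 + b * (s0' - \<mu> * s0) - ((\<mu> * b\<^sup>2 + e * a\<^sup>2) / N * x0 + (e - \<mu>) * a * b / N * y0))
     (y0 - a * (s0' - \<mu> * s0) - ((e - \<mu>) * a * b / N * x0 + (\<mu> * a\<^sup>2 + e * b\<^sup>2) / N * y0)))"
  have Tq: "N * (fst (T e q) - x0) = b * (\<mu> * u q + N * (s0' - \<mu> * s0)) + a * (e * h q)"
    "N * (snd (T e q) - y0) = - a * (\<mu> * u q + N * (s0' - \<mu> * s0)) + b * (e * h q)" for e q
  proof -
    define A11 where "A11 = (\<mu> * b\<^sup>2 + e * a\<^sup>2) / N"
    define A12 where "A12 = (e - \<mu>) * a * b / N"
    define A22 where "A22 = (\<mu> * a\<^sup>2 + e * b\<^sup>2) / N"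
    have A: "N * A11 = \<mu> * b\<^sup>2 + e * a\<^sup>2" "N * A12 = (e - \<mu>) * a * b" "N * A22 = \<mu> * a\<^sup>2 + e * b\<^sup>2"
      using N by (simp_all add: A11_def A12_def A22_def)
    have "N * (fst (T e q) - x0) = (N * A11) * (fst q - x0) + (N * A12) * (snd q - y0) + b * (N * (s0' - \<mu> * s0))"
      unfolding T_def A11_def[symmetric] A12_def[symmetric] A22_def[symmetric] by (simp add: aff_def algebra_simps)
    also have "\<dots> = b * (\<mu> * u q + N * (s0' - \<mu> * s0)) + a * (e * h q)"
      unfolding A u_def h_def by (simp add: power2_eq_square algebra_simps)
    finally show "N * (fst (T e q) - x0) = b * (\<mu> * u q + N * (s0' - \<mu> * s0)) + a * (e * h q)" .
    have "N * (snd (T e q) - y0) = (N * A12) * (fst q - x0) + (N * A22) * (snd q - y0) - a * (N * (s0' - \<mu> * s0))"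
      unfolding T_def A11_def[symmetric] A12_def[symmetric] A22_def[symmetric] by (simp add: aff_def algebra_simps)
    also have "\<dots> = - a * (\<mu> * u q + N * (s0' - \<mu> * s0)) + b * (e * h q)"
      unfolding A u_def h_def by (simp add: power2_eq_square algebra_simps)
    finally show "N * (snd (T e q) - y0) = - a * (\<mu> * u q + N * (s0' - \<mu> * s0)) + b * (e * h q)" .
  qed
  have cover: "\<exists>e\<in>{1, -1}. eval_at f (T e q) = 0" if q: "q \<in> Q" for q
  proof -
    from key2[OF q] obtain X Y where XY: "ceval f X Y = 0"
      "(U X Y - of_real (N * s0'))\<^sup>2 + (H X Y)\<^sup>2 = of_real ((u q - N * s0)\<^sup>2 + (h q)\<^sup>2)"
      "2 * U X Y = of_real (m1 * 2 * u q + k1)" by blast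
    have "2 * U X Y = 2 * of_real (\<mu> * u q + N * (s0' - \<mu> * s0))"
      unfolding XY(3) k1 \<mu>_def[symmetric] by (simp add: algebra_simps)
    then have UU: "U X Y = of_real (\<mu> * u q + N * (s0' - \<mu> * s0))"
      by (rule mult_left_cancel[THEN iffD1, rotated]) simp
    have "(U X Y - of_real (N * s0'))\<^sup>2 = of_real ((\<mu> * (u q - N * s0))\<^sup>2)"
      unfolding UU by (simp add: algebra_simps)
    also have "(\<mu> * (u q - N * s0))\<^sup>2 = (u q - N * s0)\<^sup>2" using \<open>\<mu>\<^sup>2 = 1\<close> by (simp add: power_mult_distrib)
    finally have "(H X Y)\<^sup>2 = (of_real (h q))\<^sup>2" using XY(2) by simp
    then have "H X Y = of_real (1 * h q) \<or> H X Y = of_real (- 1 * h q)"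
      by (simp add: power2_eq_iff)
    then have "\<exists>e\<in>{1, -1}. H X Y = of_real (e * h q)" by blast
    then obtain e :: real where e: "e \<in> {1, -1}" "H X Y = of_real (e * h q)" by blast
    have "of_real N * (X - of_real x0) = of_real b * U X Y + of_real a * H X Y"
      by (simp add: N_def U_def H_def power2_eq_square algebra_simps)
    also have "\<dots> = of_real (N * (fst (T e q) - x0))" unfolding UU e(2) Tq by simp
    finally have X: "X = of_real (fst (T e q))" using N by simp
    have "of_real N * (Y - of_real y0) = - of_real a * U X Y + of_real b * H X Y"
      by (simp add: N_def U_def H_def power2_eq_square algebra_simps)
    also have "\<dots> = of_real (N * (snd (T e q) - y0))" unfolding UU e(2) Tq by simp
    finally have Y: "Y = of_real (snd (T e q))" using N by simp
    show ?thesis using XY(1) e(1) unfolding X Y ceval_of_real by (intro bexI[of _ e]) simp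
  qed
  have "Q \<subseteq> {q\<in>Q. eval_at f (T 1 q) = 0} \<union> {q\<in>Q. eval_at f (T (-1) q) = 0}" using cover by auto
  then have "\<exists>e\<in>{1, -1}. infinite {q\<in>Q. eval_at f (T e q) = 0}" using Q(1) finite_subset by auto
  then obtain e where e: "e \<in> {1, -1 :: real}" "infinite {q\<in>Q. eval_at f (T e q) = 0}" by blast
  have stays: "T e q \<in> C" if "q \<in> C" for q
    unfolding T_def by (rule aff_stays_in_curve[OF C e(2) _ _ that]) (use Q(2) in \<open>auto simp: T_def\<close>)
  have e2: "e\<^sup>2 = 1" using e(1) by auto
  have "u (g s0) = N * s0" "h (g s0) = 0" by (simp_all add: u_def h_def g N_def power2_eq_square algebra_simps)
  then have "N * (fst (T e (g s0)) - x0) = N * (b * s0')" "N * (snd (T e (g s0)) - y0) = N * (- a * s0')"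
    unfolding Tq by (simp_all add: algebra_simps)
  then have "fst (T e (g s0)) - x0 = b * s0'" "snd (T e (g s0)) - y0 = - a * s0'"
    using N mult_left_cancel by blast+
  then have Tp: "T e (g s0) = g s0'" by (simp add: g prod_eq_iff)
  have o1: "((\<mu> * b\<^sup>2 + e * a\<^sup>2) / N)\<^sup>2 + ((e - \<mu>) * a * b / N)\<^sup>2 = 1"
  proof -
    have "(\<mu> * b\<^sup>2 + e * a\<^sup>2)\<^sup>2 + ((e - \<mu>) * a * b)\<^sup>2 = \<mu>\<^sup>2 * (b\<^sup>2 * b\<^sup>2 + a\<^sup>2 * b\<^sup>2) + e\<^sup>2 * (a\<^sup>2 * a\<^sup>2 + a\<^sup>2 * b\<^sup>2)"
      by (simp add: power2_eq_square algebra_simps)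
    also have "\<dots> = N\<^sup>2" unfolding \<open>\<mu>\<^sup>2 = 1\<close> e2 N_def by (simp add: power2_eq_square algebra_simps)
    finally show ?thesis using N by (simp add: power_divide add_divide_distrib[symmetric])
  qed
  have o2: "((e - \<mu>) * a * b / N)\<^sup>2 + ((\<mu> * a\<^sup>2 + e * b\<^sup>2) / N)\<^sup>2 = 1"
  proof -
    have "((e - \<mu>) * a * b)\<^sup>2 + (\<mu> * a\<^sup>2 + e * b\<^sup>2)\<^sup>2 = \<mu>\<^sup>2 * (a\<^sup>2 * a\<^sup>2 + a\<^sup>2 * b\<^sup>2) + e\<^sup>2 * (b\<^sup>2 * b\<^sup>2 + a\<^sup>2 * b\<^sup>2)"
      by (simp add: power2_eq_square algebra_simps)
    also have "\<dots> = N\<^sup>2" unfolding \<open>\<mu>\<^sup>2 = 1\<close> e2 N_def by (simp add: power2_eq_square algebra_simps)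
    finally show ?thesis using N by (simp add: power_divide add_divide_distrib[symmetric])
  qed
  have o3: "(\<mu> * b\<^sup>2 + e * a\<^sup>2) / N * ((e - \<mu>) * a * b / N) + (e - \<mu>) * a * b / N * ((\<mu> * a\<^sup>2 + e * b\<^sup>2) / N) = 0"
  proof -
    have "(\<mu> * b\<^sup>2 + e * a\<^sup>2) * ((e - \<mu>) * a * b) + (e - \<mu>) * a * b * (\<mu> * a\<^sup>2 + e * b\<^sup>2) = (e\<^sup>2 - \<mu>\<^sup>2) * (a * b * (a\<^sup>2 + b\<^sup>2))"
      by (simp add: power2_eq_square algebra_simps)
    then show ?thesis using \<open>\<mu>\<^sup>2 = 1\<close> e2 by (simp add: add_divide_distrib[symmetric])
  qed
  show ?thesis unfolding moved_def using o1 o2 o3 Tp stays unfolding T_def by blast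
qed

section \<open>Common neighbours of two pairs of points\<close>

text \<open>The only points whose distance fibres on C can be infinite; they will be removed from
  the point sets.\<close>

definition central :: "(real \<times> real) set \<Rightarrow> real \<times> real \<Rightarrow> bool" where
  "central C p \<longleftrightarrow> (\<exists>\<rho>. C \<subseteq> circle p \<rho>)"

lemma noncentral_dist_bound:
  assumes "acurve d f C" "\<not> central C p"
  shows "finite {q\<in>C. dist2 q p = \<rho>}" "card {q\<in>C. dist2 q p = \<rho>} \<le> bez d 2"
proof -
  have "{q\<in>C. dist2 q p = \<rho>} = C \<inter> circle p \<rho>" by (auto simp: circle_def)
  moreover have "\<not> (C = circle p \<rho> \<and> \<rho> > 0)" using assms(2) unfolding central_def by blast
  ultimately show "finite {q\<in>C. dist2 q p = \<rho>}" "card {q\<in>C. dist2 q p = \<rho>} \<le> bez d 2"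
    using circle_bound[OF assms(1), of p \<rho>] by auto
qed

lemma bisector:
  assumes "p \<noteq> p'" "dist2 q p = dist2 q p'"
  shows "q \<in> line (2 * (fst p' - fst p)) (2 * (snd p' - snd p)) (dist2 p (0, 0) - dist2 p' (0, 0))"
    "(2 * (fst p' - fst p), 2 * (snd p' - snd p)) \<noteq> (0, 0)"
  using assms by (auto simp: line_def dist2_def case_prod_unfold prod_eq_iff power2_eq_square algebra_simps)

lemma complex_square_eq_of_real:
  assumes "s\<^sup>2 = complex_of_real r" "r > 0" shows "\<exists>t. s = of_real t"
proof -
  have "s\<^sup>2 = (of_real (sqrt r))\<^sup>2" using assms by (simp flip: of_real_power)
  then have "s = of_real (sqrt r) \<or> s = of_real (- sqrt r)" by (simp add: power2_eq_iff)
  then show ?thesis by blast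
qed

lemma ceval_second_0: "ceval P z 0 = ceval1 (coeff P 0) z"
  by (cases P) (simp add: ceval_pCons)

text \<open>The degree 2 (8d + 3) of the eliminant times the two signs of the root.\<close>

definition fiberK :: "nat \<Rightarrow> nat" where
  "fiberK d = 2 * (2 * (8 * d + 3))"

text \<open>The points in question are (x0 + z, y0 + s) with s^2 = \<rho> - z^2, and elimination
  leaves a polynomial h in z. If h were zero, each real z between 0 and sqrt \<rho> would give a
  real s, so C would share infinitely many points with a circle about p. Complex finiteness thus
  follows from a real hypothesis.\<close>

lemma complex_fiber_bound:
  assumes C: "acurve d f C" and nc: "\<not> central C p" and \<rho>: "\<rho> > 0"
  shows "finite {(X, Y). ceval f X Y = 0 \<and> dist2c p X Y = of_real \<rho>}"
    "card {(X, Y). ceval f X Y = 0 \<and> dist2c p X Y = of_real \<rho>} \<le> fiberK d"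
proof -
  have fd: "bideg_le f d" using C by (simp add: acurve_def)
  define x0 where "x0 = fst p"
  define y0 where "y0 = snd p"
  have r: "rpoly 2 (\<lambda>z w. of_real x0 + z)" "rpoly 2 (\<lambda>z w. 0)" "rpoly 2 (\<lambda>z w. of_real y0)" "rpoly 2 (\<lambda>z w. 1)"
    "rpoly 2 (\<lambda>z w. of_real \<rho> - z * z)"
    using rpoly_const[of 2 0] rpoly_const[of 2 1]
    by (simp_all, intro rpoly_add rpoly_const rpoly_fst, simp, intro rpoly_const,
        intro rpoly_diff rpoly_const rpoly_mult[OF rpoly_fst[OF order_refl] rpoly_fst[OF order_refl]], simp)
  from eliminate_sqrt[OF fd r(1,2,3,4,5,4)] obtain N where N: "rpoly (2 * (8 * d + 3)) N"
    "\<And>z w. N z w = 0 \<longleftrightarrow> (\<exists>s. s\<^sup>2 = of_real \<rho> - z * z \<and> ceval f (of_real x0 + z) (of_real y0 + s) = 0)"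
    by auto
  from N(1) obtain P where P: "bideg_le P (2 * (8 * d + 3))" "N = ceval P" unfolding rpoly_def by blast
  \<comment> \<open>The condition does not involve the second variable, so the slice w = 0
    suffices.\<close>
  define h where "h = coeff P 0"
  have dh: "degree h \<le> 2 * (8 * d + 3)" using P(1) by (auto simp: h_def bideg_le_def)
  have hN: "ceval1 h z = 0 \<longleftrightarrow> (\<exists>s. s\<^sup>2 = of_real \<rho> - z * z \<and> ceval f (of_real x0 + z) (of_real y0 + s) = 0)" for z
    using N(2)[of z 0] unfolding P(2) ceval_second_0 h_def .
  have "h \<noteq> 0"
  proof
    assume h0: "h = 0"
    have pt: "\<exists>t. (x0 + z, y0 + t) \<in> C \<inter> circle p \<rho>" if z: "z \<in> {0<..<sqrt \<rho>}" for z
    proof -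
      obtain s where s: "s\<^sup>2 = of_real \<rho> - of_real z * of_real z" "ceval f (of_real x0 + of_real z) (of_real y0 + s) = 0"
        using hN[of "of_real z"] h0 by auto
      have "z\<^sup>2 < (sqrt \<rho>)\<^sup>2" using z by (intro power_strict_mono) auto
      then have zz: "z * z < \<rho>" using \<rho> by (simp add: power2_eq_square)
      have s2: "s\<^sup>2 = of_real (\<rho> - z * z)" using s(1) by simp
      obtain t where t: "s = of_real t" using complex_square_eq_of_real[OF s2] zz by auto
      have "complex_of_real (t\<^sup>2) = of_real (\<rho> - z * z)" using s2 unfolding t by simp
      then have "t\<^sup>2 = \<rho> - z * z" by (simp only: of_real_eq_iff)
      then have "dist2 (x0 + z, y0 + t) p = \<rho>" by (simp add: dist2_def x0_def y0_def power2_eq_square)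
      moreover have "ceval f (of_real (x0 + z)) (of_real (y0 + t)) = 0" using s(2) unfolding t by simp
      then have "eval2 f (x0 + z) (y0 + t) = 0" unfolding ceval_of_real by simp
      then have "(x0 + z, y0 + t) \<in> C" using acurve_mem[OF C] by simp
      ultimately show ?thesis by (auto simp: circle_def)
    qed
    have "{0<..<sqrt \<rho>} \<subseteq> (\<lambda>q. fst q - x0) ` (C \<inter> circle p \<rho>)"
    proof
      fix z assume "z \<in> {0<..<sqrt \<rho>}"
      from pt[OF this] obtain t where "(x0 + z, y0 + t) \<in> C \<inter> circle p \<rho>" by blast
      then show "z \<in> (\<lambda>q. fst q - x0) ` (C \<inter> circle p \<rho>)" by (rule rev_image_eqI) simp
    qed
    moreover have "infinite {0<..<sqrt \<rho>}" using \<rho> by simp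
    ultimately have "infinite (C \<inter> circle p \<rho>)" using finite_surj by blast
    then show False using circle_bound[OF C, of p \<rho>] nc unfolding central_def by blast
  qed
  define hc where "hc = map_poly complex_of_real h"
  have hc: "hc \<noteq> 0" "degree hc = degree h" using \<open>h \<noteq> 0\<close> by (auto simp: hc_def map_poly_eq_0_iff degree_map_poly)
  define Rt where "Rt = {z. poly hc z = 0}"
  have Rt: "finite Rt" "card Rt \<le> 2 * (8 * d + 3)"
    using poly_roots_finite[OF hc(1)] card_poly_roots_bound[OF hc(1)] dh hc(2) by (auto simp: Rt_def)
  let ?F = "{(X, Y). ceval f X Y = 0 \<and> dist2c p X Y = of_real \<rho>}"
  define g where "g = (\<lambda>(z, e). (of_real x0 + z, of_real y0 + e * csqrt (of_real \<rho> - z * z)))"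
  have sub: "?F \<subseteq> g ` (Rt \<times> {1, -1})"
  proof
    fix x assume "x \<in> ?F"
    then obtain X Y where x: "x = (X, Y)" "ceval f X Y = 0" "dist2c p X Y = of_real \<rho>" by auto
    define z where "z = X - of_real x0"
    define s where "s = Y - of_real y0"
    have s: "s\<^sup>2 = of_real \<rho> - z * z" using x(3) by (simp add: dist2c_def s_def z_def x0_def y0_def power2_eq_square algebra_simps)
    have "ceval1 h z = 0" unfolding hN using s x(2) by (intro exI[of _ s]) (simp add: z_def s_def)
    then have zR: "z \<in> Rt" by (simp add: Rt_def hc_def ceval1_def)
    have "s\<^sup>2 = (csqrt (of_real \<rho> - z * z))\<^sup>2" using s by simp
    from power2_eq_iff[THEN iffD1, OF this]
    have "s = 1 * csqrt (of_real \<rho> - z * z) \<or> s = -1 * csqrt (of_real \<rho> - z * z)" by simp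
    moreover have "x = (of_real x0 + z, of_real y0 + s)" by (simp add: x(1) z_def s_def)
    ultimately have "x = g (z, 1) \<or> x = g (z, -1)" by (auto simp: g_def)
    then show "x \<in> g ` (Rt \<times> {1, -1})" using zR by blast
  qed
  have fin: "finite (g ` (Rt \<times> {1, -1}))" using Rt(1) by simp
  show "finite ?F" using finite_subset[OF sub fin] .
  have "card ?F \<le> card (g ` (Rt \<times> {1, -1}))" by (rule card_mono[OF fin sub])
  also have "\<dots> \<le> card (Rt \<times> {1, -1 :: complex})" by (rule card_image_le) (use Rt(1) in simp)
  also have "\<dots> \<le> fiberK d" using Rt(2) by (simp add: fiberK_def card_cartesian_product)
  finally show "card ?F \<le> fiberK d" .
qed

text \<open>In the graph joining (p, p') to (q, q') when |pq| = |p'q'|, this is the common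
  neighbourhood of two vertices.\<close>

definition common_nbrs :: "(real \<times> real) set \<Rightarrow> (real \<times> real) \<times> (real \<times> real) \<Rightarrow> (real \<times> real) \<times> (real \<times> real) \<Rightarrow>
    ((real \<times> real) \<times> (real \<times> real)) set" where
  "common_nbrs C P P' = {(q, q'). q \<in> C \<and> q' \<in> C \<and> dist2 q (fst P) = dist2 q' (snd P) \<and> dist2 q (fst P') = dist2 q' (snd P')}"

text \<open>The bounds for q in the two cases of \<open>common_nbrs_dichotomy\<close> are added and
  multiplied by the number of q' on a circle.\<close>

definition codegK :: "nat \<Rightarrow> nat" where
  "codegK d = (bez d (4 * (8 * d + 3)) + bez d 1) * bez d 2"

lemma common_nbrs_bound:
  assumes C: "acurve d f C" and nc: "\<not> central C (snd P)" and Q: "finite Q" "card Q \<le> k"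
    and sub: "\<And>q q'. (q, q') \<in> common_nbrs C P P' \<Longrightarrow> q \<in> Q"
  shows "finite (common_nbrs C P P')" "card (common_nbrs C P P') \<le> k * bez d 2"
proof -
  define S where "S = (SIGMA q:Q. {q'\<in>C. dist2 q' (snd P) = dist2 q (fst P)})"
  have fin: "finite {q'\<in>C. dist2 q' (snd P) = \<rho>}" "card {q'\<in>C. dist2 q' (snd P) = \<rho>} \<le> bez d 2" for \<rho>
    using noncentral_dist_bound[OF C nc] by auto
  have S: "finite S" unfolding S_def using Q(1) fin(1) by (rule finite_SigmaI)
  have s: "common_nbrs C P P' \<subseteq> S"
  proof
    fix x assume x: "x \<in> common_nbrs C P P'"
    obtain q q' where "x = (q, q')" by (cases x)
    with x sub have "q \<in> Q" by blast
    then show "x \<in> S" using x \<open>x = (q, q')\<close> by (simp add: S_def common_nbrs_def)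
  qed
  show "finite (common_nbrs C P P')" using finite_subset[OF s S] .
  have "card (common_nbrs C P P') \<le> card S" by (rule card_mono[OF S s])
  also have "\<dots> = (\<Sum>q\<in>Q. card {q'\<in>C. dist2 q' (snd P) = dist2 q (fst P)})"
    unfolding S_def using Q(1) fin(1) by (intro card_SigmaI) auto
  also have "\<dots> \<le> card Q * bez d 2" using sum_bounded_above[of Q _ "bez d 2"] fin(2) by fastforce
  also have "\<dots> \<le> k * bez d 2" using Q(2) by simp
  finally show "card (common_nbrs C P P') \<le> k * bez d 2" .
qed

text \<open>The degenerate alternative. The partners are complex because a vanishing norm does not
  tell whether the root behind it is real.\<close>

definition cplx_related :: "real poly poly \<Rightarrow> (real \<times> real) set \<Rightarrow> (real \<times> real) \<times> (real \<times> real) \<Rightarrow> (real \<times> real) \<times> (real \<times> real) \<Rightarrow> bool" where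
  "cplx_related f C P P' \<longleftrightarrow> snd P \<noteq> snd P' \<and> (\<forall>q\<in>C. \<exists>X Y. ceval f X Y = 0 \<and>
     dist2c (snd P) X Y = of_real (dist2 q (fst P)) \<and> dist2c (snd P') X Y = of_real (dist2 q (fst P')))"

text \<open>If the second points agree, q lies on the bisector of the first points. Otherwise q' is
  an intersection of two circles, polynomial in q up to one square root; eliminating the root leaves
  a polynomial in q, which vanishes on all of C or bounds the number of q.\<close>

lemma common_nbrs_dichotomy:
  assumes C: "acurve d f C" and nl: "nonline C" and nc: "\<not> central C (snd P)" and ne: "P \<noteq> P'"
  shows "cplx_related f C P P' \<or> (finite (common_nbrs C P P') \<and> card (common_nbrs C P P') \<le> codegK d)"
proof (cases "snd P = snd P'")
  case True
  then have ne': "fst P \<noteq> fst P'" using ne by (auto simp: prod_eq_iff)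
  define Q where "Q = C \<inter> line (2 * (fst (fst P') - fst (fst P))) (2 * (snd (fst P') - snd (fst P))) (dist2 (fst P) (0, 0) - dist2 (fst P') (0, 0))"
  have b: "(2 * (fst (fst P') - fst (fst P)), 2 * (snd (fst P') - snd (fst P))) \<noteq> (0, 0)"
    using ne' by (auto simp: prod_eq_iff)
  have finQ: "finite Q" unfolding Q_def using nl b unfolding nonline_def by blast
  moreover have "infinite C" using nl by (simp add: nonline_def)
  ultimately have "card Q \<le> bez d 1" using line_bound[OF C b] unfolding Q_def by (metis Int_absorb)
  moreover have "q \<in> Q" if "(q, q') \<in> common_nbrs C P P'" for q q'
  proof -
    have "dist2 q (fst P) = dist2 q (fst P')" "q \<in> C" using that True by (auto simp: common_nbrs_def)
    then show ?thesis using bisector(1)[OF ne'] by (simp add: Q_def)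
  qed
  ultimately have "finite (common_nbrs C P P')" "card (common_nbrs C P P') \<le> bez d 1 * bez d 2"
    using common_nbrs_bound[OF C nc finQ] by blast+
  moreover have "bez d 1 * bez d 2 \<le> codegK d" by (simp add: codegK_def)
  ultimately show ?thesis using le_trans by blast
next
  case False
  have fd: "bideg_le f d" using C by (simp add: acurve_def)
  define x0 where "x0 = fst (snd P)" define y0 where "y0 = snd (snd P)"
  define v1 where "v1 = fst (snd P') - x0" define v2 where "v2 = snd (snd P') - y0"
  define n where "n = v1\<^sup>2 + v2\<^sup>2"
  have n: "n \<noteq> 0" using False by (auto simp: n_def v1_def v2_def x0_def y0_def sum_power2_eq_zero_iff prod_eq_iff)
  \<comment> \<open>Subtracting the two circle equations, X is the scalar product of q' - snd P with
    v = snd P' - snd P. The root s will be the component along the orthogonal vector, with X^2 + s^2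
    = n |q' - snd P|^2.\<close>
  define X where "X = (\<lambda>z w. of_real (1/2) * (dist2c (fst P) z w - dist2c (fst P') z w + of_real n))"
  define Xr where "Xr = (\<lambda>q. (dist2 q (fst P) - dist2 q (fst P') + n) / 2)"
  have rX: "rpoly 2 X" unfolding X_def by (intro rpoly_cmult rpoly_add rpoly_diff rpoly_dist2c rpoly_const)
  have Xq: "X (of_real (fst q)) (of_real (snd q)) = of_real (Xr q)" for q
    using pev_dist2c[of "fst P" q] pev_dist2c[of "fst P'" q] by (simp add: X_def Xr_def pev_def)
  define U where "U = (\<lambda>z w. of_real n * dist2c (fst P) z w - X z w * X z w)"
  have rU: "rpoly 4 U" unfolding U_def
    using rpoly_diff[OF rpoly_mono[OF rpoly_cmult[OF rpoly_dist2c[of "fst P"], of n]] rpoly_mult[OF rX rX]] by simp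
  have Uq: "U (of_real (fst q)) (of_real (snd q)) = of_real (n * dist2 q (fst P) - Xr q * Xr q)" for q
    using pev_dist2c[of "fst P" q] by (simp add: U_def Xq pev_def)
  have r: "rpoly 4 (\<lambda>z w. of_real x0 + of_real (v1 / n) * X z w)" "rpoly 4 (\<lambda>z w. of_real (- v2 / n))"
    "rpoly 4 (\<lambda>z w. of_real y0 + of_real (v2 / n) * X z w)" "rpoly 4 (\<lambda>z w. of_real (v1 / n))"
    by (intro rpoly_add rpoly_const rpoly_cmult rpoly_mono[OF rX]; simp)+
  have r1: "rpoly 4 (\<lambda>z w. 1)" using rpoly_const[of 4 1] by simp
  from eliminate_sqrt[OF fd r rU r1] obtain N where N: "rpoly (4 * (8 * d + 3)) N"
    "\<And>z w. N z w = 0 \<longleftrightarrow> (\<exists>s. s\<^sup>2 = U z w \<and> ceval f (of_real x0 + of_real (v1 / n) * X z w + s * of_real (- v2 / n))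
       (of_real y0 + of_real (v2 / n) * X z w + s * of_real (v1 / n)) = 0)" by auto
  show ?thesis
  proof (cases "\<forall>q\<in>C. pev N q = 0")
    case True
    have "\<exists>A B. ceval f A B = 0 \<and> dist2c (snd P) A B = of_real (dist2 q (fst P)) \<and> dist2c (snd P') A B = of_real (dist2 q (fst P'))"
      if q: "q \<in> C" for q
    proof -
      from True q have "pev N q = 0" by blast
      then obtain s where s: "s\<^sup>2 = of_real (n * dist2 q (fst P) - Xr q * Xr q)"
        "ceval f (of_real x0 + of_real (v1 / n) * of_real (Xr q) + s * of_real (- v2 / n))
          (of_real y0 + of_real (v2 / n) * of_real (Xr q) + s * of_real (v1 / n)) = 0"
        unfolding pev_def N(2) Uq Xq by blast
      define A where "A = of_real x0 + of_real (v1 / n) * of_real (Xr q) + s * of_real (- v2 / n)"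
      define B where "B = of_real y0 + of_real (v2 / n) * of_real (Xr q) + s * of_real (v1 / n)"
      define x where "x = complex_of_real (Xr q)"
      have nA: "of_real n * (A - of_real x0) = of_real v1 * x - s * of_real v2"
        using n by (simp add: A_def x_def algebra_simps)
      have nB: "of_real n * (B - of_real y0) = of_real v2 * x + s * of_real v1"
        using n by (simp add: B_def x_def algebra_simps)
      have "(of_real n)\<^sup>2 * dist2c (snd P) A B = (of_real n * (A - of_real x0))\<^sup>2 + (of_real n * (B - of_real y0))\<^sup>2"
        by (simp add: dist2c_def x0_def y0_def power2_eq_square algebra_simps)
      also have "\<dots> = of_real n * (x * x + s\<^sup>2)"
        unfolding nA nB by (simp add: n_def power2_eq_square algebra_simps)
      also have "\<dots> = (of_real n)\<^sup>2 * of_real (dist2 q (fst P))"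
        unfolding s(1) by (simp add: x_def power2_eq_square)
      finally have d1: "dist2c (snd P) A B = of_real (dist2 q (fst P))" using n by simp
      have "of_real n * dist2c (snd P') A B = of_real n * dist2c (snd P) A B
         - 2 * (of_real v1 * (of_real n * (A - of_real x0)) + of_real v2 * (of_real n * (B - of_real y0))) + of_real n * of_real n"
        by (simp add: dist2c_def x0_def y0_def v1_def v2_def n_def power2_eq_square algebra_simps)
      also have "\<dots> = of_real n * dist2c (snd P) A B - 2 * (of_real n * x) + of_real n * of_real n"
        unfolding nA nB by (simp add: n_def power2_eq_square algebra_simps)
      also have "\<dots> = of_real n * (of_real (dist2 q (fst P)) - 2 * x + of_real n)"
        unfolding d1 by (simp add: algebra_simps)
      also have "of_real (dist2 q (fst P)) - 2 * x + of_real n = of_real (dist2 q (fst P'))"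
        unfolding x_def Xr_def by simp
      finally have "dist2c (snd P') A B = of_real (dist2 q (fst P'))" using n by simp
      then show ?thesis using s(2) d1 unfolding A_def B_def by blast
    qed
    then show ?thesis using False unfolding cplx_related_def by blast
  next
    case Nz: False
    define Q where "Q = {q\<in>C. pev N q = 0}"
    have Q: "finite Q" "card Q \<le> bez d (4 * (8 * d + 3))" using bezout[OF C N(1)] Nz by (auto simp: Q_def)
    have "q \<in> Q" if "(q, q') \<in> common_nbrs C P P'" for q q'
    proof -
      from that have h: "q \<in> C" "q' \<in> C" "dist2 q (fst P) = dist2 q' (snd P)" "dist2 q (fst P') = dist2 q' (snd P')"
        by (auto simp: common_nbrs_def)
      define s where "s = v1 * (snd q' - y0) - v2 * (fst q' - x0)"
      have Xr: "Xr q = v1 * (fst q' - x0) + v2 * (snd q' - y0)"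
        unfolding Xr_def h by (simp add: dist2_def x0_def y0_def v1_def v2_def n_def power2_eq_square field_simps)
      have "s\<^sup>2 = n * dist2 q (fst P) - Xr q * Xr q"
        unfolding h(3) Xr s_def by (simp add: dist2_def x0_def y0_def n_def power2_eq_square algebra_simps)
      then have s2: "(of_real s)\<^sup>2 = complex_of_real (n * dist2 q (fst P) - Xr q * Xr q)" by (metis of_real_power)
      have "n * (x0 + v1 / n * Xr q + s * (- v2 / n)) = n * x0 + v1 * Xr q - s * v2" using n by (simp add: algebra_simps)
      also have "\<dots> = n * fst q'" unfolding Xr s_def n_def by (simp add: power2_eq_square algebra_simps)
      finally have a: "x0 + v1 / n * Xr q + s * (- v2 / n) = fst q'" using n by simp
      have "n * (y0 + v2 / n * Xr q + s * (v1 / n)) = n * y0 + v2 * Xr q + s * v1" using n by (simp add: algebra_simps)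
      also have "\<dots> = n * snd q'" unfolding Xr s_def n_def by (simp add: power2_eq_square algebra_simps)
      finally have b: "y0 + v2 / n * Xr q + s * (v1 / n) = snd q'" using n by simp
      have "ceval f (of_real (x0 + v1 / n * Xr q + s * (- v2 / n))) (of_real (y0 + v2 / n * Xr q + s * (v1 / n))) = 0"
        unfolding a b using h(2) acurve_mem[OF C] by (simp add: ceval_of_real)
      then have "pev N q = 0" unfolding pev_def N(2) Uq Xq
        using s2 by (intro exI[of _ "of_real s"]) (simp only: of_real_add of_real_mult)
      then show ?thesis using h(1) by (simp add: Q_def)
    qed
    then have "finite (common_nbrs C P P')" "card (common_nbrs C P P') \<le> bez d (4 * (8 * d + 3)) * bez d 2"
      using common_nbrs_bound[OF C nc Q] by blast+
    moreover have "bez d (4 * (8 * d + 3)) * bez d 2 \<le> codegK d" by (simp add: codegK_def)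
    ultimately show ?thesis using le_trans by blast
  qed
qed

lemma fiber_with_many_preimages:
  assumes "finite A" "g ` A \<subseteq> B" "finite B" "card B \<le> k" "card A > k * n"
  shows "\<exists>b. card {a\<in>A. g a = b} > n"
proof (rule ccontr)
  assume "\<not> ?thesis"
  then have le: "\<And>b. card {a\<in>A. g a = b} \<le> n" by (meson not_less)
  have "A = (\<Union>b\<in>B. {a\<in>A. g a = b})" using assms(2) by auto
  then have "card A \<le> (\<Sum>b\<in>B. card {a\<in>A. g a = b})" using card_UN_le[OF assms(3), of "\<lambda>b. {a\<in>A. g a = b}"] by simp
  also have "\<dots> \<le> card B * n" using sum_bounded_above[of B _ n] le by fastforce
  also have "\<dots> \<le> k * n" using assms(4) by simp
  finally show False using assms(5) by simp
qed

text \<open>One is added for the pair P itself, which is not compared with P.\<close>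

definition badK :: "nat \<Rightarrow> nat" where
  "badK d = fiberK d * (bez d 1 + 2) + 1"

text \<open>If too many pairs were related to \<open>P\<close> over the complex numbers, then, the complex fibres being
  bounded, infinitely many points \<open>q\<close> would share one partner \<open>q'\<close> for three of these pairs. Three such
  relations determine \<open>q'\<close> as an affine image of \<open>q\<close>.\<close>

lemma cplx_related_bound:
  assumes C: "acurve d f C" and nl: "nonline C" and C1: "acurve d f1 C1"
    and P: "fst P \<in> C1" "snd P \<in> C1" "\<not> central C (fst P)" "\<not> central C (snd P)" "\<not> moved C (fst P) (snd P)"
    and X: "finite X" "\<And>P'. P' \<in> X \<Longrightarrow> fst P' \<in> C1 \<and> snd P' \<in> C1 \<and> cplx_related f C P P'"
  shows "card X \<le> fiberK d * (bez d 1 + 2)"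
proof (rule ccontr)
  assume "\<not> card X \<le> fiberK d * (bez d 1 + 2)"
  then have big: "card X > fiberK d * (bez d 1 + 2)" by simp
  define Fib where "Fib = (\<lambda>q. {(A, B). ceval f A B = 0 \<and> dist2c (snd P) A B = of_real (dist2 q (fst P))})"
  \<comment> \<open>The pairs for which b serves as the partner of q. By pigeonhole over the complex
    fibre, some b serves many pairs.\<close>
  define I0 where "I0 = (\<lambda>q b. {P'\<in>X. b \<in> Fib q \<and> dist2c (snd P') (fst b) (snd b) = of_real (dist2 q (fst P'))})"
  have finI0: "finite (I0 q b)" for q b using X(1) by (simp add: I0_def)
  have "\<exists>b. card (I0 q b) > bez d 1 + 2"
    if q: "q \<in> C - {fst P}" for q
  proof -
    have pos: "dist2 q (fst P) > 0" using q dist2_nonneg[of q "fst P"] dist2_eq_0[of q "fst P"] by (auto simp: less_le)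
    have fib: "finite (Fib q)" "card (Fib q) \<le> fiberK d"
      unfolding Fib_def using complex_fiber_bound[OF C P(4) pos] by auto
    have "\<forall>P'\<in>X. \<exists>b. b \<in> Fib q \<and> dist2c (snd P') (fst b) (snd b) = of_real (dist2 q (fst P'))"
    proof
      fix P' assume "P' \<in> X"
      from X(2)[OF this] q obtain A B where "ceval f A B = 0"
        "dist2c (snd P) A B = of_real (dist2 q (fst P))" "dist2c (snd P') A B = of_real (dist2 q (fst P'))"
        unfolding cplx_related_def by blast
      then show "\<exists>b. b \<in> Fib q \<and> dist2c (snd P') (fst b) (snd b) = of_real (dist2 q (fst P'))"
        by (intro exI[of _ "(A, B)"]) (simp add: Fib_def)
    qed
    then obtain g where g: "\<And>P'. P' \<in> X \<Longrightarrow> g P' \<in> Fib q \<and> dist2c (snd P') (fst (g P')) (snd (g P')) = of_real (dist2 q (fst P'))"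
      by metis
    then have "g ` X \<subseteq> Fib q" by blast
    from fiber_with_many_preimages[OF X(1) this fib big] obtain b where b: "card {P'\<in>X. g P' = b} > bez d 1 + 2" by blast
    have "{P'\<in>X. g P' = b} \<subseteq> I0 q b" using g unfolding I0_def by blast
    from card_mono[OF finI0 this] b have "card (I0 q b) > bez d 1 + 2" by linarith
    then show ?thesis by blast
  qed
  then obtain b where b: "\<And>q. q \<in> C - {fst P} \<Longrightarrow>
      card (I0 q (b q)) > bez d 1 + 2"
    by metis
  define I where "I = (\<lambda>q. I0 q (b q))"
  have "infinite (C - {fst P})" using nl by (simp add: nonline_def)
  moreover have "finite (I ` (C - {fst P}))"
    by (rule finite_subset[of _ "Pow X"]) (use X(1) in \<open>auto simp: I_def I0_def\<close>)
  \<comment> \<open>X has finitely many subsets, so infinitely many q have the same set of pairs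
    served by their chosen partner.\<close>
  ultimately obtain q0 where q0: "q0 \<in> C - {fst P}" "infinite {q\<in>C - {fst P}. I q = I q0}"
    using pigeonhole_infinite by blast
  define Q where "Q = {q\<in>C - {fst P}. I q = I q0}"
  define J where "J = I q0"
  have Q: "infinite Q" "Q \<subseteq> C" using q0 by (auto simp: Q_def)
  have J: "J \<subseteq> X" "card J > bez d 1 + 2" using b[OF q0(1)] by (auto simp: J_def I_def I0_def)
  have finJ: "finite J" using J(1) X(1) finite_subset by blast
  have rel: "\<exists>A B. ceval f A B = 0 \<and> dist2c (snd P) A B = of_real (dist2 q (fst P)) \<and>
      (\<forall>P'\<in>J. dist2c (snd P') A B = of_real (dist2 q (fst P')))" if q: "q \<in> Q" for q
  proof -
    have Iq: "I q = J" using q by (simp add: Q_def J_def)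
    have "J \<noteq> {}" using J(2) by auto
    then have "b q \<in> Fib q" using Iq by (auto simp: I_def I0_def)
    moreover have "\<forall>P'\<in>J. dist2c (snd P') (fst (b q)) (snd (b q)) = of_real (dist2 q (fst P'))"
      using Iq by (auto simp: I_def I0_def)
    ultimately show ?thesis by (intro exI[of _ "fst (b q)"] exI[of _ "snd (b q)"]) (auto simp: Fib_def)
  qed
  \<comment> \<open>Two pairs with the same second point would put the infinite set Q on the
    bisector of their first points.\<close>
  have inj: "inj_on snd J"
  proof (rule inj_onI, rule ccontr)
    fix P1 P2 assume h: "P1 \<in> J" "P2 \<in> J" "snd P1 = snd P2" "P1 \<noteq> P2"
    then have ne: "fst P1 \<noteq> fst P2" by (auto simp: prod_eq_iff)
    have "dist2 q (fst P1) = dist2 q (fst P2)" if "q \<in> Q" for q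
      using rel[OF that] h by (metis of_real_eq_iff)
    then have "Q \<subseteq> C \<inter> line (2 * (fst (fst P2) - fst (fst P1))) (2 * (snd (fst P2) - snd (fst P1))) (dist2 (fst P1) (0, 0) - dist2 (fst P2) (0, 0))"
      using bisector(1)[OF ne] Q(2) by blast
    moreover have "(2 * (fst (fst P2) - fst (fst P1)), 2 * (snd (fst P2) - snd (fst P1))) \<noteq> (0, 0)"
      using ne by (auto simp: prod_eq_iff)
    ultimately show False using nl Q(1) finite_subset unfolding nonline_def by metis
  qed
  have ne0: "snd P' \<noteq> snd P" if "P' \<in> J" for P' using X(2) J(1) that unfolding cplx_related_def by fastforce
  define S where "S = snd ` J"
  have S: "card S > bez d 1 + 2" using J(2) card_image[OF inj] by (simp add: S_def)
  have SC: "S \<subseteq> C1" unfolding S_def using X(2) J(1) by blast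
  \<comment> \<open>If \<open>C1\<close> is a line, all centres are collinear and two further pairs
    suffice. Otherwise more than \<open>bez d 1\<close> points of \<open>C1\<close> do not fit on
    one line, so a noncollinear triple exists.\<close>
  have moved: "moved C (fst P) (snd P)"
  proof (cases "\<exists>a b c. (a, b) \<noteq> (0, 0) \<and> C1 = line a b c")
    case True
    then obtain a b' c where ab: "(a, b') \<noteq> (0, 0)" "C1 = line a b' c" by blast
    define x0 where "x0 = - a * c / (a\<^sup>2 + b'\<^sup>2)"
    define y0 where "y0 = - b' * c / (a\<^sup>2 + b'\<^sup>2)"
    define g where "g = (\<lambda>t. (x0 + b' * t, y0 - a * t))"
    have rg: "C1 = range g" using line_param(1)[OF ab(1), of c] ab(2) by (simp add: g_def x0_def y0_def)
    have "J \<noteq> {}" using J(2) by auto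
    then obtain P1 where P1: "P1 \<in> J" by blast
    have "\<not> J \<subseteq> {P1}" using J(2) finJ card_mono[of "{P1}" J] by auto
    then obtain P2 where P2: "P2 \<in> J" "P2 \<noteq> P1" by blast
    have d12: "snd P1 \<noteq> snd P2" using inj P1 P2 by (auto dest: inj_onD)
    have mem: "fst P1 \<in> C1" "snd P1 \<in> C1" "fst P2 \<in> C1" "snd P2 \<in> C1" using X(2) J(1) P1 P2 by blast+
    obtain s0 s0' s1 s1' s2 s2' where s: "fst P = g s0" "snd P = g s0'" "fst P1 = g s1" "snd P1 = g s1'" "fst P2 = g s2" "snd P2 = g s2'"
      using P(1,2) mem unfolding rg by blast
    have "moved C (g s0) (g s0')"
    proof (rule moved_of_three_collinear[OF C nl ab(1) Q g_def, of s0' s1' s2' s0 s1 s2])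
      show "s0' \<noteq> s1'" "s0' \<noteq> s2'" "s1' \<noteq> s2'" using ne0[OF P1] ne0[OF P2(1)] d12 s by auto
      fix q assume "q \<in> Q"
      from rel[OF this] P1 P2(1) show "\<exists>A B. ceval f A B = 0 \<and> dist2c (g s0') A B = of_real (dist2 q (g s0)) \<and>
        dist2c (g s1') A B = of_real (dist2 q (g s1)) \<and> dist2c (g s2') A B = of_real (dist2 q (g s2))"
        unfolding s(1,2)[symmetric] s(3-6)[symmetric] by blast
    qed
    then show ?thesis by (simp add: s)
  next
    case False
    then have nl1: "\<And>a b c. (a, b) \<noteq> (0, 0) \<Longrightarrow> card (C1 \<inter> line a b c) \<le> bez d 1 \<and> finite (C1 \<inter> line a b c)"
      using line_bound[OF C1] by blast
    have "J \<noteq> {}" using J(2) by auto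
    then obtain P1 where P1: "P1 \<in> J" by blast
    define v1 where "v1 = fst (snd P1) - fst (snd P)"
    define v2 where "v2 = snd (snd P1) - snd (snd P)"
    have v: "(v2, - v1) \<noteq> (0, 0)" using ne0[OF P1] by (auto simp: v1_def v2_def prod_eq_iff)
    define l where "l = line v2 (- v1) (v1 * snd (snd P) - v2 * fst (snd P))"
    have "\<not> S \<subseteq> l"
    proof
      assume "S \<subseteq> l"
      then have "S \<subseteq> C1 \<inter> l" using SC by blast
      then have "card S \<le> card (C1 \<inter> l)" using nl1[OF v] by (intro card_mono) (auto simp: l_def)
      then show False using S nl1[OF v] unfolding l_def by (meson le_trans not_less trans_le_add1)
    qed
    then have "\<exists>P2\<in>J. snd P2 \<notin> l" unfolding S_def by blast
    then obtain P2 where P2: "P2 \<in> J" "snd P2 \<notin> l" by blast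
    have det: "(fst (snd P1) - fst (snd P)) * (snd (snd P2) - snd (snd P)) - (snd (snd P1) - snd (snd P)) * (fst (snd P2) - fst (snd P)) \<noteq> 0"
      using P2(2) unfolding l_def line_def v1_def v2_def by (auto simp: case_prod_unfold algebra_simps)
    show ?thesis
    proof (rule moved_of_three_noncollinear[OF C nl _ Q det])
      show "\<And>\<rho>. \<not> C \<subseteq> circle (fst P) \<rho>" using P(3) unfolding central_def by blast
      fix q assume "q \<in> Q"
      from rel[OF this] P1 P2(1) show "\<exists>A B. ceval f A B = 0 \<and> dist2c (snd P) A B = of_real (dist2 q (fst P)) \<and>
        dist2c (snd P1) A B = of_real (dist2 q (fst P1)) \<and> dist2c (snd P2) A B = of_real (dist2 q (fst P2))"
        by blast
    qed
  qed
  then show False using P(5) by blast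
qed

lemma codegree_nonline:
  assumes C: "acurve d f C" and nl: "nonline C" and C1: "acurve d f1 C1"
    and P: "fst P \<in> C1" "snd P \<in> C1" "\<not> central C (fst P)" "\<not> central C (snd P)" "\<not> moved C (fst P) (snd P)"
    and X: "finite X" "X \<subseteq> C1 \<times> C1"
  shows "card {P'\<in>X. \<not> (finite (common_nbrs C P P') \<and> card (common_nbrs C P P') \<le> codegK d)} \<le> badK d"
proof -
  let ?B = "{P'\<in>X. \<not> (finite (common_nbrs C P P') \<and> card (common_nbrs C P P') \<le> codegK d)}"
  define B' where "B' = ?B - {P}"
  have "card B' \<le> fiberK d * (bez d 1 + 2)"
  proof (rule cplx_related_bound[OF C nl C1 P])
    show "finite B'" using X(1) by (simp add: B'_def)
    fix P' assume P': "P' \<in> B'"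
    then have "P' \<in> C1 \<times> C1" using X(2) by (auto simp: B'_def)
    moreover have "cplx_related f C P P'"
      using common_nbrs_dichotomy[OF C nl P(4), of P'] P' by (auto simp: B'_def)
    ultimately show "fst P' \<in> C1 \<and> snd P' \<in> C1 \<and> cplx_related f C P P'" by auto
  qed
  moreover have "card ?B \<le> card (insert P B')" using X(1) by (intro card_mono) (auto simp: B'_def)
  moreover have "finite B'" using X(1) by (simp add: B'_def)
  then have "card (insert P B') \<le> card B' + 1" by (simp add: card_insert_if)
  ultimately show ?thesis unfolding badK_def by linarith
qed

text \<open>Subtracting the equations of two circles with different centres leaves a line containing
  C.\<close>

lemma central_unique:
  assumes nl: "nonline C" and c: "central C z" "central C z'" shows "z = z'"
proof (rule ccontr)
  assume ne: "z \<noteq> z'"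
  from c obtain \<rho> \<rho>' where sub: "C \<subseteq> circle z \<rho>" "C \<subseteq> circle z' \<rho>'" unfolding central_def by blast
  have r: "dist2 q z = \<rho>" "dist2 q z' = \<rho>'" if "q \<in> C" for q using sub that by (auto simp: circle_def)
  show False
  proof (rule nonline_one_line[OF nl, of "2 * (fst z' - fst z)" "2 * (snd z' - snd z)" "dist2 z (0,0) - dist2 z' (0,0) - \<rho> + \<rho>'"])
    show "(2 * (fst z' - fst z), 2 * (snd z' - snd z)) \<noteq> (0, 0)" using ne by (auto simp: prod_eq_iff)
    fix x y assume "(x, y) \<in> C"
    from r(1)[OF this] r(2)[OF this]
    show "2 * (fst z' - fst z) * x + 2 * (snd z' - snd z) * y + (dist2 z (0, 0) - dist2 z' (0, 0) - \<rho> + \<rho>') = 0"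
      by (simp add: dist2_def power2_eq_square algebra_simps)
  qed
qed

lemma dist2_aff:
  assumes "a\<^sup>2 + c\<^sup>2 = 1" "b\<^sup>2 + d\<^sup>2 = 1" "a * b + c * d = 0"
  shows "dist2 (aff a b c d k l p) (aff a b c d k l q) = dist2 p q"
proof -
  have "dist2 (aff a b c d k l p) (aff a b c d k l q) = (a\<^sup>2 + c\<^sup>2) * (fst p - fst q)\<^sup>2 + (b\<^sup>2 + d\<^sup>2) * (snd p - snd q)\<^sup>2
     + 2 * (a * b + c * d) * ((fst p - fst q) * (snd p - snd q))"
    by (simp add: dist2_def aff_def power2_eq_square algebra_simps)
  then show ?thesis using assms by (simp add: dist2_def)
qed

text \<open>C is a full circle. Its image under the isometry is infinite and lies both in C and in a
  circle about the image of z, so the image of z is again the centre.\<close>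

lemma moved_fixes_center:
  assumes C: "acurve n f C" and nl: "nonline C" and cen: "central C z" and m: "moved C p p'"
  shows "dist2 p' z = dist2 p z"
proof -
  from m obtain a b c d k l where T: "a\<^sup>2 + c\<^sup>2 = 1" "b\<^sup>2 + d\<^sup>2 = 1" "a * b + c * d = 0"
    "aff a b c d k l p = p'" "\<And>q. q \<in> C \<Longrightarrow> aff a b c d k l q \<in> C" unfolding moved_def by blast
  define T where "T = aff a b c d k l"
  have iso: "dist2 (T q) (T r) = dist2 q r" for q r unfolding T_def by (rule dist2_aff[OF T(1-3)])
  from cen obtain \<rho> where "C \<subseteq> circle z \<rho>" unfolding central_def by blast
  then have \<rho>: "dist2 q z = \<rho>" if "q \<in> C" for q using that by (auto simp: circle_def)
  have "T q \<in> C \<inter> circle (T z) \<rho>" if "q \<in> C" for q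
    using \<rho>[OF that] iso[of q z] T(5)[OF that] by (simp add: circle_def T_def)
  then have "T ` C \<subseteq> C \<inter> circle (T z) \<rho>" by blast
  moreover have "inj_on T C"
  proof (rule inj_onI)
    fix q r assume "T q = T r"
    then have "dist2 q r = 0" using iso[of q r] dist2_eq_0 by metis
    then show "q = r" by simp
  qed
  from finite_imageD[OF _ this] have "infinite (T ` C)" using nl unfolding nonline_def by blast
  ultimately have "infinite (C \<inter> circle (T z) \<rho>)" using finite_subset by blast
  then have "C = circle (T z) \<rho>" using circle_bound[OF C] by blast
  then have "central C (T z)" unfolding central_def by blast
  then have "T z = z" using central_unique[OF nl _ cen] by blast
  then show ?thesis using iso[of p z] T(4) unfolding T_def by simp
qed

section \<open>Symmetries of a curve as complex affine maps\<close>

definition cpx :: "real \<times> real \<Rightarrow> complex" where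
  "cpx p = Complex (fst p) (snd p)"

lemma cpx_inj [simp]: "cpx p = cpx q \<longleftrightarrow> p = q"
  by (auto simp: cpx_def prod_eq_iff)

lemma dist2_cpx: "dist2 p q = (cmod (cpx p - cpx q))\<^sup>2"
  by (simp add: dist2_def cpx_def cmod_def)

text \<open>Orientation-preserving isometries taking C into itself, encoded by coefficients so that
  they can be counted and composed by arithmetic.\<close>

definition dirmaps :: "(real \<times> real) set \<Rightarrow> (complex \<times> complex) set" where
  "dirmaps C = {(\<alpha>, \<beta>). cmod \<alpha> = 1 \<and> (\<forall>q\<in>C. \<alpha> * cpx q + \<beta> \<in> cpx ` C)}"

definition oppmaps :: "(real \<times> real) set \<Rightarrow> (complex \<times> complex) set" where
  "oppmaps C = {(\<alpha>, \<beta>). cmod \<alpha> = 1 \<and> (\<forall>q\<in>C. \<alpha> * cnj (cpx q) + \<beta> \<in> cpx ` C)}"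

text \<open>Orthogonality leaves the determinant e = 1 or e = -1, which decides between a rotation
  and a reflection matrix.\<close>

lemma moved_cases:
  assumes "moved C p p'"
  shows "(\<exists>(\<alpha>, \<beta>)\<in>dirmaps C. cpx p' = \<alpha> * cpx p + \<beta>) \<or> (\<exists>(\<alpha>, \<beta>)\<in>oppmaps C. cpx p' = \<alpha> * cnj (cpx p) + \<beta>)"
proof -
  from assms obtain a b c d k l where T: "a\<^sup>2 + c\<^sup>2 = 1" "b\<^sup>2 + d\<^sup>2 = 1" "a * b + c * d = 0"
    "aff a b c d k l p = p'" "\<And>q. q \<in> C \<Longrightarrow> aff a b c d k l q \<in> C" unfolding moved_def by blast
  define e where "e = a * d - b * c"
  have b: "b = - e * c" "d = e * a"
  proof -
    have "b = b * (a\<^sup>2 + c\<^sup>2)" using T(1) by simp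
    also have "\<dots> = a * (a * b + c * d) - c * e" by (simp add: e_def power2_eq_square algebra_simps)
    finally show "b = - e * c" using T(3) by simp
    have "d = d * (a\<^sup>2 + c\<^sup>2)" using T(1) by simp
    also have "\<dots> = c * (a * b + c * d) + a * e" by (simp add: e_def power2_eq_square algebra_simps)
    finally show "d = e * a" using T(3) by simp
  qed
  have "e\<^sup>2 * (a\<^sup>2 + c\<^sup>2) = b\<^sup>2 + d\<^sup>2" unfolding b by (simp add: power2_eq_square algebra_simps)
  then have "e\<^sup>2 = 1" using T(1,2) by simp
  then have "e = 1 \<or> e = -1" by (simp add: power2_eq_1_iff)
  then show ?thesis
  proof
    assume e: "e = 1"
    have eq: "cpx (aff a b c d k l q) = Complex a c * cpx q + Complex k l" for q
      unfolding b e by (simp add: cpx_def aff_def complex_eq_iff)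
    have "(Complex a c, Complex k l) \<in> dirmaps C"
      unfolding dirmaps_def using T(1,5) by (auto simp: cmod_def simp flip: eq)
    moreover have "cpx p' = Complex a c * cpx p + Complex k l" unfolding eq[symmetric] T(4) ..
    ultimately show ?thesis by blast
  next
    assume e: "e = -1"
    have eq: "cpx (aff a b c d k l q) = Complex a c * cnj (cpx q) + Complex k l" for q
      unfolding b e by (simp add: cpx_def aff_def complex_eq_iff)
    have "(Complex a c, Complex k l) \<in> oppmaps C"
      unfolding oppmaps_def using T(1,5) by (auto simp: cmod_def simp flip: eq)
    moreover have "cpx p' = Complex a c * cnj (cpx p) + Complex k l" unfolding eq[symmetric] T(4) ..
    ultimately show ?thesis by blast
  qed
qed

text \<open>The orbit of a point under a nonzero translation would be an infinite collinear subset
  of C.\<close>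

lemma nonline_no_translation:
  assumes nl: "nonline C" and T: "\<And>q. q \<in> C \<Longrightarrow> cpx q + \<tau> \<in> cpx ` C" shows "\<tau> = 0"
proof (rule ccontr)
  assume "\<tau> \<noteq> 0"
  define s where "s = (Re \<tau>, Im \<tau>)"
  have s: "(snd s, - fst s) \<noteq> (0, 0)" using \<open>\<tau> \<noteq> 0\<close> by (auto simp: s_def complex_eq_iff)
  have step: "(fst q + fst s, snd q + snd s) \<in> C" if "q \<in> C" for q
  proof -
    have "cpx q + \<tau> = cpx (fst q + fst s, snd q + snd s)" by (simp add: cpx_def s_def complex_eq_iff)
    then show ?thesis using T[OF that] by auto
  qed
  obtain q where q: "q \<in> C" using nl unfolding nonline_def by (metis finite.emptyI ex_in_conv)
  define g where "g = (\<lambda>n::nat. (fst q + real n * fst s, snd q + real n * snd s))"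
  have g: "g n \<in> C" for n
  proof (induction n)
    case 0 then show ?case using q by (simp add: g_def)
  next
    case (Suc n) then show ?case using step[OF Suc] by (simp add: g_def algebra_simps)
  qed
  define L where "L = line (snd s) (- fst s) (fst s * snd q - snd s * fst q)"
  have "range g \<subseteq> C \<inter> L" using g by (auto simp: L_def line_def g_def algebra_simps)
  moreover have "finite (C \<inter> L)" using nl s unfolding nonline_def L_def by blast
  ultimately have "finite (range g)" using finite_subset by blast
  moreover have "inj g" using s by (auto simp: inj_def g_def)
  ultimately show False using finite_imageD by blast
qed

text \<open>The two compositions differ by a translation \<tau>. Inverses are not known to preserve
  C, so no commutator is formed: \<tau> carries the infinite subset ST(C) of C to TS(C), also in C.
  Bezout extends this to all of C, and a curve that is no line admits only \<tau> = 0.\<close>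

lemma dirmaps_commute:
  assumes C: "acurve n f C" and nl: "nonline C"
    and T: "(\<alpha>, \<beta>) \<in> dirmaps C" and S: "(\<gamma>, \<delta>) \<in> dirmaps C"
  shows "\<alpha> * \<delta> + \<beta> = \<gamma> * \<beta> + \<delta>"
proof -
  define \<tau> where "\<tau> = (\<alpha> * \<delta> + \<beta>) - (\<gamma> * \<beta> + \<delta>)"
  define R where "R = (\<lambda>q. \<gamma> * (\<alpha> * cpx q + \<beta>) + \<delta>)"
  have R1: "R q \<in> cpx ` C" if q: "q \<in> C" for q
  proof -
    from T q obtain r where r: "r \<in> C" "\<alpha> * cpx q + \<beta> = cpx r" unfolding dirmaps_def by blast
    then show ?thesis using S unfolding dirmaps_def R_def r(2) by blast
  qed
  have R2: "R q + \<tau> \<in> cpx ` C" if q: "q \<in> C" for q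
  proof -
    from S q obtain r where r: "r \<in> C" "\<gamma> * cpx q + \<delta> = cpx r" unfolding dirmaps_def by blast
    have eq: "R q + \<tau> = \<alpha> * (\<gamma> * cpx q + \<delta>) + \<beta>" by (simp add: R_def \<tau>_def algebra_simps)
    show ?thesis unfolding eq r(2) using T r(1) unfolding dirmaps_def by blast
  qed
  define Q where "Q = {q\<in>C. cpx q \<in> R ` C}"
  have RQ: "R ` C = cpx ` Q"
  proof
    show "cpx ` Q \<subseteq> R ` C" unfolding Q_def by blast
    show "R ` C \<subseteq> cpx ` Q"
    proof
      fix w assume w: "w \<in> R ` C"
      with R1 obtain q where q: "q \<in> C" "w = cpx q" by blast
      show "w \<in> cpx ` Q" by (rule image_eqI[of _ _ q]) (use w q in \<open>simp_all add: Q_def\<close>)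
    qed
  qed
  have "inj_on R C"
  proof -
    have "\<alpha> \<noteq> 0" "\<gamma> \<noteq> 0" using S T by (auto simp: dirmaps_def)
    then show ?thesis by (simp add: inj_on_def R_def)
  qed
  from finite_imageD[OF _ this] have "infinite (R ` C)" using nl unfolding nonline_def by blast
  then have Q: "infinite Q" unfolding RQ using finite_imageI by blast
  have QC: "Q \<subseteq> C" by (auto simp: Q_def)
  have eq: "cpx (aff 1 0 0 1 (Re \<tau>) (Im \<tau>) q) = cpx q + \<tau>" for q
    by (simp add: cpx_def aff_def complex_eq_iff)
  have "eval_at f (aff 1 0 0 1 (Re \<tau>) (Im \<tau>) q) = 0" if "q \<in> Q" for q
  proof -
    from that obtain q0 where q0: "q0 \<in> C" "cpx q = R q0" by (auto simp: Q_def)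
    from R2[OF q0(1)] obtain r where r: "r \<in> C" "R q0 + \<tau> = cpx r" by blast
    have "aff 1 0 0 1 (Re \<tau>) (Im \<tau>) q = r" using r(2) q0(2) by (simp flip: cpx_inj add: eq)
    then show ?thesis using r(1) acurve_mem[OF C] by blast
  qed
  from aff_stays_in_curve[OF C Q QC this] have "cpx q + \<tau> \<in> cpx ` C" if "q \<in> C" for q
    using that unfolding eq[symmetric] by blast
  then have "\<tau> = 0" by (rule nonline_no_translation[OF nl])
  then show ?thesis by (simp add: \<tau>_def)
qed

text \<open>A map with \<alpha> \<noteq> 1 has a unique fixed point c, and the maps commuting with
  it fix c. Each is then determined by the image of one point q \<noteq> c, which lies on C and on a
  circle about c. If every \<alpha> is 1, only the identity remains.\<close>

lemma dirmaps_bound: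
  assumes C: "acurve n f C" and nl: "nonline C" and nc: "\<And>z. \<not> central C z"
  shows "finite (dirmaps C) \<and> card (dirmaps C) \<le> bez n 2 + 1"
proof (cases "\<exists>\<alpha> \<beta>. (\<alpha>, \<beta>) \<in> dirmaps C \<and> \<alpha> \<noteq> 1")
  case False
  have "dirmaps C \<subseteq> {(1, 0)}"
  proof
    fix x assume x: "x \<in> dirmaps C"
    obtain \<alpha> \<beta> where ab: "x = (\<alpha>, \<beta>)" by force
    have a: "\<alpha> = 1" using False x ab by blast
    have "cpx q + \<beta> \<in> cpx ` C" if "q \<in> C" for q using x that by (auto simp: ab a dirmaps_def)
    then have "\<beta> = 0" by (rule nonline_no_translation[OF nl])
    then show "x \<in> {(1, 0)}" by (simp add: ab a)
  qed
  from finite_subset[OF this] card_mono[OF _ this] show ?thesis by simp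
next
  case True
  then obtain \<alpha> \<beta> where T: "(\<alpha>, \<beta>) \<in> dirmaps C" "\<alpha> \<noteq> 1" by blast
  define c where "c = \<beta> / (1 - \<alpha>)"
  define z where "z = (Re c, Im c)"
  have cz: "cpx z = c" by (simp add: z_def cpx_def)
  have \<beta>: "\<beta> = c * (1 - \<alpha>)" using T(2) by (simp add: c_def)
  have fix_c: "\<delta> = c * (1 - \<gamma>)" if "(\<gamma>, \<delta>) \<in> dirmaps C" for \<gamma> \<delta>
  proof -
    have "(1 - \<alpha>) * \<delta> = (1 - \<alpha>) * (c * (1 - \<gamma>))"
      using dirmaps_commute[OF C nl T(1) that] unfolding \<beta> by (simp add: algebra_simps)
    then show ?thesis using T(2) by simp
  qed
  have "\<not> C \<subseteq> {z}" using nl unfolding nonline_def by (meson finite.emptyI finite_insert finite_subset)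
  then obtain q where q: "q \<in> C" "q \<noteq> z" by blast
  have nz: "cpx q - c \<noteq> 0" using q(2) unfolding cz[symmetric] by simp
  have "\<not> (C = circle z (dist2 q z) \<and> dist2 q z > 0)" using nc[of z] unfolding central_def by blast
  then have fin: "finite (C \<inter> circle z (dist2 q z))" "card (C \<inter> circle z (dist2 q z)) \<le> bez n 2"
    using circle_bound[OF C, of z "dist2 q z"] by auto
  define \<Phi> where "\<Phi> = (\<lambda>(\<gamma>, \<delta>). \<gamma> * cpx q + \<delta>)"
  have form: "\<Phi> (\<gamma>, \<delta>) = c + \<gamma> * (cpx q - c)" if "(\<gamma>, \<delta>) \<in> dirmaps C" for \<gamma> \<delta>
    unfolding \<Phi>_def using fix_c[OF that] by (simp add: algebra_simps)
  have inj: "inj_on \<Phi> (dirmaps C)"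
  proof (rule inj_onI)
    fix x y assume xy: "x \<in> dirmaps C" "y \<in> dirmaps C" "\<Phi> x = \<Phi> y"
    obtain g1 d1 g2 d2 where e: "x = (g1, d1)" "y = (g2, d2)" by force
    have "g1 = g2" using xy(3) form[OF xy(1)[unfolded e]] form[OF xy(2)[unfolded e]] nz unfolding e by simp
    then show "x = y" using fix_c[OF xy(1)[unfolded e]] fix_c[OF xy(2)[unfolded e]] by (simp add: e)
  qed
  have img: "\<Phi> ` dirmaps C \<subseteq> cpx ` (C \<inter> circle z (dist2 q z))"
  proof
    fix w assume "w \<in> \<Phi> ` dirmaps C"
    then obtain \<gamma> \<delta> where gd: "(\<gamma>, \<delta>) \<in> dirmaps C" "w = \<Phi> (\<gamma>, \<delta>)" by force
    from gd(1) q(1) obtain r where r: "r \<in> C" "\<Phi> (\<gamma>, \<delta>) = cpx r" unfolding dirmaps_def \<Phi>_def by auto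
    have "cpx r - c = \<gamma> * (cpx q - c)" using form[OF gd(1)] r(2) by simp
    then have "dist2 r z = dist2 q z" unfolding dist2_cpx cz using gd(1) by (simp add: norm_mult dirmaps_def)
    then show "w \<in> cpx ` (C \<inter> circle z (dist2 q z))" using r gd(2) by (auto simp: circle_def)
  qed
  have finI: "finite (cpx ` (C \<inter> circle z (dist2 q z)))" using fin(1) by simp
  have finD: "finite (dirmaps C)" using finite_imageD[OF finite_subset[OF img finI] inj] .
  have "card (dirmaps C) = card (\<Phi> ` dirmaps C)" using card_image[OF inj] by simp
  also have "\<dots> \<le> card (cpx ` (C \<inter> circle z (dist2 q z)))" by (rule card_mono[OF finI img])
  also have "\<dots> \<le> card (C \<inter> circle z (dist2 q z))" by (rule card_image_le[OF fin(1)])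
  finally show ?thesis using fin(2) finD by simp
qed

text \<open>Composition with one fixed orientation-reversing map embeds these maps into
  \<open>dirmaps\<close>.\<close>

lemma oppmaps_bound:
  assumes D: "finite (dirmaps C)" "card (dirmaps C) \<le> k"
  shows "finite (oppmaps C) \<and> card (oppmaps C) \<le> k"
proof (cases "oppmaps C = {}")
  case False
  then obtain \<alpha>0 \<beta>0 where R: "(\<alpha>0, \<beta>0) \<in> oppmaps C" by force
  then have a0: "\<alpha>0 \<noteq> 0" by (auto simp: oppmaps_def)
  define \<Phi> where "\<Phi> = (\<lambda>(\<alpha>, \<beta>). (\<alpha> * cnj \<alpha>0, \<alpha> * cnj \<beta>0 + \<beta>))"
  have inj: "inj_on \<Phi> (oppmaps C)" using a0 by (auto simp: inj_on_def \<Phi>_def)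
  have img: "\<Phi> ` oppmaps C \<subseteq> dirmaps C"
  proof
    fix x assume "x \<in> \<Phi> ` oppmaps C"
    then obtain \<alpha> \<beta> where ab: "(\<alpha>, \<beta>) \<in> oppmaps C" "x = \<Phi> (\<alpha>, \<beta>)" by force
    have "\<alpha> * cnj \<alpha>0 * cpx q + (\<alpha> * cnj \<beta>0 + \<beta>) \<in> cpx ` C" if q: "q \<in> C" for q
    proof -
      from R q obtain r where r: "r \<in> C" "\<alpha>0 * cnj (cpx q) + \<beta>0 = cpx r" unfolding oppmaps_def by blast
      have "\<alpha> * cnj \<alpha>0 * cpx q + (\<alpha> * cnj \<beta>0 + \<beta>) = \<alpha> * cnj (\<alpha>0 * cnj (cpx q) + \<beta>0) + \<beta>"
        by (simp add: algebra_simps)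
      also have "\<dots> = \<alpha> * cnj (cpx r) + \<beta>" unfolding r(2) ..
      finally have eq: "\<alpha> * cnj \<alpha>0 * cpx q + (\<alpha> * cnj \<beta>0 + \<beta>) = \<alpha> * cnj (cpx r) + \<beta>" .
      show ?thesis unfolding eq using ab(1) r(1) unfolding oppmaps_def by blast
    qed
    moreover have "cmod (\<alpha> * cnj \<alpha>0) = 1" using ab(1) R by (simp add: oppmaps_def norm_mult)
    ultimately show "x \<in> dirmaps C" unfolding ab(2) \<Phi>_def dirmaps_def by simp
  qed
  show ?thesis using finite_imageD[OF finite_subset[OF img D(1)] inj] card_inj_on_le[OF inj img D(1)] D(2) by simp
qed auto

definition movedK :: "nat \<Rightarrow> nat" where
  "movedK d = 2 * (bez d 2 + 1)"

text \<open>A circle C has infinitely many symmetries, but they keep the distance of p to the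
  centre, so p' lies on a concentric circle, which is not \<open>C1\<close>. Otherwise the
  symmetries themselves are finite in number.\<close>

lemma moved_bound:
  assumes C: "acurve d f C" and nl: "nonline C" and C1: "acurve d f1 C1"
    and ncc: "\<And>z \<rho> \<rho>'. \<not> (\<rho> > 0 \<and> \<rho>' > 0 \<and> C1 = circle z \<rho> \<and> C = circle z \<rho>')"
  shows "finite {p'\<in>C1. moved C p p'}" "card {p'\<in>C1. moved C p p'} \<le> movedK d"
proof -
  have "finite {p'\<in>C1. moved C p p'} \<and> card {p'\<in>C1. moved C p p'} \<le> movedK d"
  proof (cases "\<exists>z. central C z")
    case True
    then obtain z where z: "central C z" by blast
    then obtain \<rho> where "C \<subseteq> circle z \<rho>" unfolding central_def by blast
    then have "infinite (C \<inter> circle z \<rho>)" using nl unfolding nonline_def by (simp add: Int_absorb2)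
    then have cz: "C = circle z \<rho>" "\<rho> > 0" using circle_bound[OF C] by blast+
    have sub: "{p'\<in>C1. moved C p p'} \<subseteq> C1 \<inter> circle z (dist2 p z)"
      using moved_fixes_center[OF C nl z] unfolding circle_def by blast
    have "\<not> (C1 = circle z (dist2 p z) \<and> dist2 p z > 0)" using ncc cz by blast
    then have "finite (C1 \<inter> circle z (dist2 p z))" "card (C1 \<inter> circle z (dist2 p z)) \<le> bez d 2"
      using circle_bound[OF C1] by blast+
    then show ?thesis using finite_subset[OF sub] card_mono[OF _ sub] by (auto simp: movedK_def)
  next
    case False
    then have D: "finite (dirmaps C)" "card (dirmaps C) \<le> bez d 2 + 1"
      using dirmaps_bound[OF C nl] by auto
    have O: "finite (oppmaps C)" "card (oppmaps C) \<le> bez d 2 + 1" using oppmaps_bound[OF D] by auto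
    define A where "A = (\<lambda>(\<alpha>, \<beta>). \<alpha> * cpx p + \<beta>) ` dirmaps C"
    define B where "B = (\<lambda>(\<alpha>, \<beta>). \<alpha> * cnj (cpx p) + \<beta>) ` oppmaps C"
    have AB: "finite (A \<union> B)" "card (A \<union> B) \<le> movedK d"
    proof -
      show "finite (A \<union> B)" using D O by (simp add: A_def B_def)
      have "card A \<le> bez d 2 + 1" unfolding A_def using card_image_le[OF D(1)] D(2) le_trans by blast
      moreover have "card B \<le> bez d 2 + 1" unfolding B_def using card_image_le[OF O(1)] O(2) le_trans by blast
      ultimately show "card (A \<union> B) \<le> movedK d" using card_Un_le[of A B] by (simp add: movedK_def)
    qed
    have sub: "cpx ` {p'\<in>C1. moved C p p'} \<subseteq> A \<union> B"
    proof
      fix w assume "w \<in> cpx ` {p'\<in>C1. moved C p p'}"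
      then obtain p' where p': "w = cpx p'" "moved C p p'" by blast
      from moved_cases[OF p'(2)] show "w \<in> A \<union> B" unfolding A_def B_def p'(1) by auto
    qed
    have inj: "inj_on cpx {p'\<in>C1. moved C p p'}" by (auto simp: inj_on_def)
    show ?thesis using finite_imageD[OF finite_subset[OF sub AB(1)] inj] card_inj_on_le[OF inj sub AB(1)] AB(2) by simp
  qed
  then show "finite {p'\<in>C1. moved C p p'}" "card {p'\<in>C1. moved C p p'} \<le> movedK d" by auto
qed

text \<open>A hyperbola with e \<noteq> 0 contains no line: solving the linear equation for one
  variable leaves a nonzero quadratic in the other.\<close>

lemma hyperbola_line:
  fixes e \<alpha> \<alpha>' \<kappa> :: real
  assumes "e \<noteq> 0" "(\<alpha>, \<alpha>') \<noteq> (0, 0)"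
  shows "finite {(w, w'). w\<^sup>2 - w'\<^sup>2 = e \<and> 2 * \<alpha> * w - 2 * \<alpha>' * w' = \<kappa>} \<and>
    card {(w, w'). w\<^sup>2 - w'\<^sup>2 = e \<and> 2 * \<alpha> * w - 2 * \<alpha>' * w' = \<kappa>} \<le> 2" (is "finite ?W \<and> _")
proof -
  have "\<exists>(p :: real poly) g. p \<noteq> 0 \<and> degree p \<le> 2 \<and> ?W \<subseteq> g ` {x. poly p x = 0}"
  proof (cases "\<alpha> = 0")
    case False
    define p where "p = [:\<kappa>\<^sup>2 - 4 * \<alpha>\<^sup>2 * e, 4 * \<kappa> * \<alpha>', 4 * \<alpha>'\<^sup>2 - 4 * \<alpha>\<^sup>2:]"
    have "p \<noteq> 0"
    proof
      assume "p = 0"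
      then have 0: "\<kappa>\<^sup>2 - 4 * \<alpha>\<^sup>2 * e = 0" "4 * \<kappa> * \<alpha>' = 0" "4 * \<alpha>'\<^sup>2 - 4 * \<alpha>\<^sup>2 = 0" by (simp_all add: p_def)
      then have "\<alpha>' \<noteq> 0" using False by auto
      then have "\<kappa> = 0" using 0 by simp
      then show False using 0 False assms(1) by simp
    qed
    moreover have "degree p \<le> 2" by (simp add: p_def)
    moreover have "?W \<subseteq> (\<lambda>w'. ((\<kappa> + 2 * \<alpha>' * w') / (2 * \<alpha>), w')) ` {x. poly p x = 0}"
    proof
      fix x assume "x \<in> ?W"
      then obtain w w' where w: "x = (w, w')" "w\<^sup>2 - w'\<^sup>2 = e" "2 * \<alpha> * w - 2 * \<alpha>' * w' = \<kappa>" by blast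
      have w2: "2 * \<alpha> * w = \<kappa> + 2 * \<alpha>' * w'" using w(3) by simp
      have "(2 * \<alpha> * w)\<^sup>2 = 4 * \<alpha>\<^sup>2 * (e + w'\<^sup>2)" using w(2) by (simp add: power_mult_distrib algebra_simps)
      then have "poly p w' = 0" unfolding w2 by (simp add: p_def power2_eq_square algebra_simps)
      moreover have "w = (\<kappa> + 2 * \<alpha>' * w') / (2 * \<alpha>)" using w2 False by (simp add: field_simps)
      ultimately show "x \<in> (\<lambda>w'. ((\<kappa> + 2 * \<alpha>' * w') / (2 * \<alpha>), w')) ` {x. poly p x = 0}"
        by (intro image_eqI[of _ _ w']) (simp_all add: w(1))
    qed
    ultimately show ?thesis
      by (intro exI[of _ p] exI[of _ "\<lambda>w'. ((\<kappa> + 2 * \<alpha>' * w') / (2 * \<alpha>), w')"] conjI)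
  next
    case True
    then have a': "\<alpha>' \<noteq> 0" using assms(2) by simp
    define v where "v = - \<kappa> / (2 * \<alpha>')"
    define p where "p = [:- (e + v\<^sup>2), 0, 1:]"
    have "p \<noteq> 0" "degree p \<le> 2" by (simp_all add: p_def)
    moreover have "?W \<subseteq> (\<lambda>w. (w, v)) ` {x. poly p x = 0}"
    proof
      fix x assume "x \<in> ?W"
      then obtain w w' where w: "x = (w, w')" "w\<^sup>2 - w'\<^sup>2 = e" "2 * \<alpha> * w - 2 * \<alpha>' * w' = \<kappa>" by blast
      have w': "w' = v" using w(3) True a' by (simp add: v_def field_simps)
      have "poly p w = 0" using w(2) unfolding w' by (simp add: p_def power2_eq_square)
      then show "x \<in> (\<lambda>w. (w, v)) ` {x. poly p x = 0}" by (intro image_eqI[of _ _ w]) (simp_all add: w(1) w')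
    qed
    ultimately show ?thesis by (intro exI[of _ p] exI[of _ "\<lambda>w. (w, v)"] conjI)
  qed
  then obtain p :: "real poly" and g where pg: "p \<noteq> 0" "degree p \<le> 2" "?W \<subseteq> g ` {x. poly p x = 0}" by blast
  have fin: "finite (g ` {x. poly p x = 0})" using poly_roots_finite[OF pg(1)] by simp
  have "card ?W \<le> card (g ` {x. poly p x = 0})" by (rule card_mono[OF fin pg(3)])
  also have "\<dots> \<le> card {x. poly p x = 0}" by (rule card_image_le[OF poly_roots_finite[OF pg(1)]])
  also have "\<dots> \<le> 2" using card_poly_roots_bound[OF pg(1)] pg(2) by simp
  finally show ?thesis using finite_subset[OF pg(3) fin] by blast
qed

text \<open>On a line, |pq| = |p'q'| is a hyperbola in the positions of q and q', nondegenerate when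
  p and p' have different distances to the line. A second such equation differs from it by a linear
  one, which is nontrivial when the projections of the two pairs differ.\<close>

lemma common_nbrs_line:
  assumes ab: "(a, b) \<noteq> (0, 0)" and C: "C = line a b c"
  defines "h \<equiv> \<lambda>p. a * fst p + b * snd p + c" and "u \<equiv> \<lambda>p. b * fst p - a * snd p"
  assumes e: "(h (fst P))\<^sup>2 \<noteq> (h (snd P))\<^sup>2"
    and ne: "u (fst P') \<noteq> u (fst P) \<or> u (snd P') \<noteq> u (snd P)"
  shows "finite (common_nbrs C P P') \<and> card (common_nbrs C P P') \<le> 2"
proof -
  define n where "n = a\<^sup>2 + b\<^sup>2"
  have n: "n \<noteq> 0" using ab by (simp add: n_def sum_power2_eq_zero_iff)
  have d: "n * dist2 q p = (u q - u p)\<^sup>2 + (h p)\<^sup>2" if "q \<in> C" for q p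
  proof -
    have "h q = 0" using that by (simp add: C line_def h_def case_prod_unfold)
    moreover have "n * dist2 q p = (u q - u p)\<^sup>2 + (h q - h p)\<^sup>2"
      by (simp add: n_def dist2_def u_def h_def power2_eq_square algebra_simps)
    ultimately show ?thesis by simp
  qed
  define E where "E = (h (snd P))\<^sup>2 - (h (fst P))\<^sup>2"
  define E' where "E' = (h (snd P'))\<^sup>2 - (h (fst P'))\<^sup>2"
  define \<alpha> where "\<alpha> = u (fst P) - u (fst P')"
  define \<alpha>' where "\<alpha>' = u (snd P) - u (snd P')"
  define \<kappa> where "\<kappa> = E' - E - \<alpha>\<^sup>2 + \<alpha>'\<^sup>2"
  define W where "W = {(w, w'). w\<^sup>2 - w'\<^sup>2 = E \<and> 2 * \<alpha> * w - 2 * \<alpha>' * w' = \<kappa>}"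
  have "E \<noteq> 0" "(\<alpha>, \<alpha>') \<noteq> (0, 0)" using e ne by (auto simp: E_def \<alpha>_def \<alpha>'_def)
  then have W: "finite W" "card W \<le> 2" using hyperbola_line[of E \<alpha> \<alpha>' \<kappa>] by (auto simp: W_def)
  define \<Phi> where "\<Phi> = (\<lambda>(q, q'). (u q - u (fst P), u q' - u (snd P)))"
  have uinj: "q = r" if "q \<in> C" "r \<in> C" "u q = u r" for q r
  proof -
    have "n * dist2 q r = 0" using d[OF that(1), of r] that by (simp add: C line_def h_def case_prod_unfold)
    then show ?thesis using n by simp
  qed
  have inj: "inj_on \<Phi> (common_nbrs C P P')"
  proof (rule inj_onI)
    fix x y assume xy: "x \<in> common_nbrs C P P'" "y \<in> common_nbrs C P P'" "\<Phi> x = \<Phi> y"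
    obtain q q' r r' where x: "x = (q, q')" and y: "y = (r, r')" by (cases x, cases y)
    have "u q = u r" "u q' = u r'" using xy(3) by (simp_all add: x y \<Phi>_def)
    moreover have "q \<in> C" "q' \<in> C" "r \<in> C" "r' \<in> C" using xy(1,2) by (simp_all add: x y common_nbrs_def)
    ultimately show "x = y" using uinj by (simp add: x y)
  qed
  have img: "\<Phi> ` common_nbrs C P P' \<subseteq> W"
  proof
    fix w assume "w \<in> \<Phi> ` common_nbrs C P P'"
    then obtain x where x: "x \<in> common_nbrs C P P'" "w = \<Phi> x" by blast
    obtain q q' where qq: "x = (q, q')" by (cases x)
    have h: "q \<in> C" "q' \<in> C" "dist2 q (fst P) = dist2 q' (snd P)" "dist2 q (fst P') = dist2 q' (snd P')"
      using x(1) by (simp_all add: qq common_nbrs_def)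
    have 1: "(u q - u (fst P))\<^sup>2 + (h (fst P))\<^sup>2 = (u q' - u (snd P))\<^sup>2 + (h (snd P))\<^sup>2"
      using h(3) d[OF h(1), of "fst P"] d[OF h(2), of "snd P"] by simp
    have 2: "(u q - u (fst P'))\<^sup>2 + (h (fst P'))\<^sup>2 = (u q' - u (snd P'))\<^sup>2 + (h (snd P'))\<^sup>2"
      using h(4) d[OF h(1), of "fst P'"] d[OF h(2), of "snd P'"] by simp
    have "(u q - u (fst P))\<^sup>2 - (u q' - u (snd P))\<^sup>2 = E" using 1 by (simp add: E_def)
    moreover have "2 * \<alpha> * (u q - u (fst P)) - 2 * \<alpha>' * (u q' - u (snd P)) = \<kappa>"
      using 1 2 unfolding \<kappa>_def E_def E'_def \<alpha>_def \<alpha>'_def by (simp add: power2_eq_square algebra_simps)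
    ultimately show "w \<in> W" by (simp add: x(2) qq \<Phi>_def W_def)
  qed
  show ?thesis using finite_imageD[OF finite_subset[OF img W(1)] inj] card_inj_on_le[OF inj img W(1)] W(2) by simp
qed

text \<open>These three constants serve both cases of \<open>codegree\<close>, whether or not the
  second curve is a line.\<close>

definition exK :: "nat \<Rightarrow> nat" where "exK d = movedK d + 2 * bez d 1"
definition comK :: "nat \<Rightarrow> nat" where "comK d = codegK d + 2"
definition brK :: "nat \<Rightarrow> nat" where "brK d = badK d + bez d 1 * bez d 1"

text \<open>Exc marks the pairs to be discarded: those related by a symmetry of \<open>C2\<close>
  or, if \<open>C2\<close> is a line, those equidistant from it. In the line case, excluding
  parallel lines bounds the equidistant points of \<open>C1\<close>, and excluding orthogonal lines
  bounds the points of \<open>C1\<close> with a given projection. Excluding concentric circles is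
  what \<open>moved_bound\<close> needs.\<close>

lemma codegree:
  assumes C1: "acurve d f1 C1" and C2: "acurve d f2 C2"
    and np: "\<not> parallel_lines C1 C2" and no: "\<not> orthogonal_lines C1 C2" and ncc: "\<not> concentric_circles C1 C2"
  shows "\<exists>Exc. (\<forall>p. Exc p p \<and> finite {p'\<in>C1. Exc p p'} \<and> card {p'\<in>C1. Exc p p'} \<le> exK d) \<and>
    (\<forall>P\<in>C1 \<times> C1. \<not> central C2 (fst P) \<and> \<not> central C2 (snd P) \<and> \<not> Exc (fst P) (snd P) \<longrightarrow>
      (\<forall>X. finite X \<and> X \<subseteq> C1 \<times> C1 \<longrightarrow>
         card {P'\<in>X. \<not> (finite (common_nbrs C2 P P') \<and> card (common_nbrs C2 P P') \<le> comK d)} \<le> brK d))"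
proof (cases "\<exists>a b c. (a, b) \<noteq> (0, 0) \<and> C2 = line a b c")
  case False
  then have nl: "nonline C2" using acurve_nonline[OF C2] by blast
  have cc: "\<not> (\<rho> > 0 \<and> \<rho>' > 0 \<and> C1 = circle z \<rho> \<and> C2 = circle z \<rho>')" for z \<rho> \<rho>'
  proof
    assume h: "\<rho> > 0 \<and> \<rho>' > 0 \<and> C1 = circle z \<rho> \<and> C2 = circle z \<rho>'"
    have "circle_with_center (circle z r) z" if "r > 0" for r
      unfolding circle_with_center_def circle_def dist2_def using that
      by (intro exI[of _ "sqrt r"]) auto
    then show False using h ncc unfolding concentric_circles_def by blast
  qed
  show ?thesis
  proof (intro exI[of _ "moved C2"] conjI allI ballI impI)
    fix p
    show "moved C2 p p" unfolding moved_def
      by (rule exI[of _ 1], rule exI[of _ 0], rule exI[of _ 0], rule exI[of _ 1], rule exI[of _ 0], rule exI[of _ 0])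
         (simp add: aff_def)
    show "finite {p'\<in>C1. moved C2 p p'}" by (rule moved_bound(1)[OF C2 nl C1 cc])
    have "card {p'\<in>C1. moved C2 p p'} \<le> movedK d" by (rule moved_bound(2)[OF C2 nl C1 cc])
    then show "card {p'\<in>C1. moved C2 p p'} \<le> exK d" by (simp add: exK_def)
  next
    fix P X assume P: "P \<in> C1 \<times> C1" "\<not> central C2 (fst P) \<and> \<not> central C2 (snd P) \<and> \<not> moved C2 (fst P) (snd P)"
      and X: "finite X \<and> X \<subseteq> C1 \<times> C1"
    have P1: "fst P \<in> C1" "snd P \<in> C1" using P(1) by auto
    have le: "codegK d \<le> comK d" "badK d \<le> brK d" by (simp_all add: comK_def brK_def)
    have "{P'\<in>X. \<not> (finite (common_nbrs C2 P P') \<and> card (common_nbrs C2 P P') \<le> comK d)}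
      \<subseteq> {P'\<in>X. \<not> (finite (common_nbrs C2 P P') \<and> card (common_nbrs C2 P P') \<le> codegK d)}"
      using le(1) le_trans by blast
    then have "card {P'\<in>X. \<not> (finite (common_nbrs C2 P P') \<and> card (common_nbrs C2 P P') \<le> comK d)}
      \<le> card {P'\<in>X. \<not> (finite (common_nbrs C2 P P') \<and> card (common_nbrs C2 P P') \<le> codegK d)}"
      using X by (intro card_mono) auto
    also have "\<dots> \<le> badK d" using P(2) X by (intro codegree_nonline[OF C2 nl C1 P1]) auto
    finally show "card {P'\<in>X. \<not> (finite (common_nbrs C2 P P') \<and> card (common_nbrs C2 P P') \<le> comK d)} \<le> brK d"
      using le(2) by simp
  qed
next
  case True
  then obtain a b c where ab: "(a, b) \<noteq> (0, 0)" and L: "C2 = line a b c" by blast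
  have l2: "line_with_normal C2 a b" unfolding line_with_normal_def L line_def using ab by blast
  have par: "C1 \<noteq> line a b c'" for c'
  proof
    assume "C1 = line a b c'"
    then have "line_with_normal C1 a b" unfolding line_with_normal_def line_def using ab by blast
    then have "parallel_lines C1 C2" using l2 unfolding parallel_lines_def
      by (intro exI[of _ a] exI[of _ b]) auto
    then show False using np by blast
  qed
  have ba: "(b, - a) \<noteq> (0, 0)" using ab by auto
  have orth: "C1 \<noteq> line b (- a) c'" for c'
  proof
    assume "C1 = line b (- a) c'"
    then have "line_with_normal C1 b (- a)" unfolding line_with_normal_def line_def using ba by blast
    moreover have "b * a + (- a) * b = 0" by simp
    ultimately have "orthogonal_lines C1 C2" using l2 unfolding orthogonal_lines_def by blast
    then show False using no by blast
  qed
  have par': "finite (C1 \<inter> line a b c') \<and> card (C1 \<inter> line a b c') \<le> bez d 1" for c' using line_bound[OF C1 ab] par by blast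
  have orth': "finite (C1 \<inter> line b (-a) c') \<and> card (C1 \<inter> line b (-a) c') \<le> bez d 1" for c' using line_bound[OF C1 ba] orth by blast
  define h where "h = (\<lambda>p. a * fst p + b * snd p + c)"
  define u where "u = (\<lambda>p::real\<times>real. b * fst p - a * snd p)"
  show ?thesis
  proof (intro exI[of _ "\<lambda>p p'. (h p)\<^sup>2 = (h p')\<^sup>2"] conjI allI ballI impI)
    fix p
    show "(h p)\<^sup>2 = (h p)\<^sup>2" ..
    have sub: "{p'\<in>C1. (h p)\<^sup>2 = (h p')\<^sup>2} \<subseteq> (C1 \<inter> line a b (c - h p)) \<union> (C1 \<inter> line a b (c + h p))"
    proof
      fix p' assume "p' \<in> {p'\<in>C1. (h p)\<^sup>2 = (h p')\<^sup>2}"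
      then have "p' \<in> C1" "h p = h p' \<or> h p = - h p'" by (simp_all add: power2_eq_iff)
      then show "p' \<in> (C1 \<inter> line a b (c - h p)) \<union> (C1 \<inter> line a b (c + h p))"
        by (cases p') (simp add: line_def h_def, linarith)
    qed
    have fin: "finite ((C1 \<inter> line a b (c - h p)) \<union> (C1 \<inter> line a b (c + h p)))" using par' by simp
    show "finite {p'\<in>C1. (h p)\<^sup>2 = (h p')\<^sup>2}" by (rule finite_subset[OF sub fin])
    have "card {p'\<in>C1. (h p)\<^sup>2 = (h p')\<^sup>2} \<le> card ((C1 \<inter> line a b (c - h p)) \<union> (C1 \<inter> line a b (c + h p)))"
      by (rule card_mono[OF fin sub])
    also have "\<dots> \<le> card (C1 \<inter> line a b (c - h p)) + card (C1 \<inter> line a b (c + h p))" by (rule card_Un_le)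
    also have "\<dots> \<le> bez d 1 + bez d 1" using par' by (intro add_mono) auto
    finally show "card {p'\<in>C1. (h p)\<^sup>2 = (h p')\<^sup>2} \<le> exK d" by (simp add: exK_def)
  next
    fix P X assume P: "P \<in> C1 \<times> C1" "\<not> central C2 (fst P) \<and> \<not> central C2 (snd P) \<and> (h (fst P))\<^sup>2 \<noteq> (h (snd P))\<^sup>2"
      and X: "finite X \<and> X \<subseteq> C1 \<times> C1"
    define S where "S = (C1 \<inter> line b (-a) (- u (fst P))) \<times> (C1 \<inter> line b (-a) (- u (snd P)))"
    have S: "finite S" "card S \<le> bez d 1 * bez d 1"
      unfolding S_def card_cartesian_product using orth' by (simp, intro mult_le_mono) auto
    have "{P'\<in>X. \<not> (finite (common_nbrs C2 P P') \<and> card (common_nbrs C2 P P') \<le> comK d)} \<subseteq> S"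
    proof
      fix P' assume P': "P' \<in> {P'\<in>X. \<not> (finite (common_nbrs C2 P P') \<and> card (common_nbrs C2 P P') \<le> comK d)}"
      have "u (fst P') = u (fst P)" "u (snd P') = u (snd P)"
      proof -
        have "\<not> (u (fst P') \<noteq> u (fst P) \<or> u (snd P') \<noteq> u (snd P))"
        proof
          assume ne: "u (fst P') \<noteq> u (fst P) \<or> u (snd P') \<noteq> u (snd P)"
          have "finite (common_nbrs C2 P P') \<and> card (common_nbrs C2 P P') \<le> 2"
            by (rule common_nbrs_line[OF ab L]) (use P(2) ne in \<open>simp_all add: h_def u_def\<close>)
          then show False using P' by (simp add: comK_def)
        qed
        then show "u (fst P') = u (fst P)" "u (snd P') = u (snd P)" by auto
      qed
      moreover have "fst P' \<in> C1" "snd P' \<in> C1" using P' X by auto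
      moreover have "r \<in> line b (- a) (- u s)" if "u r = u s" for r s
        using that by (simp add: line_def u_def case_prod_unfold)
      ultimately show "P' \<in> S" unfolding S_def by (simp add: mem_Times_iff)
    qed
    from card_mono[OF S(1) this] S(2)
    show "card {P'\<in>X. \<not> (finite (common_nbrs C2 P P') \<and> card (common_nbrs C2 P P') \<le> comK d)} \<le> brK d"
      by (simp add: brK_def)
  qed
qed

section \<open>Counting incident pairs\<close>

lemma card_fibers_Cauchy_Schwarz:
  assumes "finite G" "finite K" "\<kappa> ` G \<subseteq> K"
  shows "(card G)\<^sup>2 \<le> card K * card {(x, y). x \<in> G \<and> y \<in> G \<and> \<kappa> x = \<kappa> y}"
proof -
  define F where "F = (\<lambda>k. {x\<in>G. \<kappa> x = k})"
  have finF: "finite (F k)" for k using assms(1) by (simp add: F_def)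
  have "card G = card (\<Union>k\<in>K. F k)" by (rule arg_cong[of _ _ card]) (use assms(3) in \<open>auto simp: F_def\<close>)
  also have "\<dots> = (\<Sum>k\<in>K. card (F k))"
    using assms(2) finF by (intro card_UN_disjoint) (auto simp: F_def)
  finally have G: "card G = (\<Sum>k\<in>K. card (F k))" .
  have "{(x, y). x \<in> G \<and> y \<in> G \<and> \<kappa> x = \<kappa> y} = (\<Union>k\<in>K. F k \<times> F k)"
    using assms(3) by (auto simp: F_def)
  also have "card \<dots> = (\<Sum>k\<in>K. card (F k \<times> F k))"
    using assms(2) finF by (intro card_UN_disjoint) (auto simp: F_def)
  finally have T: "card {(x, y). x \<in> G \<and> y \<in> G \<and> \<kappa> x = \<kappa> y} = (\<Sum>k\<in>K. (card (F k))\<^sup>2)"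
    by (simp add: card_cartesian_product power2_eq_square)
  have "(real (card G))\<^sup>2 \<le> (\<Sum>k\<in>K. (real (card (F k)))\<^sup>2) * card K"
    using sum_squared_le_sum_of_squares[of "\<lambda>k. real (card (F k))" K] assms(2) unfolding G by simp
  also have "\<dots> = real (card K * card {(x, y). x \<in> G \<and> y \<in> G \<and> \<kappa> x = \<kappa> y})"
    unfolding T by simp
  finally have "real ((card G)\<^sup>2) \<le> real (card K * card {(x, y). x \<in> G \<and> y \<in> G \<and> \<kappa> x = \<kappa> y})" by simp
  then show ?thesis by (simp only: of_nat_le_iff)
qed

text \<open>The Kovari--Sos--Turan count with exceptions. Pairs of edges with a common end in Y are
  sorted by their ends P, P' in X: an ordinary P' contributes at most s, and each of the at most L
  exceptional ones at most the degree of P, which sums to L card T.\<close>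

lemma edges_bound_few_common:
  assumes X: "finite X" and Y: "finite Y" and T: "T \<subseteq> X \<times> Y"
    and cod: "\<And>P. P \<in> X \<Longrightarrow> card {P'\<in>X. card {Q. (P, Q) \<in> T \<and> (P', Q) \<in> T} > s} \<le> L"
  shows "(card T)\<^sup>2 \<le> card Y * (s * (card X)\<^sup>2 + L * card T)"
proof -
  have finT: "finite T" using finite_subset[OF T] X Y by simp
  define N where "N = (\<lambda>P. {Q. (P, Q) \<in> T})"
  have finN: "finite (N P)" for P unfolding N_def using finite_subset[of "{Q. (P, Q) \<in> T}" Y] Y T by auto
  have NN: "N P \<inter> N P' = {Q. (P, Q) \<in> T \<and> (P', Q) \<in> T}" for P P' by (auto simp: N_def)
  define W where "W = {(x, y). x \<in> T \<and> y \<in> T \<and> snd x = snd y}"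
  define S where "S = (SIGMA P:X. SIGMA P':X. N P \<inter> N P')"
  have finS: "finite S" unfolding S_def using X finN by (intro finite_SigmaI) auto
  have "card W \<le> card S"
  proof (rule card_inj_on_le[OF _ _ finS])
    show "inj_on (\<lambda>(x, y). (fst x, fst y, snd x)) W" by (auto simp: inj_on_def W_def)
    show "(\<lambda>(x, y). (fst x, fst y, snd x)) ` W \<subseteq> S" using T by (auto simp: W_def S_def N_def)
  qed
  also have "card S = (\<Sum>P\<in>X. \<Sum>P'\<in>X. card (N P \<inter> N P'))"
    unfolding S_def using X finN by simp
  also have "\<dots> \<le> (\<Sum>P\<in>X. s * card X + L * card (N P))"
  proof (rule sum_mono)
    fix P assume P: "P \<in> X"
    define B where "B = {P'\<in>X. card (N P \<inter> N P') > s}"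
    have B: "B \<subseteq> X" "card B \<le> L" using cod[OF P] unfolding B_def NN by auto
    have finB: "finite B" using B(1) X finite_subset by blast
    have "(\<Sum>P'\<in>X. card (N P \<inter> N P')) = (\<Sum>P'\<in>X - B. card (N P \<inter> N P')) + (\<Sum>P'\<in>B. card (N P \<inter> N P'))"
      by (rule sum.subset_diff[OF B(1) X])
    also have "(\<Sum>P'\<in>X - B. card (N P \<inter> N P')) \<le> card (X - B) * s"
      by (rule order_trans[OF sum_bounded_above[of "X - B" _ s]]) (auto simp: B_def not_less)
    also have "card (X - B) \<le> card X" using X by (intro card_mono) auto
    also have "(\<Sum>P'\<in>B. card (N P \<inter> N P')) \<le> card B * card (N P)"
      using sum_bounded_above[of B "\<lambda>P'. card (N P \<inter> N P')" "card (N P)"] finN by (auto intro: card_mono)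
    also have "card B * card (N P) \<le> L * card (N P)" using B(2) by simp
    finally show "(\<Sum>P'\<in>X. card (N P \<inter> N P')) \<le> s * card X + L * card (N P)" by (simp add: mult.commute)
  qed
  also have "\<dots> = s * (card X)\<^sup>2 + L * (\<Sum>P\<in>X. card (N P))"
    by (simp add: sum.distrib sum_distrib_left power2_eq_square)
  also have "(\<Sum>P\<in>X. card (N P)) = card T"
  proof -
    have "T = (SIGMA P:X. N P)" using T by (auto simp: N_def)
    then show ?thesis using X finN by simp
  qed
  finally have W: "card W \<le> s * (card X)\<^sup>2 + L * card T" .
  have "(card T)\<^sup>2 \<le> card Y * card W"
    unfolding W_def by (rule card_fibers_Cauchy_Schwarz[OF finT Y]) (use T in auto)
  also have "\<dots> \<le> card Y * (s * (card X)\<^sup>2 + L * card T)" using W by simp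
  finally show ?thesis .
qed

text \<open>Blocks of h consecutive ranks. With h = card A div r + 1 the product r h exceeds card A,
  so r labels suffice.\<close>

lemma ordered_blocks:
  fixes A :: "real set"
  assumes A: "finite A" and r: "r \<ge> 1"
  shows "\<exists>\<beta>. (\<forall>a\<in>A. \<forall>a'\<in>A. a \<le> a' \<longrightarrow> \<beta> a \<le> \<beta> a') \<and> \<beta> ` A \<subseteq> {..<r} \<and>
     (\<forall>i::nat. card {a\<in>A. \<beta> a = i} \<le> card A div r + 1)"
proof -
  define h where "h = card A div r + 1"
  define rank where "rank = (\<lambda>a. card {x\<in>A. x < a})"
  have mono: "rank a \<le> rank a'" if "a \<le> a'" for a a'
    unfolding rank_def using A that by (intro card_mono) auto
  have strict: "rank a < rank a'" if "a \<in> A" "a < a'" for a a'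
    unfolding rank_def using A that by (intro psubset_card_mono) (auto intro: less_trans)
  have inj: "inj_on rank A"
  proof (rule inj_onI, rule ccontr)
    fix a a' assume "a \<in> A" "a' \<in> A" "rank a = rank a'" "a \<noteq> a'"
    then show False using strict[of a a'] strict[of a' a] by (cases "a < a'") auto
  qed
  have rk: "rank a < card A" if "a \<in> A" for a
    unfolding rank_def using A that by (intro psubset_card_mono) auto
  have "card A < r * h"
  proof -
    have "card A = r * (card A div r) + card A mod r" by simp
    moreover have "card A mod r < r" using r by simp
    ultimately show ?thesis unfolding h_def by (simp only: distrib_left)
  qed
  then have lt: "rank a div h < r" if "a \<in> A" for a
    using rk[OF that] by (intro less_mult_imp_div_less) linarith
  have "card {a\<in>A. rank a div h = i} \<le> h" for i
  proof -
    have "card {a\<in>A. rank a div h = i} = card (rank ` {a\<in>A. rank a div h = i})"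
      by (rule card_image[symmetric], rule inj_on_subset[OF inj]) auto
    also have "\<dots> \<le> card {i * h..<i * h + h}"
    proof (rule card_mono)
      show "rank ` {a\<in>A. rank a div h = i} \<subseteq> {i * h..<i * h + h}"
      proof
        fix k assume "k \<in> rank ` {a\<in>A. rank a div h = i}"
        then have k: "k div h = i" by auto
        have "k = h * (k div h) + k mod h" by simp
        moreover have "k mod h < h" by (simp add: h_def)
        ultimately show "k \<in> {i * h..<i * h + h}" unfolding k by (simp only: mult.commute[of i] atLeastLessThan_iff) linarith
      qed
    qed simp
    finally show ?thesis by simp
  qed
  then show ?thesis using mono lt unfolding h_def[symmetric]
    by (intro exI[of _ "\<lambda>a. rank a div h"]) (auto intro: div_le_mono)
qed

lemma card_block_pairs:
  assumes "finite A" "\<And>i. card {a\<in>A. \<beta> a = i} \<le> h"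
  shows "finite {(a, a'). a \<in> A \<and> a' \<in> A \<and> \<beta> a = \<beta> a'}" "card {(a, a'). a \<in> A \<and> a' \<in> A \<and> \<beta> a = \<beta> a'} \<le> card A * h"
proof -
  have eq: "{(a, a'). a \<in> A \<and> a' \<in> A \<and> \<beta> a = \<beta> a'} = (SIGMA a:A. {a'\<in>A. \<beta> a' = \<beta> a})" by auto
  show "finite {(a, a'). a \<in> A \<and> a' \<in> A \<and> \<beta> a = \<beta> a'}" unfolding eq using assms(1) by auto
  have "card (SIGMA a:A. {a'\<in>A. \<beta> a' = \<beta> a}) = (\<Sum>a\<in>A. card {a'\<in>A. \<beta> a' = \<beta> a})" using assms(1) by simp
  also have "\<dots> \<le> card A * h" using sum_bounded_above[of A _ h] assms(2) by fastforce
  finally show "card {(a, a'). a \<in> A \<and> a' \<in> A \<and> \<beta> a = \<beta> a'} \<le> card A * h" unfolding eq .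
qed

text \<open>t counts edges, X and Y the pairs inside blocks. If the exceptional term L t dominates,
  then t \<le> 2 L Y, and the lower bound for t gives the first alternative. Otherwise t^2 \<le> 2 s
  X^2 Y; with the lower bound for t this bounds n^2 r from above, and the lower bound for r gives
  the second.\<close>

lemma distances_tradeoff:
  fixes m n D r t X Y K E M s L :: real
  assumes pos: "m > 0" "n > 0" "D > 0" "r > 0" and ge1: "K \<ge> 1" "E \<ge> 1" "M \<ge> 1" "s \<ge> 1" "L \<ge> 1"
    and XY: "0 \<le> X" "X * r \<le> 2 * m\<^sup>2" "0 \<le> Y" "Y * r \<le> 2 * n\<^sup>2" and t0: "t > 0"
    and rlow: "m * n \<le> 16 * K * E * M * D * r"
    and t: "(m * n)\<^sup>2 \<le> 8 * D * K * r * t"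
    and kst: "t\<^sup>2 \<le> Y * (s * X\<^sup>2 + L * t)"
  shows "m\<^sup>2 \<le> 32 * K * L * D \<or> m * n ^ 3 \<le> 16384 * s * K ^ 3 * E * M * D ^ 3"
proof (cases "s * X\<^sup>2 \<le> L * t")
  case True
  have "t\<^sup>2 \<le> Y * (L * t + L * t)"
    by (rule order_trans[OF kst]) (intro mult_left_mono add_right_mono True XY)
  then have "t * t \<le> (2 * L * Y) * t" by (simp add: power2_eq_square algebra_simps)
  then have "t \<le> 2 * L * Y" using t0 by simp
  then have "t * r \<le> 2 * L * (Y * r)" using pos by (simp add: mult.assoc[symmetric])
  also have "\<dots> \<le> 2 * L * (2 * n\<^sup>2)" using XY ge1 by (intro mult_left_mono) auto
  finally have "8 * D * K * (t * r) \<le> 8 * D * K * (2 * L * (2 * n\<^sup>2))" using pos ge1 by (intro mult_left_mono) auto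
  then have "(m * n)\<^sup>2 \<le> 8 * D * K * (2 * L * (2 * n\<^sup>2))" using t by (simp add: algebra_simps)
  then have "m\<^sup>2 * n\<^sup>2 \<le> (32 * K * L * D) * n\<^sup>2" by (simp add: power_mult_distrib algebra_simps)
  then show ?thesis using pos by simp
next
  case False
  have "t\<^sup>2 \<le> Y * (s * X\<^sup>2 + s * X\<^sup>2)"
    by (rule order_trans[OF kst]) (use False XY in \<open>intro mult_left_mono add_left_mono, auto\<close>)
  then have "t\<^sup>2 * r ^ 3 \<le> Y * (s * X\<^sup>2 + s * X\<^sup>2) * r ^ 3" using pos by (intro mult_right_mono) auto
  also have "\<dots> = 2 * s * ((Y * r) * (X * r)\<^sup>2)" by (simp add: power2_eq_square power3_eq_cube)
  also have "\<dots> \<le> 2 * s * ((2 * n\<^sup>2) * (2 * m\<^sup>2)\<^sup>2)"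
    using ge1 by (intro mult_left_mono mult_mono[OF XY(4) power_mono[OF XY(2)]]) (use XY pos in auto)
  finally have t3: "t\<^sup>2 * r ^ 3 \<le> 16 * s * n\<^sup>2 * m ^ 4" by (simp add: power_mult_distrib)
  have "((m * n)\<^sup>2)\<^sup>2 * r \<le> (8 * D * K * r * t)\<^sup>2 * r" using pos t by (intro mult_right_mono power_mono) auto
  also have "\<dots> = 64 * D\<^sup>2 * K\<^sup>2 * (t\<^sup>2 * r ^ 3)" by (simp add: power_mult_distrib power2_eq_square power3_eq_cube)
  also have "\<dots> \<le> 64 * D\<^sup>2 * K\<^sup>2 * (16 * s * n\<^sup>2 * m ^ 4)" using t3 by (intro mult_left_mono) auto
  finally have "(m ^ 4 * n\<^sup>2) * (n\<^sup>2 * r) \<le> (m ^ 4 * n\<^sup>2) * (1024 * s * D\<^sup>2 * K\<^sup>2)"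
    by (simp add: power_mult_distrib power2_eq_square power4_eq_xxxx ac_simps)
  then have nr: "n\<^sup>2 * r \<le> 1024 * s * D\<^sup>2 * K\<^sup>2"
    by (rule mult_left_le_imp_le) (use pos in simp)
  have "m * n ^ 3 = (m * n) * n\<^sup>2" by (simp add: power2_eq_square power3_eq_cube)
  also have "\<dots> \<le> (16 * K * E * M * D * r) * n\<^sup>2" using rlow by (intro mult_right_mono) auto
  also have "\<dots> = 16 * K * E * M * D * (n\<^sup>2 * r)" by simp
  also have "\<dots> \<le> 16 * K * E * M * D * (1024 * s * D\<^sup>2 * K\<^sup>2)" using nr pos ge1 by (intro mult_left_mono) auto
  also have "\<dots> = 16384 * s * K ^ 3 * E * M * D ^ 3" by (simp add: power2_eq_square power3_eq_cube)
  finally show ?thesis by blast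
qed

text \<open>Monotonicity is what makes the intervals spanned by different blocks disjoint.\<close>

definition monotone_blocks :: "nat \<Rightarrow> real set \<Rightarrow> (real \<Rightarrow> nat) \<Rightarrow> bool" where
  "monotone_blocks r A \<beta> \<longleftrightarrow> (\<forall>a\<in>A. \<forall>a'\<in>A. a \<le> a' \<longrightarrow> \<beta> a \<le> \<beta> a') \<and> \<beta> ` A \<subseteq> {..<r}"

section \<open>The counting argument, separated from geometry\<close>

lemma card_le_fibers:
  assumes "finite B" "finite \<Delta>" "h ` B \<subseteq> \<Delta>" "\<And>\<delta>. card {b\<in>B. h b = \<delta>} \<le> M"
  shows "card B \<le> card \<Delta> * M"
proof -
  have "card B \<le> card (\<Union>\<delta>\<in>\<Delta>. {b\<in>B. h b = \<delta>})"
    using assms(1-3) by (intro card_mono finite_UN_I) auto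
  also have "\<dots> \<le> (\<Sum>\<delta>\<in>\<Delta>. card {b\<in>B. h b = \<delta>})" using assms(2) by (rule card_UN_le)
  also have "\<dots> \<le> card \<Delta> * M" using sum_bounded_above[of \<Delta> "\<lambda>\<delta>. card {b\<in>B. h b = \<delta>}" M] assms(4) by simp
  finally show ?thesis .
qed

text \<open>F stands for the squared distance in arc parameters. The first alternative covers values
  of D so large that the chosen number r of blocks could drop below 1.\<close>

lemma few_level_boxes_imp_many_values:
  fixes F :: "real \<Rightarrow> real \<Rightarrow> real" and A B :: "real set" and K E M s L k0 :: nat
  assumes A: "finite A" "A \<noteq> {}" and B: "finite B" "B \<noteq> {}"
    and ge1: "K \<ge> 1" "E \<ge> 1" "M \<ge> 1" "s \<ge> 1" "L \<ge> 1"
    and row: "\<And>a \<delta>. a \<in> A \<Longrightarrow> card {b\<in>B. F a b = \<delta>} \<le> M"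
    and col: "\<And>b \<delta>. b \<in> B \<Longrightarrow> card {a\<in>A. F a b = \<delta>} \<le> M"
    and Bad: "finite Bad" "card Bad \<le> k0" and big: "card B \<ge> 2 * k0 * M"
    and box: "\<And>r \<beta>1 \<beta>2 \<delta>. \<delta> \<notin> Bad \<Longrightarrow> monotone_blocks r A \<beta>1 \<Longrightarrow> monotone_blocks r B \<beta>2 \<Longrightarrow> r \<ge> 1 \<Longrightarrow>
       card ((\<lambda>(a, b). (\<beta>1 a, \<beta>2 b)) ` {(a, b). a \<in> A \<and> b \<in> B \<and> F a b = \<delta>}) \<le> K * r"
    and exc: "\<And>a. a \<in> A \<Longrightarrow> card {a'\<in>A. Exc a a'} \<le> E"
    and cod: "\<And>a a'. a \<in> A \<Longrightarrow> a' \<in> A \<Longrightarrow> \<not> Exc a a' \<Longrightarrow>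
       card {P\<in>A \<times> A. card {Q\<in>B \<times> B. F a (fst Q) = F a' (snd Q) \<and> F (fst P) (fst Q) = F (snd P) (snd Q)} > s} \<le> L"
    and D: "D = card ((\<lambda>(a, b). F a b) ` (A \<times> B))" and m: "m = card A" and n: "n = card B"
  shows "real m * real n \<le> 8 * real K * real E * real M * real D \<or> (real m)\<^sup>2 \<le> 32 * real K * real L * real D \<or>
    real m * real n ^ 3 \<le> 16384 * real s * real K ^ 3 * real E * real M * real D ^ 3"
proof (cases "real m * real n \<le> 8 * real K * real E * real M * real D")
  case False
  define \<Delta> where "\<Delta> = (\<lambda>(a, b). F a b) ` (A \<times> B)"
  have fin\<Delta>: "finite \<Delta>" unfolding \<Delta>_def using A B by simp
  have m0: "m > 0" and n0: "n > 0" using A B m n by (auto simp: card_gt_0_iff)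
  have D0: "D > 0" unfolding D using A B by (auto simp: card_gt_0_iff)
  have fib_n: "n \<le> D * M"
  proof -
    from A obtain a where a: "a \<in> A" by blast
    have "card B \<le> card \<Delta> * M"
      by (rule card_le_fibers[OF B(1) fin\<Delta> _ row[OF a]]) (use a in \<open>auto simp: \<Delta>_def\<close>)
    then show ?thesis by (simp add: n D \<Delta>_def)
  qed
  have fib_m: "m \<le> D * M"
  proof -
    from B obtain b where b: "b \<in> B" by blast
    have "card A \<le> card \<Delta> * M"
      by (rule card_le_fibers[OF A(1) fin\<Delta> _ col[OF b]]) (use b in \<open>auto simp: \<Delta>_def\<close>)
    then show ?thesis by (simp add: m D \<Delta>_def)
  qed
  \<comment> \<open>At most m n E M quadruples are discarded as exceptional. Since r q \<le> m n,
    they account for at most half of (m n)^2 in the lower bound for the edges: the 8 is the 4 from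
    squaring \<open>G2\<close>, times 2.\<close>
  define q where "q = 8 * K * E * M * D"
  define r where "r = (m * n) div q"
  have q0: "q > 0" using ge1 D0 by (simp add: q_def)
  have "real q < real (m * n)" using False by (simp add: q_def)
  then have qmn: "q < m * n" by (simp only: of_nat_less_iff)
  have r1: "r \<ge> 1" using qmn q0 by (simp add: r_def div_greater_zero_iff Suc_le_eq)
  have rq: "r * q \<le> m * n" unfolding r_def by simp
  have rlow: "m * n \<le> 2 * (r * q)"
  proof -
    have "m * n = r * q + (m * n) mod q" unfolding r_def by simp
    moreover have "(m * n) mod q < q" using q0 by simp
    moreover have "q \<le> r * q" using r1 by simp
    ultimately show ?thesis by linarith
  qed
  \<comment> \<open>Each of the D values is taken at most M times in a row or column, so m and n are
    at most D M \<le> q. This yields r \<le> m and r \<le> n, which keeps the blocks as small as 2m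
    / r and 2n / r.\<close>
  have DMq: "D * M \<le> q" using ge1 by (simp add: q_def mult.commute)
  have rm: "r \<le> m"
  proof -
    have "r * n \<le> r * q" using fib_n DMq by simp
    also note rq
    finally show ?thesis using n0 by simp
  qed
  have rn: "r \<le> n"
  proof -
    have "r * m \<le> r * q" using fib_m DMq by simp
    also note rq
    finally show ?thesis using m0 by simp
  qed
  define G where "G = {(a, b). a \<in> A \<and> b \<in> B \<and> F a b \<notin> Bad}"
  have GAB: "G \<subseteq> A \<times> B" by (auto simp: G_def)
  have finG: "finite G" using finite_subset[OF GAB] A B by simp
  \<comment> \<open>Bad values use up at most m k0 M pairs, which \<open>big\<close> makes at most
    half of all.\<close>
  have G2: "m * n \<le> 2 * card G"
  proof -
    have "card (A \<times> B - G) \<le> card (SIGMA a:A. {b\<in>B. F a b \<in> Bad})"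
      using A B Bad by (intro card_mono finite_SigmaI) (auto simp: G_def)
    also have "\<dots> = (\<Sum>a\<in>A. card {b\<in>B. F a b \<in> Bad})"
      using A B Bad by simp
    also have "\<dots> \<le> card A * (k0 * M)"
    proof -
      have "card {b\<in>B. F a b \<in> Bad} \<le> k0 * M" if a: "a \<in> A" for a
      proof -
        have "card {b\<in>B. F a b \<in> Bad} \<le> card Bad * M"
        proof (rule card_le_fibers[OF _ Bad(1), of _ "F a"])
          fix \<delta> show "card {b\<in>{b\<in>B. F a b \<in> Bad}. F a b = \<delta>} \<le> M"
            by (rule order_trans[OF card_mono row[OF a, of \<delta>]]) (use B in auto)
        qed (use B in auto)
        also have "\<dots> \<le> k0 * M" using Bad(2) by simp
        finally show ?thesis .
      qed
      then show ?thesis using sum_bounded_above[of A "\<lambda>a. card {b\<in>B. F a b \<in> Bad}" "k0 * M"] by simp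
    qed
    finally have c: "card (A \<times> B - G) \<le> m * (k0 * M)" by (simp add: m)
    have "card (A \<times> B - G) = card (A \<times> B) - card G" using card_Diff_subset[OF finG GAB] .
    then have "m * n \<le> card G + m * (k0 * M)" using c by (simp add: card_cartesian_product m n)
    moreover have "2 * (m * (k0 * M)) \<le> m * n" using big m0 unfolding n by (simp add: ac_simps)
    ultimately show ?thesis by linarith
  qed
  from ordered_blocks[OF A(1) r1] obtain \<beta>1 where \<beta>1: "monotone_blocks r A \<beta>1"
    and \<beta>1h: "\<And>i. card {a\<in>A. \<beta>1 a = i} \<le> card A div r + 1" unfolding monotone_blocks_def by blast
  from ordered_blocks[OF B(1) r1] obtain \<beta>2 where \<beta>2: "monotone_blocks r B \<beta>2"
    and \<beta>2h: "\<And>i. card {a\<in>B. \<beta>2 a = i} \<le> card B div r + 1" unfolding monotone_blocks_def by blast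
  \<comment> \<open>Coincident keys mean equal distances inside one box. A value outside
    \<open>Bad\<close> meets at most K r boxes, so there are at most D K r keys.\<close>
  define key where "key = (\<lambda>(a, b). (F a b, \<beta>1 a, \<beta>2 b))"
  have keyG: "card (key ` G) \<le> D * (K * r)"
  proof -
    define V where "V = (\<lambda>\<delta>. (\<lambda>(a, b). (\<beta>1 a, \<beta>2 b)) ` {(a, b). a \<in> A \<and> b \<in> B \<and> F a b = \<delta>})"
    have finV: "finite (V \<delta>)" for \<delta> unfolding V_def
      by (rule finite_imageI, rule finite_subset[of _ "A \<times> B"]) (use A B in auto)
    have "card (key ` G) \<le> card (SIGMA \<delta>:\<Delta> - Bad. V \<delta>)"
    proof (rule card_mono)
      show "finite (SIGMA \<delta>:\<Delta> - Bad. V \<delta>)" using fin\<Delta> finV by auto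
      show "key ` G \<subseteq> (SIGMA \<delta>:\<Delta> - Bad. V \<delta>)" by (auto simp: key_def G_def \<Delta>_def V_def image_iff) 
    qed
    also have "\<dots> = (\<Sum>\<delta>\<in>\<Delta> - Bad. card (V \<delta>))" using fin\<Delta> finV by simp
    also have "\<dots> \<le> card (\<Delta> - Bad) * (K * r)"
      using sum_bounded_above[of "\<Delta> - Bad" "\<lambda>\<delta>. card (V \<delta>)" "K * r"] box[OF _ \<beta>1 \<beta>2 r1] unfolding V_def by fastforce
    also have "\<dots> \<le> card \<Delta> * (K * r)" using fin\<Delta> by (intro mult_right_mono card_mono) auto
    finally show ?thesis by (simp add: D \<Delta>_def)
  qed
  define T0 where "T0 = {(x, y). x \<in> G \<and> y \<in> G \<and> key x = key y}"
  have T0GG: "T0 \<subseteq> G \<times> G" by (auto simp: T0_def)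
  have finT0: "finite T0" using finite_subset[OF T0GG] finG by simp
  have GT0: "(card G)\<^sup>2 \<le> D * (K * r) * card T0"
  proof -
    have "(card G)\<^sup>2 \<le> card (key ` G) * card T0"
      unfolding T0_def by (rule card_fibers_Cauchy_Schwarz) (use finG in auto)
    also have "\<dots> \<le> D * (K * r) * card T0" using keyG by (rule mult_right_mono) simp
    finally show ?thesis .
  qed
  \<comment> \<open>For a given (a, b) there are at most E choices of a' and then at most M of
    b'.\<close>
  define Ex where "Ex = {z\<in>T0. Exc (fst (fst z)) (fst (snd z))}"
  have Ex: "card Ex \<le> m * n * (E * M)"
  proof -
    have "Ex \<subseteq> (SIGMA x:A \<times> B. SIGMA a':{a'\<in>A. Exc (fst x) a'}. {b'\<in>B. F a' b' = F (fst x) (snd x)})"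
      by (auto simp: Ex_def T0_def G_def key_def)
    then have "card Ex \<le> card (SIGMA x:A \<times> B. SIGMA a':{a'\<in>A. Exc (fst x) a'}. {b'\<in>B. F a' b' = F (fst x) (snd x)})"
      using A B by (intro card_mono finite_SigmaI) auto
    also have "\<dots> = (\<Sum>x\<in>A \<times> B. card (SIGMA a':{a'\<in>A. Exc (fst x) a'}. {b'\<in>B. F a' b' = F (fst x) (snd x)}))"
      using A B by (intro card_SigmaI) auto
    also have "\<dots> \<le> of_nat (card (A \<times> B)) * (E * M)"
    proof (rule sum_bounded_above)
      fix x assume x: "x \<in> A \<times> B"
      have "card (SIGMA a':{a'\<in>A. Exc (fst x) a'}. {b'\<in>B. F a' b' = F (fst x) (snd x)})
          = (\<Sum>a'\<in>{a'\<in>A. Exc (fst x) a'}. card {b'\<in>B. F a' b' = F (fst x) (snd x)})"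
        using A B by (intro card_SigmaI) auto
      also have "\<dots> \<le> of_nat (card {a'\<in>A. Exc (fst x) a'}) * M"
        by (rule sum_bounded_above) (use row in auto)
      also have "\<dots> \<le> E * M" using exc[of "fst x"] x by auto
      finally show "card (SIGMA a':{a'\<in>A. Exc (fst x) a'}. {b'\<in>B. F a' b' = F (fst x) (snd x)}) \<le> E * M" .
    qed
    finally show ?thesis by (simp add: card_cartesian_product m n)
  qed
  define X where "X = {(a, a'). a \<in> A \<and> a' \<in> A \<and> \<beta>1 a = \<beta>1 a'} \<inter> {(a, a'). \<not> Exc a a'}"
  define Y where "Y = {(b, b'). b \<in> B \<and> b' \<in> B \<and> \<beta>2 b = \<beta>2 b'}"
  note bpA = card_block_pairs[OF A(1) \<beta>1h] and bpB = card_block_pairs[OF B(1) \<beta>2h]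
  have finX: "finite X" unfolding X_def using bpA(1) by blast
  have finY: "finite Y" unfolding Y_def by (rule bpB)
  have size: "N * (N div r + 1) * r \<le> 2 * N\<^sup>2" if "r \<le> N" for N
  proof -
    have "N div r * r \<le> N" by simp
    then have "(N div r + 1) * r \<le> 2 * N" using that unfolding distrib_right by linarith
    then have "N * ((N div r + 1) * r) \<le> N * (2 * N)" by (rule mult_left_mono) simp
    then show ?thesis by (simp only: power2_eq_square ac_simps)
  qed
  have "card X \<le> m * (m div r + 1)" unfolding X_def m by (rule order_trans[OF card_mono[OF bpA(1)] bpA(2)]) auto
  then have "card X * r \<le> m * (m div r + 1) * r" by (rule mult_right_mono) simp
  then have Xr: "card X * r \<le> 2 * m\<^sup>2" using size[OF rm] by linarith
  have "card Y \<le> n * (n div r + 1)" unfolding Y_def n by (rule bpB(2))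
  then have "card Y * r \<le> n * (n div r + 1) * r" by (rule mult_right_mono) simp
  then have Yr: "card Y * r \<le> 2 * n\<^sup>2" using size[OF rn] by linarith
  \<comment> \<open>Regroups a quadruple as an edge between a pair from the first set and a pair
    from the second.\<close>
  define h where "h = (\<lambda>((a, b), (a', b')). ((a, a'), (b, b')) :: (real \<times> real) \<times> (real \<times> real))"
  have hinj: "inj h" by (auto simp: inj_def h_def)
  define T where "T = h ` (T0 - Ex)"
  have cardT: "card T = card T0 - card Ex"
    unfolding T_def using card_Diff_subset[of Ex T0] finT0 finite_subset[of Ex T0]
    by (subst card_image) (auto intro: inj_on_subset[OF hinj] simp: Ex_def)
  have TXY: "T \<subseteq> X \<times> Y" by (auto simp: T_def h_def T0_def Ex_def X_def Y_def G_def key_def)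
  have TF: "F (fst P) (fst Q) = F (snd P) (snd Q)" if "(P, Q) \<in> T" for P Q
    using that by (auto simp: T_def h_def T0_def key_def)
  have kst: "(card T)\<^sup>2 \<le> card Y * (s * (card X)\<^sup>2 + L * card T)"
  proof (rule edges_bound_few_common[OF finX finY TXY])
    fix P assume P: "P \<in> X"
    then obtain a a' where aa: "P = (a, a')" "a \<in> A" "a' \<in> A" "\<not> Exc a a'" by (auto simp: X_def)
    define cn where "cn = (\<lambda>P'. {Q\<in>B \<times> B. F a (fst Q) = F a' (snd Q) \<and> F (fst P') (fst Q) = F (snd P') (snd Q)})"
    have fincn: "finite (cn P')" for P' unfolding cn_def using B by simp
    have le: "card {Q. (P, Q) \<in> T \<and> (P', Q) \<in> T} \<le> card (cn P')" for P'
    proof (rule card_mono[OF fincn], rule subsetI)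
      fix Q assume Q: "Q \<in> {Q. (P, Q) \<in> T \<and> (P', Q) \<in> T}"
      then have "Q \<in> Y" using TXY by blast
      then have "Q \<in> B \<times> B" by (auto simp: Y_def)
      then show "Q \<in> cn P'" using TF[of P Q] TF[of P' Q] Q unfolding cn_def aa(1) by simp
    qed
    have "card {P' \<in> X. s < card {Q. (P, Q) \<in> T \<and> (P', Q) \<in> T}} \<le> card {P'\<in>A \<times> A. card (cn P') > s}"
    proof (rule card_mono)
      show "finite {P'\<in>A \<times> A. card (cn P') > s}" using A by simp
      show "{P' \<in> X. s < card {Q. (P, Q) \<in> T \<and> (P', Q) \<in> T}} \<subseteq> {P'\<in>A \<times> A. card (cn P') > s}"
        using less_le_trans[OF _ le] by (auto simp: X_def)
    qed
    also have "\<dots> \<le> L" unfolding cn_def by (rule cod[OF aa(2-4)])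
    finally show "card {P' \<in> X. s < card {Q. (P, Q) \<in> T \<and> (P', Q) \<in> T}} \<le> L" .
  qed
  have tlow: "(m * n)\<^sup>2 \<le> 8 * D * K * r * card T"
  proof -
    have "(m * n)\<^sup>2 \<le> (2 * card G)\<^sup>2" using G2 by (rule power_mono) simp
    also have "\<dots> = 4 * (card G)\<^sup>2" by (simp add: power_mult_distrib)
    also have "\<dots> \<le> 4 * (D * (K * r) * card T0)" using GT0 by simp
    also have "\<dots> \<le> 4 * (D * (K * r) * (card T + m * n * (E * M)))"
      using Ex cardT by (intro mult_left_mono) auto
    finally have 1: "(m * n)\<^sup>2 \<le> 4 * (D * (K * r) * card T) + (4 * D * K * r * E * M) * (m * n)"
      by (simp add: algebra_simps)
    have "2 * (4 * D * K * r * E * M) \<le> m * n" using rq unfolding q_def by (simp only: ac_simps)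
    then have "2 * (4 * D * K * r * E * M) * (m * n) \<le> (m * n) * (m * n)" by (rule mult_right_mono) simp
    then have "2 * ((4 * D * K * r * E * M) * (m * n)) \<le> (m * n)\<^sup>2" by (simp only: power2_eq_square mult.assoc)
    then have "(m * n)\<^sup>2 \<le> 8 * (D * (K * r) * card T)" using 1 by linarith
    then show ?thesis by (simp only: ac_simps)
  qed
  have t0: "card T > 0"
  proof (rule ccontr)
    assume "\<not> card T > 0"
    then have "(m * n)\<^sup>2 \<le> 0" using tlow by simp
    then show False using m0 n0 by simp
  qed
  have "(real m)\<^sup>2 \<le> 32 * real K * real L * real D \<or>
    real m * real n ^ 3 \<le> 16384 * real s * real K ^ 3 * real E * real M * real D ^ 3"
  proof (rule distances_tradeoff[where r = r and t = "card T" and X = "card X" and Y = "card Y"])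
    show "real (card X) * real r \<le> 2 * (real m)\<^sup>2" using Xr by (metis of_nat_le_iff of_nat_mult of_nat_power of_nat_numeral)
    show "real (card Y) * real r \<le> 2 * (real n)\<^sup>2" using Yr by (metis of_nat_le_iff of_nat_mult of_nat_power of_nat_numeral)
    have "real (m * n) \<le> real (2 * (r * q))" using rlow by (simp only: of_nat_le_iff)
    then show "real m * real n \<le> 16 * real K * real E * real M * real D * real r" by (simp add: q_def algebra_simps)
    have "real ((m * n)\<^sup>2) \<le> real (8 * D * K * r * card T)" using tlow by (simp only: of_nat_le_iff)
    then show "(real m * real n)\<^sup>2 \<le> 8 * real D * real K * real r * real (card T)" by simp
    have "real ((card T)\<^sup>2) \<le> real (card Y * (s * (card X)\<^sup>2 + L * card T))" using kst by (simp only: of_nat_le_iff)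
    then show "(real (card T))\<^sup>2 \<le> real (card Y) * (real s * (real (card X))\<^sup>2 + real L * real (card T))" by simp
  qed (use m0 n0 D0 r1 ge1 t0 in auto)
  then show ?thesis by blast
qed blast

section \<open>Distances between two curves\<close>

lemma arc_fiber_bound:
  assumes C: "acurve d g C" and arc: "smooth_arc g U \<gamma>" and nc: "\<not> central C p"
  shows "finite {t\<in>U. dist2 p (\<gamma> t) = \<delta>}" "card {t\<in>U. dist2 p (\<gamma> t) = \<delta>} \<le> bez d 2"
proof -
  have inj: "inj_on \<gamma> {t\<in>U. dist2 p (\<gamma> t) = \<delta>}"
    using arc unfolding smooth_arc_def by (auto intro: inj_on_subset)
  have sub: "\<gamma> ` {t\<in>U. dist2 p (\<gamma> t) = \<delta>} \<subseteq> {q\<in>C. dist2 q p = \<delta>}"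
    using arc acurve_mem[OF C] by (auto simp: smooth_arc_def dist2_commute)
  show "finite {t\<in>U. dist2 p (\<gamma> t) = \<delta>}"
    by (rule inj_on_finite[OF inj sub noncentral_dist_bound(1)[OF C nc]])
  show "card {t\<in>U. dist2 p (\<gamma> t) = \<delta>} \<le> bez d 2"
    using card_inj_on_le[OF inj sub noncentral_dist_bound(1)[OF C nc]] noncentral_dist_bound(2)[OF C nc, of \<delta>] by linarith
qed

text \<open>The ends of the interval spanned by a block are points of the set itself, so the
  distance fibres through the sides of a box are bounded.\<close>

definition block_lo :: "real set \<Rightarrow> (real \<Rightarrow> nat) \<Rightarrow> nat \<Rightarrow> real" where
  "block_lo A \<beta> i = Min {a\<in>A. \<beta> a = i}"
definition block_hi :: "real set \<Rightarrow> (real \<Rightarrow> nat) \<Rightarrow> nat \<Rightarrow> real" where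
  "block_hi A \<beta> i = Max {a\<in>A. \<beta> a = i}"

lemma block_interval:
  assumes A: "finite A" and i: "i \<in> \<beta> ` A"
  shows "block_lo A \<beta> i \<in> A" "\<beta> (block_lo A \<beta> i) = i" "block_hi A \<beta> i \<in> A" "\<beta> (block_hi A \<beta> i) = i"
    "block_lo A \<beta> i \<le> block_hi A \<beta> i"
    "\<And>a. a \<in> A \<Longrightarrow> \<beta> a = i \<Longrightarrow> a \<in> {block_lo A \<beta> i..block_hi A \<beta> i}"
proof -
  have fin: "finite {a\<in>A. \<beta> a = i}" and ne: "{a\<in>A. \<beta> a = i} \<noteq> {}" using assms by auto
  show "block_lo A \<beta> i \<in> A" "\<beta> (block_lo A \<beta> i) = i" using Min_in[OF fin ne] by (auto simp: block_lo_def)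
  show "block_hi A \<beta> i \<in> A" "\<beta> (block_hi A \<beta> i) = i" using Max_in[OF fin ne] by (auto simp: block_hi_def)
  show *: "a \<in> {block_lo A \<beta> i..block_hi A \<beta> i}" if "a \<in> A" "\<beta> a = i" for a
    using that Min_le[OF fin, of a] Max_ge[OF fin, of a] by (simp add: block_lo_def block_hi_def)
  show "block_lo A \<beta> i \<le> block_hi A \<beta> i" using i * by force
qed

lemma block_intervals_disjoint:
  assumes A: "finite A" and \<beta>: "monotone_blocks r A \<beta>" and ij: "i \<in> \<beta> ` A" "j \<in> \<beta> ` A" "i \<noteq> j"
  shows "{block_lo A \<beta> i..block_hi A \<beta> i} \<inter> {block_lo A \<beta> j..block_hi A \<beta> j} = {}"
proof -
  have lt: "block_hi A \<beta> i < block_lo A \<beta> j" if "i \<in> \<beta> ` A" "j \<in> \<beta> ` A" "i < j" for i j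
  proof (rule ccontr)
    assume "\<not> block_hi A \<beta> i < block_lo A \<beta> j"
    then have "\<beta> (block_lo A \<beta> j) \<le> \<beta> (block_hi A \<beta> i)"
      using \<beta> block_interval(1)[OF A that(2)] block_interval(3)[OF A that(1)] by (simp add: monotone_blocks_def)
    then show False using that block_interval(2)[OF A that(2)] block_interval(4)[OF A that(1)] by simp
  qed
  consider "i < j" | "j < i" using ij by linarith
  then show ?thesis using lt[OF ij(1,2)] lt[OF ij(2,1)] by cases fastforce+
qed

text \<open>The spanned intervals stay inside the parameter sets because these are connected, and at
  most r blocks occur on each curve; the factor 3 comes from the three families of sides.\<close>

lemma level_block_count:
  assumes C1: "acurve d f C1" and C2: "acurve d g C2"
    and arcs: "smooth_arc f U1 \<gamma>1" "smooth_arc g U2 \<gamma>2"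
    and A: "finite A" "A \<subseteq> U1" "\<And>a. a \<in> A \<Longrightarrow> \<not> central C2 (\<gamma>1 a)"
    and B: "finite B" "B \<subseteq> U2" "\<And>b. b \<in> B \<Longrightarrow> \<not> central C1 (\<gamma>2 b)"
    and crit: "finite (crit f g \<delta>)" "card (crit f g \<delta>) \<le> Kc"
    and \<beta>: "monotone_blocks r A \<beta>1" "monotone_blocks r B \<beta>2" and r: "r \<ge> 1"
  shows "card ((\<lambda>(a, b). (\<beta>1 a, \<beta>2 b)) ` {(a, b). a \<in> A \<and> b \<in> B \<and> dist2 (\<gamma>1 a) (\<gamma>2 b) = \<delta>}) \<le> (3 * bez d 2 + Kc) * r"
proof -
  let ?R1 = "\<beta>1 ` A" and ?R2 = "\<beta>2 ` B"
  let ?V = "{(i, j). i \<in> ?R1 \<and> j \<in> ?R2 \<and> (\<exists>s\<in>{block_lo A \<beta>1 i..block_hi A \<beta>1 i}.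
     \<exists>t\<in>{block_lo B \<beta>2 j..block_hi B \<beta>2 j}. dist2 (\<gamma>1 s) (\<gamma>2 t) = \<delta>)}"
  have con: "connected U1" "connected U2" using arcs by (auto simp: smooth_arc_def)
  have "card ((\<lambda>(a, b). (\<beta>1 a, \<beta>2 b)) ` {(a, b). a \<in> A \<and> b \<in> B \<and> dist2 (\<gamma>1 a) (\<gamma>2 b) = \<delta>}) \<le> card ?V"
  proof (rule card_mono)
    show "finite ?V" by (rule finite_subset[of _ "?R1 \<times> ?R2"]) (use A B in auto)
    show "(\<lambda>(a, b). (\<beta>1 a, \<beta>2 b)) ` {(a, b). a \<in> A \<and> b \<in> B \<and> dist2 (\<gamma>1 a) (\<gamma>2 b) = \<delta>} \<subseteq> ?V"
    proof (rule image_subsetI)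
      fix x assume "x \<in> {(a, b). a \<in> A \<and> b \<in> B \<and> dist2 (\<gamma>1 a) (\<gamma>2 b) = \<delta>}"
      then obtain a b where x: "x = (a, b)" "a \<in> A" "b \<in> B" "dist2 (\<gamma>1 a) (\<gamma>2 b) = \<delta>" by blast
      have "\<exists>s\<in>{block_lo A \<beta>1 (\<beta>1 a)..block_hi A \<beta>1 (\<beta>1 a)}.
         \<exists>t\<in>{block_lo B \<beta>2 (\<beta>2 b)..block_hi B \<beta>2 (\<beta>2 b)}. dist2 (\<gamma>1 s) (\<gamma>2 t) = \<delta>"
        by (rule bexI[of _ a], rule bexI[of _ b], rule x(4))
          (rule block_interval(6)[OF B(1) imageI[OF x(3)] x(3) refl] block_interval(6)[OF A(1) imageI[OF x(2)] x(2) refl])+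
      then show "(case x of (a, b) \<Rightarrow> (\<beta>1 a, \<beta>2 b)) \<in> ?V" using x by simp
    qed
  qed
  also have "\<dots> \<le> card ?R1 * bez d 2 + 2 * (card ?R2 * bez d 2) + Kc"
  proof (rule level_box_count[OF arcs _ _ _ _ crit])
    fix s assume "s \<in> block_hi A \<beta>1 ` ?R1"
    then have "s \<in> A" using block_interval(3)[OF A(1)] by auto
    then show "finite {t \<in> U2. dist2 (\<gamma>1 s) (\<gamma>2 t) = \<delta>} \<and> card {t \<in> U2. dist2 (\<gamma>1 s) (\<gamma>2 t) = \<delta>} \<le> bez d 2"
      using arc_fiber_bound[OF C2 arcs(2) A(3)] by blast
  next
    fix t assume "t \<in> block_lo B \<beta>2 ` ?R2 \<union> block_hi B \<beta>2 ` ?R2"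
    then have "t \<in> B" using block_interval(1,3)[OF B(1)] by auto
    then show "finite {s \<in> U1. dist2 (\<gamma>1 s) (\<gamma>2 t) = \<delta>} \<and> card {s \<in> U1. dist2 (\<gamma>1 s) (\<gamma>2 t) = \<delta>} \<le> bez d 2"
      using arc_fiber_bound[OF C1 arcs(1) B(3)] by (simp add: dist2_commute[of "\<gamma>1 _"])
  next
    fix i assume i: "i \<in> ?R1"
    show "block_lo A \<beta>1 i \<le> block_hi A \<beta>1 i \<and> {block_lo A \<beta>1 i..block_hi A \<beta>1 i} \<subseteq> U1"
      using block_interval(1,3,5)[OF A(1) i] connected_contains_Icc[OF con(1)] A(2) by blast
  next
    fix i assume i: "i \<in> ?R2"
    show "block_lo B \<beta>2 i \<le> block_hi B \<beta>2 i \<and> {block_lo B \<beta>2 i..block_hi B \<beta>2 i} \<subseteq> U2"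
      using block_interval(1,3,5)[OF B(1) i] connected_contains_Icc[OF con(2)] B(2) by blast
  qed (use A B block_intervals_disjoint[OF A(1) \<beta>(1)] block_intervals_disjoint[OF B(1) \<beta>(2)] in auto)
  also have "\<dots> \<le> r * bez d 2 + 2 * (r * bez d 2) + r * Kc"
  proof -
    have "card ?R1 \<le> r" "card ?R2 \<le> r"
      using card_mono[of "{..<r}" ?R1] card_mono[of "{..<r}" ?R2] \<beta> by (auto simp: monotone_blocks_def)
    then show ?thesis using r by (intro add_mono mult_left_mono mult_right_mono) auto
  qed
  finally show ?thesis by (simp add: algebra_simps)
qed

definition boxK :: "nat \<Rightarrow> nat" where "boxK d = 3 * bez d 2 + critK d + 1"

text \<open>The counting argument applied to distances pulled back to the parameters. The value 0
  joins the bad ones, hence \<open>bez d 1 + 1\<close>, because critical pairs are controlled only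
  for \<delta> > 0; the other added ones keep the constants positive.\<close>

lemma arcs_distances:
  assumes C1: "acurve d f C1" and C2: "acurve d g C2"
    and np: "\<not> parallel_lines C1 C2" and no: "\<not> orthogonal_lines C1 C2" and ncc: "\<not> concentric_circles C1 C2"
    and arcs: "smooth_arc f U1 \<gamma>1" "smooth_arc g U2 \<gamma>2"
    and A: "finite A" "A \<noteq> {}" "A \<subseteq> U1" "\<And>a. a \<in> A \<Longrightarrow> \<not> central C2 (\<gamma>1 a)"
    and B: "finite B" "B \<noteq> {}" "B \<subseteq> U2" "\<And>b. b \<in> B \<Longrightarrow> \<not> central C1 (\<gamma>2 b)"
    and big: "2 * (bez d 1 + 1) * (bez d 2 + 1) \<le> card B"
    and D: "D = card ((\<lambda>(a, b). dist2 (\<gamma>1 a) (\<gamma>2 b)) ` (A \<times> B))" and m: "m = card A" and n: "n = card B"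
  shows "real m * real n \<le> 8 * real (boxK d) * real (exK d + 1) * real (bez d 2 + 1) * real D \<or>
    (real m)\<^sup>2 \<le> 32 * real (boxK d) * real (brK d + 1) * real D \<or>
    real m * real n ^ 3 \<le> 16384 * real (comK d + 1) * real (boxK d) ^ 3 * real (exK d + 1) * real (bez d 2 + 1) * real D ^ 3"
proof -
  have nl: "\<not> (C1 = line a b c \<and> C2 = line a b c)" if "(a, b) \<noteq> (0, 0)" for a b c
  proof
    assume "C1 = line a b c \<and> C2 = line a b c"
    then have "line_with_normal C1 a b" "line_with_normal C2 a b" using that by (auto simp: line_with_normal_def line_def)
    then show False using np unfolding parallel_lines_def by fastforce
  qed
  from crit_count[OF C1 C2 nl] obtain Bad where Bad: "finite Bad" "card Bad \<le> bez d 1"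
    and crit: "\<And>\<delta>. \<delta> > 0 \<Longrightarrow> \<delta> \<notin> Bad \<Longrightarrow> finite (crit f g \<delta>) \<and> card (crit f g \<delta>) \<le> critK d" by blast
  from codegree[OF C1 C2 np no ncc] obtain Exc where
    E: "(\<forall>p. Exc p p \<and> finite {p'\<in>C1. Exc p p'} \<and> card {p'\<in>C1. Exc p p'} \<le> exK d) \<and>
      (\<forall>P\<in>C1 \<times> C1. \<not> central C2 (fst P) \<and> \<not> central C2 (snd P) \<and> \<not> Exc (fst P) (snd P) \<longrightarrow>
      (\<forall>X. finite X \<and> X \<subseteq> C1 \<times> C1 \<longrightarrow>
         card {P'\<in>X. \<not> (finite (common_nbrs C2 P P') \<and> card (common_nbrs C2 P P') \<le> comK d)} \<le> brK d))" by (rule exE)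
  note Exc = conjunct1[OF E] and cod = conjunct2[OF E]
  have inj: "inj_on \<gamma>1 U1" "inj_on \<gamma>2 U2" using arcs by (auto simp: smooth_arc_def)
  have on1: "\<gamma>1 a \<in> C1" if "a \<in> A" for a using that A(3) arcs(1) acurve_mem[OF C1] by (auto simp: smooth_arc_def)
  have on2: "\<gamma>2 b \<in> C2" if "b \<in> B" for b using that B(3) arcs(2) acurve_mem[OF C2] by (auto simp: smooth_arc_def)
  have "real m * real n \<le> 8 * real (boxK d) * real (exK d + 1) * real (bez d 2 + 1) * real D \<or>
    (real m)\<^sup>2 \<le> 32 * real (boxK d) * real (brK d + 1) * real D \<or>
    real m * real n ^ 3 \<le> 16384 * real (comK d + 1) * real (boxK d) ^ 3 * real (exK d + 1) * real (bez d 2 + 1) * real D ^ 3"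
  proof (rule few_level_boxes_imp_many_values[where F = "\<lambda>a b. dist2 (\<gamma>1 a) (\<gamma>2 b)" and Bad = "insert 0 Bad"
        and ?k0.0 = "bez d 1 + 1" and Exc = "\<lambda>a a'. Exc (\<gamma>1 a) (\<gamma>1 a')" and A = A and B = B
        and K = "boxK d" and E = "exK d + 1" and M = "bez d 2 + 1" and s = "comK d + 1" and L = "brK d + 1" and D = D and m = m and n = n])
    fix a \<delta> assume a: "a \<in> A"
    show "card {b \<in> B. dist2 (\<gamma>1 a) (\<gamma>2 b) = \<delta>} \<le> bez d 2 + 1"
      using arc_fiber_bound[OF C2 arcs(2) A(4)[OF a], of \<delta>] card_mono[of "{t \<in> U2. dist2 (\<gamma>1 a) (\<gamma>2 t) = \<delta>}" "{b \<in> B. dist2 (\<gamma>1 a) (\<gamma>2 b) = \<delta>}"] B(3)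
      by fastforce
  next
    fix b \<delta> assume b: "b \<in> B"
    show "card {a \<in> A. dist2 (\<gamma>1 a) (\<gamma>2 b) = \<delta>} \<le> bez d 2 + 1"
      unfolding dist2_commute[of "\<gamma>1 _"]
      using arc_fiber_bound[OF C1 arcs(1) B(4)[OF b], of \<delta>] card_mono[of "{t \<in> U1. dist2 (\<gamma>2 b) (\<gamma>1 t) = \<delta>}" "{a \<in> A. dist2 (\<gamma>2 b) (\<gamma>1 a) = \<delta>}"] A(3)
      by fastforce
  next
    fix r \<beta>1 \<beta>2 and \<delta> :: real
    assume \<delta>: "\<delta> \<notin> insert 0 Bad" and \<beta>: "monotone_blocks r A \<beta>1" "monotone_blocks r B \<beta>2" and r: "1 \<le> r"
    show "card ((\<lambda>(a, b). (\<beta>1 a, \<beta>2 b)) ` {(a, b). a \<in> A \<and> b \<in> B \<and> dist2 (\<gamma>1 a) (\<gamma>2 b) = \<delta>}) \<le> boxK d * r"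
    proof (cases "\<delta> > 0")
      case True
      then have "finite (crit f g \<delta>)" "card (crit f g \<delta>) \<le> critK d" using crit[of \<delta>] \<delta> by auto
      from level_block_count[OF C1 C2 arcs A(1,3,4) B(1,3,4) this \<beta> r]
      show ?thesis unfolding boxK_def by (simp add: algebra_simps)
    next
      case False
      then have neg: "\<delta> < 0" using \<delta> by auto
      have "{(a, b). a \<in> A \<and> b \<in> B \<and> dist2 (\<gamma>1 a) (\<gamma>2 b) = \<delta>} = {}"
        using neg dist2_nonneg[of "\<gamma>1 _" "\<gamma>2 _"] by (auto simp: not_le[symmetric])
      then show ?thesis by (simp only: image_empty card.empty zero_le)
    qed
  next
    fix a assume a: "a \<in> A"
    have "card {a' \<in> A. Exc (\<gamma>1 a) (\<gamma>1 a')} \<le> card {p'\<in>C1. Exc (\<gamma>1 a) p'}"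
    proof (rule card_inj_on_le[of \<gamma>1])
      show "finite {p'\<in>C1. Exc (\<gamma>1 a) p'}" using Exc[rule_format, of "\<gamma>1 a"] by (elim conjE)
      show "inj_on \<gamma>1 {a' \<in> A. Exc (\<gamma>1 a) (\<gamma>1 a')}" by (rule inj_on_subset[OF inj(1)]) (use A(3) in auto)
      show "\<gamma>1 ` {a' \<in> A. Exc (\<gamma>1 a) (\<gamma>1 a')} \<subseteq> {p'\<in>C1. Exc (\<gamma>1 a) p'}" using on1 by blast
    qed
    then show "card {a' \<in> A. Exc (\<gamma>1 a) (\<gamma>1 a')} \<le> exK d + 1" using Exc[rule_format, of "\<gamma>1 a"] by linarith
  next
    fix a a' assume aa: "a \<in> A" "a' \<in> A" and nE: "\<not> Exc (\<gamma>1 a) (\<gamma>1 a')"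
    define X where "X = map_prod \<gamma>1 \<gamma>1 ` (A \<times> A)"
    define BB where "BB = (\<lambda>P. {Q\<in>B \<times> B. dist2 (\<gamma>1 a) (\<gamma>2 (fst Q)) = dist2 (\<gamma>1 a') (\<gamma>2 (snd Q)) \<and>
       dist2 (\<gamma>1 (fst P)) (\<gamma>2 (fst Q)) = dist2 (\<gamma>1 (snd P)) (\<gamma>2 (snd Q))})"
    let ?W = "{P'\<in>X. \<not> (finite (common_nbrs C2 (\<gamma>1 a, \<gamma>1 a') P') \<and> card (common_nbrs C2 (\<gamma>1 a, \<gamma>1 a') P') \<le> comK d)}"
    have X: "finite X" "X \<subseteq> C1 \<times> C1" unfolding X_def using A(1) on1 by auto
    have W: "card ?W \<le> brK d"
      using cod[THEN bspec, of "(\<gamma>1 a, \<gamma>1 a')"] X on1[OF aa(1)] on1[OF aa(2)] A(4)[OF aa(1)] A(4)[OF aa(2)] nE by simp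
    have "card {P \<in> A \<times> A. comK d + 1 < card (BB P)} \<le> card ?W"
    proof (rule card_inj_on_le[of "map_prod \<gamma>1 \<gamma>1"])
      show "inj_on (map_prod \<gamma>1 \<gamma>1) {P \<in> A \<times> A. comK d + 1 < card (BB P)}"
        by (rule inj_on_subset[OF map_prod_inj_on[OF inj(1) inj(1)]]) (use A(3) in auto)
      show "finite ?W" using X by simp
      show "map_prod \<gamma>1 \<gamma>1 ` {P \<in> A \<times> A. comK d + 1 < card (BB P)} \<subseteq> ?W"
      proof (rule image_subsetI)
        fix P assume P: "P \<in> {P \<in> A \<times> A. comK d + 1 < card (BB P)}"
        let ?N = "common_nbrs C2 (\<gamma>1 a, \<gamma>1 a') (map_prod \<gamma>1 \<gamma>1 P)"
        have injB: "inj_on (map_prod \<gamma>2 \<gamma>2) (BB P)"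
          by (rule inj_on_subset[OF map_prod_inj_on[OF inj(2) inj(2)]]) (use B(3) in \<open>auto simp: BB_def\<close>)
        have sub: "map_prod \<gamma>2 \<gamma>2 ` BB P \<subseteq> ?N"
        proof (rule image_subsetI)
          fix Q assume "Q \<in> BB P"
          then show "map_prod \<gamma>2 \<gamma>2 Q \<in> ?N"
            by (cases Q) (auto simp: BB_def common_nbrs_def on2 dist2_commute[of "\<gamma>2 _"])
        qed
        have "\<not> (finite ?N \<and> card ?N \<le> comK d)"
        proof
          assume "finite ?N \<and> card ?N \<le> comK d"
          then have "card (BB P) \<le> comK d" using card_inj_on_le[OF injB sub] by linarith
          then show False using P by simp
        qed
        moreover have "map_prod \<gamma>1 \<gamma>1 P \<in> X" using P unfolding X_def by blast
        ultimately show "map_prod \<gamma>1 \<gamma>1 P \<in> ?W" by blast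
      qed
    qed
    then show "card {P \<in> A \<times> A. comK d + 1 < card {Q \<in> B \<times> B. dist2 (\<gamma>1 a) (\<gamma>2 (fst Q)) = dist2 (\<gamma>1 a') (\<gamma>2 (snd Q)) \<and>
         dist2 (\<gamma>1 (fst P)) (\<gamma>2 (fst Q)) = dist2 (\<gamma>1 (snd P)) (\<gamma>2 (snd Q))}} \<le> brK d + 1"
      using W unfolding BB_def by linarith
  next
    show "card (insert 0 Bad) \<le> bez d 1 + 1" using card_insert_le_m1[of "bez d 1 + 1" Bad 0] Bad(2) by simp
  qed (use A B Bad big D m n in \<open>auto simp: boxK_def\<close>)
  then show ?thesis .
qed

text \<open>A line has no centre: the second difference of the squared distance along it is 2 (a^2 +
  b^2), not 0.\<close>

lemma acurve_central_unique:
  assumes C: "acurve d f C" and z: "central C z" "central C z'"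
  shows "z = z'"
proof (cases "\<exists>a b c. (a, b) \<noteq> (0, 0) \<and> C = line a b c")
  case True
  then obtain a b c where ab: "(a, b) \<noteq> (0, 0)" and l: "C = line a b c" by blast
  obtain \<rho> where \<rho>: "C \<subseteq> circle z \<rho>" using z(1) unfolding central_def by blast
  have "C \<noteq> {}" using C by (auto simp: acurve_def)
  then obtain x y where xy: "(x, y) \<in> C" by fastforce
  have "(x + t * b, y - t * a) \<in> C" for t using xy unfolding l line_def by (auto simp: algebra_simps)
  then have d: "dist2 (x + t * b, y - t * a) z = \<rho>" for t using \<rho> by (auto simp: circle_def)
  have "2 * (a\<^sup>2 + b\<^sup>2) = dist2 (x + 1 * b, y - 1 * a) z + dist2 (x + (-1) * b, y - (-1) * a) z - 2 * dist2 (x + 0 * b, y - 0 * a) z"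
    by (simp add: dist2_def power2_eq_square algebra_simps)
  also have "\<dots> = 0" unfolding d by simp
  finally have "a\<^sup>2 + b\<^sup>2 = 0" by (rule mult_eq_0_iff[THEN iffD1, THEN disjE]) simp_all
  then show ?thesis using ab sum_power2_eq_zero_iff[of a b] by simp
next
  case False
  then show ?thesis using central_unique[OF acurve_nonline[OF C] z] by blast
qed

text \<open>The centre of the other curve, at most one point, is discarded before an arc is chosen;
  the added ones in the bound pay for this and for the points off the arcs.\<close>

lemma smooth_arc_points:
  assumes C: "acurve d f C" and C': "acurve d g C'" and S: "finite S" "S \<subseteq> C"
  shows "\<exists>U \<gamma> A. smooth_arc f U \<gamma> \<and> finite A \<and> A \<subseteq> U \<and> \<gamma> ` A \<subseteq> S \<and> (\<forall>a\<in>A. \<not> central C' (\<gamma> a)) \<and>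
     card S \<le> (arcK d + 1) * (card A + 1)"
proof -
  define S' where "S' = {p\<in>S. \<not> central C' p}"
  have S': "finite S'" "S' \<subseteq> C" using S by (auto simp: S'_def)
  have "card (S - S') \<le> 1"
    using acurve_central_unique[OF C'] S(1) by (subst card_le_Suc0_iff_eq[unfolded One_nat_def[symmetric]]) (auto simp: S'_def)
  moreover have "card (S - S') = card S - card S'" by (rule card_Diff_subset[OF S'(1)]) (auto simp: S'_def)
  ultimately have cS: "card S \<le> card S' + 1" by linarith
  from arcs_cover[OF C S'] obtain U \<gamma> where arc: "smooth_arc f U \<gamma>"
    and le: "card S' \<le> arcK d * card (S' \<inter> \<gamma> ` U) + arcK d" by blast
  define A where "A = {s\<in>U. \<gamma> s \<in> S'}"
  have inj: "inj_on \<gamma> A" by (rule inj_on_subset[of \<gamma> U]) (use arc in \<open>auto simp: smooth_arc_def A_def\<close>)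
  have im: "\<gamma> ` A = S' \<inter> \<gamma> ` U" by (auto simp: A_def)
  have "card S \<le> (arcK d + 1) * (card A + 1)"
    using le cS card_image[OF inj] unfolding im by simp
  moreover have "finite A" by (rule inj_on_finite[OF inj _ S'(1)]) (auto simp: A_def)
  ultimately show ?thesis using arc
    by (intro exI[of _ U] exI[of _ \<gamma>] exI[of _ A]) (auto simp: A_def S'_def)
qed

lemma powr_two_thirds_le:
  fixes x y :: real
  assumes "x \<ge> 0" "y \<ge> 0" "x\<^sup>2 \<le> y ^ 3" shows "x powr (2/3) \<le> y"
proof (cases "x = 0")
  case False
  then have x: "x > 0" using assms(1) by simp
  have "(x powr (2/3)) ^ 3 = (x powr (2/3)) powr 3" using x by (simp add: powr_numeral)
  also have "\<dots> = x\<^sup>2" using x by (simp add: powr_powr powr_numeral)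
  finally have "(x powr (2/3)) ^ Suc 2 \<le> y ^ Suc 2" using assms(3) by simp
  then show ?thesis by (rule power_le_imp_le_base) (rule assms(2))
qed (use assms in auto)

text \<open>A product that dominates the constants in all three alternatives of
  \<open>arcs_distances\<close>.\<close>

definition crossK :: "nat \<Rightarrow> nat" where
  "crossK d = 16384 * (comK d + 1) * boxK d ^ 3 * (exK d + 1) * (bez d 2 + 1) * (brK d + 1)"

text \<open>If one arc keeps too few points for \<open>arcs_distances\<close>, the smaller set has
  at most this many points.\<close>

definition smallK :: "nat \<Rightarrow> nat" where
  "smallK d = (arcK d + 1) * (2 * (bez d 1 + 1) * (bez d 2 + 1) + 1)"

text \<open>Each set shrinks by a factor of at most 2 (arcK d + 1) on passing to an arc, which costs
  16 (arcK d + 1)^4 in m n^3. The factor \<open>smallK d ^ 2\<close> absorbs the case of small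
  m.\<close>

definition distK :: "nat \<Rightarrow> nat" where
  "distK d = 16 * (arcK d + 1) ^ 4 * crossK d * smallK d ^ 2"

lemma crossK_pos: "crossK d > 0"
  unfolding crossK_def boxK_def by (intro mult_pos_pos zero_less_power) auto

lemma smallK_pos: "smallK d > 0"
  unfolding smallK_def by (intro mult_pos_pos) auto

lemma distK_pos: "distK d > 0"
  unfolding distK_def by (intro mult_pos_pos zero_less_power crossK_pos smallK_pos) auto

lemma crossK_ge:
  "8 * real (boxK d) * real (exK d + 1) * real (bez d 2 + 1) \<le> real (crossK d)" (is ?a)
  "32 * real (boxK d) * real (brK d + 1) \<le> real (crossK d)" (is ?b)
  "16384 * real (comK d + 1) * real (boxK d) ^ 3 * real (exK d + 1) * real (bez d 2 + 1) \<le> real (crossK d)" (is ?c)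
proof -
  define x where "x = comK d + 1"
  define y where "y = boxK d"
  define e where "e = exK d + 1"
  define m where "m = bez d 2 + 1"
  define l where "l = brK d + 1"
  have ge1: "x \<ge> 1" "y \<ge> 1" "e \<ge> 1" "m \<ge> 1" "l \<ge> 1" by (auto simp: x_def y_def e_def m_def l_def boxK_def)
  have K: "crossK d = 16384 * x * y ^ 3 * e * m * l" by (simp add: crossK_def x_def y_def e_def m_def l_def)
  have y3: "y \<le> y ^ 3" using ge1 by (simp add: self_le_power)
  have "(8 * y * e * m) * 1 \<le> (8 * y ^ 3 * e * m) * (2048 * x * l)"
    using y3 ge1 by (intro mult_mono mult_right_mono mult_left_mono) auto
  then have "8 * y * e * m \<le> crossK d" unfolding K by (simp add: ac_simps)
  moreover have "(32 * y * l) * 1 \<le> (32 * y ^ 3 * l) * (512 * x * e * m)"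
    using y3 ge1 by (intro mult_mono mult_right_mono mult_left_mono) auto
  then have "32 * y * l \<le> crossK d" unfolding K by (simp add: ac_simps)
  moreover have "16384 * x * y ^ 3 * e * m \<le> crossK d" unfolding K using ge1 by simp
  ultimately show ?a ?b ?c
    unfolding x_def[symmetric] y_def[symmetric] e_def[symmetric] m_def[symmetric] l_def[symmetric]
    by (simp_all flip: of_nat_le_iff[where ?'a = real])
qed

text \<open>For m \<le> n the alternatives of \<open>arcs_distances\<close> bound m^2 or (mn)^2: the
  first by m^2 \<le> mn, the third by (mn)^2 \<le> m n^3, from which the exponent 2/3 arises. If an
  arc has too few points, m is bounded and a single distance suffices.\<close>

lemma cross_distances_ordered:
  assumes C1: "acurve d f C1" and C2: "acurve d g C2"
    and np: "\<not> parallel_lines C1 C2" and no: "\<not> orthogonal_lines C1 C2" and ncc: "\<not> concentric_circles C1 C2"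
    and S1: "finite S1" "S1 \<subseteq> C1" and S2: "finite S2" "S2 \<subseteq> C2" and mn: "card S1 \<le> card S2"
  shows "min (real (card S1) powr (2/3) * real (card S2) powr (2/3)) ((real (card S1))\<^sup>2)
     \<le> real (distK d) * real (card ((\<lambda>(p, q). dist2 p q) ` (S1 \<times> S2)))"
proof -
  define m where "m = card S1"
  define n where "n = card S2"
  define \<Delta> where "\<Delta> = (\<lambda>(p, q). dist2 p q) ` (S1 \<times> S2)"
  define k where "k = arcK d + 1"
  define n0 where "n0 = 2 * (bez d 1 + 1) * (bez d 2 + 1)"
  have fin\<Delta>: "finite \<Delta>" unfolding \<Delta>_def using S1 S2 by simp
  have k1: "k \<ge> 1" by (simp add: k_def)
  have cross1: "crossK d \<ge> 1" using crossK_pos[of d] by simp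
  have small1: "smallK d \<ge> 1" using smallK_pos[of d] by simp
  from smooth_arc_points[OF C1 C2 S1] obtain U1 \<gamma>1 A where arc1: "smooth_arc f U1 \<gamma>1"
    and A: "finite A" "A \<subseteq> U1" "\<gamma>1 ` A \<subseteq> S1" "\<forall>a\<in>A. \<not> central C2 (\<gamma>1 a)" and mA: "m \<le> k * (card A + 1)"
    unfolding k_def m_def by blast
  from smooth_arc_points[OF C2 C1 S2] obtain U2 \<gamma>2 B where arc2: "smooth_arc g U2 \<gamma>2"
    and B: "finite B" "B \<subseteq> U2" "\<gamma>2 ` B \<subseteq> S2" "\<forall>a\<in>B. \<not> central C1 (\<gamma>2 a)" and nB: "n \<le> k * (card B + 1)"
    unfolding k_def n_def by blast
  have "real m powr (2/3) * real n powr (2/3) \<le> real (distK d) * real (card \<Delta>) \<or> (real m)\<^sup>2 \<le> real (distK d) * real (card \<Delta>)"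
  proof (cases "m = 0 \<or> card A = 0 \<or> card B < n0")
    case True
    show ?thesis
    proof (cases "m = 0")
      case False
      have "m \<le> smallK d"
      proof (cases "card A = 0")
        case True
        then have "m \<le> k * 1" using mA by simp
        also have "\<dots> \<le> k * (n0 + 1)" by (rule mult_left_mono) auto
        finally show ?thesis by (simp only: smallK_def k_def n0_def)
      next
        case False
        then have "card B < n0" using \<open>m \<noteq> 0\<close> True by simp
        have "m \<le> k * (card B + 1)" using mn nB by (simp add: m_def n_def)
        also have "\<dots> \<le> k * (n0 + 1)" using \<open>card B < n0\<close> by (intro mult_left_mono) auto
        finally show ?thesis by (simp only: smallK_def k_def n0_def)
      qed
      then have "m\<^sup>2 \<le> smallK d ^ 2" by (rule power_mono) simp
      also have "\<dots> \<le> distK d" unfolding distK_def using k1 cross1 by (simp add: k_def)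
      finally have "real (m\<^sup>2) \<le> real (distK d)" by (simp only: of_nat_le_iff)
      moreover have "card \<Delta> \<ge> 1"
      proof -
        have "S1 \<noteq> {}" "S2 \<noteq> {}" using False mn by (auto simp: m_def)
        then have "\<Delta> \<noteq> {}" by (auto simp: \<Delta>_def)
        then show ?thesis using fin\<Delta> by (simp add: Suc_le_eq card_gt_0_iff)
      qed
      then have "real (distK d) * 1 \<le> real (distK d) * real (card \<Delta>)" by (intro mult_left_mono) auto
      ultimately have "(real m)\<^sup>2 \<le> real (distK d) * real (card \<Delta>)" unfolding of_nat_power by linarith
      then show ?thesis by blast
    qed simp
  next
    case False
    define m1 where "m1 = card A"
    define n1 where "n1 = card B"
    define D where "D = card ((\<lambda>(a, b). dist2 (\<gamma>1 a) (\<gamma>2 b)) ` (A \<times> B))"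
    have n0: "n0 \<ge> 1" by (simp add: n0_def)
    have ne: "A \<noteq> {}" "B \<noteq> {}" using False n0 by auto
    have D\<Delta>: "D \<le> card \<Delta>"
      unfolding D_def by (rule card_mono[OF fin\<Delta>]) (use A(3) B(3) in \<open>auto simp: \<Delta>_def\<close>)
    have "m \<le> k * (2 * m1)" by (rule order_trans[OF mA]) (use False in \<open>auto simp: m1_def\<close>)
    then have m2: "real m \<le> 2 * real k * real m1" by (simp flip: of_nat_le_iff[where ?'a = real])
    have "n \<le> k * (2 * n1)" by (rule order_trans[OF nB]) (use False n0 in \<open>auto simp: n1_def\<close>)
    then have n2: "real n \<le> 2 * real k * real n1" by (simp flip: of_nat_le_iff[where ?'a = real])
    have mn': "real m \<le> real n" using mn by (simp add: m_def n_def)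
    define J where "J = real (crossK d)"
    define H where "H = 16 * real k ^ 4 * J"
    have J1: "J \<ge> 1" using cross1 by (simp add: J_def)
    have k1': "real k \<ge> 1" using k1 by simp
    have HJ: "4 * (real k)\<^sup>2 * J \<le> H"
    proof -
      have "(real k)\<^sup>2 \<le> real k ^ 4" by (rule power_increasing[OF _ k1']) simp
      then have "4 * (real k)\<^sup>2 \<le> 16 * real k ^ 4" using zero_le_power[of "real k" 4] by linarith
      then show ?thesis unfolding H_def using J1 by (intro mult_right_mono) auto
    qed
    have "1 \<le> (real k)\<^sup>2" using k1' by (rule one_le_power)
    then have "1 * 1 \<le> 4 * (real k)\<^sup>2 * J" using J1 by (intro mult_mono) auto
    then have H1: "H \<ge> 1" using HJ by linarith
    have HK: "H \<le> real (distK d)"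
    proof -
      have "16 * k ^ 4 * crossK d \<le> distK d" unfolding distK_def k_def using small1 by simp
      then have "real (16 * k ^ 4 * crossK d) \<le> real (distK d)" by (simp only: of_nat_le_iff)
      then show ?thesis by (simp add: H_def J_def)
    qed
    have HD: "H * real D \<le> real (distK d) * real (card \<Delta>)" using HK D\<Delta> H1 by (intro mult_mono) auto
    from arcs_distances[OF C1 C2 np no ncc arc1 arc2 A(1) ne(1) A(2) A(4)[rule_format] B(1) ne(2) B(2) B(4)[rule_format] _ D_def m1_def n1_def]
    consider "real m1 * real n1 \<le> 8 * real (boxK d) * real (exK d + 1) * real (bez d 2 + 1) * real D"
      | "(real m1)\<^sup>2 \<le> 32 * real (boxK d) * real (brK d + 1) * real D"
      | "real m1 * real n1 ^ 3 \<le> 16384 * real (comK d + 1) * real (boxK d) ^ 3 * real (exK d + 1) * real (bez d 2 + 1) * real D ^ 3"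
      using False unfolding n0_def by linarith
    then show ?thesis
    proof cases
      case 1
      then have *: "real m1 * real n1 \<le> J * real D"
        using mult_right_mono[OF crossK_ge(1), of "real D" d] unfolding J_def by linarith
      have "(real m)\<^sup>2 \<le> real m * real n" unfolding power2_eq_square using mn' by (intro mult_left_mono) auto
      also have "\<dots> \<le> (2 * real k * real m1) * (2 * real k * real n1)" using m2 n2 by (intro mult_mono) auto
      also have "\<dots> = 4 * (real k)\<^sup>2 * (real m1 * real n1)" by (simp add: power2_eq_square)
      also have "\<dots> \<le> 4 * (real k)\<^sup>2 * (J * real D)" using * by (intro mult_left_mono) auto
      also have "\<dots> \<le> H * real D" using mult_right_mono[OF HJ, of "real D"] by (simp add: mult.assoc)
      finally show ?thesis using HD by linarith
    next
      case 2
      then have *: "(real m1)\<^sup>2 \<le> J * real D"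
        using mult_right_mono[OF crossK_ge(2), of "real D" d] unfolding J_def by linarith
      have "(real m)\<^sup>2 \<le> (2 * real k * real m1)\<^sup>2" using m2 by (intro power_mono) auto
      also have "\<dots> = 4 * (real k)\<^sup>2 * (real m1)\<^sup>2" by (simp add: power_mult_distrib)
      also have "\<dots> \<le> 4 * (real k)\<^sup>2 * (J * real D)" using * by (intro mult_left_mono) auto
      also have "\<dots> \<le> H * real D" using mult_right_mono[OF HJ, of "real D"] by (simp add: mult.assoc)
      finally show ?thesis using HD by linarith
    next
      case 3
      then have *: "real m1 * real n1 ^ 3 \<le> J * real D ^ 3"
        using mult_right_mono[OF crossK_ge(3), of "real D ^ 3" d] unfolding J_def by simp
      have "(real m * real n)\<^sup>2 = real m * (real n)\<^sup>2 * real m" by (simp add: power2_eq_square)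
      also have "\<dots> \<le> real m * (real n)\<^sup>2 * real n" using mn' by (intro mult_left_mono) auto
      also have "\<dots> = real m * real n ^ 3" by (simp add: power2_eq_square power3_eq_cube)
      also have "\<dots> \<le> (2 * real k * real m1) * (2 * real k * real n1) ^ 3" using m2 n2 by (intro mult_mono power_mono) auto
      also have "\<dots> = 16 * real k ^ 4 * (real m1 * real n1 ^ 3)" by (simp add: power_mult_distrib power3_eq_cube power4_eq_xxxx)
      also have "\<dots> \<le> 16 * real k ^ 4 * (J * real D ^ 3)" using * by (intro mult_left_mono) auto
      also have "\<dots> = H * real D ^ 3" by (simp add: H_def)
      \<comment> \<open>As H \<ge> 1, it may be replaced by its cube, which turns the bound into a
        cube.\<close>
      also have "\<dots> \<le> H ^ 3 * real D ^ 3" using H1 self_le_power[OF H1, of 3] by (intro mult_right_mono) auto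
      finally have "(real m * real n)\<^sup>2 \<le> (H * real D) ^ 3" by (simp add: power_mult_distrib)
      then have "(real m * real n) powr (2/3) \<le> H * real D" using H1 by (intro powr_two_thirds_le) auto
      then show ?thesis using HD by (simp add: powr_mult)
    qed
  qed
  then show ?thesis unfolding \<Delta>_def m_def n_def by (simp add: min_le_iff_disj)
qed

section \<open>Symmetry of the hypotheses and conclusion\<close>

lemma parallel_lines_sym: "parallel_lines C1 C2 \<Longrightarrow> parallel_lines C2 C1"
proof -
  assume "parallel_lines C1 C2"
  then obtain a1 b1 a2 b2 where "line_with_normal C1 a1 b1" "line_with_normal C2 a2 b2" "a1 * b2 - a2 * b1 = 0"
    unfolding parallel_lines_def by blast
  then show ?thesis unfolding parallel_lines_def
    by (intro exI[of _ a2] exI[of _ b2] exI[of _ a1] exI[of _ b1]) auto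
qed

lemma orthogonal_lines_sym: "orthogonal_lines C1 C2 \<Longrightarrow> orthogonal_lines C2 C1"
proof -
  assume "orthogonal_lines C1 C2"
  then obtain a1 b1 a2 b2 where "line_with_normal C1 a1 b1" "line_with_normal C2 a2 b2" "a1 * a2 + b1 * b2 = 0"
    unfolding orthogonal_lines_def by blast
  then show ?thesis unfolding orthogonal_lines_def
    by (intro exI[of _ a2] exI[of _ b2] exI[of _ a1] exI[of _ b1]) (auto simp: mult.commute)
qed

lemma concentric_circles_sym: "concentric_circles C1 C2 \<Longrightarrow> concentric_circles C2 C1"
  unfolding concentric_circles_def by blast

text \<open>The square root is injective, so passing to squared distances keeps the count.\<close>

lemma card_edist: "card {edist p q | p q. p \<in> S1 \<and> q \<in> S2} = card ((\<lambda>(p, q). dist2 p q) ` (S1 \<times> S2))"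
proof -
  have "{edist p q | p q. p \<in> S1 \<and> q \<in> S2} = (\<lambda>(p, q). edist p q) ` (S1 \<times> S2)" by force
  also have "\<dots> = sqrt ` ((\<lambda>(p, q). dist2 p q) ` (S1 \<times> S2))"
    unfolding image_image by (rule image_cong) (auto simp: edist_def dist2_def)
  also have "card \<dots> = card ((\<lambda>(p, q). dist2 p q) ` (S1 \<times> S2))"
    by (rule card_image) (simp add: inj_on_def)
  finally show ?thesis .
qed

theorem theorem1p2:
  fixes d :: nat
  assumes "d \<ge> 1"
  shows "\<exists>c > 0. \<forall>C1 C2 S1 S2.
     irreducible_curve C1 \<and> irreducible_curve C2 \<and>
     curve_deg_le C1 d \<and> curve_deg_le C2 d \<and>
     \<not> parallel_lines C1 C2 \<and> \<not> orthogonal_lines C1 C2 \<and>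
     \<not> concentric_circles C1 C2 \<and>
     finite S1 \<and> S1 \<subseteq> C1 \<and> finite S2 \<and> S2 \<subseteq> C2 \<longrightarrow>
     real (card {edist p q | p q. p \<in> S1 \<and> q \<in> S2}) \<ge>
       c * min ((real (card S1)) powr (2/3) * (real (card S2)) powr (2/3))
               (min ((real (card S1))^2) ((real (card S2))^2))"
proof (intro exI[of _ "1 / real (distK d)"] conjI allI impI)
  have dK: "real (distK d) > 0" using distK_pos[of d] by simp
  then show "1 / real (distK d) > 0" by simp
  fix C1 C2 S1 S2
  assume H: "irreducible_curve C1 \<and> irreducible_curve C2 \<and>
     curve_deg_le C1 d \<and> curve_deg_le C2 d \<and>
     \<not> parallel_lines C1 C2 \<and> \<not> orthogonal_lines C1 C2 \<and>
     \<not> concentric_circles C1 C2 \<and>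
     finite S1 \<and> S1 \<subseteq> C1 \<and> finite S2 \<and> S2 \<subseteq> C2"
  obtain f where f: "acurve d f C1" using irreducible_curve_acurve[of C1 d] H assms by blast
  obtain g where g: "acurve d g C2" using irreducible_curve_acurve[of C2 d] H assms by blast
  let ?D = "card ((\<lambda>(p, q). dist2 p q) ` (S1 \<times> S2))"
  have "min (real (card S1) powr (2/3) * real (card S2) powr (2/3)) (min ((real (card S1))\<^sup>2) ((real (card S2))\<^sup>2))
      \<le> real (distK d) * real ?D"
  \<comment> \<open>The curves exchange roles when \<open>S2\<close> is the smaller set; the three
    excluded configurations are symmetric.\<close>
  proof (cases "card S1 \<le> card S2")
    case True
    show ?thesis using cross_distances_ordered[OF f g _ _ _ _ _ _ _ True] H by (simp add: min_le_iff_disj) argo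
  next
    case False
    have img: "(\<lambda>(p, q). dist2 p q) ` (S2 \<times> S1) = (\<lambda>(p, q). dist2 p q) ` (S1 \<times> S2)"
      using dist2_commute by (auto simp: image_iff; blast)
    have le: "card S2 \<le> card S1" using False by simp
    have n: "\<not> parallel_lines C2 C1" "\<not> orthogonal_lines C2 C1" "\<not> concentric_circles C2 C1"
      using H parallel_lines_sym[of C2 C1] orthogonal_lines_sym[of C2 C1] concentric_circles_sym[of C2 C1] by blast+
    show ?thesis using cross_distances_ordered[OF g f n _ _ _ _ le] H unfolding img
      by (simp add: min_le_iff_disj mult.commute) argo
  qed
  then show "real (card {edist p q | p q. p \<in> S1 \<and> q \<in> S2}) \<ge> 1 / real (distK d) *
       min ((real (card S1)) powr (2/3) * (real (card S2)) powr (2/3))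
               (min ((real (card S1))^2) ((real (card S2))^2))"
    unfolding card_edist using dK by (simp add: divide_le_eq mult.commute)
qed

end
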